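(* Assume $\psi \in L^1(\mathbb{R}^d)$ and $$\sup_{|y| \leq 1} \| \psi - \psi(\cdot- y) \|_{H^1} < \infty .$$ Then $S : \ell^1(h^1) \to H^1(\mathbb{R}^d)$ is bounded. More precisely, if $c \in \ell^1(h^1)$ then the series $Sc = \sum_{j>0} \sum_{k \in \mathbb{Z}^d} c_{j,k} \psi_{j,k}$ converges in $H^1$ in the sense that the sum over $k$ converges absolutely in $L^1$ to a function belonging to $H^1$ and the sum over $j$ converges absolutely in $H^1$; and furthermore $\| Sc \|_{H^1} \leq C \| c \|_{\ell^1(h^1)}$ for some constant $C=C(\psi,b)$.
   Context: Fix $d\in\mathbb{N}$. The dilation matrices are isotropic and expanding: $a_j=\alpha_j I$ ($j=1,2,3,\ldots$), where $\alpha_j$ are nonzero real numbers with $|\alpha_j|\to\infty$ as $j\to\infty$. The translation matrix $b$ is an invertible $d\times d$ real matrix. Functions are complex-valued; sums over $j>0$ are over $j=1,2,3,\ldots$. Here $\psi_{j,k}(x) = |\det a_j|\,\psi(a_jx-bk)$ for $k\in\mathbb{Z}^d$. Hardy space: let $C_d=\Gamma((d+1)/2)\pi^{-(d+1)/2}$, $Z(x)=C_d\,x/|x|^{d+1}$ for $x\ne0$ and $Z(0)=0$. The (vector-valued) Riesz transform of $f\in L^1(\mathbb{R}^d)$ is $Rf(x)=(f*Z)(x)=\text{p.v.}\int f(x-y)Z(y)\,dy$. $H^1=H^1(\mathbb{R}^d)=\{f\in L^1: Rf\in L^1\}$ with $\|f\|_{H^1}=\|f\|_1+\|Rf\|_1$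 (with $\|f\|_{H^1}=\infty$ if $f\notin H^1$). Discrete Hardy space: let $\mathcal{C}_0=(-1/2,1/2)^d$ (row vectors). Fix a smooth, compactly supported cut-off function $\nu$ supported in $\mathcal{C}_0$ with $\nu\equiv1$ near the origin. The discrete Riesz kernel $z=\{z_k\}_{k\in\mathbb{Z}^d}\in\ell^2$, $z_k\in\mathbb{C}^d$, is defined by its Fourier series $$\zeta(\xi)=\sum_{k\in\mathbb{Z}^d} z_k e^{-2\pi i\xi k}:=-i\frac{\xi b^{-1}}{|\xi b^{-1}|}\nu(\xi),\qquad \xi\in\mathcal{C}_0,$$ with $\xi$ a row vector and $k$ a column vector. Then $h^1=\{s\in\ell^1(\mathbb{Z}^d): s*z\in\ell^1\}$ with norm $\|s\|_{h^1}=\|s\|_{\ell^1}+\|s*z\|_{\ell^1}$. For sequences $c=\{c_{j,k}\}_{j>0,k\in\mathbb{Z}^d}$ of complex numbers, with $c_j=\{c_{j,k}\}_{k\in\mathbb{Z}^d}$, put $\|c\|_{\ell^1(h^1)}=\sum_{j>0}\|c_j\|_{h^1}$; $\ell^1(h^1)$ is the Banach space of sequences for which this is finite. *)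

theory Defs
  imports "HOL-Analysis.Analysis"
begin

text \<open>
  Throughout, the dimension \<open>d\<close> is \<open>CARD('n)\<close>, the lattice \<open>\<int>\<^sup>d\<close> is the type \<open>int ^ 'n\<close>, and
  \<open>L\<^sup>1\<close> refers to (complete) Lebesgue measure.
\<close>

definition lattice_vec :: "int ^ 'n \<Rightarrow> real ^ 'n" where
  "lattice_vec k = (\<chi> i. real_of_int (k $ i))"

definition affine_copy ::
  "real ^ 'n ^ 'n \<Rightarrow> real ^ 'n ^ 'n \<Rightarrow> (real ^ 'n \<Rightarrow> complex) \<Rightarrow> int ^ 'n \<Rightarrow> real ^ 'n \<Rightarrow> complex"
  where
  "affine_copy a b \<psi> k x = of_real \<bar>det a\<bar> * \<psi> (a *v x - b *v lattice_vec k)"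


subsection \<open>The Hardy space \<open>H\<^sup>1\<close>\<close>

definition riesz_kernel :: "real ^ 'n \<Rightarrow> real ^ 'n" where
  "riesz_kernel x =
     (Gamma ((real CARD('n) + 1) / 2) * pi powr (- ((real CARD('n) + 1) / 2))
        / norm x ^ (CARD('n) + 1)) *\<^sub>R x"

definition riesz_truncated :: "real \<Rightarrow> (real ^ 'n \<Rightarrow> complex) \<Rightarrow> real ^ 'n \<Rightarrow> complex ^ 'n" where
  "riesz_truncated \<epsilon> f x =
     (LINT y:{y. \<epsilon> < norm y}|lebesgue. (\<chi> i. f (x - y) * of_real (riesz_kernel y $ i)))"

text \<open>
  For integrable \<open>f\<close> the principal value exists almost everywhere, so the unspecified value of
  \<open>Lim\<close> at points where it does not exist affects neither integrability of the Riesz transform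
  with respect to the complete measure \<open>lebesgue\<close> nor its norm.
\<close>

definition riesz_transform :: "(real ^ 'n \<Rightarrow> complex) \<Rightarrow> real ^ 'n \<Rightarrow> complex ^ 'n" where
  "riesz_transform f x = Lim (at_right 0) (\<lambda>\<epsilon>. riesz_truncated \<epsilon> f x)"

definition H1 :: "(real ^ 'n \<Rightarrow> complex) set" where
  "H1 = {f. integrable lebesgue f \<and> integrable lebesgue (riesz_transform f)}"

definition H1_norm :: "(real ^ 'n \<Rightarrow> complex) \<Rightarrow> ennreal" where
  "H1_norm f =
     (if f \<in> H1
      then ennreal ((LINT x|lebesgue. norm (f x)) + (LINT x|lebesgue. norm (riesz_transform f x)))
      else \<infinity>)"


subsection \<open>Absolutely convergent series in \<open>L\<^sup>1\<close> and \<open>H\<^sup>1\<close>\<close>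

definition L1_abs_has_sum ::
  "('i \<Rightarrow> real ^ 'n \<Rightarrow> complex) \<Rightarrow> 'i set \<Rightarrow> (real ^ 'n \<Rightarrow> complex) \<Rightarrow> bool" where
  "L1_abs_has_sum g A f \<longleftrightarrow>
     (\<forall>k\<in>A. integrable lebesgue (g k)) \<and>
     integrable lebesgue f \<and>
     (\<lambda>k. LINT x|lebesgue. norm (g k x)) summable_on A \<and>
     ((\<lambda>K. LINT x|lebesgue. norm (f x - (\<Sum>k\<in>K. g k x))) \<longlongrightarrow> 0) (finite_subsets_at_top A)"

definition H1_abs_has_sum ::
  "('i \<Rightarrow> real ^ 'n \<Rightarrow> complex) \<Rightarrow> 'i set \<Rightarrow> (real ^ 'n \<Rightarrow> complex) \<Rightarrow> bool" where
  "H1_abs_has_sum g A f \<longleftrightarrow>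
     (\<forall>j\<in>A. g j \<in> H1) \<and>
     f \<in> H1 \<and>
     (\<Sum>\<^sub>\<infinity>j\<in>A. H1_norm (g j)) < \<infinity> \<and>
     ((\<lambda>J. H1_norm (\<lambda>x. f x - (\<Sum>j\<in>J. g j x))) \<longlongrightarrow> 0) (finite_subsets_at_top A)"


subsection \<open>The discrete Hardy space \<open>h\<^sup>1\<close>\<close>

definition unit_cell :: "(real ^ 'n) set" where
  "unit_cell = {\<xi>. \<forall>i. - 1 / 2 < \<xi> $ i \<and> \<xi> $ i < 1 / 2}"

primrec Ck :: "nat \<Rightarrow> (real ^ 'n \<Rightarrow> complex) \<Rightarrow> bool" where
  "Ck 0 f \<longleftrightarrow> continuous_on UNIV f"
| "Ck (Suc m) f \<longleftrightarrow>
     (\<forall>x. f differentiable (at x)) \<and>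
     (\<forall>i. Ck m (\<lambda>x. frechet_derivative f (at x) (axis i 1)))"

definition cutoff :: "(real ^ 'n \<Rightarrow> complex) \<Rightarrow> bool" where
  "cutoff \<nu> \<longleftrightarrow>
     (\<forall>m. Ck m \<nu>) \<and>
     compact (closure {\<xi>. \<nu> \<xi> \<noteq> 0}) \<and>
     closure {\<xi>. \<nu> \<xi> \<noteq> 0} \<subseteq> unit_cell \<and>
     (\<forall>\<^sub>F \<xi> in nhds 0. \<nu> \<xi> = 1)"

definition discrete_riesz_symbol ::
  "real ^ 'n ^ 'n \<Rightarrow> (real ^ 'n \<Rightarrow> complex) \<Rightarrow> real ^ 'n \<Rightarrow> complex ^ 'n" where
  "discrete_riesz_symbol b \<nu> \<xi> =
     (let \<eta> = \<xi> v* matrix_inv b in \<chi> i. - \<i> * of_real (\<eta> $ i / norm \<eta>) * \<nu> \<xi>)"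

text \<open>
  The sequence whose Fourier series \<open>\<Sum>\<^sub>k z\<^sub>k exp (- 2 \<pi> i \<xi>\<cdot>k)\<close> on the unit cell is the
  symbol above, i.e. the sequence of its Fourier coefficients.
\<close>

definition discrete_riesz_kernel ::
  "real ^ 'n ^ 'n \<Rightarrow> (real ^ 'n \<Rightarrow> complex) \<Rightarrow> int ^ 'n \<Rightarrow> complex ^ 'n" where
  "discrete_riesz_kernel b \<nu> k =
     (LINT \<xi>:unit_cell|lebesgue.
        exp (2 * of_real pi * \<i> * of_real (\<xi> \<bullet> lattice_vec k)) *s discrete_riesz_symbol b \<nu> \<xi>)"

definition discrete_conv ::
  "(int ^ 'n \<Rightarrow> complex) \<Rightarrow> (int ^ 'n \<Rightarrow> complex ^ 'n) \<Rightarrow> int ^ 'n \<Rightarrow> complex ^ 'n" where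
  "discrete_conv s z k = (\<Sum>\<^sub>\<infinity>l. s l *s z (k - l))"

definition h1 :: "real ^ 'n ^ 'n \<Rightarrow> (real ^ 'n \<Rightarrow> complex) \<Rightarrow> (int ^ 'n \<Rightarrow> complex) set" where
  "h1 b \<nu> =
     {s. (\<lambda>k. norm (s k)) summable_on UNIV \<and>
         (\<lambda>k. norm (discrete_conv s (discrete_riesz_kernel b \<nu>) k)) summable_on UNIV}"

definition h1_norm ::
  "real ^ 'n ^ 'n \<Rightarrow> (real ^ 'n \<Rightarrow> complex) \<Rightarrow> (int ^ 'n \<Rightarrow> complex) \<Rightarrow> real" where
  "h1_norm b \<nu> s =
     (\<Sum>\<^sub>\<infinity>k. norm (s k)) + (\<Sum>\<^sub>\<infinity>k. norm (discrete_conv s (discrete_riesz_kernel b \<nu>) k))"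

text \<open>Scales are indexed by the positive naturals; entries with index \<open>0\<close> are ignored.\<close>

definition l1_h1 ::
  "real ^ 'n ^ 'n \<Rightarrow> (real ^ 'n \<Rightarrow> complex) \<Rightarrow> (nat \<Rightarrow> int ^ 'n \<Rightarrow> complex) set" where
  "l1_h1 b \<nu> =
     {c. (\<forall>j>0. c j \<in> h1 b \<nu>) \<and> (\<lambda>j. h1_norm b \<nu> (c j)) summable_on {0<..}}"

definition l1_h1_norm ::
  "real ^ 'n ^ 'n \<Rightarrow> (real ^ 'n \<Rightarrow> complex) \<Rightarrow> (nat \<Rightarrow> int ^ 'n \<Rightarrow> complex) \<Rightarrow> real" where
  "l1_h1_norm b \<nu> c = (\<Sum>\<^sub>\<infinity>j\<in>{0<..}. h1_norm b \<nu> (c j))"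


subsection \<open>Affine synthesis\<close>

text \<open>
  The sums are taken pointwise.  Absolute convergence in \<open>L\<^sup>1\<close> makes them converge absolutely
  almost everywhere to a representative of the limit in norm.
\<close>

definition synthesis_at ::
  "real ^ 'n ^ 'n \<Rightarrow> real ^ 'n ^ 'n \<Rightarrow> (real ^ 'n \<Rightarrow> complex) \<Rightarrow> (int ^ 'n \<Rightarrow> complex)
     \<Rightarrow> real ^ 'n \<Rightarrow> complex" where
  "synthesis_at a b \<psi> s x = (\<Sum>\<^sub>\<infinity>k. s k * affine_copy a b \<psi> k x)"

definition synthesis ::
  "(nat \<Rightarrow> real ^ 'n ^ 'n) \<Rightarrow> real ^ 'n ^ 'n \<Rightarrow> (real ^ 'n \<Rightarrow> complex)
     \<Rightarrow> (nat \<Rightarrow> int ^ 'n \<Rightarrow> complex) \<Rightarrow> real ^ 'n \<Rightarrow> complex" where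
  "synthesis a b \<psi> c x = (\<Sum>\<^sub>\<infinity>j\<in>{0<..}. synthesis_at (a j) b \<psi> (c j) x)"

end

theory Submission
 imports Defs "HOL-Probability.Sinc_Integral" "HOL-Probability.Characteristic_Functions"
begin

text \<open>
 The Riesz transform is treated weakly: \<open>r\<close> is the transform of \<open>f\<close> in direction \<open>b\<close> if smoothing \<open>r\<close> by any
 Gaussian agrees with convolving \<open>f\<close> with the Riesz transform of that Gaussian. This relation is stable under
 translations, dilations and absolutely convergent superpositions, and a Calderon-Zygmund argument shows that for
 integrable \<open>r\<close> it amounts to the principal value definition of the Hardy space.

 Let \<open>\<phi>\<close> be a function of integral \<open>1\<close> whose Fourier transform is supported where the cut-off \<open>\<nu>\<close>, transported by \<open>b\<close>,
 equals \<open>1\<close>. Then \<open>\<psi> - \<psi> * \<phi>\<close> is the superposition of the differences \<open>\<psi> - \<psi>(\<cdot> - y)\<close> with weight \<open>\<phi> y\<close>, whose Hardy norms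
 grow at most linearly in \<open>y\<close>, so its lattice series are controlled by the \<open>\<ell>\<^sup>1\<close> norm of the coefficients. The other part of
 the series is the convolution of \<open>\<psi>\<close> with \<open>\<Sum>\<^sub>k s\<^sub>k \<phi>(\<cdot> - b k)\<close>, and the Riesz transform of the latter is
 \<open>\<Sum>\<^sub>k (s * z)\<^sub>k \<phi>(\<cdot> - b k)\<close> up to a constant, because the Fourier transform of \<open>\<phi>\<close> lives where the symbol of \<open>z\<close> is that of the
 Riesz transform. Dilations preserve all norms involved.
\<close>

text \<open>The symbol of z is discontinuous at 0, so z need not be summable and the Riesz transform
  of a single \<phi> need not be integrable: it is only a bounded function N, a constant times the
  sum of z_k \<phi>(x - b k). Integrability returns only after convolution with s. The identity
  between \<phi> and N is therefore one of Gaussian smoothings, which make sense for bounded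
  functions too; and at fixed t smoothings commute with infinite sums by Fubini, as principal values
  do not. The smoothed kernels come from subordination: 1/|eta| is a constant times the integral of
  s^(-1/2) exp(-s |eta|^2) over s > 0, so gradients of Gaussians superpose to the multiplier
  eta/|eta| with explicit bounds. The price of the weak form is paid once: smoothings could converge
  almost everywhere while losing a singular measure in the limit, and integrability of the principal
  value has to be shown to exclude this. The linear growth in y asks for a first moment of \<phi>,
  the support condition for a band-limited \<phi>; a bump with two continuous derivatives supplies
  both.\<close>

abbreviation nn_lborel :: "('a::euclidean_space \<Rightarrow> ennreal) \<Rightarrow> ennreal" (binder "NN " 10) where
 "nn_lborel f \<equiv> nn_integral lborel f"
abbreviation L1_lborel :: "('a::euclidean_space \<Rightarrow> 'b::real_normed_vector) \<Rightarrow> ennreal" (binder "N1 " 10) where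
 "L1_lborel f \<equiv> nn_lborel (\<lambda>x. ennreal (norm (f x)))"
abbreviation int_lborel :: "('a::euclidean_space \<Rightarrow> 'b::{banach, second_countable_topology}) \<Rightarrow> 'b" (binder "LL " 10) where
 "int_lborel f \<equiv> lebesgue_integral lborel f"
abbreviation nn_count :: "('k \<Rightarrow> ennreal) \<Rightarrow> ennreal" (binder "NC " 10) where
 "nn_count f \<equiv> nn_integral (count_space UNIV) f"
abbreviation int_count :: "('k \<Rightarrow> 'b::{banach, second_countable_topology}) \<Rightarrow> 'b" (binder "LC " 10) where
 "int_count f \<equiv> lebesgue_integral (count_space UNIV) f"
abbreviation mass :: "'a::euclidean_space set \<Rightarrow> ('a \<Rightarrow> 'b::real_normed_vector) \<Rightarrow> ennreal" where
 "mass A f \<equiv> \<integral>\<^sup>+x\<in>A. ennreal (norm (f x)) \<partial>lborel"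
abbreviation borel_fun :: "('a::topological_space \<Rightarrow> 'b::topological_space) set" where
 "borel_fun \<equiv> borel_measurable borel"

lemmas L_integrable_bound = Bochner_Integration.integrable_bound
lemmas L_integrable_diff = Bochner_Integration.integrable_diff
lemmas L_integrable_sum = Bochner_Integration.integrable_sum
lemmas L_integral_add = Bochner_Integration.integral_add
lemmas L_integral_cnj = Bochner_Integration.integral_cnj
lemmas L_integral_cong = Bochner_Integration.integral_cong
lemmas L_integral_diff = Bochner_Integration.integral_diff
lemmas L_integral_sum = Bochner_Integration.integral_sum

section \<open>Affine substitutions in Lebesgue integrals\<close>

lemma nn_integral_lborel_affine:
 fixes f :: "'a::euclidean_space \<Rightarrow> ennreal"
 assumes [measurable]: "f \<in> borel_fun" and "c \<noteq> 0"
 shows "(NN x. f (t + c *\<^sub>R x)) = ennreal (1 / \<bar>c\<bar> ^ DIM('a)) * (NN x. f x)"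
proof -
 have "(NN x. f x) = ennreal (\<bar>c\<bar> ^ DIM('a)) * (NN x. f (t + c *\<^sub>R x))"
  by (subst lborel_affine[OF \<open>c \<noteq> 0\<close>, of t])
    (simp add: nn_integral_density nn_integral_distr nn_integral_cmult)
 then have "ennreal (1 / \<bar>c\<bar> ^ DIM('a)) * (NN x. f x) =
   (ennreal (1 / \<bar>c\<bar> ^ DIM('a)) * ennreal (\<bar>c\<bar> ^ DIM('a))) * (NN x. f (t + c *\<^sub>R x))"
  by (simp add: mult.assoc)
 also have "ennreal (1 / \<bar>c\<bar> ^ DIM('a)) * ennreal (\<bar>c\<bar> ^ DIM('a)) = 1"
  using \<open>c \<noteq> 0\<close> by (subst ennreal_mult[symmetric]) auto
 finally show ?thesis by simp
qed

lemma has_bochner_integral_lborel_affine: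
 fixes f :: "'a::euclidean_space \<Rightarrow> 'b::{banach, second_countable_topology}"
 assumes "integrable lborel f" and "c \<noteq> 0"
 shows "has_bochner_integral lborel (\<lambda>x. f (t + c *\<^sub>R x)) ((1 / \<bar>c\<bar> ^ DIM('a)) *\<^sub>R (LL x. f x))"
proof -
 have [measurable]: "f \<in> borel_fun" using assms(1) by auto
 have i: "integrable lborel (\<lambda>x. f (t + c *\<^sub>R x))"
  using assms(1) unfolding integrable_iff_bounded
  by (auto simp: nn_integral_lborel_affine[where f = "\<lambda>x. ennreal (norm (f x))"] assms(2) ennreal_mult_less_top)
 have "(LL x. f x) = \<bar>c\<bar> ^ DIM('a) *\<^sub>R (LL x. f (t + c *\<^sub>R x))"
  by (subst lborel_affine[OF \<open>c \<noteq> 0\<close>, of t])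
    (simp add: integral_density integral_distr)
 then show ?thesis using i \<open>c \<noteq> 0\<close>
  by (auto simp: has_bochner_integral_iff)
qed

lemma integral_lborel_affine:
 fixes f :: "'a::euclidean_space \<Rightarrow> 'b::{banach, second_countable_topology}"
 assumes "integrable lborel f" and "c \<noteq> 0"
 shows "(LL x. f (t + c *\<^sub>R x)) = (1 / \<bar>c\<bar> ^ DIM('a)) *\<^sub>R (LL x. f x)"
  and "integrable lborel (\<lambda>x. f (t + c *\<^sub>R x))"
 using has_bochner_integral_lborel_affine[OF assms] by (auto simp: has_bochner_integral_iff)

lemma integrable_lborel_affine_iff:
 fixes f :: "'a::euclidean_space \<Rightarrow> 'b::{banach, second_countable_topology}"
 assumes "c \<noteq> 0"
 shows "integrable lborel (\<lambda>x. f (t + c *\<^sub>R x)) \<longleftrightarrow> integrable lborel f"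
proof
 assume "integrable lborel (\<lambda>x. f (t + c *\<^sub>R x))"
 from integral_lborel_affine(2)[OF this, where c = "1/c" and t = "- (t /\<^sub>R c)"]
 show "integrable lborel f" using assms by (simp add: algebra_simps)
qed (use integral_lborel_affine(2)[OF _ assms] in blast)

lemma integral_lborel_reflect:
 fixes f :: "'a::euclidean_space \<Rightarrow> 'b::{banach, second_countable_topology}"
 shows "(LL y. f (x - y)) = (LL y. f y)" (is ?g1)
  and "integrable lborel (\<lambda>y. f (x - y)) \<longleftrightarrow> integrable lborel f"
proof -
 show *: "integrable lborel (\<lambda>y. f (x - y)) \<longleftrightarrow> integrable lborel f"
  using integrable_lborel_affine_iff[of "-1" f x] by simp
 show ?g1
 proof (cases "integrable lborel f")
  case True
  from integral_lborel_affine(1)[OF True, of "-1" x] show ?thesis by simp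
 next
  case False
  with * show ?thesis by (simp add: not_integrable_integral_eq)
 qed
qed

lemma integral_lborel_shift:
 fixes f :: "'a::euclidean_space \<Rightarrow> 'b::{banach, second_countable_topology}"
 shows "(LL y. f (y - x)) = (LL y. f y)"
  and "integrable lborel (\<lambda>y. f (y - x)) \<longleftrightarrow> integrable lborel f"
 using integral_lborel_reflect[of "\<lambda>y. f (-y)" x] integral_lborel_reflect[of f 0] by auto

lemma nn_integral_lborel_reflect:
 fixes f :: "'a::euclidean_space \<Rightarrow> ennreal"
 assumes [measurable]: "f \<in> borel_fun"
 shows "(NN y. f (x - y)) = (NN y. f y)"
  and "(NN y. f (y - x)) = (NN y. f y)"
 using nn_integral_lborel_affine[of f "-1" x] nn_integral_lborel_affine[of f 1 "-x"] by auto

subsection \<open>Radial weights\<close>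

lemma nn_integral_one_plus_abs_powr:
 assumes "p > 1"
 shows "(NN u. ennreal ((1 + \<bar>u\<bar>) powr (-p))) < \<infinity>"
proof -
 let ?g = "\<lambda>u::real. (1 + u) powr (-p)"
 have half: "(NN u. ennreal (?g u) * indicator {0..} u) < \<infinity>"
 proof -
  have "(NN u. ennreal (?g u) * indicator {0..} u)
    = ennreal (0 - (1 + 0) powr (1 - p) / (1 - p))"
  proof (rule nn_integral_FTC_atLeast)
   show "((\<lambda>u. (1 + u) powr (1 - p) / (1 - p)) \<longlongrightarrow> 0) at_top"
    using assms by real_asymp
  next
   fix x :: real assume x: "0 \<le> x"
   have "DERIV (\<lambda>u. (1 + u) powr (1 - p) / (1 - p)) x :> (1 - p) * (1 + x) powr (1 - p - 1) / (1 - p)"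
    using x assms by (auto intro!: derivative_eq_intros)
   then show "DERIV (\<lambda>u. (1 + u) powr (1 - p) / (1 - p)) x :> (1 + x) powr - p"
    using assms by simp
  qed auto
  then show ?thesis by simp
 qed
 have "(NN u. ennreal ((1 + \<bar>u\<bar>) powr (-p))) \<le>
   (NN u. ennreal (?g u) * indicator {0..} u + ennreal (?g (-u)) * indicator {0..} (-u))"
  by (intro nn_integral_mono) (auto simp: indicator_def)
 also have "... = (NN u. ennreal (?g u) * indicator {0..} u) + (NN u. ennreal (?g (-u)) * indicator {0..} (-u))"
  by (intro nn_integral_add) auto
 also have "(NN u. ennreal (?g (-u)) * indicator {0..} (-u)) = (NN u. ennreal (?g u) * indicator {0..} u)"
  using nn_integral_lborel_reflect(1)[of "\<lambda>u. ennreal (?g u) * indicator {0..} u" 0] by auto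
 finally show ?thesis using half by (auto simp: less_top[symmetric] top_unique)
qed

text \<open>Splitting the exponent d + 1 evenly over the d coordinates leaves 1 + 1/d > 1 on each,
  so integrability of the radial weight reduces to the real line.\<close>

lemma prod_powr_le_norm:
 fixes x :: "'a::euclidean_space"
 shows "(\<Prod>b\<in>Basis. (1 + \<bar>x \<bullet> b\<bar>) powr (1 + 1 / DIM('a))) \<le> (1 + norm x) ^ (DIM('a) + 1)"
proof -
 have "(\<Prod>b\<in>Basis. (1 + \<bar>x \<bullet> b\<bar>) powr (1 + 1 / DIM('a))) \<le> (\<Prod>b\<in>(Basis::'a set). (1 + norm x) powr (1 + 1 / DIM('a)))"
  by (intro prod_mono) (auto intro!: powr_mono2 simp: Basis_le_norm)
 also have "... = (1 + norm x) powr (DIM('a) + 1)"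
 proof -
  have "((1 + norm x) powr (1 + 1 / DIM('a))) ^ DIM('a) = (1 + norm x) powr (real DIM('a) * (1 + 1 / DIM('a)))"
   using norm_ge_zero[of x] by (intro powr_power) linarith
  also have "real DIM('a) * (1 + 1 / DIM('a)) = DIM('a) + 1" by (simp add: field_simps)
  finally show ?thesis by simp
 qed
 also have "... = (1 + norm x) ^ (DIM('a) + 1)"
  by (subst powr_realpow[symmetric]) (auto simp: add_pos_nonneg add.commute)
 finally show ?thesis .
qed

lemma integrable_inverse_norm_power:
 "integrable lborel (\<lambda>x::'a::euclidean_space. inverse ((1 + norm x) ^ (DIM('a) + 1)))"
proof (rule integrableI_bounded)
 have "(N1 (x::'a). inverse ((1 + norm x) ^ (DIM('a) + 1)))
   \<le> (NN (x::'a). (\<Prod>b\<in>Basis. ennreal ((1 + \<bar>x \<bullet> b\<bar>) powr (- (1 + 1 / DIM('a))))))"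
 proof (intro nn_integral_mono)
  fix x :: 'a
  have "inverse ((1 + norm x) ^ (DIM('a) + 1)) \<le> inverse (\<Prod>b\<in>Basis. (1 + \<bar>x \<bullet> b\<bar>) powr (1 + 1 / DIM('a)))" (is "?l \<le> _")
   by (rule le_imp_inverse_le[OF prod_powr_le_norm]) (auto intro!: prod_pos simp: add_pos_nonneg)
  also have "... = (\<Prod>b\<in>Basis. (1 + \<bar>x \<bullet> b\<bar>) powr (- (1 + 1 / DIM('a))))"
   by (simp only: powr_minus prod_inversef[symmetric])
     (simp add: o_def)
  finally show "ennreal (norm (?l)) \<le> (\<Prod>b\<in>Basis. ennreal ((1 + \<bar>x \<bullet> b\<bar>) powr (- (1 + 1 / DIM('a)))))"
   by (subst prod_ennreal) (auto intro!: ennreal_leI)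
 qed
 also have "... = (\<Prod>b\<in>(Basis::'a set). (NN u. ennreal ((1 + \<bar>u\<bar>) powr (- (1 + 1 / DIM('a))))))"
  by (rule nn_integral_lborel_prod) auto
 also have "... < \<infinity>"
  using nn_integral_one_plus_abs_powr[of "1 + 1 / DIM('a)"]
  by (simp add: power_less_top_ennreal)
 finally show "(N1 (x::'a). inverse ((1 + norm x) ^ (DIM('a) + 1))) < \<infinity>" .
qed auto

text \<open>For |x| >= r one has 1 + |x|/r <= 2 |x|/r, so the tail is dominated by the integrable
  weight dilated by r; the dilation turns r^(-(d+1)) into 1/r.\<close>

lemma nn_integral_norm_tail:
 "\<exists>C>0. \<forall>r>0. \<forall>z::'a::euclidean_space.
   (NN x. ennreal (1 / norm (x - z) ^ (DIM('a) + 1)) * indicator {x. r \<le> norm (x - z)} x) \<le> ennreal (C / r)"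
proof -
 define w where "w x = inverse ((1 + norm x) ^ (DIM('a) + 1))" for x :: 'a
 define I where "I = (LL x. w x)"
 have w0: "w x \<ge> 0" for x by (simp add: w_def)
 have nI: "(NN x. ennreal (w x)) = ennreal I" 
  unfolding I_def using integrable_inverse_norm_power[where 'a='a] w0
  by (intro nn_integral_eq_integral) (auto simp: w_def)
 have I0: "I \<ge> 0" unfolding I_def by (intro integral_nonneg_AE) (auto simp: w0)
 show ?thesis
 proof (intro exI[of _ "2 ^ (DIM('a) + 1) * (I + 1)"] conjI allI impI)
  fix r :: real and z :: 'a assume r: "r > 0"
  let ?F = "\<lambda>x::'a. ennreal (1 / norm x ^ (DIM('a) + 1)) * indicator {x. r \<le> norm x} x"
  have pw: "?F x \<le> ennreal (2 ^ (DIM('a)+1) / r ^ (DIM('a)+1)) * ennreal (w (0 + (1/r) *\<^sub>R x))" for x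
  proof (cases "r \<le> norm x")
   case True
   then have nx: "norm x > 0" using r by linarith
   have "(1 + norm x / r) \<le> 2 * (norm x / r)" using True r by (simp add: field_simps)
   then have "(1 + norm x / r) ^ (DIM('a)+1) \<le> (2 * (norm x / r)) ^ (DIM('a)+1)"
    using r by (intro power_mono) auto
   then have "inverse ((2 * (norm x / r)) ^ (DIM('a)+1)) \<le> inverse ((1 + norm x / r) ^ (DIM('a)+1))"
    using r by (intro le_imp_inverse_le zero_less_power add_pos_nonneg) auto
   then have "1 / norm x ^ (DIM('a) + 1) \<le> 2 ^ (DIM('a)+1) / r ^ (DIM('a)+1) * inverse ((1 + norm x / r) ^ (DIM('a)+1))"
   proof -
    assume a: "inverse ((2 * (norm x / r)) ^ (DIM('a)+1)) \<le> inverse ((1 + norm x / r) ^ (DIM('a)+1))"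
    have "1 / norm x ^ (DIM('a) + 1) = 2 ^ (DIM('a)+1) / r ^ (DIM('a)+1) * inverse ((2 * (norm x / r)) ^ (DIM('a)+1))"
     using nx r by (simp add: power_mult_distrib power_divide field_simps)
    also have "... \<le> 2 ^ (DIM('a)+1) / r ^ (DIM('a)+1) * inverse ((1 + norm x / r) ^ (DIM('a)+1))"
     using r by (intro mult_left_mono a) auto
    finally show ?thesis .
   qed
   then show ?thesis using True r by (simp add: w_def ennreal_mult[symmetric] ennreal_leI)
  qed (simp add: w0)
  have "(NN x. ennreal (1 / norm (x - z) ^ (DIM('a) + 1)) * indicator {x. r \<le> norm (x - z)} x)
    = (NN x. ?F (x - z))"
   by (simp add: indicator_def)
  also have "... = (NN x. ?F x)" by (rule nn_integral_lborel_reflect(2)) auto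
  also have "... \<le> (NN x. ennreal (2 ^ (DIM('a)+1) / r ^ (DIM('a)+1)) * ennreal (w (0 + (1/r) *\<^sub>R x)))"
   by (intro nn_integral_mono pw)
  also have "... = ennreal (2 ^ (DIM('a)+1) / r ^ (DIM('a)+1)) * (ennreal (1 / \<bar>1/r\<bar> ^ DIM('a)) * ennreal I)"
  proof -
   have [measurable]: "w \<in> borel_fun" unfolding w_def by measurable
   show ?thesis
    using r nn_integral_lborel_affine[of "\<lambda>x. ennreal (w x)" "1/r" 0]
    by (subst nn_integral_cmult) (auto simp: nI)
  qed
  also have "... = ennreal (2 ^ (DIM('a)+1) / r ^ (DIM('a)+1) * (r ^ DIM('a) * I))"
   using r I0 by (simp add: ennreal_mult[symmetric] power_one_over)
  also have "... \<le> ennreal (2 ^ (DIM('a) + 1) * (I + 1) / r)"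
   using r I0 by (intro ennreal_leI) (simp add: field_simps)
  finally show "(NN x. ennreal (1 / norm (x - z) ^ (DIM('a) + 1)) * indicator {x. r \<le> norm (x - z)} x) \<le> ennreal (2 ^ (DIM('a) + 1) * (I + 1) / r)" .
 qed (use I0 in auto)
qed

subsection \<open>Lebesgue points and approximate identities\<close>

definition lebesgue_point :: "('a::euclidean_space \<Rightarrow> 'b::real_normed_vector) \<Rightarrow> 'a \<Rightarrow> bool" where
 "lebesgue_point f x \<longleftrightarrow> (\<forall>e>0. \<exists>dl>0. \<forall>rho. 0 < rho \<and> rho < dl \<longrightarrow>
   (mass (cball x rho) (\<lambda>y. f y - f x)) \<le> ennreal (e * rho ^ DIM('a)))"

definition locally_integrable :: "('a::euclidean_space \<Rightarrow> 'b::{banach, second_countable_topology}) \<Rightarrow> bool" where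
 "locally_integrable f \<longleftrightarrow> f \<in> borel_fun \<and> (\<forall>r. set_integrable lborel (cball 0 r) f)"

lemma locally_integrableD:
 assumes "locally_integrable f" "A \<in> sets borel" "bounded A"
 shows "set_integrable lborel A f"
proof -
 obtain r where "A \<subseteq> cball 0 r" using assms(3) unfolding bounded_iff by (auto simp: subset_eq)
 then show ?thesis using assms(1,2) unfolding locally_integrable_def
  by (auto intro: set_integrable_subset)
qed

lemma locally_integrable_integrable: "integrable lborel f \<Longrightarrow> locally_integrable f"
 unfolding locally_integrable_def set_integrable_def
 by (auto intro!: integrable_mult_indicator)

lemma locally_integrable_norm_diff:
 fixes f :: "'a::euclidean_space \<Rightarrow> 'b::{banach, second_countable_topology}"
 assumes "locally_integrable f"
 shows "locally_integrable (\<lambda>y. norm (f y - q))"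
proof -
 have "set_integrable lborel (cball 0 r) (\<lambda>y. norm (f y - q))" for r
 proof -
  have "set_integrable lborel (cball 0 r) (\<lambda>y::'a. q)"
   unfolding set_integrable_def by (rule integrable_indicator) (use emeasure_lborel_cball_finite[of "0::'a" r] in auto)
  with locally_integrableD[OF assms, of "cball 0 r"]
  have "set_integrable lborel (cball 0 r) (\<lambda>y. f y - q)"
   by (intro set_integral_diff) auto
  then show ?thesis by (rule set_integrable_norm)
 qed
 then show ?thesis using assms unfolding locally_integrable_def by auto
qed

text \<open>Differentiation of the integral along cubes that have x as their lower corner. The
  remaining corners, and hence balls around x, are reached through coordinate reflections.\<close>

lemma AE_corner_averages:
 fixes h :: "'a::euclidean_space \<Rightarrow> real"
 assumes "locally_integrable h"
 shows "AE x in lborel. \<forall>e>0. \<exists>dl>0. \<forall>rho. 0 < rho \<and> rho < dl \<longrightarrow>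
  \<bar>(LINT y:cbox x (x + rho *\<^sub>R One)|lborel. h y) / rho ^ DIM('a) - h x\<bar> < e"
proof -
 have si: "set_integrable lborel (cbox a b) h" for a b
  by (rule locally_integrableD[OF assms]) auto
 have "h integrable_on cbox a b" for a b
  using set_borel_integral_eq_integral(1)[OF si] .
 then obtain N where N: "negligible N"
   "\<And>x e. \<lbrakk>x \<notin> N; 0 < e\<rbrakk> \<Longrightarrow> \<exists>d>0. \<forall>k. 0 < k \<and> k < d \<longrightarrow>
     norm(integral (cbox x (x + k *\<^sub>R One)) h /\<^sub>R k ^ DIM('a) - h x) < e"
  using integrable_ccontinuous_explicit[of h] by metis
 have "AE x in lebesgue. x \<notin> N"
  using N(1) by (auto simp: negligible_iff_null_sets intro: AE_not_in)
 then have "AE x in lborel. x \<notin> N" by (simp add: AE_completion_iff)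
 then show ?thesis
 proof eventually_elim
  case (elim x)
  show ?case
   using N(2)[OF elim] by (simp add: set_borel_integral_eq_integral(2)[OF si] divide_inverse_commute)
 qed
qed

text \<open>Sign change in the coordinates belonging to S. It moves the distinguished corner of a
  cube to any of its 2^d corners.\<close>

definition reflect :: "'a::euclidean_space set \<Rightarrow> 'a \<Rightarrow> 'a" where
 "reflect S x = (\<Sum>b\<in>Basis. (if b \<in> S then - (x \<bullet> b) else x \<bullet> b) *\<^sub>R b)"

lemma reflect_inner: "b \<in> Basis \<Longrightarrow> reflect S x \<bullet> b = (if b \<in> S then - (x \<bullet> b) else x \<bullet> b)"
 unfolding reflect_def by (rule inner_sum_left_Basis)

lemma reflect_reflect [simp]: "reflect S (reflect S x) = x"
 by (rule euclidean_eqI) (simp add: reflect_inner)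

lemma measurable_reflect [measurable]: "reflect S \<in> borel_fun"
 unfolding reflect_def[abs_def] by measurable

lemma distr_reflect: "distr lborel borel (reflect S) = (lborel :: 'a::euclidean_space measure)"
proof -
 define c :: "'a \<Rightarrow> real" where "c b = (if b \<in> S then -1 else 1)" for b
 have r: "(\<lambda>x::'a. 0 + (\<Sum>j\<in>Basis. (c j * (x \<bullet> j)) *\<^sub>R j)) = reflect S"
  by (auto simp: reflect_def c_def intro!: sum.cong ext)
 have "(lborel :: 'a measure) = density (distr lborel borel (\<lambda>x. 0 + (\<Sum>j\<in>Basis. (c j * (x \<bullet> j)) *\<^sub>R j))) (\<lambda>_. \<Prod>j\<in>Basis. \<bar>c j\<bar>)"
  by (rule lborel_affine_euclidean) (auto simp: c_def)
 also have "(\<Prod>j\<in>(Basis::'a set). \<bar>c j\<bar>) = 1" by (intro prod.neutral) (auto simp: c_def)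
 finally show ?thesis unfolding r by (simp add: density_1)
qed

lemma AE_reflect:
 assumes "AE x in lborel. P x"
 shows "AE x in lborel. P (reflect S x)"
proof (rule AE_distrD[of "reflect S" lborel borel P])
 show "AE x in distr lborel borel (reflect S). P x"
  unfolding distr_reflect by (rule assms)
qed measurable

lemma integrable_reflect:
 fixes f :: "'a::euclidean_space \<Rightarrow> 'b::{banach, second_countable_topology}"
 shows "integrable lborel f \<Longrightarrow> integrable lborel (\<lambda>x. f (reflect S x))"
  and "f \<in> borel_fun \<Longrightarrow> (LL x. f (reflect S x)) = (LL x. f x)"
 using integrable_distr[of "reflect S" lborel borel f] integral_distr[of "reflect S" lborel borel f]
 by (auto simp: distr_reflect)

lemma norm_reflect [simp]: "norm (reflect S x) = norm x"
 unfolding norm_eq_sqrt_inner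
 by (subst (1 2) euclidean_inner) (auto simp: reflect_inner intro!: sum.cong)

lemma locally_integrable_reflect:
 assumes "locally_integrable f"
 shows "locally_integrable (\<lambda>x. f (reflect S x))"
proof -
 have [measurable]: "f \<in> borel_fun" using assms by (simp add: locally_integrable_def)
 have "integrable lborel (\<lambda>x. indicator (cball 0 r) x *\<^sub>R f (reflect S x))" for r
 proof -
  have "integrable lborel (\<lambda>x. indicator (cball 0 r) x *\<^sub>R f x)"
   using assms by (simp add: locally_integrable_def set_integrable_def)
  from integrable_reflect(1)[OF this, of S] show ?thesis
   by (simp add: indicator_def)
 qed
 then show ?thesis by (simp add: locally_integrable_def set_integrable_def)
qed

lemma AE_reflected_corner_averages:
 fixes h :: "'a::euclidean_space \<Rightarrow> real"
 assumes "locally_integrable h"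
 shows "AE x in lborel. \<forall>e>0. \<exists>dl>0. \<forall>rho. 0 < rho \<and> rho < dl \<longrightarrow>
  \<bar>(LINT y:{y. reflect S y \<in> cbox (reflect S x) (reflect S x + rho *\<^sub>R One)}|lborel. h y) / rho ^ DIM('a) - h x\<bar> < e"
proof -
 have [measurable]: "h \<in> borel_fun" using assms by (simp add: locally_integrable_def)
 have "(LINT y:cbox (reflect S x) (reflect S x + rho *\<^sub>R One)|lborel. h (reflect S y))
   = (LINT y:{y. reflect S y \<in> cbox (reflect S x) (reflect S x + rho *\<^sub>R One)}|lborel. h y)" for x rho
  unfolding set_lebesgue_integral_def
  by (subst integrable_reflect(2)[where S=S, symmetric]) (auto simp: indicator_def)
 then show ?thesis
  using AE_reflect[OF AE_corner_averages[OF locally_integrable_reflect[OF assms, of S]], of S] by simp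
qed

text \<open>S collects the coordinates in which y lies below x; after reflection y lies above x in
  all of them.\<close>

lemma cball_subset_corners:
 fixes x :: "'a::euclidean_space"
 assumes "y \<in> cball x rho"
 shows "\<exists>S\<in>Pow Basis. reflect S y \<in> cbox (reflect S x) (reflect S x + rho *\<^sub>R One)"
proof -
 define S where "S = {b\<in>Basis. y \<bullet> b < x \<bullet> b}"
 have *: "y \<bullet> b \<le> x \<bullet> b + rho \<and> x \<bullet> b \<le> y \<bullet> b + rho" if "b \<in> Basis" for b
  using Basis_le_norm[OF that, of "y - x"] assms
  by (simp add: dist_norm norm_minus_commute inner_diff_left) linarith
 then have "reflect S y \<in> cbox (reflect S x) (reflect S x + rho *\<^sub>R One)"
  unfolding mem_box
  using * by (intro ballI) (force simp: reflect_inner S_def inner_add_left)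
 then show ?thesis unfolding S_def by blast
qed

text \<open>One null set must serve all centres q, so corner averages of |f - q| are taken only for
  q in a countable dense set; at a good point x some such q is close to f x, and the 2^d corner
  cubes cover the ball.\<close>

lemma AE_lebesgue_point:
 fixes f :: "'a::euclidean_space \<Rightarrow> 'b::{banach, second_countable_topology}"
 assumes f: "locally_integrable f"
 shows "AE x in lborel. lebesgue_point f x"
proof -
 obtain D :: "'b set" where D: "countable D" "\<And>X. open X \<Longrightarrow> X \<noteq> {} \<Longrightarrow> \<exists>d\<in>D. d \<in> X"
  using countable_dense_exists[where 'a='b] by blast
 have [measurable]: "f \<in> borel_fun" using f by (simp add: locally_integrable_def)
 define K where "K S x rho = {y::'a. reflect S y \<in> cbox (reflect S x) (reflect S x + rho *\<^sub>R One)}" for S x rho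
 have Km [measurable]: "K S x rho \<in> sets borel" for S x rho
  unfolding K_def using measurable_sets[OF measurable_reflect[of S], of "cbox (reflect S x) (reflect S x + rho *\<^sub>R One)"]
  by (auto simp: vimage_def)
 have Kb: "bounded (K S x rho)" for S x rho
 proof -
  have "bounded (cbox (reflect S x) (reflect S x + rho *\<^sub>R One))" by simp
  then obtain B where B: "\<And>z. z \<in> cbox (reflect S x) (reflect S x + rho *\<^sub>R One) \<Longrightarrow> norm z \<le> B"
   unfolding bounded_iff by blast
  show ?thesis unfolding bounded_iff K_def using B[of "reflect S _"] by auto
 qed
 have "AE x in lborel. \<forall>S\<in>Pow (Basis::'a set). \<forall>q\<in>D. \<forall>e>0. \<exists>dl>0. \<forall>rho. 0 < rho \<and> rho < dl \<longrightarrow>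
  \<bar>(LINT y:K S x rho|lborel. norm (f y - q)) / rho ^ DIM('a) - norm (f x - q)\<bar> < e"
  unfolding K_def using D(1)
 proof (subst AE_ball_countable)
  show "\<forall>S\<in>Pow (Basis::'a set). AE x in lborel. \<forall>q\<in>D. \<forall>e>0. \<exists>dl>0. \<forall>rho. 0 < rho \<and> rho < dl \<longrightarrow>
   \<bar>(LINT y:{y. reflect S y \<in> cbox (reflect S x) (reflect S x + rho *\<^sub>R One)}|lborel. norm (f y - q)) / rho ^ DIM('a) - norm (f x - q)\<bar> < e"
   by (intro ballI, subst AE_ball_countable[OF D(1)])
     (intro ballI AE_reflected_corner_averages locally_integrable_norm_diff f)
 qed (auto intro: countable_finite)
 then show ?thesis
 proof eventually_elim
  case (elim x)
  show ?case unfolding lebesgue_point_def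
  proof (intro allI impI)
   fix e :: real assume e: "e > 0"
   define M where "M = (2::real) ^ DIM('a)"
   define c where "c = measure lborel (cball (0::'a) 1)"
   have M: "M > 0" and c: "c \<ge> 0" by (auto simp: M_def c_def)
   \<comment> \<open>Each of the M = 2^d corner cubes contributes 2 eta rho^d, and replacing q by f
     x on the ball contributes eta c rho^d.\<close>
   define eta where "eta = e / (2 * M + c)"
   have eta: "eta > 0" using e M c by (simp add: eta_def)
   obtain q where q: "q \<in> D" "norm (f x - q) < eta"
    using D(2)[of "ball (f x) eta"] eta by (auto simp: dist_norm)
   have "\<forall>S\<in>Pow (Basis::'a set). \<exists>dl>0. \<forall>rho. 0 < rho \<and> rho < dl \<longrightarrow>
     \<bar>(LINT y:K S x rho|lborel. norm (f y - q)) / rho ^ DIM('a) - norm (f x - q)\<bar> < eta"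
    using elim q(1) eta by blast
   then obtain dl where dl: "\<And>S. S \<in> Pow (Basis::'a set) \<Longrightarrow> dl S > 0"
     "\<And>S rho. S \<in> Pow (Basis::'a set) \<Longrightarrow> 0 < rho \<Longrightarrow> rho < dl S \<Longrightarrow>
     \<bar>(LINT y:K S x rho|lborel. norm (f y - q)) / rho ^ DIM('a) - norm (f x - q)\<bar> < eta"
    by metis
   define dl0 where "dl0 = Min (dl ` Pow Basis)"
   show "\<exists>dl>0. \<forall>rho. 0 < rho \<and> rho < dl \<longrightarrow>
    (mass (cball x rho) (\<lambda>y. f y - f x)) \<le> ennreal (e * rho ^ DIM('a))"
   proof (intro exI[of _ dl0] conjI allI impI)
    show "dl0 > 0" unfolding dl0_def using dl(1) by (subst Min_gr_iff) auto
   next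
    fix rho assume "0 < rho \<and> rho < dl0"
    then have rho: "0 < rho" "\<And>S. S \<in> Pow Basis \<Longrightarrow> rho < dl S"
     using Min_le[of "dl ` Pow Basis"] by (auto simp: dl0_def intro: less_le_trans)
    have one: "(mass (K S x rho) (\<lambda>y. f y - q)) \<le> ennreal (2 * eta * rho ^ DIM('a))"
     if S: "S \<in> Pow Basis" for S
    proof -
     have i: "set_integrable lborel (K S x rho) (\<lambda>y. norm (f y - q))"
      by (rule locally_integrableD[OF locally_integrable_norm_diff[OF f] Km Kb])
     have "(mass (K S x rho) (\<lambda>y. f y - q)) = ennreal (LINT y:K S x rho|lborel. norm (f y - q))"
      unfolding set_lebesgue_integral_def
      using i[unfolded set_integrable_def] 
      by (subst nn_integral_eq_integral[symmetric]) (auto intro!: nn_integral_cong simp: indicator_def)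
     also have "(LINT y:K S x rho|lborel. norm (f y - q)) \<le> 2 * eta * rho ^ DIM('a)"
      proof -
      have "(LINT y:K S x rho|lborel. norm (f y - q)) / rho ^ DIM('a) \<le> 2 * eta"
       using dl(2)[OF S rho(1) rho(2)[OF S]] q(2) by linarith
      then show ?thesis using rho(1) by (simp add: divide_le_eq)
     qed
     finally show ?thesis by (simp add: ennreal_leI)
    qed
    have "(mass (cball x rho) (\<lambda>y. f y - f x))
      \<le> (NN y. (\<Sum>S\<in>Pow (Basis::'a set). ennreal (norm (f y - q)) * indicator (K S x rho) y) + ennreal eta * indicator (cball x rho) y)"
    proof (intro nn_integral_mono)
     fix y
     show "ennreal (norm (f y - f x)) * indicator (cball x rho) y \<le>
      (\<Sum>S\<in>Pow (Basis::'a set). ennreal (norm (f y - q)) * indicator (K S x rho) y) + ennreal eta * indicator (cball x rho) y"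
     proof (cases "y \<in> cball x rho")
      case True
      from cball_subset_corners[OF True] obtain S where S: "S \<in> Pow Basis" "y \<in> K S x rho" unfolding K_def by blast
      have "norm (f y - f x) \<le> norm (f y - q) + eta"
       using norm_triangle_ineq[of "f y - q" "q - f x"] q(2) by (simp add: norm_minus_commute)
      then have "ennreal (norm (f y - f x)) \<le> ennreal (norm (f y - q)) + ennreal eta"
       using eta by (simp add: ennreal_plus[symmetric] ennreal_leI del: ennreal_plus)
      also have "ennreal (norm (f y - q)) = ennreal (norm (f y - q)) * indicator (K S x rho) y" using S by simp
      also have "... \<le> (\<Sum>S\<in>Pow (Basis::'a set). ennreal (norm (f y - q)) * indicator (K S x rho) y)"
       by (rule member_le_sum[OF S(1)]) auto
      finally show ?thesis using True by (simp add: add_right_mono)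
     qed auto
    qed
    also have "... = (\<Sum>S\<in>Pow (Basis::'a set). mass (K S x rho) (\<lambda>y. f y - q)) + ennreal eta * emeasure lborel (cball x rho)"
    proof -
     have [measurable]: "cball x rho \<in> sets borel" by simp
     have "(NN y. ennreal eta * indicator (cball x rho) y) = ennreal eta * emeasure lborel (cball x rho)"
      by (rule nn_integral_cmult_indicator) simp
     moreover have "(NN y. (\<Sum>S\<in>Pow (Basis::'a set). ennreal (norm (f y - q)) * indicator (K S x rho) y))
      = (\<Sum>S\<in>Pow (Basis::'a set). mass (K S x rho) (\<lambda>y. f y - q))"
      by (rule nn_integral_sum) measurable
     moreover have "(NN y. (\<Sum>S\<in>Pow (Basis::'a set). ennreal (norm (f y - q)) * indicator (K S x rho) y) + ennreal eta * indicator (cball x rho) y)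
      = (NN y. (\<Sum>S\<in>Pow (Basis::'a set). ennreal (norm (f y - q)) * indicator (K S x rho) y)) + (NN y. ennreal eta * indicator (cball x rho) y)"
      by (rule nn_integral_add) measurable
     ultimately show ?thesis by (simp only:)

    qed
    also have "... \<le> (\<Sum>S\<in>Pow (Basis::'a set). ennreal (2 * eta * rho ^ DIM('a))) + ennreal eta * emeasure lborel (cball x rho)"
     by (intro add_right_mono sum_mono one) auto
    also have "emeasure lborel (cball x rho) = ennreal (c * rho ^ DIM('a))"
     using rho(1) by (simp add: c_def emeasure_cball content_cball)
    also have "(\<Sum>S\<in>Pow (Basis::'a set). ennreal (2 * eta * rho ^ DIM('a))) = ennreal (M * (2 * eta * rho ^ DIM('a)))"
     by (simp add: M_def card_Pow ennreal_mult ennreal_power[symmetric] mult_ac eta less_imp_le rho(1))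
    also have "ennreal (M * (2 * eta * rho ^ DIM('a))) + ennreal eta * ennreal (c * rho ^ DIM('a)) = ennreal ((2 * M + c) * eta * rho ^ DIM('a))"
     using M c eta rho(1) by (simp add: ennreal_mult[symmetric] ennreal_plus[symmetric] algebra_simps del: ennreal_plus)
    also have "(2 * M + c) * eta = e" using M c by (simp add: eta_def)
    finally show "(mass (cball x rho) (\<lambda>y. f y - f x)) \<le> ennreal (e * rho ^ DIM('a))" .
   qed
  qed
 qed
qed

lemma cball_sets_borel [measurable]: "cball x r \<in> sets borel" for x :: "'a::metric_space"
 by simp

text \<open>Large-scale counterpart of \<open>lebesgue_point\<close>. The weights used below decay
  only polynomially, so distant balls must be controlled as well.\<close>

definition bounded_averages :: "('a::euclidean_space \<Rightarrow> 'b::real_normed_vector) \<Rightarrow> 'a \<Rightarrow> bool" where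
 "bounded_averages f x \<longleftrightarrow> (\<exists>M\<ge>0. \<forall>rho\<ge>1.
   (mass (cball x rho) (\<lambda>y. f y - f x)) \<le> ennreal (M * rho ^ DIM('a)))"

lemma bounded_averagesI:
 fixes f :: "'a::euclidean_space \<Rightarrow> 'b::{banach, second_countable_topology}"
 assumes [measurable]: "f \<in> borel_fun" and p: "p = 1 \<or> p = 2"
  and fin: "(NN y. ennreal (norm (f y) ^ p)) < \<infinity>"
 shows "bounded_averages f x"
proof -
 obtain B where B: "B \<ge> 0" "(NN y. ennreal (norm (f y) ^ p)) = ennreal B"
  using fin by (cases "NN y. ennreal (norm (f y) ^ p)") auto
 define c where "c = measure lborel (cball (0::'a) 1)"
 have c: "c \<ge> 0" by (simp add: c_def)
 show ?thesis unfolding bounded_averages_def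
 proof (intro exI[of _ "B + (1 + norm (f x)) * c"] conjI allI impI)
  fix rho :: real assume rho: "rho \<ge> 1"
  have "(mass (cball x rho) (\<lambda>y. f y - f x))
   \<le> (NN y. ennreal (norm (f y) ^ p) + ennreal (1 + norm (f x)) * indicator (cball x rho) y)"
  proof (intro nn_integral_mono)
   fix y
   have "norm (f y - f x) \<le> norm (f y) + norm (f x)" by (rule norm_triangle_ineq4)
   \<comment> \<open>For p = 2 this follows from (u - 1/2)^2 >= 0.\<close>
   also have "norm (f y) \<le> norm (f y) ^ p + 1"
    using p zero_le_power2[of "norm (f y) - 1/2"] by (auto simp: power2_eq_square algebra_simps)
   finally have "norm (f y - f x) \<le> norm (f y) ^ p + (1 + norm (f x))" by simp
   then have "ennreal (norm (f y - f x)) \<le> ennreal (norm (f y) ^ p) + ennreal (1 + norm (f x))"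
    by (subst ennreal_plus[symmetric]) (auto intro!: ennreal_leI simp del: ennreal_plus)
   then show "ennreal (norm (f y - f x)) * indicator (cball x rho) y \<le> ennreal (norm (f y) ^ p) + ennreal (1 + norm (f x)) * indicator (cball x rho) y"
    by (auto simp: indicator_def)
  qed
  also have "... = ennreal B + ennreal (1 + norm (f x)) * emeasure lborel (cball x rho)"
   by (subst nn_integral_add) (auto simp: B nn_integral_cmult)
  also have "emeasure lborel (cball x rho) = ennreal (c * rho ^ DIM('a))"
   using rho by (simp add: c_def emeasure_cball content_cball)
  also have "ennreal B + ennreal (1 + norm (f x)) * ennreal (c * rho ^ DIM('a)) = ennreal (B + (1 + norm (f x)) * (c * rho ^ DIM('a)))"
   using B c rho by (subst ennreal_mult[symmetric]) auto
  also have "... \<le> ennreal ((B + (1 + norm (f x)) * c) * rho ^ DIM('a))"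
  proof -
   have "B * 1 \<le> B * rho ^ DIM('a)" using B rho by (intro mult_left_mono one_le_power) auto
   then show ?thesis by (intro ennreal_leI) (simp add: algebra_simps)
  qed
  finally show "(mass (cball x rho) (\<lambda>y. f y - f x)) \<le> ennreal ((B + (1 + norm (f x)) * c) * rho ^ DIM('a))" .
 qed (use B c in auto)
qed

text \<open>Let k be the least exponent with u <= 2^k t. Then t + u is at least half of 2^k t, and
  the exponent d + 1 leaves a factor (1/2)^k after division by the volume scale of that ball; this
  factor makes the dyadic sum converge.\<close>

lemma weight_le_dyadic:
 fixes u t :: real
 assumes "u \<ge> 0" "t > 0"
 shows "\<exists>k. u \<le> 2 ^ k * t \<and> t / (t + u) ^ (d + 1) \<le> 2 ^ (d + 1) * (1/2) ^ k / (2 ^ k * t) ^ d"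
proof -
 have ex: "\<exists>k. u \<le> 2 ^ k * t"
  using real_arch_pow[of 2 "u / t"] assms by (auto simp: field_simps intro: less_imp_le)
 define k where "k = (LEAST k. u \<le> 2 ^ k * t)"
 have k: "u \<le> 2 ^ k * t" unfolding k_def by (rule LeastI_ex[OF ex])
 have low: "2 ^ k * t / 2 \<le> t + u"
 proof (cases k)
  case (Suc j)
  then have "\<not> u \<le> 2 ^ j * t" using not_less_Least[of j "\<lambda>k. u \<le> 2 ^ k * t"] by (auto simp: k_def)
  then show ?thesis using Suc assms by simp
 qed (use assms in auto)
 have pos: "2 ^ k * t / 2 > 0" using assms by simp
 have "t / (t + u) ^ (d + 1) \<le> t / (2 ^ k * t / 2) ^ (d + 1)"
  using assms pos low by (intro divide_left_mono power_mono mult_pos_pos zero_less_power) auto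
 also have "... = 2 ^ (d + 1) * (1/2) ^ k / (2 ^ k * t) ^ d"
  using assms by (simp add: power_divide field_simps)
 finally show ?thesis using k by blast
qed

text \<open>The weight is spread over the dyadic balls around x. On radii below \<open>dl\<close>
  the oscillation is small by the Lebesgue point property; on larger ones it is merely bounded, but
  those carry little weight when t is small.\<close>

lemma weighted_oscillation_small:
 fixes f :: "'a::euclidean_space \<Rightarrow> 'b::{banach, second_countable_topology}"
 assumes [measurable]: "f \<in> borel_fun"
  and lp: "lebesgue_point f x" and ba: "bounded_averages f x" and "e > 0"
 shows "\<exists>dl>0. \<forall>t. 0 < t \<and> t < dl \<longrightarrow>
   (NN y. ennreal (t / (t + norm (x - y)) ^ (DIM('a) + 1)) * ennreal (norm (f y - f x))) \<le> ennreal e"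
proof -
 define A where "A rho = (mass (cball x rho) (\<lambda>y. f y - f x))" for rho
 define D where "D = (2::real) ^ (DIM('a) + 1)"
 have D: "D > 0" by (simp add: D_def)
 define eta where "eta = e / (4 * D)"
 have eta: "eta > 0" using D assms(4) by (simp add: eta_def)
 obtain dl' where dl': "dl' > 0" "\<And>rho. 0 < rho \<Longrightarrow> rho < dl' \<Longrightarrow> A rho \<le> ennreal (eta * rho ^ DIM('a))"
  using lp eta unfolding lebesgue_point_def A_def by blast
 obtain M where M: "M \<ge> 0" "\<And>rho. 1 \<le> rho \<Longrightarrow> A rho \<le> ennreal (M * rho ^ DIM('a))"
  using ba unfolding bounded_averages_def A_def by blast
 define dl where "dl = min dl' 1"
 have dl: "0 < dl" "dl \<le> 1" using dl' by (auto simp: dl_def)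
 \<comment> \<open>Dividing by dl^d carries the bound for radii >= 1 down to radii between
   \<open>dl\<close> and 1.\<close>
 define M' where "M' = M / dl ^ DIM('a)"
 have M': "M' \<ge> 0" using M dl by (simp add: M'_def)
 have Alarge: "A rho \<le> ennreal (M' * rho ^ DIM('a))" if "rho \<ge> dl" for rho
 proof (cases "rho \<ge> 1")
  case True
  have "dl ^ DIM('a) \<le> 1" using dl by (intro power_le_one) auto
  then have "M \<le> M'" using M(1) dl by (simp add: M'_def le_divide_eq mult_left_le)
  then have "M * rho ^ DIM('a) \<le> M' * rho ^ DIM('a)" using True by (intro mult_right_mono) auto
  with M(2)[OF True] show ?thesis by (meson ennreal_leI order_trans)
 next
  case False
  have "A rho \<le> A 1" unfolding A_def using False by (intro nn_integral_mono) (auto simp: indicator_def)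
  also have "... \<le> ennreal (M * 1 ^ DIM('a))" by (rule M(2)) simp
  also have "M * 1 ^ DIM('a) \<le> M' * rho ^ DIM('a)"
  proof -
   have "dl ^ DIM('a) \<le> rho ^ DIM('a)" using that dl by (intro power_mono) auto
   then have "M' * dl ^ DIM('a) \<le> M' * rho ^ DIM('a)" using M' by (rule mult_left_mono)
   then show ?thesis using dl by (simp add: M'_def)
  qed
  finally show ?thesis by (simp add: ennreal_leI)
 qed
 define s where "s = sqrt (1/2)"
 have s: "0 < s" "s < 1" by (auto simp: s_def real_sqrt_lt_1_iff)
 \<comment> \<open>One bound for all radii: the square root is at least 1 beyond \<open>dl\<close>,
   and it grows like 2^(k/2), which the factor (1/2)^k of the weight still beats. Summation leaves a
   multiple of sqrt t.\<close>
 have Aall: "A (2 ^ k * t) \<le> ennreal ((eta + M' * sqrt (2 ^ k * t / dl)) * (2 ^ k * t) ^ DIM('a))" if t: "t > 0" for t k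
 proof (cases "2 ^ k * t < dl")
  case True
  then have "A (2 ^ k * t) \<le> ennreal (eta * (2 ^ k * t) ^ DIM('a))"
   using t by (intro dl'(2)) (auto simp: dl_def)
  also have "... \<le> ennreal ((eta + M' * sqrt (2 ^ k * t / dl)) * (2 ^ k * t) ^ DIM('a))"
   using t M' dl by (intro ennreal_leI mult_right_mono) auto
  finally show ?thesis .
 next
  case False
  then have "A (2 ^ k * t) \<le> ennreal (M' * (2 ^ k * t) ^ DIM('a))" by (intro Alarge) auto
  also have "... \<le> ennreal ((eta + M' * sqrt (2 ^ k * t / dl)) * (2 ^ k * t) ^ DIM('a))"
  proof (intro ennreal_leI mult_right_mono)
   have "1 \<le> sqrt (2 ^ k * t / dl)" using False dl by (simp add: le_divide_eq)
   then have "M' * 1 \<le> M' * sqrt (2 ^ k * t / dl)" using M' by (intro mult_left_mono) auto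
   then show "M' \<le> eta + M' * sqrt (2 ^ k * t / dl)" using eta by simp
  qed (use t in auto)
  finally show ?thesis .
 qed
 define N where "N = D * M' / (1 - s) / sqrt dl"
 have N: "N \<ge> 0" using D M' s dl by (simp add: N_def)
 have main: "(NN y. ennreal (t / (t + norm (x - y)) ^ (DIM('a) + 1)) * ennreal (norm (f y - f x)))
   \<le> ennreal (e / 2 + N * sqrt t)" if t: "t > 0" for t
 proof -
  define w where "w k = D * (1/2) ^ k / (2 ^ k * t) ^ DIM('a)" for k
  have w: "w k \<ge> 0" for k using t D by (simp add: w_def)
  have "(NN y. ennreal (t / (t + norm (x - y)) ^ (DIM('a) + 1)) * ennreal (norm (f y - f x)))
   \<le> (NN y. (\<Sum>k. ennreal (w k) * (ennreal (norm (f y - f x)) * indicator (cball x (2 ^ k * t)) y)))"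
  proof (intro nn_integral_mono)
   fix y
   obtain k where k: "norm (x - y) \<le> 2 ^ k * t" "t / (t + norm (x - y)) ^ (DIM('a) + 1) \<le> w k"
    using weight_le_dyadic[of "norm (x - y)" t "DIM('a)"] t by (auto simp: w_def D_def)
   have "ennreal (t / (t + norm (x - y)) ^ (DIM('a) + 1)) * ennreal (norm (f y - f x))
    \<le> ennreal (w k) * (ennreal (norm (f y - f x)) * indicator (cball x (2 ^ k * t)) y)"
    using k by (auto simp: dist_norm intro!: mult_right_mono ennreal_leI)
   also have "... = (\<Sum>i\<in>{k}. ennreal (w i) * (ennreal (norm (f y - f x)) * indicator (cball x (2 ^ i * t)) y))" by simp
   also have "... \<le> (\<Sum>k. ennreal (w k) * (ennreal (norm (f y - f x)) * indicator (cball x (2 ^ k * t)) y))"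
    by (rule sum_le_suminf) auto
   finally show "ennreal (t / (t + norm (x - y)) ^ (DIM('a) + 1)) * ennreal (norm (f y - f x)) \<le> ..." .
  qed
  also have "... = (\<Sum>k. ennreal (w k) * A (2 ^ k * t))"
   by (subst nn_integral_suminf) (auto simp: A_def nn_integral_cmult)
  also have "... \<le> (\<Sum>k. ennreal (D * eta * (1/2) ^ k + D * M' / sqrt dl * sqrt t * s ^ k))"
  proof (intro suminf_le)
   fix k
   have "ennreal (w k) * A (2 ^ k * t) \<le> ennreal (w k) * ennreal ((eta + M' * sqrt (2 ^ k * t / dl)) * (2 ^ k * t) ^ DIM('a))" (is "?l \<le> _")
    by (intro mult_left_mono Aall t) auto
   also have "... = ennreal (w k * ((eta + M' * sqrt (2 ^ k * t / dl)) * (2 ^ k * t) ^ DIM('a)))"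
    using w by (intro ennreal_mult'[symmetric]) auto
   also have "w k * ((eta + M' * sqrt (2 ^ k * t / dl)) * (2 ^ k * t) ^ DIM('a)) = D * (1/2) ^ k * (eta + M' * sqrt (2 ^ k * t / dl))"
    using t by (simp add: w_def)
   also have "... = D * eta * (1/2) ^ k + D * M' / sqrt dl * sqrt t * ((1/2)^k * sqrt (2 ^ k))"
    by (simp add: real_sqrt_mult real_sqrt_divide algebra_simps)
   also have "(1/2::real)^k * sqrt (2 ^ k) = s ^ k"
   proof -
    have "sqrt 2 * sqrt 2 = (2::real)" by simp
    then have "(1/2::real) * sqrt 2 = s" by (simp add: s_def real_sqrt_divide field_simps)
    then have "s ^ k = (1/2)^k * sqrt 2 ^ k" by (simp only: power_mult_distrib[symmetric])
    then show ?thesis by (simp add: real_sqrt_power)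
   qed
   finally show "?l \<le> ennreal (D * eta * (1/2) ^ k + D * M' / sqrt dl * sqrt t * s ^ k)" .
  qed auto
  also have "... = ennreal (D * eta * (1 / (1 - 1/2)) + D * M' / sqrt dl * sqrt t * (1 / (1 - s)))"
  proof (rule suminf_ennreal_eq)
   show "(\<lambda>k. D * eta * (1/2) ^ k + D * M' / sqrt dl * sqrt t * s ^ k) sums (D * eta * (1 / (1 - 1/2)) + D * M' / sqrt dl * sqrt t * (1 / (1 - s)))"
    using s by (intro sums_add sums_mult geometric_sums) auto
  qed (use D eta M' dl t s in auto)
  also have "D * eta * (1 / (1 - 1/2)) + D * M' / sqrt dl * sqrt t * (1 / (1 - s)) = e / 2 + N * sqrt t"
   using D by (simp add: eta_def N_def)
  finally show ?thesis .
 qed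
 show ?thesis
 proof (intro exI[of _ "(e / (2 * (N + 1)))^2"] conjI allI impI)
  show "0 < (e / (2 * (N + 1)))^2" using N assms(4) by simp
  fix t assume t: "0 < t \<and> t < (e / (2 * (N + 1)))^2"
  then have "sqrt t \<le> e / (2 * (N + 1))"
   using N assms(4) by (intro real_le_lsqrt) auto
  then have "N * sqrt t \<le> N * (e / (2 * (N + 1)))" using N by (rule mult_left_mono)
  also have "... \<le> e / 2" using N assms(4) by (simp add: field_simps)
  finally have "e / 2 + N * sqrt t \<le> e" by simp
  with main[of t] t show "(NN y. ennreal (t / (t + norm (x - y)) ^ (DIM('a) + 1)) * ennreal (norm (f y - f x))) \<le> ennreal e"
   by (meson ennreal_leI order_trans)
 qed
qed

definition conv :: "('a::euclidean_space \<Rightarrow> real) \<Rightarrow> ('a \<Rightarrow> 'b::{banach, second_countable_topology}) \<Rightarrow> 'a \<Rightarrow> 'b" where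
 "conv K f x = (LL y. K (x - y) *\<^sub>R f y)"

lemma integrable_weight:
 assumes "t > 0"
 shows "integrable lborel (\<lambda>y::'a::euclidean_space. t / (t + norm y) ^ (DIM('a) + 1))"
proof -
 have "integrable lborel (\<lambda>y::'a. inverse (t ^ DIM('a)) * inverse ((1 + norm (0 + (1/t) *\<^sub>R y)) ^ (DIM('a) + 1)))"
  using assms by (intro integrable_mult_right integral_lborel_affine(2)[OF integrable_inverse_norm_power]) auto
 also have "(\<lambda>y::'a. inverse (t ^ DIM('a)) * inverse ((1 + norm (0 + (1/t) *\<^sub>R y)) ^ (DIM('a) + 1))) =
   (\<lambda>y. t / (t + norm y) ^ (DIM('a) + 1))"
 proof
  fix y :: 'a
  have "1 + norm (0 + (1/t) *\<^sub>R y) = (t + norm y) / t" using assms by (simp add: field_simps)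
  moreover have "t + norm y > 0" using assms by (simp add: add_pos_nonneg)
  ultimately show "inverse (t ^ DIM('a)) * inverse ((1 + norm (0 + (1/t) *\<^sub>R y)) ^ (DIM('a) + 1)) = t / (t + norm y) ^ (DIM('a) + 1)"
   using assms by (simp add: power_divide)
 qed
 finally show ?thesis .
qed

text \<open>Subtracting f x under the integral leaves the weighted oscillation. The mass \<kappa> is
  arbitrary: \<kappa> = 1 gives approximate identities, \<kappa> = 0 compares two regularisations of
  the Riesz kernel.\<close>

lemma conv_tendsto:
 fixes f :: "'a::euclidean_space \<Rightarrow> 'b::{banach, second_countable_topology}"
 assumes f[measurable]: "f \<in> borel_fun"
  and lp: "lebesgue_point f x" and ba: "bounded_averages f x"
  and K[measurable]: "\<And>t. K t \<in> borel_fun"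
  and Kb: "\<And>t y. t > 0 \<Longrightarrow> \<bar>K t y\<bar> \<le> C * (t / (t + norm y) ^ (DIM('a) + 1))"
  and K1: "\<And>t. t > 0 \<Longrightarrow> (LL y. K t y) = \<kappa>"
 shows "((\<lambda>t. conv (K t) f x) \<longlongrightarrow> \<kappa> *\<^sub>R f x) (at_right 0)"
proof (rule tendstoI)
 fix e :: real assume e: "e > 0"
 define C' where "C' = \<bar>C\<bar> + 1"
 have C': "C' > 0" by (simp add: C'_def)
 have Kb': "\<bar>K t y\<bar> \<le> C' * (t / (t + norm y) ^ (DIM('a) + 1))" if "t > 0" for t y
  by (rule order_trans[OF Kb[OF that]], rule mult_right_mono) (use that in \<open>auto simp: C'_def\<close>)
 from weighted_oscillation_small[OF f lp ba, of "e / (2 * C')"] e C'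
 obtain dl where dl: "dl > 0" "\<And>t. 0 < t \<Longrightarrow> t < dl \<Longrightarrow>
   (NN y. ennreal (t / (t + norm (x - y)) ^ (DIM('a) + 1)) * ennreal (norm (f y - f x))) \<le> ennreal (e / (2 * C'))"
  by auto
 have "dist (conv (K t) f x) (\<kappa> *\<^sub>R f x) < e" if t: "0 < t" "t < dl" for t
 proof -
  have iK: "integrable lborel (K t)"
   by (rule L_integrable_bound[OF integrable_mult_right[OF integrable_weight[OF t(1)], of C']])
     (use Kb'[OF t(1)] C' t in \<open>auto intro!: AE_I2\<close>)
  have iKx: "integrable lborel (\<lambda>y. K t (x - y) *\<^sub>R f x)"
   using iK by (intro integrable_scaleR_left) (simp add: integral_lborel_reflect)
  have bd: "(N1 y. K t (x - y) *\<^sub>R (f y - f x)) \<le> ennreal (e / 2)"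
  proof -
   have "(N1 y. K t (x - y) *\<^sub>R (f y - f x)) \<le>
    (NN y. ennreal C' * (ennreal (t / (t + norm (x - y)) ^ (DIM('a) + 1)) * ennreal (norm (f y - f x))))"
   proof (intro nn_integral_mono)
    fix y
    have "\<bar>K t (x - y)\<bar> * norm (f y - f x) \<le> (C' * (t / (t + norm (x - y)) ^ (DIM('a) + 1))) * norm (f y - f x)"
     by (intro mult_right_mono Kb' t) auto
    then show "ennreal (norm (K t (x - y) *\<^sub>R (f y - f x))) \<le> ennreal C' * (ennreal (t / (t + norm (x - y)) ^ (DIM('a) + 1)) * ennreal (norm (f y - f x)))"
     using C' t by (simp add: ennreal_mult[symmetric] mult.assoc[symmetric] ennreal_leI del: power_Suc)
   qed
   also have "... = ennreal C' * (NN y. (ennreal (t / (t + norm (x - y)) ^ (DIM('a) + 1)) * ennreal (norm (f y - f x))))"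
    by (rule nn_integral_cmult) measurable
   also have "... \<le> ennreal C' * ennreal (e / (2 * C'))"
    by (intro mult_left_mono dl(2) t) auto
   also have "... = ennreal (e / 2)" using C' e by (simp add: ennreal_mult[symmetric])
   finally show ?thesis .
  qed
  have iD: "integrable lborel (\<lambda>y. K t (x - y) *\<^sub>R (f y - f x))"
   by (rule integrableI_bounded) (use bd in \<open>auto simp: less_top[symmetric] top_unique\<close>)
  have "conv (K t) f x = (LL y. K t (x - y) *\<^sub>R (f y - f x) + K t (x - y) *\<^sub>R f x)"
   by (simp add: conv_def algebra_simps)
  also have "... = (LL y. K t (x - y) *\<^sub>R (f y - f x)) + \<kappa> *\<^sub>R f x"
   using iD iKx iK K1[OF t(1)]
   by (simp add: integral_lborel_reflect)
  finally have "norm (conv (K t) f x - \<kappa> *\<^sub>R f x) = norm (LL y. K t (x - y) *\<^sub>R (f y - f x))" by simp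
  also have "... \<le> e / 2"
  proof -
   have "ennreal (norm (LL y. K t (x - y) *\<^sub>R (f y - f x))) \<le> (N1 y. K t (x - y) *\<^sub>R (f y - f x))"
    by (rule integral_norm_bound_ennreal[OF iD])
   also have "... \<le> ennreal (e / 2)" by (rule bd)
   finally show ?thesis using e by (simp add: ennreal_le_iff)
  qed
  also have "... < e" using e by simp
  finally show ?thesis by (simp add: dist_norm)
 qed
 then show "\<forall>\<^sub>F t in at_right 0. dist (conv (K t) f x) (\<kappa> *\<^sub>R f x) < e"
  unfolding eventually_at_right_field using dl(1) by blast
qed

subsection \<open>Heat kernel profiles\<close>

lemma powr_neg_half: "u > 0 \<Longrightarrow> u powr (- (real k / 2)) = 1 / sqrt u ^ k"
proof -
 assume u: "u > 0"
 have "u powr (- (real k / 2)) = (u powr (1/2)) powr (- real k)" by (simp add: powr_powr)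
 also have "... = inverse (sqrt u powr real k)" using u by (simp only: powr_half_sqrt powr_minus less_imp_le)
 also have "... = 1 / sqrt u ^ k" using u by (subst powr_realpow) (auto simp: divide_inverse)
 finally show ?thesis .
qed

lemma sqrt_sum_ge: 
 assumes "a \<ge> 0" "b \<ge> 0" shows "(sqrt a + sqrt b) / 2 \<le> sqrt (a + b)"
proof -
 have "sqrt a + sqrt b \<le> sqrt (a + b) + sqrt (a + b)" using assms by (intro add_mono) auto
 then show ?thesis by simp
qed

text \<open>The inequality v <= exp v at v = (1 + q / \<tau>) / (4 p), raised to the power p = k /
  2, trades the exponential for a power of q + \<tau>. This fixes the constant: 4 p = 2 k, and exp
  (1/4) is left over.\<close>

lemma exp_decay_bound:
 assumes "k \<ge> 1" "\<tau> > 0" "q \<ge> 0"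
 shows "\<tau> powr (- (real k / 2)) * exp (- q / (4 * \<tau>)) \<le> ((2 * k) powr (real k / 2) * exp (1/4)) * (q + \<tau>) powr (- (real k / 2))"
proof -
 define p where "p = real k / 2"
 have p: "p > 0" using assms by (simp add: p_def)
 define r where "r = q / \<tau>"
 have r: "r \<ge> 0" using assms by (simp add: r_def)
 have "(1 + r) / (4 * p) \<le> exp ((1 + r) / (4 * p))" using exp_ge_add_one_self[of "(1 + r) / (4 * p)"] by linarith
 then have "((1 + r) / (4 * p)) powr p \<le> exp ((1 + r) / (4 * p)) powr p"
  using p r by (intro powr_mono2) auto
 also have "... = exp ((1 + r) / 4)" using p by (simp add: powr_def)
 finally have "(1 + r) powr p \<le> (4 * p) powr p * exp ((1 + r) / 4)"
  using p r by (simp add: powr_divide divide_le_eq mult.commute)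
 then have "(1 + r) powr p * exp (- r / 4) \<le> (4 * p) powr p * exp ((1 + r) / 4) * exp (- r / 4)" (is "?l \<le> _")
  by (intro mult_right_mono) auto
 also have "... = (4 * p) powr p * exp (1 / 4)"
  by (simp add: mult.assoc exp_add[symmetric] field_simps)
 finally have *: "?l \<le> (4 * p) powr p * exp (1 / 4)" .
 have "1 + r = (q + \<tau>) / \<tau>" using assms by (simp add: r_def field_simps)
 then have "(1 + r) powr p = (q + \<tau>) powr p * \<tau> powr (- p)"
  using assms by (simp add: powr_divide powr_minus_divide)
 with * have "(q + \<tau>) powr p * (\<tau> powr (- p) * exp (- r / 4)) \<le> (4 * p) powr p * exp (1 / 4)"
  by (simp add: mult.assoc)
 moreover have "- r / 4 = - q / (4 * \<tau>)" by (simp add: r_def)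
 moreover have "(q + \<tau>) powr p > 0" using assms by simp
 ultimately have "\<tau> powr (- p) * exp (- q / (4 * \<tau>)) \<le> (4 * p) powr p * exp (1 / 4) / (q + \<tau>) powr p"
  by (simp add: le_divide_eq mult.commute)
 moreover have "(q + \<tau>) powr (- p) = 1 / (q + \<tau>) powr p" by (rule powr_minus_divide)
 ultimately show ?thesis by (simp add: p_def)
qed

text \<open>A primitive is 2 / Q * sqrt (s / (Q + s)), which increases from 0 at s = 0 to 2 / Q at
  infinity.\<close>

lemma half_line_base:
 fixes Q :: real assumes Q: "Q > 0"
 shows "set_integrable lborel {0<..} (\<lambda>s. s powr (-1/2) * (Q + s) powr (- 3/2))"
  and "(LINT s:{0<..}|lborel. s powr (-1/2) * (Q + s) powr (- 3/2)) = 2 / Q"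
proof -
 let ?F = "\<lambda>s. 2 / Q * sqrt (s / (Q + s))"
 let ?f = "\<lambda>s. s powr (-1/2) * (Q + s) powr (- 3/2)"
 have D: "DERIV ?F s :> ?f s" if s: "s > 0" for s
 proof -
  have "DERIV ?F s :> 2 / Q * ((((Q + s) - s) / ((Q + s) * (Q + s))) * (inverse (sqrt (s / (Q + s))) / 2))"
  proof -
   have "DERIV (\<lambda>s. s / (Q + s)) s :> ((Q + s) - s) / ((Q + s) * (Q + s))"
    using s Q by (auto intro!: derivative_eq_intros simp: field_simps)
   moreover have "DERIV sqrt (s / (Q + s)) :> inverse (sqrt (s / (Q + s))) / 2"
    using s Q by (intro DERIV_real_sqrt) auto
   ultimately have "DERIV (\<lambda>s. sqrt (s / (Q + s))) s :> inverse (sqrt (s / (Q + s))) / 2 * (((Q + s) - s) / ((Q + s) * (Q + s)))"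
    by (intro DERIV_chain2[where f = sqrt])
   from DERIV_cmult[OF this, of "2 / Q"] show ?thesis by (simp add: mult_ac)
  qed
  also have "2 / Q * ((((Q + s) - s) / ((Q + s) * (Q + s))) * (inverse (sqrt (s / (Q + s))) / 2)) 
    = sqrt (Q + s) / (sqrt s * ((Q + s) * (Q + s)))"
  proof -
   have "2 / Q * (Q / D * (inverse (a / B) / 2)) = B / (a * D)" if "D > 0" "a > 0" "B > 0" for a B D :: real
    using that Q by (simp add: field_simps)
   from this[of "(Q + s) * (Q + s)" "sqrt s" "sqrt (Q + s)"] show ?thesis
    using Q s by (simp add: real_sqrt_divide)
  qed
  also have "... = ?f s"
  proof -
   have "?f s = 1 / sqrt s ^ 1 * (1 / sqrt (Q + s) ^ 3)"
    using powr_neg_half[of s 1] powr_neg_half[of "Q + s" 3] s Q by simp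
   moreover have "B / (a * (B ^ 2 * B ^ 2)) = 1 / a ^ 1 * (1 / B ^ 3)" if "a > 0" "B > 0" for a B :: real
    using that by (simp add: power2_eq_square power3_eq_cube)
   from this[of "sqrt s" "sqrt (Q + s)"]
   have "sqrt (Q + s) / (sqrt s * ((Q + s) * (Q + s))) = 1 / sqrt s ^ 1 * (1 / sqrt (Q + s) ^ 3)"
    using s Q by simp
   ultimately show ?thesis by simp
  qed
  finally show ?thesis .
 qed
 have A: "((?F \<circ> real_of_ereal) \<longlongrightarrow> 0) (at_right (ereal 0))"
 proof -
  have "(?F \<longlongrightarrow> 2 / Q * sqrt (0 / (Q + 0))) (at_right 0)"
   using Q by (intro tendsto_intros) auto
  then show ?thesis by (simp add: ereal_tendsto_simps)
 qed
 have B: "((?F \<circ> real_of_ereal) \<longlongrightarrow> 2 / Q) (at_left \<infinity>)"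
 proof -
  have "((\<lambda>s. s / (Q + s)) \<longlongrightarrow> 1) at_top" using Q by real_asymp
  then have "(?F \<longlongrightarrow> 2 / Q * sqrt 1) at_top" by (intro tendsto_intros)
  then show ?thesis by (simp add: ereal_tendsto_simps)
 qed
 have c: "isCont ?f s" if "s > 0" for s
  using that Q by (intro continuous_intros) auto
 have e: "einterval (ereal 0) \<infinity> = {0<..}" by (auto simp: einterval_def)
 note FTC = interval_integral_FTC_nonneg[where F = ?F and f = ?f, of "ereal 0" "\<infinity>", OF _ _ _ _ A B]
 show "set_integrable lborel {0<..} ?f"
  using FTC(1) D c by (simp add: e)
 have "(LBINT s=ereal 0..\<infinity>. ?f s) = 2 / Q - 0"
  using FTC(2) D c by simp
 then show "(LINT s:{0<..}|lborel. ?f s) = 2 / Q"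
  by (simp add: interval_integral_to_infinity_eq)
qed

text \<open>Of the k half powers of Q + s, all but three are estimated by those of Q; the rest is
  \<open>half_line_base\<close>. The order in Q is not spoilt, since (k - 3) + 2 = k - 1.\<close>

lemma half_line_bound:
 fixes g :: "real \<Rightarrow> real"
 assumes Q: "Q > 0" and k: "k \<ge> 3" and [measurable]: "g \<in> borel_fun"
  and b: "\<And>s. s > 0 \<Longrightarrow> \<bar>g s\<bar> \<le> c * (s powr (-1/2) * (Q + s) powr (- (real k / 2)))"
 shows "set_integrable lborel {0<..} g" (is ?g1)
  and "\<bar>LINT s:{0<..}|lborel. g s\<bar> \<le> 2 * c / sqrt Q ^ (k - 1)" (is ?g2)
proof -
 \<comment> \<open>Nonnegativity of c is forced by the bound at s = 1.\<close>
 have c: "c \<ge> 0"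
 proof (rule ccontr)
  assume "\<not> c \<ge> 0"
  moreover have "(1::real) powr (-1/2) * (Q + 1) powr (- (real k / 2)) > 0" using Q by simp
  ultimately have "c * (1 powr (-1/2) * (Q + 1) powr (- (real k / 2))) < 0" by (simp add: mult_neg_pos)
  with b[of 1] show False by linarith
 qed
 define h where "h s = c / sqrt Q ^ (k - 3) * (s powr (-1/2) * (Q + s) powr (- 3/2))" for s
 have bh: "\<bar>g s\<bar> \<le> h s" if s: "s > 0" for s
 proof -
  have "sqrt Q ^ (k - 3) * sqrt (Q + s) ^ 3 \<le> sqrt (Q + s) ^ (k - 3) * sqrt (Q + s) ^ 3" (is "?l \<le> _")
   using s Q by (intro mult_right_mono power_mono) auto
  also have "... = sqrt (Q + s) ^ k" using k by (simp flip: power_add)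
  finally have "1 / sqrt (Q + s) ^ k \<le> 1 / (?l)"
   using s Q by (intro divide_left_mono) auto
  then have "(Q + s) powr (- (real k / 2)) \<le> 1 / sqrt Q ^ (k - 3) * (Q + s) powr (- 3/2)"
   using powr_neg_half[of "Q + s" k] powr_neg_half[of "Q + s" 3] s Q by simp
  then have "c * (s powr (-1/2) * (Q + s) powr (- (real k / 2))) \<le> c * (s powr (-1/2) * (1 / sqrt Q ^ (k - 3) * (Q + s) powr (- 3/2)))"
   using c by (intro mult_left_mono) auto
  with b[OF s] show ?thesis by (simp add: h_def mult_ac)
 qed
 have hi: "set_integrable lborel {0<..} h"
  unfolding h_def using half_line_base(1)[OF Q] by (intro set_integrable_mult_right)
 have hv: "(LINT s:{0<..}|lborel. h s) = c / sqrt Q ^ (k - 3) * (2 / Q)"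
  unfolding h_def using half_line_base(2)[OF Q] by simp
 show gi: ?g1
  by (rule set_integrable_bound[OF hi]) (use bh in \<open>auto simp: set_borel_measurable_def intro!: AE_I2 order_trans[OF _ abs_ge_self]\<close>)
 have "\<bar>LINT s:{0<..}|lborel. g s\<bar> \<le> (LINT s:{0<..}|lborel. \<bar>g s\<bar>)"
  using set_integral_norm_bound[OF gi] by simp
 also have "... \<le> (LINT s:{0<..}|lborel. h s)"
  using set_integrable_norm[OF gi] hi bh by (intro set_integral_mono) auto
 also have "... = 2 * c / (sqrt Q ^ (k - 3) * sqrt Q ^ 2)" using hv Q by simp
 also have "sqrt Q ^ (k - 3) * sqrt Q ^ 2 = sqrt Q ^ (k - 1)"
  using k by (simp only: power_add[symmetric]) (rule arg_cong[where f="\<lambda>n. sqrt Q ^ n"], simp)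
 finally show ?g2 .
qed

text \<open>The Gaussian as a function of time and of q = |x|^2, with the dimension as a free
  parameter k: derivatives in q and in \<tau> are combinations of such profiles with k raised by 2
  or 4.\<close>

definition heat_profile :: "nat \<Rightarrow> real \<Rightarrow> real \<Rightarrow> real" where
 "heat_profile k \<tau> q = \<tau> powr (- (real k / 2)) * exp (- q / (4 * \<tau>))"

text \<open>Subordination: on the Fourier side the average of exp (-s |eta|^2) with weight s^(-1/2)
  is proportional to 1 / |eta|, which turns a gradient into a Riesz transform. The parameter t is
  the residual smoothing.\<close>

definition riesz_profile :: "nat \<Rightarrow> real \<Rightarrow> real \<Rightarrow> real" where
 "riesz_profile k t q = (LINT s:{0<..}|lborel. s powr (-1/2) * heat_profile k (t + s) q)"

lemma heat_profile_nonneg: "heat_profile k \<tau> q \<ge> 0"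
 by (simp add: heat_profile_def)

lemma measurable_heat_profile [measurable]:
 "(\<lambda>(\<tau>, q). heat_profile k \<tau> q) \<in> borel_fun"
 unfolding heat_profile_def borel_prod[symmetric] by measurable

lemma measurable_heat_profile' [measurable (raw)]:
 assumes "f \<in> borel_measurable M" "g \<in> borel_measurable M"
 shows "(\<lambda>x. heat_profile k (f x) (g x)) \<in> borel_measurable M"
 using assms unfolding heat_profile_def by measurable

definition heat_const :: "nat \<Rightarrow> real" where
 "heat_const k = (2 * k) powr (real k / 2) * exp (1/4)"

lemma heat_const_nonneg: "heat_const k \<ge> 0" by (simp add: heat_const_def)

lemma heat_profile_le:
 assumes "k \<ge> 1" "\<tau> > 0" "q \<ge> 0"
 shows "heat_profile k \<tau> q \<le> heat_const k * (q + \<tau>) powr (- (real k / 2))"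
 using exp_decay_bound[OF assms] by (simp add: heat_profile_def heat_const_def)

lemma riesz_profile_integrand_le:
 assumes "k \<ge> 3" "t \<ge> 0" "q \<ge> 0" "s > 0"
 shows "\<bar>s powr (-1/2) * heat_profile k (t + s) q\<bar> \<le> heat_const k * (s powr (-1/2) * ((q + t) + s) powr (- (real k / 2)))"
proof -
 have "heat_profile k (t + s) q \<le> heat_const k * ((q + t) + s) powr (- (real k / 2))"
  using heat_profile_le[of k "t + s" q] assms by (simp add: add_ac)
 then have "s powr (-1/2) * heat_profile k (t + s) q \<le> s powr (-1/2) * (heat_const k * ((q + t) + s) powr (- (real k / 2)))"
  by (rule mult_left_mono) simp
 moreover have "\<bar>s powr (-1/2) * heat_profile k (t + s) q\<bar> = s powr (-1/2) * heat_profile k (t + s) q"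
  by (simp add: heat_profile_nonneg abs_mult)
 ultimately show ?thesis by (simp only: mult_ac)
qed

lemma riesz_profile_integrable:
 assumes "k \<ge> 3" "t \<ge> 0" "q \<ge> 0" "q + t > 0"
 shows "set_integrable lborel {0<..} (\<lambda>s. s powr (-1/2) * heat_profile k (t + s) q)"
 using assms by (intro half_line_bound(1)[where Q="q+t" and c="heat_const k" and k=k] riesz_profile_integrand_le) auto

lemma riesz_profile_nonneg: "riesz_profile k t q \<ge> 0"
 unfolding riesz_profile_def set_lebesgue_integral_def
 by (intro integral_nonneg_AE) (auto simp: heat_profile_nonneg)

lemma riesz_profile_le:
 assumes "k \<ge> 3" "t \<ge> 0" "q \<ge> 0" "q + t > 0"
 shows "riesz_profile k t q \<le> 2 * heat_const k / sqrt (q + t) ^ (k - 1)"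
proof -
 have "\<bar>riesz_profile k t q\<bar> \<le> 2 * heat_const k / sqrt (q + t) ^ (k - 1)"
  unfolding riesz_profile_def
  using assms by (intro half_line_bound(2) riesz_profile_integrand_le) auto
 then show ?thesis by linarith
qed

lemma riesz_profile_pos:
 assumes "k \<ge> 3" "t \<ge> 0" "q \<ge> 0" "q + t > 0"
 shows "riesz_profile k t q > 0"
proof -
 have "riesz_profile k t q \<noteq> 0"
 proof
  assume "riesz_profile k t q = 0"
  then have "AE s in lborel. indicator {0<..} s *\<^sub>R (s powr (-1/2) * heat_profile k (t + s) q) = 0"
   using riesz_profile_integrable[OF assms]
   unfolding riesz_profile_def set_lebesgue_integral_def set_integrable_def
   by (subst (asm) integral_nonneg_eq_0_iff_AE) (auto simp: heat_profile_nonneg)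
  then have "AE s::real in lborel. s \<notin> {0<..<1}"
   by eventually_elim (use assms in \<open>auto simp: heat_profile_def\<close>)
  then have "emeasure lborel {0<..<1::real} = 0"
   by (subst (asm) AE_iff_measurable[where N="{0<..<1}"]) auto
  then show False by simp
 qed
 with riesz_profile_nonneg[of k t q] show ?thesis by linarith
qed

lemma measurable_riesz_profile' [measurable (raw)]:
 assumes [measurable]: "f \<in> borel_measurable M" "g \<in> borel_measurable M"
 shows "(\<lambda>x. riesz_profile k (f x) (g x)) \<in> borel_measurable M"
 unfolding riesz_profile_def set_lebesgue_integral_def by measurable

text \<open>Substitution s -> c s. At t = 0 it yields the homogeneity of the Riesz kernel, at t > 0
  the parabolic scaling needed for dilations.\<close>

lemma riesz_profile_scale:
 assumes c: "c > 0" and "k \<ge> 3" and t: "t \<ge> 0"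
 shows "riesz_profile k (c * t) (c * q) = riesz_profile k t q / sqrt c ^ (k - 1)"
proof -
 have "riesz_profile k (c * t) (c * q) = (LL s. indicator {0<..} s *\<^sub>R (s powr (-1/2) * heat_profile k (c * t + s) (c * q)))"
  by (simp add: riesz_profile_def set_lebesgue_integral_def)
 also have "... = c * (LL s. indicator {0<..} (0 + c * s) *\<^sub>R ((0 + c * s) powr (-1/2) * heat_profile k (c * t + (0 + c * s)) (c * q)))"
  using c by (subst lborel_integral_real_affine[where c=c and t=0]) auto
 also have "... = c * (LL s. (1 / sqrt c * (1 / sqrt c ^ k)) * (indicator {0<..} s *\<^sub>R (s powr (-1/2) * heat_profile k (t + s) q)))"
 proof -
  have "indicator {0<..} (0 + c * s) *\<^sub>R ((0 + c * s) powr (-1/2) * heat_profile k (c * t + (0 + c * s)) (c * q)) =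
   (1 / sqrt c * (1 / sqrt c ^ k)) * (indicator {0<..} s *\<^sub>R (s powr (-1/2) * heat_profile k (t + s) q))" for s
  proof (cases "s > 0")
   case True
   have 1: "c * t + c * s = c * (t + s)" by (simp add: algebra_simps)
   have 2: "(c * s) powr (-1/2) = 1 / sqrt c * s powr (-1/2)"
    using c True powr_neg_half[of c 1] by (simp add: powr_mult)
   have 3: "heat_profile k (c * (t + s)) (c * q) = (1 / sqrt c ^ k) * heat_profile k (t + s) q"
    using c t True powr_neg_half[of c k] unfolding heat_profile_def by (simp add: powr_mult)
   show ?thesis using True c 2 by (simp add: 1 3)
  qed (use c in \<open>auto simp: indicator_def zero_less_mult_iff\<close>)
  then show ?thesis by simp
 qed
 also have "... = c * (1 / sqrt c * (1 / sqrt c ^ k)) * riesz_profile k t q"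
  by (simp add: riesz_profile_def set_lebesgue_integral_def)
 also have "c * (1 / sqrt c * (1 / sqrt c ^ k)) = 1 / sqrt c ^ (k - 1)"
 proof -
  have "sqrt c ^ k = sqrt c * sqrt c ^ (k - 1)" using assms by (cases k) auto
  moreover have "c = sqrt c * sqrt c" using c by simp
  ultimately show ?thesis using c by (simp add: field_simps)
 qed
 finally show ?thesis by simp
qed

lemma exp_diff_bound:
 fixes u v :: real
 assumes "0 \<le> u" "u \<le> v"
 shows "\<bar>exp (-u) - exp (-v)\<bar> \<le> (v - u) * exp (-u)"
proof -
 have "1 - exp (- (v - u)) \<le> v - u" using exp_ge_add_one_self[of "- (v - u)"] by linarith
 then have 1: "exp (-u) * (1 - exp (- (v - u))) \<le> exp (-u) * (v - u)" by (intro mult_left_mono) auto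
 have "exp (-u) - exp (-v) = exp (-u) * (1 - exp (- (v - u)))"
  by (simp add: right_diff_distrib exp_add[symmetric])
 also note 1
 finally have "exp (-u) - exp (-v) \<le> (v - u) * exp (-u)" by (simp only: mult.commute)
 moreover have "exp (-v) \<le> exp (-u)" using assms by simp
 ultimately show ?thesis by (simp only: abs_of_nonneg diff_ge_0_iff_ge)
qed

text \<open>The bound is uniform in t >= 0: dropping t from q + t + s only enlarges a negative
  power. This uniformity later gives a majorant independent of the smoothing.\<close>

lemma riesz_profile_diff_q:
 assumes k: "k \<ge> 3" and t: "t \<ge> 0" and q: "0 < q" "q \<le> q'"
 shows "\<bar>riesz_profile k t q - riesz_profile k t q'\<bar> \<le> 2 * ((q' - q) * heat_const (k + 2)) / sqrt q ^ (k + 1)"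
proof -
 have i: "set_integrable lborel {0<..} (\<lambda>s. s powr (-1/2) * heat_profile k (t + s) q)"
   "set_integrable lborel {0<..} (\<lambda>s. s powr (-1/2) * heat_profile k (t + s) q')"
  by (rule riesz_profile_integrable; use assms in simp)+
 have "riesz_profile k t q - riesz_profile k t q' = (LINT s:{0<..}|lborel. s powr (-1/2) * heat_profile k (t + s) q - s powr (-1/2) * heat_profile k (t + s) q')"
  unfolding riesz_profile_def using i by (rule set_integral_diff(2)[symmetric])
 also have "\<bar>...\<bar> \<le> 2 * ((q' - q) * heat_const (k + 2)) / sqrt q ^ (k + 2 - 1)"
 proof (rule half_line_bound(2))
  fix s :: real assume s: "s > 0"
  define \<tau> where "\<tau> = t + s"
  have \<tau>: "\<tau> > 0" using s t by (simp add: \<tau>_def)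
  have "\<bar>heat_profile k \<tau> q - heat_profile k \<tau> q'\<bar> = \<tau> powr (- (real k / 2)) * \<bar>exp (- (q / (4 * \<tau>))) - exp (- (q' / (4 * \<tau>)))\<bar>" (is "?l = _")
   by (simp add: heat_profile_def abs_mult right_diff_distrib[symmetric])
  also have "... \<le> \<tau> powr (- (real k / 2)) * ((q' / (4 * \<tau>) - q / (4 * \<tau>)) * exp (- (q / (4 * \<tau>))))"
   using \<tau> q by (intro mult_left_mono exp_diff_bound divide_right_mono) auto
  also have "... = (q' - q) / 4 * (\<tau> powr (- (real k / 2)) / \<tau> * exp (- q / (4 * \<tau>)))"
   using \<tau> by (simp add: field_simps)
  also have "\<tau> powr (- (real k / 2)) / \<tau> = \<tau> powr (- (real (k + 2) / 2))"
  proof -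
   have "- (real (k + 2) / 2) = - (real k / 2) - 1" by (simp add: field_simps)
   then show ?thesis using \<tau> by (simp only: powr_diff) simp
  qed
  also have "(q' - q) / 4 * (\<tau> powr (- (real (k + 2) / 2)) * exp (- q / (4 * \<tau>))) \<le> (q' - q) * (heat_const (k + 2) * (q + \<tau>) powr (- (real (k + 2) / 2)))"
   unfolding heat_profile_def[symmetric]
   using q \<tau> heat_profile_nonneg by (intro mult_mono[of "(q' - q) / 4" "q' - q"] heat_profile_le) auto
  also have "(q + \<tau>) powr (- (real (k + 2) / 2)) \<le> (q + s) powr (- (real (k + 2) / 2))"
   using q t s by (intro powr_mono2') (auto simp: \<tau>_def)
  finally have "?l \<le> (q' - q) * heat_const (k + 2) * (q + s) powr (- (real (k + 2) / 2))"
   using q heat_const_nonneg by (simp add: mult_left_mono mult.assoc)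
  then have "s powr (-1/2) * \<bar>heat_profile k \<tau> q - heat_profile k \<tau> q'\<bar> \<le> s powr (-1/2) * ((q' - q) * heat_const (k + 2) * (q + s) powr (- (real (k + 2) / 2)))"
   by (intro mult_left_mono) auto
  moreover have "\<bar>s powr (-1/2) * heat_profile k (t + s) q - s powr (-1/2) * heat_profile k (t + s) q'\<bar> = s powr (-1/2) * \<bar>heat_profile k \<tau> q - heat_profile k \<tau> q'\<bar>"
   by (simp add: \<tau>_def right_diff_distrib[symmetric] abs_mult)
  ultimately show "\<bar>s powr (-1/2) * heat_profile k (t + s) q - s powr (-1/2) * heat_profile k (t + s) q'\<bar>
    \<le> ((q' - q) * heat_const (k + 2)) * (s powr (-1/2) * (q + s) powr (- (real (k + 2) / 2)))"
   by (simp add: mult_ac)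
 qed (use q k in auto)
 finally show ?thesis by simp
qed

lemma heat_profile_deriv:
 assumes "\<tau> > 0"
 shows "((\<lambda>\<tau>. heat_profile k \<tau> q) has_real_derivative (- (real k / 2) * heat_profile (k + 2) \<tau> q + q / 4 * heat_profile (k + 4) \<tau> q)) (at \<tau>)"
proof -
 have e: "- (real (k + 2) / 2) = - (real k / 2) - 1" "- (real (k + 4) / 2) = - (real k / 2) - 2" by (auto simp: field_simps)
 have p: "\<tau> powr (- (real k / 2) - 2) = \<tau> powr (- (real k / 2)) / \<tau>\<^sup>2"
  using assms by (simp add: powr_diff)
 have "((\<lambda>\<tau>. \<tau> powr (- (real k / 2)) * exp (- q / (4 * \<tau>))) has_real_derivative
   (- (real k / 2)) * \<tau> powr (- (real k / 2) - 1) * exp (- q / (4 * \<tau>)) + exp (- q / (4 * \<tau>)) * (q * 4 / (4 * \<tau>)\<^sup>2) * \<tau> powr (- (real k / 2))) (at \<tau>)"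
  using assms by (auto intro!: derivative_eq_intros simp: power2_eq_square)
 also have "exp (- q / (4 * \<tau>)) * (q * 4 / (4 * \<tau>)\<^sup>2) * \<tau> powr (- (real k / 2)) = q / 4 * (\<tau> powr (- (real k / 2) - 2) * exp (- q / (4 * \<tau>)))"
  unfolding p using assms by (simp add: power2_eq_square field_simps)
 finally show ?thesis unfolding heat_profile_def e by (simp add: mult.assoc)
qed

lemma heat_profile_deriv_bound:
 assumes "\<tau> > 0" "q \<ge> 0"
 shows "\<bar>- (real k / 2) * heat_profile (k + 2) \<tau> q + q / 4 * heat_profile (k + 4) \<tau> q\<bar>
   \<le> (real k * heat_const (k + 2) + heat_const (k + 4)) * (q + \<tau>) powr (- (real (k + 2) / 2))"
proof -
 have "\<bar>- (real k / 2) * heat_profile (k + 2) \<tau> q + q / 4 * heat_profile (k + 4) \<tau> q\<bar> \<le>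
   real k / 2 * heat_profile (k + 2) \<tau> q + q / 4 * heat_profile (k + 4) \<tau> q"
  using assms(2) by (intro order_trans[OF abs_triangle_ineq]) (simp add: abs_mult heat_profile_nonneg)
 also have "... \<le> real k * (heat_const (k + 2) * (q + \<tau>) powr (- (real (k + 2) / 2)))
   + q * (heat_const (k + 4) * (q + \<tau>) powr (- (real (k + 4) / 2)))"
  using assms by (intro add_mono mult_mono heat_profile_le) (auto simp: heat_profile_nonneg)
 also have "q * (heat_const (k + 4) * (q + \<tau>) powr (- (real (k + 4) / 2))) \<le> heat_const (k + 4) * (q + \<tau>) powr (- (real (k + 2) / 2))"
 proof -
  have e: "- (real (k + 2) / 2) = - (real (k + 4) / 2) + 1" by (simp add: field_simps)
  have "(q + \<tau>) powr (- (real (k + 2) / 2)) = (q + \<tau>) powr (- (real (k + 4) / 2)) * (q + \<tau>)"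
   unfolding e powr_add using assms by simp
  moreover have "q * (q + \<tau>) powr (- (real (k + 4) / 2)) \<le> (q + \<tau>) * (q + \<tau>) powr (- (real (k + 4) / 2))"
   using assms by (intro mult_right_mono) auto
  ultimately have "q * (q + \<tau>) powr (- (real (k + 4) / 2)) \<le> (q + \<tau>) powr (- (real (k + 2) / 2))" by (simp add: mult.commute)
  from mult_left_mono[OF this heat_const_nonneg[of "k+4"]] show ?thesis by (simp add: mult_ac)
 qed
 finally show ?thesis by (simp add: algebra_simps)
qed

text \<open>Mean value theorem in time, with t0 = 0 allowed as long as q > 0. It controls how fast
  the smoothed kernel approaches the singular one away from the origin.\<close>

lemma riesz_profile_diff_t:
 assumes k: "k \<ge> 3" and t: "t \<ge> 0" and t0: "t0 \<ge> 0" and q: "0 \<le> q" and p: "0 < q + t0"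
 shows "\<bar>riesz_profile k (t0 + t) q - riesz_profile k t0 q\<bar> \<le> 2 * (t * (real k * heat_const (k + 2) + heat_const (k + 4))) / sqrt (q + t0) ^ (k + 1)"
proof -
 define B where "B = real k * heat_const (k + 2) + heat_const (k + 4)"
 have B: "B \<ge> 0" by (simp add: B_def heat_const_nonneg)
 have i: "set_integrable lborel {0<..} (\<lambda>s. s powr (-1/2) * heat_profile k (t0 + t + s) q)"
   "set_integrable lborel {0<..} (\<lambda>s. s powr (-1/2) * heat_profile k (t0 + s) q)"
  by (rule riesz_profile_integrable; use assms in simp)+
 have "riesz_profile k (t0 + t) q - riesz_profile k t0 q = (LINT s:{0<..}|lborel. s powr (-1/2) * heat_profile k (t0 + t + s) q - s powr (-1/2) * heat_profile k (t0 + s) q)"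
  unfolding riesz_profile_def using i by (rule set_integral_diff(2)[symmetric])
 also have "\<bar>...\<bar> \<le> 2 * (t * B) / sqrt (q + t0) ^ (k + 2 - 1)"
 proof (rule half_line_bound(2))
  fix s :: real assume s: "s > 0"
  let ?D = "\<lambda>\<tau>. - (real k / 2) * heat_profile (k + 2) \<tau> q + q / 4 * heat_profile (k + 4) \<tau> q"
  have "norm (heat_profile k (t0 + t + s) q - heat_profile k (t0 + s) q) \<le> (B * ((q + t0) + s) powr (- (real (k + 2) / 2))) * norm (t0 + t + s - (t0 + s))"
  proof (rule differentiable_bound[of "{t0 + s..t0 + t + s}"])
   fix x assume x: "x \<in> {t0 + s..t0 + t + s}"
   then have x0: "x > 0" using s t0 by auto
   show "((\<lambda>\<tau>. heat_profile k \<tau> q) has_derivative (\<lambda>h. ?D x * h)) (at x within {t0 + s..t0 + t + s})"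
    using heat_profile_deriv[OF x0, of k q] has_derivative_at_withinI by (auto simp: has_field_derivative_def)
   have "\<bar>?D x\<bar> \<le> B * (q + x) powr (- (real (k + 2) / 2))"
    unfolding B_def using x0 q by (intro heat_profile_deriv_bound) auto
   also have "... \<le> B * ((q + t0) + s) powr (- (real (k + 2) / 2))"
    using q s x p by (intro mult_left_mono[OF _ B] powr_mono2') auto
   finally show "onorm (\<lambda>h. ?D x * h) \<le> B * ((q + t0) + s) powr (- (real (k + 2) / 2))"
    by (intro onorm_le) (auto simp: abs_mult intro: mult_right_mono)
  qed (use t in auto)
  then have "s powr (-1/2) * \<bar>heat_profile k (t0 + t + s) q - heat_profile k (t0 + s) q\<bar> \<le> s powr (-1/2) * ((B * ((q + t0) + s) powr (- (real (k + 2) / 2))) * t)"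
   using t by (intro mult_left_mono) auto
  moreover have "\<bar>s powr (-1/2) * heat_profile k (t0 + t + s) q - s powr (-1/2) * heat_profile k (t0 + s) q\<bar> = s powr (-1/2) * \<bar>heat_profile k (t0 + t + s) q - heat_profile k (t0 + s) q\<bar>"
   by (simp add: right_diff_distrib[symmetric] abs_mult)
  ultimately show "\<bar>s powr (-1/2) * heat_profile k (t0 + t + s) q - s powr (-1/2) * heat_profile k (t0 + s) q\<bar>
    \<le> (t * B) * (s powr (-1/2) * ((q + t0) + s) powr (- (real (k + 2) / 2)))"
   by (simp add: mult_ac)
 qed (use p k in auto)
 finally show ?thesis by (simp add: B_def)
qed

subsection \<open>Gaussians and their Riesz transforms\<close>

lemma lborel_prod_basis:
 fixes f :: "'a::euclidean_space \<Rightarrow> real \<Rightarrow> 'b::{real_normed_field, banach, second_countable_topology}"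
 assumes i: "\<And>b. b \<in> Basis \<Longrightarrow> integrable lborel (f b)"
 shows "integrable lborel (\<lambda>x. \<Prod>b\<in>Basis. f b (x \<bullet> b))" (is ?g1)
  and "(LL x. (\<Prod>b\<in>Basis. f b (x \<bullet> b))) = (\<Prod>b\<in>Basis. LL u. f b u)" (is ?g2)
proof -
 interpret product_sigma_finite "\<lambda>b::'a. lborel :: real measure" ..
 have [measurable]: "b \<in> Basis \<Longrightarrow> f b \<in> borel_fun" for b
  using i[of b] by auto
 have *: "(\<Prod>b\<in>Basis. f b ((\<Sum>b\<in>Basis. w b *\<^sub>R b) \<bullet> b)) = (\<Prod>b\<in>Basis. f b (w b))" for w
  by (intro prod.cong refl) (simp add: inner_sum_left_Basis)
 show ?g1
  unfolding lborel_eq[where 'a='a]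
  by (subst integrable_distr_eq) (auto simp: * intro!: product_integrable_prod i)
 show ?g2
  unfolding lborel_eq[where 'a='a]
  by (subst integral_distr) (auto simp: * intro!: product_integral_prod i)
qed

text \<open>The heat kernel (4 pi t)^(-d/2) exp (-|x|^2 / (4 t)), whose Fourier transform is exp (-t
  |eta|^2) without further constants.\<close>

definition gauss_kernel :: "real \<Rightarrow> 'a::euclidean_space \<Rightarrow> real" where
 "gauss_kernel t x = (1 / sqrt (4 * pi)) ^ DIM('a) * heat_profile DIM('a) t ((norm x)\<^sup>2)"

definition grad_kernel :: "real \<Rightarrow> 'a::euclidean_space \<Rightarrow> 'a" where
 "grad_kernel t x = heat_profile (DIM('a) + 2) t ((norm x)\<^sup>2) *\<^sub>R x"

text \<open>Up to a constant, \<open>riesz_heat t\<close> is the Riesz transform of the Gaussian \<open>gauss_kernel t\<close>: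
 it is the superposition of the kernels \<open>grad_kernel (t + s)\<close>, which are proportional to the
 gradients of the Gaussians, with weight \<open>s powr (-1/2)\<close>. At \<open>t = 0\<close> it is proportional to the
 Riesz kernel.\<close>

definition riesz_heat :: "real \<Rightarrow> 'a::euclidean_space \<Rightarrow> 'a" where
 "riesz_heat t x = riesz_profile (DIM('a) + 2) t ((norm x)\<^sup>2) *\<^sub>R x"

abbreviation riesz_conv :: "real \<Rightarrow> 'a \<Rightarrow> ('a::euclidean_space \<Rightarrow> 'b::{banach, second_countable_topology}) \<Rightarrow> 'a \<Rightarrow> 'b" where
 "riesz_conv t b \<equiv> conv (\<lambda>z. riesz_heat t z \<bullet> b)"

lemma measurable_kernels [measurable]:
 "gauss_kernel t \<in> borel_fun"
 "grad_kernel t \<in> borel_fun"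
 "riesz_heat t \<in> borel_fun"
 "(\<lambda>(t, x). grad_kernel t x) \<in> borel_measurable (borel \<Otimes>\<^sub>M borel)"
 unfolding gauss_kernel_def[abs_def] grad_kernel_def[abs_def] riesz_heat_def[abs_def]
 by measurable

lemma gauss_kernel_nonneg [simp]: "gauss_kernel t x \<ge> 0"
 by (simp add: gauss_kernel_def heat_profile_nonneg)

text \<open>Independent normal coordinates of variance 2 t; mass and Fourier transform thereby
  reduce to the real line.\<close>

lemma gauss_kernel_prod:
 assumes "t > 0"
 shows "gauss_kernel t (x::'a::euclidean_space) = (\<Prod>b\<in>Basis. normal_density 0 (sqrt (2 * t)) (x \<bullet> b))"
proof -
 have "(\<Prod>b\<in>Basis. normal_density 0 (sqrt (2 * t)) (x \<bullet> b))
   = (\<Prod>b\<in>(Basis::'a set). 1 / sqrt (4 * pi * t) * exp (- (x \<bullet> b)\<^sup>2 / (4 * t)))"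
  using assms by (intro prod.cong refl) (simp add: normal_density_def mult_ac)
 also have "... = (1 / sqrt (4 * pi * t)) ^ DIM('a) * (\<Prod>b\<in>(Basis::'a set). exp (- (x \<bullet> b)\<^sup>2 / (4 * t)))"
  by (simp only: prod.distrib prod_constant)
 also have "(\<Prod>b\<in>(Basis::'a set). exp (- (x \<bullet> b)\<^sup>2 / (4 * t))) = exp (\<Sum>b\<in>(Basis::'a set). - (x \<bullet> b)\<^sup>2 / (4 * t))"
  by (simp add: exp_sum)
 also have "(\<Sum>b\<in>(Basis::'a set). - (x \<bullet> b)\<^sup>2 / (4 * t)) = - (norm x)\<^sup>2 / (4 * t)"
 proof -
  have "(norm x)\<^sup>2 = (\<Sum>b\<in>(Basis::'a set). (x \<bullet> b)\<^sup>2)"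
   unfolding power2_norm_eq_inner by (subst euclidean_inner) (simp add: power2_eq_square)
  then show ?thesis by (simp add: sum_negf sum_divide_distrib[symmetric])
 qed
 also have "(1 / sqrt (4 * pi * t)) ^ DIM('a) * exp (- (norm x)\<^sup>2 / (4 * t)) = gauss_kernel t x"
  using assms by (simp add: gauss_kernel_def heat_profile_def powr_neg_half real_sqrt_mult power_divide power_mult_distrib)
 finally show ?thesis ..
qed

lemma gauss_kernel_integral:
 assumes "t > 0"
 shows "integrable lborel (gauss_kernel t :: 'a::euclidean_space \<Rightarrow> real)"
  and "(LL x. gauss_kernel t (x::'a)) = 1"
 using lborel_prod_basis[of "\<lambda>b::'a. normal_density 0 (sqrt (2 * t))"] assms
 by (auto simp: gauss_kernel_prod[OF assms, abs_def])

lemma gauss_kernel_minus [simp]: "gauss_kernel t (- x) = gauss_kernel t x"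
 by (simp add: gauss_kernel_def)

lemma grad_kernel_minus [simp]: "grad_kernel t (- x) = - grad_kernel t x"
 by (simp add: grad_kernel_def)

lemma riesz_heat_minus [simp]: "riesz_heat t (- x) = - riesz_heat t x"
 by (simp add: riesz_heat_def)

lemma grad_kernel_gauss: 
 fixes x :: "'a::euclidean_space"
 assumes "t > 0"
 shows "gauss_kernel t x *\<^sub>R x = ((1 / sqrt (4 * pi)) ^ DIM('a) * t) *\<^sub>R grad_kernel t x"
proof -
 have "t powr (- (real (DIM('a) + 2) / 2)) = t powr (- (real DIM('a) / 2)) / t"
 proof -
  have e: "- (real (DIM('a) + 2) / 2) = - (real DIM('a) / 2) - 1" by (simp add: field_simps)
  show ?thesis unfolding e powr_diff using assms by simp
 qed
 then show ?thesis using assms by (simp add: gauss_kernel_def grad_kernel_def heat_profile_def)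
qed

lemma lborel_Fubini:
 fixes f :: "'a::euclidean_space \<Rightarrow> 'c::euclidean_space \<Rightarrow> 'b::{banach, second_countable_topology}"
 assumes [measurable]: "(\<lambda>(x, y). f x y) \<in> borel_measurable (borel \<Otimes>\<^sub>M borel)"
  and fin: "(NN x. (N1 y. f x y)) < \<infinity>"
 shows "integrable (lborel \<Otimes>\<^sub>M lborel) (\<lambda>(x, y). f x y)" (is ?g1)
  and "(LL x. (LL y. f x y)) = (LL y. (LL x. f x y))" (is ?g2)
  and "integrable lborel (\<lambda>x. LL y. f x y)" (is ?g3)
  and "integrable lborel (\<lambda>y. LL x. f x y)" (is ?g4)
  and "AE x in lborel. integrable lborel (\<lambda>y. f x y)" (is ?g5)
  and "AE y in lborel. integrable lborel (\<lambda>x. f x y)" (is ?g6)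
proof -
 show i: ?g1
 proof (rule integrableI_bounded)
  show "(\<lambda>(x, y). f x y) \<in> borel_measurable (lborel \<Otimes>\<^sub>M lborel)"
   using assms(1) by (simp cong: measurable_cong_sets)
  have "(\<integral>\<^sup>+z. ennreal (norm (case z of (x, y) \<Rightarrow> f x y)) \<partial>(lborel \<Otimes>\<^sub>M lborel)) =
    (NN x. (N1 y. f x y))"
   by (subst lborel.nn_integral_fst[symmetric]) auto
  then show "(\<integral>\<^sup>+z. ennreal (norm (case z of (x, y) \<Rightarrow> f x y)) \<partial>(lborel \<Otimes>\<^sub>M lborel)) < \<infinity>"
   using fin by simp
 qed
 show ?g2
  using lborel_pair.Fubini_integral[OF i] by simp
 show ?g3 using lborel_pair.integrable_fst[OF i] .
 show ?g4 using lborel_pair.integrable_snd[OF i] .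
 show ?g5 using lborel_pair.AE_integrable_fst[OF i] .
 show ?g6 using lborel_pair.AE_integrable_snd[OF i] .
qed

lemma nn_integral_half_line:
 assumes "set_integrable lborel {0<..} g" "\<And>s. s > 0 \<Longrightarrow> g s \<ge> 0"
 shows "(NN s. ennreal (indicator {0<..} s * g s)) = ennreal (LINT s:{0<..}|lborel. g s)"
 unfolding set_lebesgue_integral_def
 using assms unfolding set_integrable_def by (subst nn_integral_eq_integral) (auto simp: indicator_def)

lemma powr_int_bound:
 assumes t: "t > 0"
 shows "1 / sqrt ((norm x)\<^sup>2 + t) ^ k \<le> 2 ^ k / (sqrt t + norm x) ^ k"
proof -
 have "(norm x + sqrt t) / 2 \<le> sqrt ((norm x)\<^sup>2 + t)"
  using sqrt_sum_ge[of "(norm x)\<^sup>2" t] t by simp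
 then have "((norm x + sqrt t) / 2) ^ k \<le> sqrt ((norm x)\<^sup>2 + t) ^ k"
  using t by (intro power_mono) auto
 moreover have "((norm x + sqrt t) / 2) ^ k > 0" using t by (auto intro!: zero_less_power add_nonneg_pos)
 ultimately have "1 / sqrt ((norm x)\<^sup>2 + t) ^ k \<le> 1 / ((norm x + sqrt t) / 2) ^ k"
  using t by (intro divide_left_mono mult_pos_pos zero_less_power) (auto intro!: add_nonneg_pos)
 then show ?thesis by (simp add: power_divide add.commute)
qed

lemma grad_kernel_bound:
 fixes x :: "'a::euclidean_space"
 assumes t: "t > 0"
 shows "norm (grad_kernel t x) \<le> 2 ^ (DIM('a) + 1) * heat_const (DIM('a) + 2) / (sqrt t + norm x) ^ (DIM('a) + 1)"
proof -
 define U where "U = (norm x)\<^sup>2 + t"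
 have U: "U > 0" using t by (simp add: U_def add_nonneg_pos)
 have "heat_profile (DIM('a) + 2) t ((norm x)\<^sup>2) \<le> heat_const (DIM('a) + 2) * (1 / sqrt U ^ (DIM('a) + 2))"
  using heat_profile_le[of "DIM('a) + 2" t "(norm x)\<^sup>2"] powr_neg_half[OF U, of "DIM('a) + 2"] t by (simp add: U_def)
 from mult_right_mono[OF this, of "norm x"]
 have "norm (grad_kernel t x) \<le> heat_const (DIM('a) + 2) * (1 / sqrt U ^ (DIM('a) + 2)) * norm x"
  unfolding grad_kernel_def norm_scaleR by (simp only: abs_of_nonneg heat_profile_nonneg norm_ge_zero)
 also have "... \<le> heat_const (DIM('a) + 2) * (1 / sqrt U ^ (DIM('a) + 2)) * sqrt U"
  using t by (intro mult_left_mono) (auto simp: U_def heat_const_nonneg real_le_rsqrt)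
 also have "... = heat_const (DIM('a) + 2) * (1 / sqrt U ^ (DIM('a) + 1))"
  using U by simp
 also have "... \<le> heat_const (DIM('a) + 2) * (2 ^ (DIM('a) + 1) / (sqrt t + norm x) ^ (DIM('a) + 1))"
  unfolding U_def by (intro mult_left_mono powr_int_bound t heat_const_nonneg)
 finally show ?thesis by (simp add: mult_ac)
qed

lemma riesz_heat_bound:
 fixes x :: "'a::euclidean_space"
 assumes t: "t > 0"
 shows "norm (riesz_heat t x) \<le> 2 ^ (DIM('a) + 1) * heat_const (DIM('a) + 2) / (sqrt t + norm x) ^ DIM('a)"
proof -
 define U where "U = (norm x)\<^sup>2 + t"
 have U: "U > 0" using t by (simp add: U_def add_nonneg_pos)
 have "riesz_profile (DIM('a) + 2) t ((norm x)\<^sup>2) \<le> 2 * heat_const (DIM('a) + 2) / sqrt U ^ (DIM('a) + 1)"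
  using riesz_profile_le[of "DIM('a) + 2" t "(norm x)\<^sup>2"] U t DIM_positive[where 'a='a] by (simp add: U_def)
 from mult_right_mono[OF this, of "norm x"]
 have "norm (riesz_heat t x) \<le> 2 * heat_const (DIM('a) + 2) / sqrt U ^ (DIM('a) + 1) * norm x"
  unfolding riesz_heat_def norm_scaleR by (simp only: abs_of_nonneg riesz_profile_nonneg norm_ge_zero)
 also have "... \<le> 2 * heat_const (DIM('a) + 2) / sqrt U ^ (DIM('a) + 1) * sqrt U"
  using t U by (intro mult_left_mono) (auto simp: U_def heat_const_nonneg real_le_rsqrt)
 also have "... = 2 * heat_const (DIM('a) + 2) * (1 / sqrt U ^ DIM('a))"
  using U by simp
 also have "... \<le> 2 * heat_const (DIM('a) + 2) * (2 ^ DIM('a) / (sqrt t + norm x) ^ DIM('a))"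
  unfolding U_def by (intro mult_left_mono powr_int_bound t) (simp add: heat_const_nonneg)
 finally show ?thesis by (simp add: mult_ac)
qed

lemma gauss_kernel_bound:
 "\<exists>C\<ge>0. \<forall>t>0. \<forall>x::'a::euclidean_space. gauss_kernel t x \<le> C * (sqrt t / (sqrt t + norm x) ^ (DIM('a) + 1))"
proof (intro exI[of _ "(1 / sqrt (4 * pi)) ^ DIM('a) * (heat_const (DIM('a) + 1) * 2 ^ (DIM('a) + 1))"] conjI allI impI)
 fix t :: real and x :: 'a assume t: "t > 0"
 define U where "U = (norm x)\<^sup>2 + t"
 have U: "U > 0" using t by (simp add: U_def add_nonneg_pos)
 have "heat_profile DIM('a) t ((norm x)\<^sup>2) = sqrt t * heat_profile (DIM('a) + 1) t ((norm x)\<^sup>2)" (is "?l = _")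
  using t unfolding heat_profile_def by (subst (1 2) powr_neg_half) auto
 also have "... \<le> sqrt t * (heat_const (DIM('a) + 1) * (1 / sqrt U ^ (DIM('a) + 1)))"
  using heat_profile_le[of "DIM('a) + 1" t "(norm x)\<^sup>2"] powr_neg_half[OF U, of "DIM('a) + 1"] t
  by (intro mult_left_mono) (auto simp: U_def)
 also have "... \<le> sqrt t * (heat_const (DIM('a) + 1) * (2 ^ (DIM('a) + 1) / (sqrt t + norm x) ^ (DIM('a) + 1)))"
  unfolding U_def using t by (intro mult_left_mono powr_int_bound heat_const_nonneg) auto
 finally have "(1 / sqrt (4 * pi)) ^ DIM('a) * ?l \<le> (1 / sqrt (4 * pi)) ^ DIM('a) *
   (sqrt t * (heat_const (DIM('a) + 1) * (2 ^ (DIM('a) + 1) / (sqrt t + norm x) ^ (DIM('a) + 1))))"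
  by (intro mult_left_mono) auto
 then show "gauss_kernel t x \<le> (1 / sqrt (4 * pi)) ^ DIM('a) * (heat_const (DIM('a) + 1) * 2 ^ (DIM('a) + 1)) * (sqrt t / (sqrt t + norm x) ^ (DIM('a) + 1))"
  by (simp add: gauss_kernel_def mult_ac)
qed (simp add: heat_const_nonneg)

lemma bilinear_riesz_heat:
 fixes pr :: "'a::euclidean_space \<Rightarrow> 'b::{banach, second_countable_topology} \<Rightarrow> 'c::{banach, second_countable_topology}"
 assumes "bounded_bilinear pr" and s: "s > 0"
 shows "pr (riesz_heat s z) m = (LL u. (indicator {0<..} u * u powr (-1/2)) *\<^sub>R pr (grad_kernel (s + u) z) m)"
proof -
 interpret bounded_bilinear pr by fact
 have "(LL u. (indicator {0<..} u * u powr (-1/2)) *\<^sub>R pr (grad_kernel (s + u) z) m) =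
  (LL u. (indicator {0<..} u *\<^sub>R (u powr (-1/2) * heat_profile (DIM('a) + 2) (s + u) ((norm z)\<^sup>2))) *\<^sub>R pr z m)"
  by (simp add: grad_kernel_def scaleR_left mult_ac)
 also have "... = riesz_profile (DIM('a) + 2) s ((norm z)\<^sup>2) *\<^sub>R pr z m"
  unfolding riesz_profile_def set_lebesgue_integral_def
 proof (rule integral_scaleR_left)
  have "set_integrable lborel {0<..} (\<lambda>u. u powr (-1/2) * heat_profile (DIM('a) + 2) (s + u) ((norm z)\<^sup>2))"
   using s DIM_positive[where 'a='a] by (intro riesz_profile_integrable) (auto intro!: add_nonneg_pos simp: Suc_le_eq)
  then show "integrable lborel (\<lambda>u. indicator {0<..} u *\<^sub>R (u powr (-1/2) * heat_profile (DIM('a) + 2) (s + u) ((norm z)\<^sup>2)))"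
   unfolding set_integrable_def .
 qed
 finally show ?thesis by (simp add: riesz_heat_def scaleR_left)
qed

text \<open>Fubini between the convolution and the superposition over u. Since the profile is
  nonnegative, the absolute double integral is governed by |riesz_heat| itself, and finiteness of
  one single integral suffices.\<close>

lemma integral_riesz_heat:
 fixes pr :: "'a::euclidean_space \<Rightarrow> 'b::{banach, second_countable_topology} \<Rightarrow> 'c::{banach, second_countable_topology}"
 assumes bb: "bounded_bilinear pr" and s: "s > 0" and [measurable]: "M \<in> borel_fun"
  and fin: "(NN y. ennreal (norm (riesz_heat s (x - y)) * norm (M y))) < \<infinity>"
 shows "(LL y. pr (riesz_heat s (x - y)) (M y)) =
  (LL u. (indicator {0<..} u * u powr (-1/2)) *\<^sub>R (LL y. pr (grad_kernel (s + u) (x - y)) (M y)))" (is ?g1)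
  and "integrable lborel (\<lambda>u. (indicator {0<..} u * u powr (-1/2)) *\<^sub>R (LL y. pr (grad_kernel (s + u) (x - y)) (M y)))" (is ?g2)
proof -
 interpret bounded_bilinear pr by fact
 obtain K where K: "K > 0" "\<And>a b. norm (pr a b) \<le> norm a * norm b * K" using pos_bounded by blast
 have [measurable]: "(\<lambda>y. pr (x - y) (M y)) \<in> borel_fun"
  by (rule borel_measurable_continuous_Pair) (auto intro!: continuous_on continuous_intros)
 have meas: "(\<lambda>(y, u). (indicator {0<..} u * u powr (-1/2)) *\<^sub>R pr (grad_kernel (s + u) (x - y)) (M y)) \<in> borel_measurable (borel \<Otimes>\<^sub>M borel)"
  unfolding grad_kernel_def scaleR_left by measurable
 have "(NN y. (N1 u. (indicator {0<..} u * u powr (-1/2)) *\<^sub>R pr (grad_kernel (s + u) (x - y)) (M y)))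
   \<le> (NN y. ennreal K * ennreal (norm (riesz_heat s (x - y)) * norm (M y)))"
 proof (intro nn_integral_mono)
  fix y
  define z where "z = x - y"
  have "(N1 u. (indicator {0<..} u * u powr (-1/2)) *\<^sub>R pr (grad_kernel (s + u) z) (M y))
   \<le> (NN u. ennreal (K * norm z * norm (M y)) * ennreal (indicator {0<..} u * (u powr (-1/2) * heat_profile (DIM('a) + 2) (s + u) ((norm z)\<^sup>2))))"
  proof (intro nn_integral_mono)
   fix u
   have "norm (pr (grad_kernel (s + u) z) (M y)) \<le> heat_profile (DIM('a) + 2) (s + u) ((norm z)\<^sup>2) * norm z * norm (M y) * K"
    using K(2)[of "grad_kernel (s + u) z" "M y"] by (simp add: grad_kernel_def heat_profile_nonneg)
   then have "(indicator {0<..} u * u powr (-1/2)) * norm (pr (grad_kernel (s + u) z) (M y)) \<le> (indicator {0<..} u * u powr (-1/2)) * (heat_profile (DIM('a) + 2) (s + u) ((norm z)\<^sup>2) * norm z * norm (M y) * K)"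
    by (intro mult_left_mono) auto
   then show "ennreal (norm ((indicator {0<..} u * u powr (-1/2)) *\<^sub>R pr (grad_kernel (s + u) z) (M y))) \<le>
     ennreal (K * norm z * norm (M y)) * ennreal (indicator {0<..} u * (u powr (-1/2) * heat_profile (DIM('a) + 2) (s + u) ((norm z)\<^sup>2)))"
    using K(1) by (subst ennreal_mult[symmetric]) (auto simp: heat_profile_nonneg mult_ac intro!: ennreal_leI)
  qed
  also have "... = ennreal (K * norm z * norm (M y)) * ennreal (riesz_profile (DIM('a) + 2) s ((norm z)\<^sup>2))"
  proof -
   have "set_integrable lborel {0<..} (\<lambda>u. u powr (-1/2) * heat_profile (DIM('a) + 2) (s + u) ((norm z)\<^sup>2))"
    using s DIM_positive[where 'a='a] by (intro riesz_profile_integrable) (auto intro!: add_nonneg_pos simp: Suc_le_eq)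
   from nn_integral_half_line[OF this] show ?thesis
    by (subst nn_integral_cmult) (auto simp: riesz_profile_def heat_profile_nonneg)
  qed
  also have "... = ennreal K * ennreal (norm (riesz_heat s (x - y)) * norm (M y))"
   using K(1) by (simp add: riesz_heat_def z_def riesz_profile_nonneg ennreal_mult[symmetric] mult_ac)
  finally show "(N1 u. (indicator {0<..} u * u powr (-1/2)) *\<^sub>R pr (grad_kernel (s + u) (x - y)) (M y))
   \<le> ennreal K * ennreal (norm (riesz_heat s (x - y)) * norm (M y))" unfolding z_def .
 qed
 also have "... < \<infinity>" using fin by (subst nn_integral_cmult) (auto simp: ennreal_mult_less_top)
 finally have F: "(NN y. (N1 u. (indicator {0<..} u * u powr (-1/2)) *\<^sub>R pr (grad_kernel (s + u) (x - y)) (M y))) < \<infinity>" .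
 show ?g1
  unfolding bilinear_riesz_heat[OF bb s] using lborel_Fubini(2)[OF meas F] by simp
 show ?g2
  using lborel_Fubini(4)[OF meas F] by simp
qed

lemma grad_kernel_integrable:
 assumes t: "t > 0"
 shows "integrable lborel (grad_kernel t :: 'a::euclidean_space \<Rightarrow> 'a)"
proof -
 define K where "K = 2 ^ (DIM('a) + 1) * heat_const (DIM('a) + 2)"
 have "integrable lborel (\<lambda>x::'a. (K / sqrt t) * (sqrt t / (sqrt t + norm x) ^ (DIM('a) + 1)))"
  using t by (intro integrable_mult_right integrable_weight) auto
 then show ?thesis
  by (rule L_integrable_bound)
    (use grad_kernel_bound[OF t, where 'a='a] t in \<open>auto intro!: AE_I2 simp: K_def heat_const_nonneg\<close>)
qed

lemma riesz_heat_bounded: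
 assumes t: "t > 0"
 shows "\<exists>B\<ge>0. \<forall>x::'a::euclidean_space. norm (riesz_heat t x) \<le> B"
proof -
 define K where "K = 2 ^ (DIM('a) + 1) * heat_const (DIM('a) + 2)"
 have K: "K \<ge> 0" by (simp add: K_def heat_const_nonneg)
 show ?thesis
 proof (intro exI[of _ "K / sqrt t ^ DIM('a)"] conjI allI)
  fix x :: 'a
  have "K / (sqrt t + norm x) ^ DIM('a) \<le> K / sqrt t ^ DIM('a)"
   using t K by (intro divide_left_mono power_mono mult_pos_pos zero_less_power) (auto intro!: add_pos_nonneg)
  with riesz_heat_bound[OF t, of x] show "norm (riesz_heat t x) \<le> K / sqrt t ^ DIM('a)" by (simp add: K_def)
 qed (use K t in auto)
qed

lemma gauss_kernel_bounded:
 assumes t: "t > 0"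
 shows "\<exists>B\<ge>0. \<forall>x::'a::euclidean_space. gauss_kernel t x \<le> B"
proof -
 have "gauss_kernel t x \<le> (1 / sqrt (4 * pi)) ^ DIM('a) * (t powr (- (real DIM('a) / 2)))" for x :: 'a
  using t unfolding gauss_kernel_def heat_profile_def by (intro mult_left_mono) auto
 then show ?thesis by (intro exI[of _ "(1 / sqrt (4 * pi)) ^ DIM('a) * (t powr (- (real DIM('a) / 2)))"]) auto
qed

text \<open>The mode of convergence of the convolutions with \<open>riesz_heat t\<close>: that
  kernel is bounded but decays only like |x|^(-d), so integrability has to come from f.\<close>

lemma kernel_integrable:
 fixes f :: "'a::euclidean_space \<Rightarrow> 'b::{banach, second_countable_topology}"
 assumes [measurable]: "K \<in> borel_fun" and b: "\<And>z. \<bar>K z\<bar> \<le> B" and f: "integrable lborel f"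
 shows "integrable lborel (\<lambda>y. K (x - y) *\<^sub>R f y)" (is ?g1)
  and "norm (conv K f x) \<le> B * (LL y. norm (f y))" (is ?g2)
proof -
 have [measurable]: "f \<in> borel_fun" using f by auto
 have B: "B \<ge> 0" using b[of undefined] by linarith
 have le: "norm (K (x - y) *\<^sub>R f y) \<le> B * norm (f y)" for y
  using b[of "x - y"] by (simp add: mult_right_mono)
 have iB: "integrable lborel (\<lambda>y. B * norm (f y))" using f by auto
 show i: ?g1
  by (rule L_integrable_bound[OF iB]) (use le B in \<open>auto intro!: AE_I2 order_trans[OF le]\<close>)
 have "norm (conv K f x) \<le> (LL y. norm (K (x - y) *\<^sub>R f y))" unfolding conv_def by (rule integral_norm_bound)
 also have "... \<le> (LL y. B * norm (f y))"
  using integrable_norm[OF i] iB le by (rule integral_mono)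
 finally show ?g2 by simp
qed

lemma measurable_conv [measurable]:
 fixes f :: "'a::euclidean_space \<Rightarrow> 'b::{banach, second_countable_topology}"
 assumes [measurable]: "K \<in> borel_fun" "f \<in> borel_fun"
 shows "conv K f \<in> borel_fun"
 unfolding conv_def[abs_def] by measurable

lemma riesz_component_bounded:
 assumes t: "t > 0" 
 shows "\<exists>B\<ge>0. \<forall>x::'a::euclidean_space. \<bar>riesz_heat t x \<bullet> b\<bar> \<le> B"
proof -
 obtain B where B: "B \<ge> 0" "\<And>x::'a. norm (riesz_heat t x) \<le> B" using riesz_heat_bounded[OF t] by blast
 have "\<bar>riesz_heat t x \<bullet> b\<bar> \<le> B * norm b" for x :: 'a
  using Cauchy_Schwarz_ineq2[of "riesz_heat t x" b] B(2)[of x] by (meson mult_right_mono norm_ge_zero order_trans)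
 then show ?thesis using B(1) by (intro exI[of _ "B * norm b"]) auto
qed

text \<open>Inside the ball of radius eps the smoothed kernel alone is at most of order eps^(-d);
  outside, moving time from 0 to eps^2 costs at most a multiple of eps^2 / |x|^(d+2). Both fit the
  weight of \<open>conv_tendsto\<close> at scale eps.\<close>

lemma riesz_heat_truncated:
 "\<exists>C\<ge>0. \<forall>eps>0. \<forall>x::'a::euclidean_space.
   norm (riesz_heat (eps\<^sup>2) x - indicator {x. eps < norm x} x *\<^sub>R riesz_heat 0 x) \<le> C * (eps / (eps + norm x) ^ (DIM('a) + 1))"
proof -
 define K where "K = 2 ^ (DIM('a) + 1) * heat_const (DIM('a) + 2)"
 have K: "K \<ge> 0" by (simp add: K_def heat_const_nonneg)
 define B where "B = real (DIM('a) + 2) * heat_const (DIM('a) + 2 + 2) + heat_const (DIM('a) + 2 + 4)"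
 have B: "B \<ge> 0" by (simp add: B_def heat_const_nonneg)
 define C where "C = 2 * K + 2 * B * 2 ^ (DIM('a) + 1)"
 have "norm (riesz_heat (eps\<^sup>2) x - indicator {x. eps < norm x} x *\<^sub>R riesz_heat 0 x) \<le> C * (eps / (eps + norm x) ^ (DIM('a) + 1))"
  if e: "eps > 0" for eps and x :: 'a
 proof (cases "eps < norm x")
  case False
  have "norm (riesz_heat (eps\<^sup>2) x) \<le> K / (eps + norm x) ^ DIM('a)"
   using riesz_heat_bound[of "eps\<^sup>2" x] e by (simp add: K_def)
  also have "... = K * (eps + norm x) / (eps + norm x) ^ (DIM('a) + 1)"
   using e norm_ge_zero[of x] by (simp add: add_pos_nonneg)
  also have "... \<le> K * (2 * eps) / (eps + norm x) ^ (DIM('a) + 1)"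
   using e K False by (intro divide_right_mono mult_left_mono) auto
  also have "... = 2 * K * (eps / (eps + norm x) ^ (DIM('a) + 1))" by simp
  also have "... \<le> C * (eps / (eps + norm x) ^ (DIM('a) + 1))"
   using e B by (intro mult_right_mono) (auto simp: C_def)
  finally show ?thesis using False by simp
 next
  case True
  then have x: "norm x > 0" using e by linarith
  have "riesz_heat (eps\<^sup>2) x - riesz_heat 0 x = (riesz_profile (DIM('a) + 2) (0 + eps\<^sup>2) ((norm x)\<^sup>2) - riesz_profile (DIM('a) + 2) 0 ((norm x)\<^sup>2)) *\<^sub>R x"
   by (simp add: riesz_heat_def scaleR_left_diff_distrib)
  also have "norm ... \<le> 2 * (eps\<^sup>2 * B) / norm x ^ (DIM('a) + 3) * norm x"
  proof -
   have "\<bar>riesz_profile (DIM('a) + 2) (0 + eps\<^sup>2) ((norm x)\<^sup>2) - riesz_profile (DIM('a) + 2) 0 ((norm x)\<^sup>2)\<bar> \<le> 2 * (eps\<^sup>2 * B) / sqrt ((norm x)\<^sup>2 + 0) ^ (DIM('a) + 2 + 1)"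
    unfolding B_def using x DIM_positive[where 'a='a] by (intro riesz_profile_diff_t) (auto simp: Suc_le_eq)
   from mult_right_mono[OF this norm_ge_zero[of x]] show ?thesis by (simp add: numeral_3_eq_3)
  qed
  also have "... = 2 * B * eps * (eps / norm x) / norm x ^ (DIM('a) + 1)"
   using x by (simp add: power2_eq_square power_add numeral_3_eq_3)
  also have "... \<le> 2 * B * eps * 1 / norm x ^ (DIM('a) + 1)"
   using True x e B by (intro divide_right_mono mult_left_mono) auto
  also have "... \<le> 2 * B * eps / ((eps + norm x) / 2) ^ (DIM('a) + 1)"
   using True x e B by (auto intro!: divide_left_mono power_mono mult_pos_pos zero_less_power simp del: power_Suc)
  also have "... = 2 * B * 2 ^ (DIM('a) + 1) * (eps / (eps + norm x) ^ (DIM('a) + 1))"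
   by (simp add: power_divide)
  also have "... \<le> C * (eps / (eps + norm x) ^ (DIM('a) + 1))"
   using e K by (intro mult_right_mono) (auto simp: C_def)
  finally show ?thesis using True by simp
 qed
 moreover have "C \<ge> 0" using K B by (simp add: C_def)
 ultimately show ?thesis by blast
qed

lemma riesz_profile_lipschitz:
 assumes k: "k \<ge> 3" and t: "t \<ge> 0" and m: "0 < m" "m\<^sup>2 \<le> q" "m\<^sup>2 \<le> q'"
 shows "\<bar>riesz_profile k t q - riesz_profile k t q'\<bar> \<le> 2 * heat_const (k + 2) * \<bar>q' - q\<bar> / m ^ (k + 1)"
proof -
 have *: "\<bar>riesz_profile k t q - riesz_profile k t q'\<bar> \<le> 2 * heat_const (k + 2) * \<bar>q' - q\<bar> / m ^ (k + 1)"
  if q: "m\<^sup>2 \<le> q" "q \<le> q'" for q q'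
 proof -
  have "0 < m\<^sup>2" using m by simp
  then have q0: "q > 0" using q by linarith
  have mq: "m \<le> sqrt q" using q m by (intro real_le_rsqrt)
  have "\<bar>riesz_profile k t q - riesz_profile k t q'\<bar> \<le> 2 * ((q' - q) * heat_const (k + 2)) / sqrt q ^ (k + 1)"
   by (rule riesz_profile_diff_q[OF k t q0 q(2)])
  also have "... \<le> 2 * ((q' - q) * heat_const (k + 2)) / m ^ (k + 1)"
   using q m mq q0 heat_const_nonneg[of "k + 2"] by (intro divide_left_mono power_mono mult_pos_pos zero_less_power mult_nonneg_nonneg) auto
  finally show ?thesis using q by (simp add: mult_ac)
 qed
 show ?thesis
 proof (cases "q \<le> q'")
  case True then show ?thesis using * m by blast
 next
  case False
  then have "\<bar>riesz_profile k t q' - riesz_profile k t q\<bar> \<le> 2 * heat_const (k + 2) * \<bar>q - q'\<bar> / m ^ (k + 1)" using *[of q' q] m by simp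
  then show ?thesis by (simp only: abs_minus_commute)
 qed
qed

text \<open>The Calderon-Zygmund smoothness condition, uniform in t >= 0. With p the radial profile,
  the difference is p(x) (x - y) + (p(x) - p(y)) y, and p is Lipschitz in the squared norm at
  distance at least |x| / 2 from the origin.\<close>

lemma riesz_heat_smooth:
 "\<exists>C\<ge>0. \<forall>t\<ge>0. \<forall>x y::'a::euclidean_space. x \<noteq> 0 \<longrightarrow> norm (x - y) \<le> norm x / 2 \<longrightarrow>
   norm (riesz_heat t x - riesz_heat t y) \<le> C * norm (x - y) / norm x ^ (DIM('a) + 1)"
proof -
 define H where "H = 2 * heat_const (DIM('a) + 2)"
 define H' where "H' = 2 * heat_const (DIM('a) + 2 + 2)"
 have H: "H \<ge> 0" "H' \<ge> 0" by (auto simp: H_def H'_def heat_const_nonneg)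
 define C where "C = H + H' * 4 * 2 ^ (DIM('a) + 3)"
 have "norm (riesz_heat t x - riesz_heat t y) \<le> C * norm (x - y) / norm x ^ (DIM('a) + 1)"
  if t: "t \<ge> 0" and x: "x \<noteq> 0" and y: "norm (x - y) \<le> norm x / 2" for t and x y :: 'a
 proof -
  let ?p = "\<lambda>x. riesz_profile (DIM('a) + 2) t ((norm x)\<^sup>2)"
  define N where "N = norm x"
  define D where "D = norm (x - y)"
  have N: "N > 0" using x by (simp add: N_def)
  have D: "D \<ge> 0" by (simp add: D_def)
  have ny: "norm y \<le> 3/2 * N" "N / 2 \<le> norm y"
   using norm_triangle_ineq2[of x y] norm_triangle_ineq2[of y x] y by (auto simp: N_def norm_minus_commute)
  have k3: "3 \<le> DIM('a) + 2" using DIM_positive[where 'a='a] by (auto simp: Suc_le_eq)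
  have 1: "?p x \<le> H / N ^ (DIM('a) + 1)"
  proof -
   have "?p x \<le> H / sqrt ((norm x)\<^sup>2 + t) ^ (DIM('a) + 2 - 1)"
    unfolding H_def using t x by (intro riesz_profile_le k3) (auto intro: add_pos_nonneg)
   also have "... \<le> H / N ^ (DIM('a) + 2 - 1)"
    using H N t by (intro divide_left_mono power_mono mult_pos_pos zero_less_power) (auto simp: N_def real_le_rsqrt intro!: add_pos_nonneg)
   finally show ?thesis by simp
  qed
  have 2: "\<bar>?p x - ?p y\<bar> \<le> H' * (5/2 * N * D) / (N / 2) ^ (DIM('a) + 3)"
  proof -
   have "\<bar>?p x - ?p y\<bar> \<le> H' * \<bar>(norm y)\<^sup>2 - (norm x)\<^sup>2\<bar> / (N / 2) ^ (DIM('a) + 2 + 1)"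
    unfolding H'_def using N ny by (intro riesz_profile_lipschitz k3 t power_mono) (auto simp: N_def)
   also have "\<bar>(norm y)\<^sup>2 - (norm x)\<^sup>2\<bar> \<le> 5/2 * N * D"
   proof -
    have "(norm y)\<^sup>2 - (norm x)\<^sup>2 = (norm y + norm x) * (norm y - norm x)" by (simp add: power2_eq_square algebra_simps)
    then have "\<bar>(norm y)\<^sup>2 - (norm x)\<^sup>2\<bar> = (norm y + norm x) * \<bar>norm y - norm x\<bar>" by (simp add: abs_mult)
    also have "... \<le> (5/2 * N) * D"
     using ny norm_triangle_ineq3[of y x] by (intro mult_mono) (auto simp: N_def D_def norm_minus_commute)
    finally show ?thesis .
   qed
   then have "H' * \<bar>(norm y)\<^sup>2 - (norm x)\<^sup>2\<bar> / (N / 2) ^ (DIM('a) + 2 + 1) \<le> H' * (5/2 * N * D) / (N / 2) ^ (DIM('a) + 2 + 1)"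
    using N H by (intro divide_right_mono mult_left_mono) auto
   finally show ?thesis by (simp add: numeral_3_eq_3)
  qed
  have "riesz_heat t x - riesz_heat t y = ?p x *\<^sub>R (x - y) + (?p x - ?p y) *\<^sub>R y"
   by (simp add: riesz_heat_def algebra_simps)
  also have "norm ... \<le> ?p x * D + \<bar>?p x - ?p y\<bar> * norm y"
   by (intro order_trans[OF norm_triangle_ineq]) (simp add: D_def riesz_profile_nonneg)
  also have "... \<le> H / N ^ (DIM('a) + 1) * D + H' * (5/2 * N * D) / (N / 2) ^ (DIM('a) + 3) * (3/2 * N)"
   using 1 2 ny D N H by (intro add_mono mult_mono) auto
  also have "H' * (5/2 * N * D) / (N / 2) ^ (DIM('a) + 3) * (3/2 * N) = H' * (15/4) * 2 ^ (DIM('a) + 3) * D / N ^ (DIM('a) + 1)"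
   using N by (simp add: power_divide power_add numeral_3_eq_3)
  also have "... \<le> H' * 4 * 2 ^ (DIM('a) + 3) * D / N ^ (DIM('a) + 1)"
   using H D N by (intro divide_right_mono mult_right_mono mult_left_mono) auto
  also have "H / N ^ (DIM('a) + 1) * D + H' * 4 * 2 ^ (DIM('a) + 3) * D / N ^ (DIM('a) + 1) = C * D / N ^ (DIM('a) + 1)"
   by (simp add: C_def add_divide_distrib distrib_right)
  finally show ?thesis by (simp add: N_def D_def)
 qed
 moreover have "C \<ge> 0" using H by (simp add: C_def)
 ultimately show ?thesis by blast
qed

lemma riesz_heat_tendsto:
 fixes x :: "'a::euclidean_space"
 assumes t: "t \<ge> 0" and p: "t > 0 \<or> x \<noteq> 0"
 shows "((\<lambda>h. riesz_heat (t + h) x) \<longlongrightarrow> riesz_heat t x) (at_right 0)"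
proof -
 define B where "B = real (DIM('a) + 2) * heat_const (DIM('a) + 2 + 2) + heat_const (DIM('a) + 2 + 4)"
 define D where "D = sqrt ((norm x)\<^sup>2 + t) ^ (DIM('a) + 2 + 1)"
 have "((\<lambda>h. riesz_profile (DIM('a) + 2) (t + h) ((norm x)\<^sup>2)) \<longlongrightarrow> riesz_profile (DIM('a) + 2) t ((norm x)\<^sup>2)) (at_right 0)"
 proof (rule LIM_zero_cancel, rule Lim_null_comparison)
  show "\<forall>\<^sub>F h in at_right 0. norm (riesz_profile (DIM('a) + 2) (t + h) ((norm x)\<^sup>2) - riesz_profile (DIM('a) + 2) t ((norm x)\<^sup>2)) \<le> 2 * (h * B) / D"
   using eventually_at_right_less[of 0]
  proof eventually_elim
   case (elim h)
   have "\<bar>riesz_profile (DIM('a) + 2) (t + h) ((norm x)\<^sup>2) - riesz_profile (DIM('a) + 2) t ((norm x)\<^sup>2)\<bar> \<le> 2 * (h * B) / D"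
    unfolding B_def D_def using p t elim DIM_positive[where 'a='a]
    by (intro riesz_profile_diff_t) (auto simp: Suc_le_eq intro: add_nonneg_pos add_pos_nonneg)
   then show ?case by simp
  qed
  show "((\<lambda>h. 2 * (h * B) / D) \<longlongrightarrow> 0) (at_right 0)"
  proof -
   have "(norm x)\<^sup>2 + t > 0" using p t by (auto intro: add_nonneg_pos add_pos_nonneg)
   then have "D \<noteq> 0" by (simp add: D_def)
   then show ?thesis by (auto intro!: tendsto_eq_intros)
  qed
 qed
 then show ?thesis unfolding riesz_heat_def by (intro tendsto_intros)
qed

text \<open>Time scales like length squared. The sign of \<alpha> survives because the kernel is
  odd.\<close>

lemma riesz_heat_scale:
 fixes x :: "'a::euclidean_space"
 assumes a: "\<alpha> \<noteq> 0" and t: "t \<ge> 0"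
 shows "riesz_heat (\<alpha>\<^sup>2 * t) (\<alpha> *\<^sub>R x) = (sgn \<alpha> / \<bar>\<alpha>\<bar> ^ DIM('a)) *\<^sub>R riesz_heat t x"
proof -
 have "riesz_profile (DIM('a) + 2) (\<alpha>\<^sup>2 * t) (\<alpha>\<^sup>2 * (norm x)\<^sup>2) = riesz_profile (DIM('a) + 2) t ((norm x)\<^sup>2) / sqrt (\<alpha>\<^sup>2) ^ (DIM('a) + 2 - 1)"
  using a t DIM_positive[where 'a='a] by (intro riesz_profile_scale) (auto simp: Suc_le_eq)
 moreover have "\<alpha> = sgn \<alpha> * \<bar>\<alpha>\<bar>" by (simp add: sgn_mult_abs)
 then have "(riesz_profile (DIM('a) + 2) t ((norm x)\<^sup>2) / \<bar>\<alpha>\<bar> ^ (DIM('a) + 1)) * \<alpha> = sgn \<alpha> / \<bar>\<alpha>\<bar> ^ DIM('a) * riesz_profile (DIM('a) + 2) t ((norm x)\<^sup>2)"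
  using a by (simp add: field_simps)
 ultimately show ?thesis by (simp add: riesz_heat_def power_mult_distrib)
qed

lemma gauss_kernel_dilate:
 fixes x :: "'a::euclidean_space"
 assumes a: "\<alpha> \<noteq> 0" and t: "t > 0"
 shows "gauss_kernel (\<alpha>\<^sup>2 * t) (\<alpha> *\<^sub>R x) = gauss_kernel t x / \<bar>\<alpha>\<bar> ^ DIM('a)"
proof -
 have "heat_profile DIM('a) (\<alpha>\<^sup>2 * t) (\<alpha>\<^sup>2 * (norm x)\<^sup>2) = heat_profile DIM('a) t ((norm x)\<^sup>2) / \<bar>\<alpha>\<bar> ^ DIM('a)"
  using a t powr_neg_half[of "\<alpha>\<^sup>2" "DIM('a)"] by (simp add: heat_profile_def powr_mult)
 then show ?thesis by (simp add: gauss_kernel_def power_mult_distrib)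
qed

text \<open>The Riesz kernel and \<open>riesz_heat 0\<close> are both x times a radial function
  homogeneous of degree -(d + 1); this is their quotient, read off at |x| = 1.\<close>

definition riesz_ratio :: "'n::finite itself \<Rightarrow> real" where
 "riesz_ratio _ = Gamma ((real CARD('n) + 1) / 2) * pi powr (- ((real CARD('n) + 1) / 2)) / riesz_profile (CARD('n) + 2) 0 1"

lemma riesz_ratio_pos: "riesz_ratio TYPE('n::finite) > 0"
 unfolding riesz_ratio_def
 by (intro divide_pos_pos mult_pos_pos riesz_profile_pos Gamma_real_pos) (auto simp: Suc_le_eq add_pos_nonneg)

lemma riesz_kernel_eq: "riesz_kernel (x :: real ^ 'n) = riesz_ratio TYPE('n) *\<^sub>R riesz_heat 0 x"
proof (cases "x = 0")
 case True
 then show ?thesis by (simp add: riesz_kernel_def riesz_heat_def)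
next
 case False
 have k: "3 \<le> CARD('n) + 2" using zero_less_card_finite[where 'a='n] by linarith
 have "riesz_profile (CARD('n) + 2) ((norm x)\<^sup>2 * 0) ((norm x)\<^sup>2 * 1) = riesz_profile (CARD('n) + 2) 0 1 / sqrt ((norm x)\<^sup>2) ^ (CARD('n) + 2 - 1)"
  using False by (intro riesz_profile_scale k) auto
 then have "riesz_heat 0 x = (riesz_profile (CARD('n) + 2) 0 1 / norm x ^ (CARD('n) + 1)) *\<^sub>R x"
  by (simp add: riesz_heat_def)
 moreover have "riesz_profile (CARD('n) + 2) 0 1 > 0"
  by (intro riesz_profile_pos k) auto
 ultimately show ?thesis by (simp add: riesz_kernel_def riesz_ratio_def)
qed

subsection \<open>Fourier transforms\<close>

lemma measurable_cis [measurable]: "cis \<in> borel_fun"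
 by (intro borel_measurable_continuous_onI continuous_intros)

lemma measurable_cnj [measurable]: "cnj \<in> borel_fun"
 by (intro borel_measurable_continuous_onI continuous_intros)

lemma std_normal_fourier:
 "(LL u. std_normal_density u *\<^sub>R cis (\<theta> * u)) = of_real (exp (- (\<theta>\<^sup>2 / 2)))"
proof -
 have "complex_of_real (exp (- (\<theta>\<^sup>2 / 2))) = char std_normal_distribution \<theta>" by (simp add: char_std_normal_distribution)
 also have "... = (LL u. std_normal_density u *\<^sub>R cis (\<theta> * u))"
  unfolding char_def by (subst integral_density) (auto simp: cis_conv_exp)
 finally show ?thesis ..
qed

text \<open>F is a primitive of -G + i \<theta> F and vanishes at both ends, so integration over the
  line expresses the first moment through the characteristic function.\<close>

lemma std_normal_fourier_moment:
 "(LL u. (std_normal_density u * u) *\<^sub>R cis (\<theta> * u)) = \<i> * \<theta> * of_real (exp (- (\<theta>\<^sup>2 / 2)))"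
proof -
 define F where "F u = std_normal_density u *\<^sub>R cis (\<theta> * u)" for u
 define G where "G u = (std_normal_density u * u) *\<^sub>R cis (\<theta> * u)" for u
 have iF: "integrable lborel F" and iG: "integrable lborel G"
  by (rule L_integrable_bound[OF integrable_std_normal_moment[of 0]], auto simp: F_def[abs_def])
    (rule L_integrable_bound[OF integrable_std_normal_moment[of 1]], auto simp: G_def[abs_def])
 have tail: "(F \<longlongrightarrow> 0) at_top" "(F \<longlongrightarrow> 0) at_bot"
 proof -
  have "((\<lambda>u::real. 1 / sqrt (2 * pi) * exp (- (u\<^sup>2) / 2)) \<longlongrightarrow> 1 / sqrt (2 * pi) * 0) at_top"
   by (intro tendsto_mult tendsto_const filterlim_compose[OF exp_at_bot])
     (auto simp: filterlim_uminus_at_bot intro!: filterlim_tendsto_pos_mult_at_top[where f = "\<lambda>_. 1/2" and c = "1/2", simplified] filterlim_pow_at_top filterlim_ident)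
  then have top: "((\<lambda>u. norm (F u)) \<longlongrightarrow> 0) at_top" by (simp add: F_def std_normal_density_def)
  moreover have "norm (F (- u)) = norm (F u)" for u by (simp add: F_def std_normal_density_def)
  ultimately have "((\<lambda>u. norm (F u)) \<longlongrightarrow> 0) at_bot" by (simp add: at_bot_mirror filterlim_filtermap)
  then show "(F \<longlongrightarrow> 0) at_top" "(F \<longlongrightarrow> 0) at_bot" using top by (auto intro: tendsto_norm_zero_cancel)
 qed
 have "(LBINT u=-\<infinity>..\<infinity>. - G u + \<i> * \<theta> * F u) = 0 - 0"
 proof (rule interval_integral_FTC_integrable[where F = F])
  show "(F has_vector_derivative (- G u + \<i> * \<theta> * F u)) (at u)" for u
  proof -
   have 1: "(std_normal_density has_real_derivative (- std_normal_density u * u)) (at u)"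
   proof -
    have "((\<lambda>u. c * exp (- (u\<^sup>2) / 2)) has_real_derivative (- (c * exp (- (u\<^sup>2) / 2)) * u)) (at u)" for c
     by (auto intro!: derivative_eq_intros)
    then show ?thesis unfolding std_normal_density_def[abs_def] .
   qed
   have 2: "((\<lambda>u. cis (\<theta> * u)) has_vector_derivative (\<theta> *\<^sub>R (\<i> * cis (\<theta> * u)))) (at u)"
    by (auto intro!: derivative_eq_intros simp: has_vector_derivative_def)
   show ?thesis unfolding F_def[abs_def] G_def
    by (rule has_vector_derivative_eq_rhs[OF has_vector_derivative_scaleR[OF 1 2]]) (simp add: scaleR_conv_of_real)
  qed
  show "isCont (\<lambda>u. - G u + \<i> * \<theta> * F u) u" for u
   unfolding F_def G_def std_normal_density_def cis_conv_exp by (intro continuous_intros) auto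
  show "set_integrable lborel (einterval (-\<infinity>) \<infinity>) (\<lambda>u. - G u + \<i> * \<theta> * F u)"
   using iF iG by (auto simp: set_integrable_def)
 qed (use tail in \<open>auto simp: ereal_tendsto_simps\<close>)
 then have "(LL u. - G u + \<i> * \<theta> * F u) = 0"
  by (simp add: interval_lebesgue_integral_def set_lebesgue_integral_def)
 then have "(LL u. G u) = \<i> * \<theta> * (LL u. F u)" using iF iG by simp
 then show ?thesis unfolding F_def G_def std_normal_fourier .
qed

lemma normal_fourier:
 assumes t: "t > 0"
 shows "(LL u. normal_density 0 (sqrt (2 * t)) u *\<^sub>R cis (\<theta> * u)) = of_real (exp (- (t * \<theta>\<^sup>2)))" (is ?g1)
  and "(LL u. (normal_density 0 (sqrt (2 * t)) u * u) *\<^sub>R cis (\<theta> * u)) = 2 * \<i> * t * \<theta> * of_real (exp (- (t * \<theta>\<^sup>2)))" (is ?g2)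
proof -
 define \<sigma> where "\<sigma> = sqrt (2 * t)"
 have \<sigma>: "\<sigma> > 0" "\<sigma>\<^sup>2 = 2 * t" using t by (auto simp: \<sigma>_def)
 have nd: "normal_density 0 \<sigma> (\<sigma> * u) = std_normal_density u / \<sigma>" for u
  using \<sigma>(1) by (simp add: normal_density_def std_normal_density_def power_mult_distrib real_sqrt_mult)
 have e: "(\<theta> * \<sigma>)\<^sup>2 / 2 = t * \<theta>\<^sup>2" by (simp add: power_mult_distrib \<sigma>(2))
 have sub: "(LL u. f u) = \<sigma> *\<^sub>R (LL u. f (\<sigma> * u))" for f :: "real \<Rightarrow> complex"
  using lborel_integral_real_affine[of \<sigma> f 0] \<sigma> by simp
 show ?g1
  unfolding \<sigma>_def[symmetric] using std_normal_fourier[of "\<theta> * \<sigma>"] \<sigma>(1)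
  by (subst sub) (simp add: nd e mult.assoc flip: integral_scaleR_right)
 have "\<sigma> *\<^sub>R (LL u. (normal_density 0 \<sigma> (\<sigma> * u) * (\<sigma> * u)) *\<^sub>R cis (\<theta> * (\<sigma> * u))) = \<sigma> *\<^sub>R (LL u. (std_normal_density u * u) *\<^sub>R cis ((\<theta> * \<sigma>) * u))"
  using \<sigma>(1) by (simp add: nd mult.assoc)
 also have "... = \<sigma>\<^sup>2 *\<^sub>R (\<i> * \<theta> * of_real (exp (- (t * \<theta>\<^sup>2))))"
  unfolding std_normal_fourier_moment e by (simp add: scaleR_conv_of_real power2_eq_square)
 finally show ?g2
  unfolding \<sigma>_def[symmetric] by (subst sub) (simp add: \<sigma>(2) scaleR_conv_of_real mult_ac)
qed

lemma prod_cis: "(\<Prod>i\<in>A. cis (f i)) = cis (\<Sum>i\<in>A. f i)"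
 by (induction A rule: infinite_finite_induct) (auto simp: cis_mult)

text \<open>The coordinates separate; for \<open>grad_kernel\<close> the coordinate b contributes a
  first moment instead of a mass. The factor t of that moment cancels, so time enters only through
  exp (-t |eta|^2), and a superposition over times acts on this exponential alone.\<close>

lemma gauss_kernel_fourier:
 fixes eta :: "'a::euclidean_space"
 assumes t: "t > 0"
 shows "(LL x. gauss_kernel t x *\<^sub>R cis (eta \<bullet> x)) = of_real (exp (- (t * (norm eta)\<^sup>2)))" (is ?g1)
  and "b \<in> Basis \<Longrightarrow> (LL x. (grad_kernel t x \<bullet> b) *\<^sub>R cis (eta \<bullet> x)) = (2 * sqrt (4 * pi) ^ DIM('a) * (eta \<bullet> b)) *\<^sub>R (\<i> * of_real (exp (- (t * (norm eta)\<^sup>2))))"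
proof -
 let ?nd = "normal_density 0 (sqrt (2 * t))"
 have cis: "cis (eta \<bullet> x) = (\<Prod>b\<in>Basis. cis ((eta \<bullet> b) * (x \<bullet> b)))" for x :: 'a
  unfolding prod_cis by (simp add: euclidean_inner[of eta x])
 have n: "(norm eta)\<^sup>2 = (\<Sum>b\<in>Basis. (eta \<bullet> b)\<^sup>2)"
  unfolding power2_norm_eq_inner euclidean_inner[of eta eta] by (simp add: power2_eq_square)
 have en: "(\<Prod>b\<in>Basis. complex_of_real (exp (- (t * (eta \<bullet> b)\<^sup>2)))) = of_real (exp (- (t * (norm eta)\<^sup>2)))"
  by (simp add: n exp_sum[symmetric] sum_negf sum_distrib_left[symmetric] flip: of_real_prod)
 have i0: "integrable lborel (\<lambda>u. ?nd u *\<^sub>R cis (\<theta> * u))" and i1: "integrable lborel (\<lambda>u. (?nd u * u) *\<^sub>R cis (\<theta> * u))" for \<theta>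
  by (rule L_integrable_bound[OF integrable_normal_moment[where k = 0 and \<mu> = 0 and \<sigma> = "sqrt (2 * t)"]], use t in auto)
    (rule L_integrable_bound[OF integrable_normal_moment[where k = 1 and \<mu> = 0 and \<sigma> = "sqrt (2 * t)"]], use t in auto)
 have "(LL x. gauss_kernel t x *\<^sub>R cis (eta \<bullet> x)) = (LL x. (\<Prod>b\<in>Basis. ?nd (x \<bullet> b) *\<^sub>R cis ((eta \<bullet> b) * (x \<bullet> b))))"
  by (simp add: gauss_kernel_prod[OF t] cis scaleR_conv_of_real prod.distrib)
 also have "... = of_real (exp (- (t * (norm eta)\<^sup>2)))"
  by (subst lborel_prod_basis(2)[of "\<lambda>b u. ?nd u *\<^sub>R cis ((eta \<bullet> b) * u)"]) (simp_all add: i0 normal_fourier[OF t] en)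
 finally show ?g1 .
 assume b: "b \<in> Basis"
 have "(LL x. (gauss_kernel t x * (x \<bullet> b)) *\<^sub>R cis (eta \<bullet> x)) =
  (LL x. (\<Prod>b'\<in>Basis. (?nd (x \<bullet> b') * (if b' = b then x \<bullet> b' else 1)) *\<^sub>R cis ((eta \<bullet> b') * (x \<bullet> b'))))"
  using b by (simp add: gauss_kernel_prod[OF t] cis scaleR_conv_of_real prod.distrib mult_ac flip: of_real_prod)
 also have "... = (\<Prod>b'\<in>Basis. (if b' = b then 2 * \<i> * t * (eta \<bullet> b) else 1) * of_real (exp (- (t * (eta \<bullet> b')\<^sup>2))))"
 proof (subst lborel_prod_basis(2)[of "\<lambda>b' u. (?nd u * (if b' = b then u else 1)) *\<^sub>R cis ((eta \<bullet> b') * u)"])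
  show "integrable lborel (\<lambda>u. (?nd u * (if b' = b then u else 1)) *\<^sub>R cis ((eta \<bullet> b') * u))" for b'
   using i0 i1 by (cases "b' = b") auto
 qed (intro prod.cong refl, auto simp: normal_fourier[OF t])
 also have "... = 2 * \<i> * t * (eta \<bullet> b) * of_real (exp (- (t * (norm eta)\<^sup>2)))"
  using b by (simp add: prod.distrib en)
 finally have m: "(LL x. (gauss_kernel t x * (x \<bullet> b)) *\<^sub>R cis (eta \<bullet> x)) = 2 * \<i> * t * (eta \<bullet> b) * of_real (exp (- (t * (norm eta)\<^sup>2)))" .
 have s: "sqrt (4 * pi) ^ DIM('a) > 0" by simp
 have "grad_kernel t x \<bullet> b = (sqrt (4 * pi) ^ DIM('a) / t) * (gauss_kernel t x * (x \<bullet> b))" for x :: 'a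
 proof -
  have "gauss_kernel t x * (x \<bullet> b) = (1 / sqrt (4 * pi)) ^ DIM('a) * t * (grad_kernel t x \<bullet> b)"
   using arg_cong[OF grad_kernel_gauss[OF t, of x], of "\<lambda>v. v \<bullet> b"] by simp
  then show ?thesis using t s by (simp add: power_divide)
 qed
 then have "(\<lambda>x. (grad_kernel t x \<bullet> b) *\<^sub>R cis (eta \<bullet> x)) = (\<lambda>x. (sqrt (4 * pi) ^ DIM('a) / t) *\<^sub>R ((gauss_kernel t x * (x \<bullet> b)) *\<^sub>R cis (eta \<bullet> x)))"
  by simp
 then have "(LL x. (grad_kernel t x \<bullet> b) *\<^sub>R cis (eta \<bullet> x)) = (sqrt (4 * pi) ^ DIM('a) / t) *\<^sub>R (2 * \<i> * t * (eta \<bullet> b) * of_real (exp (- (t * (norm eta)\<^sup>2))))" (is "?l = _")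
  by (simp only: integral_scaleR_right m)
 also have "... = (2 * sqrt (4 * pi) ^ DIM('a) * (eta \<bullet> b)) *\<^sub>R (\<i> * of_real (exp (- (t * (norm eta)\<^sup>2))))"
  using t by (simp add: scaleR_conv_of_real)
 finally show "?l = (2 * sqrt (4 * pi) ^ DIM('a) * (eta \<bullet> b)) *\<^sub>R (\<i> * of_real (exp (- (t * (norm eta)\<^sup>2))))" .
qed

text \<open>Gamma (1/2) = sqrt pi, rescaled. With A = |eta|^2 this produces the factor 1 / |eta| of
  the Riesz multiplier.\<close>

lemma half_line_gamma:
 assumes A: "A > 0"
 shows "integrable lborel (\<lambda>u. indicator {0<..} u * u powr (-1/2) * exp (- (u * A)))" (is ?g1)
  and "(LL u. indicator {0<..} u * u powr (-1/2) * exp (- (u * A))) = sqrt (pi / A)"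
proof -
 define f where "f u = indicator {0<..} u * u powr (-1/2) * exp (- u)" for u :: real
 have [measurable]: "f \<in> borel_fun" unfolding f_def[abs_def] by measurable
 have f0: "f u \<ge> 0" for u by (simp add: f_def)
 have "(NN u. ennreal (f u)) = (NN u. ennreal (indicator {0..} u * u powr (1/2 - 1) / exp u))"
 proof (intro nn_integral_cong)
  fix u :: real
  show "ennreal (f u) = ennreal (indicator {0..} u * u powr (1/2 - 1) / exp u)"
   by (cases "u > 0"; cases "u = 0") (simp_all add: f_def exp_minus inverse_eq_divide)
 qed
 also have "... = ennreal (sqrt pi)" using Gamma_conv_nn_integral_real[of "1/2"] Gamma_one_half_real by simp
 finally have "has_bochner_integral lborel f (sqrt pi)"
  by (intro has_bochner_integral_nn_integral) (auto simp: f0)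
 then have "integrable lborel f" "(LL u. f u) = sqrt pi" by (auto simp: has_bochner_integral_iff)
 note this(1) integral_lborel_affine[OF this(1), of A 0, unfolded this(2)]
 moreover have "indicator {0<..} u * u powr (-1/2) * exp (- (u * A)) = sqrt A * f (0 + A *\<^sub>R u)" for u
  using A by (auto simp: f_def indicator_def zero_less_mult_iff powr_mult powr_minus powr_half_sqrt mult_ac)
 ultimately show ?g1
  "(LL u. indicator {0<..} u * u powr (-1/2) * exp (- (u * A))) = sqrt (pi / A)"
  using A by (auto simp: real_sqrt_divide divide_simps) (metis mult.assoc mult.commute real_sqrt_mult_self abs_of_pos)
qed

text \<open>Frequencies enter only through the map T, so that plain, shifted and lattice-transported
  frequencies are all covered.\<close>

lemma conv_fourier:
 fixes a :: "'d::euclidean_space \<Rightarrow> complex" and T :: "'d \<Rightarrow> 'a::euclidean_space"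
 assumes a: "integrable lborel a" and T[measurable]: "T \<in> borel_fun" and K: "integrable lborel K"
 shows "conv K (\<lambda>x. LL xi. a xi * cis (T xi \<bullet> x)) x = (LL xi. a xi * cis (T xi \<bullet> x) * (LL z. K z *\<^sub>R cis (- (T xi \<bullet> z))))"
proof -
 have [measurable]: "a \<in> borel_fun" "K \<in> borel_fun" using a K by auto
 have "conv K (\<lambda>x. LL xi. a xi * cis (T xi \<bullet> x)) x = (LL y. (LL xi. K (x - y) *\<^sub>R (a xi * cis (T xi \<bullet> y))))"
  unfolding conv_def by (simp only: integral_scaleR_right)
 also have "... = (LL xi. (LL y. K (x - y) *\<^sub>R (a xi * cis (T xi \<bullet> y))))"
 proof (rule lborel_Fubini(2))
  have "(NN y. (N1 xi. K (x - y) *\<^sub>R (a xi * cis (T xi \<bullet> y)))) = (NN y. ennreal \<bar>K (x - y)\<bar> * (N1 xi. a xi))" (is "?l = _")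
   by (intro nn_integral_cong) (simp add: norm_mult ennreal_mult nn_integral_cmult)
  also have "... = (NN y. ennreal \<bar>K y\<bar>) * (N1 xi. a xi)"
   by (simp add: nn_integral_multc nn_integral_lborel_reflect(1)[of "\<lambda>y. ennreal \<bar>K y\<bar>"])
  also have "... < \<infinity>" using a K by (simp add: integrable_iff_bounded ennreal_mult_less_top)
  finally show "?l < \<infinity>" .
 qed measurable
 also have "... = (LL xi. a xi * cis (T xi \<bullet> x) * (LL z. K z *\<^sub>R cis (- (T xi \<bullet> z))))"
 proof (intro L_integral_cong refl)
  fix xi
  have "(LL y. K (x - y) *\<^sub>R (a xi * cis (T xi \<bullet> y))) = (LL z. K z *\<^sub>R (a xi * cis (T xi \<bullet> (x - z))))" (is "?l = _")
   using integral_lborel_reflect(1)[of "\<lambda>z. K z *\<^sub>R (a xi * cis (T xi \<bullet> (x - z)))" x] by simp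
  also have "... = (LL z. a xi * cis (T xi \<bullet> x) * (K z *\<^sub>R cis (- (T xi \<bullet> z))))"
   by (simp add: inner_diff_right cis_mult mult.assoc)
  finally show "?l = a xi * cis (T xi \<bullet> x) * (LL z. K z *\<^sub>R cis (- (T xi \<bullet> z)))"
   by (simp del: mult_scaleR_right)
 qed
 finally show ?thesis .
qed

text \<open>In the normalisation of \<open>riesz_heat\<close> the Riesz transform is the Fourier multiplier \<open>- i (eta \<bullet> b) / |eta|\<close> times this constant.\<close>

definition multiplier_const :: "'a::euclidean_space itself \<Rightarrow> real" where
 "multiplier_const _ = 2 * sqrt (4 * pi) ^ DIM('a) * sqrt pi"

lemma multiplier_le:
 fixes v :: "'a::euclidean_space"
 assumes "b \<in> Basis"
 shows "norm ((multiplier_const TYPE('a) * (v \<bullet> b) / norm v) *\<^sub>R (- \<i> * z)) \<le> multiplier_const TYPE('a) * norm z"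
proof -
 have "\<bar>v \<bullet> b\<bar> / norm v \<le> 1" using Basis_le_norm[OF assms, of v] by (simp add: divide_le_eq)
 from mult_left_mono[OF mult_right_mono[OF this norm_ge_zero], of "multiplier_const TYPE('a)" z]
 show ?thesis by (simp add: multiplier_const_def norm_mult abs_mult mult.assoc)
qed

text \<open>The formula for the gradient kernels is a hypothesis, and a itself need not be
  integrable, because there are two sources: \<open>conv_fourier\<close> when \<phi> is the inverse
  transform of an integrable a, and the explicit inversion of Gaussians when a is only the bounded
  transform of an integrable \<phi>.\<close>

lemma riesz_heat_spectral:
 fixes a :: "'d::euclidean_space \<Rightarrow> complex" and T :: "'d \<Rightarrow> 'a::euclidean_space"
 assumes a: "integrable lborel (\<lambda>xi. exp (- (t * (norm (T xi))\<^sup>2)) *\<^sub>R a xi)" and [measurable]: "a \<in> borel_fun" "T \<in> borel_fun"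
  and t: "t > 0" and b: "b \<in> Basis" and \<phi>: "integrable lborel \<phi>"
  and grad: "\<And>\<tau>. \<tau> > t \<Longrightarrow> conv (\<lambda>z. grad_kernel \<tau> z \<bullet> b) \<phi> x =
   (LL xi. (2 * sqrt (4 * pi) ^ DIM('a) * (T xi \<bullet> b) * exp (- (\<tau> * (norm (T xi))\<^sup>2))) *\<^sub>R (- \<i> * a xi * cis (T xi \<bullet> x)))"
 shows "riesz_conv t b \<phi> x =
  (LL xi. exp (- (t * (norm (T xi))\<^sup>2)) *\<^sub>R ((multiplier_const TYPE('a) * (T xi \<bullet> b) / norm (T xi)) *\<^sub>R (- \<i> * a xi)) * cis (T xi \<bullet> x))"
proof -
 let ?w = "\<lambda>u::real. indicator {0<..} u * u powr (-1/2)" and ?e = "\<lambda>xi. exp (- (t * (norm (T xi))\<^sup>2))"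
 define c where "c = 2 * sqrt (4 * pi) ^ DIM('a)"
 have c: "c > 0" by (simp add: c_def)
 define E where "E xi s = (c * (T xi \<bullet> b) * exp (- (s * (norm (T xi))\<^sup>2))) *\<^sub>R (- \<i> * a xi * cis (T xi \<bullet> x))" for xi s
 have Eu: "E xi (t + u) = exp (- (u * (norm (T xi))\<^sup>2)) *\<^sub>R E xi t" for xi u
  by (simp add: E_def distrib_right exp_diff exp_minus field_simps)
 have bb: "bounded_bilinear (\<lambda>(v::'a) (z::complex). (v \<bullet> b) *\<^sub>R z)"
  using bounded_bilinear.comp1[OF bounded_bilinear_scaleR bounded_linear_inner_left[of b]] by simp
 obtain B where B: "B \<ge> 0" "\<And>z::'a. norm (riesz_heat t z) \<le> B" using riesz_heat_bounded[OF t] by blast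
 have [measurable]: "\<phi> \<in> borel_fun" using \<phi> by auto
 have "riesz_conv t b \<phi> x = (LL u. ?w u *\<^sub>R conv (\<lambda>z. grad_kernel (t + u) z \<bullet> b) \<phi> x)"
  unfolding conv_def
 proof (rule integral_riesz_heat(1)[OF bb t])
  have "(NN y. ennreal (norm (riesz_heat t (x - y)) * norm (\<phi> y))) \<le> (N1 y. B *\<^sub>R \<phi> y)" (is "?l \<le> _")
   using B by (intro nn_integral_mono ennreal_leI) (auto intro: mult_right_mono)
  also have "... < \<infinity>" using integrable_scaleR_right[OF \<phi>, of B] by (simp add: integrable_iff_bounded)
  finally show "?l < \<infinity>" .
 qed measurable
 also have "... = (LL u. (LL xi. ?w u *\<^sub>R E xi (t + u)))"
 proof -
  have "?w u *\<^sub>R conv (\<lambda>z. grad_kernel (t + u) z \<bullet> b) \<phi> x = ?w u *\<^sub>R (LL xi. E xi (t + u))" for u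
   using grad[of "t + u"] unfolding E_def c_def by (cases "u > 0") auto
  then show ?thesis by (simp only: integral_scaleR_right)
 qed
 also have "... = (LL xi. (LL u. ?w u *\<^sub>R E xi (t + u)))"
 proof (rule lborel_Fubini(2)[symmetric])
  have "(N1 u. ?w u *\<^sub>R E xi (t + u)) \<le> ennreal (norm ((c * sqrt pi) *\<^sub>R (?e xi *\<^sub>R a xi)))" for xi
  proof (cases "T xi = 0")
   case False
   then have A: "(norm (T xi))\<^sup>2 > 0" by simp
   have "(N1 u. ?w u *\<^sub>R E xi (t + u)) = (NN u. ennreal (norm (E xi t) * (?w u * exp (- (u * (norm (T xi))\<^sup>2)))))"
    by (simp add: Eu mult_ac abs_mult)
   also have "... = ennreal (norm (E xi t) * (sqrt pi / norm (T xi)))"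
    using half_line_gamma[OF A] by (subst nn_integral_eq_integral) (auto simp: real_sqrt_divide)
   also have "norm (E xi t) * (sqrt pi / norm (T xi)) \<le> c * norm (T xi) * ?e xi * norm (a xi) * (sqrt pi / norm (T xi))"
    using c Basis_le_norm[OF b, of "T xi"] by (intro mult_right_mono) (auto simp: E_def norm_mult abs_mult intro!: mult_right_mono)
   finally show ?thesis using c False by (simp add: mult_ac abs_mult ennreal_leI)
  qed (simp add: E_def)
  then have "(NN xi. (N1 u. ?w u *\<^sub>R E xi (t + u))) \<le> (N1 xi. (c * sqrt pi) *\<^sub>R (?e xi *\<^sub>R a xi))" (is "?l \<le> _")
   by (intro nn_integral_mono)
  also have "... < \<infinity>" using integrable_scaleR_right[OF a, of "c * sqrt pi"] unfolding integrable_iff_bounded by blast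
  finally show "?l < \<infinity>" .
  show "(\<lambda>(xi, u). ?w u *\<^sub>R E xi (t + u)) \<in> borel_measurable (borel \<Otimes>\<^sub>M borel)" unfolding E_def by measurable
 qed
 also have "... = (LL xi. ?e xi *\<^sub>R ((multiplier_const TYPE('a) * (T xi \<bullet> b) / norm (T xi)) *\<^sub>R (- \<i> * a xi)) * cis (T xi \<bullet> x))"
 proof (intro L_integral_cong refl)
  fix xi
  show "(LL u. ?w u *\<^sub>R E xi (t + u)) = ?e xi *\<^sub>R ((multiplier_const TYPE('a) * (T xi \<bullet> b) / norm (T xi)) *\<^sub>R (- \<i> * a xi)) * cis (T xi \<bullet> x)"
  proof (cases "T xi = 0")
   case False
   then have A: "(norm (T xi))\<^sup>2 > 0" by simp
   have "(LL u. ?w u *\<^sub>R E xi (t + u)) = (LL u. (?w u * exp (- (u * (norm (T xi))\<^sup>2))) *\<^sub>R E xi t)"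
    by (simp add: Eu)
   also have "... = sqrt (pi / (norm (T xi))\<^sup>2) *\<^sub>R E xi t"
    using half_line_gamma[OF A] by (simp add: integral_scaleR_left)
   also have "... = ?e xi *\<^sub>R ((multiplier_const TYPE('a) * (T xi \<bullet> b) / norm (T xi)) *\<^sub>R (- \<i> * a xi)) * cis (T xi \<bullet> x)"
    using False unfolding E_def multiplier_const_def c_def by (simp add: real_sqrt_divide scaleR_conv_of_real mult_ac)
   finally show ?thesis .
  qed (simp add: E_def)
 qed
 finally show ?thesis .
qed

text \<open>The function smoothed on the right is bounded but not known to be integrable, which is
  why the identity is not phrased as \<open>weak_riesz\<close>.\<close>

lemma riesz_heat_fourier:
 fixes a :: "'d::euclidean_space \<Rightarrow> complex" and T :: "'d \<Rightarrow> 'a::euclidean_space"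
 assumes a: "integrable lborel a" and T[measurable]: "T \<in> borel_fun" and t: "t > 0" and b: "b \<in> Basis"
  and \<phi>: "integrable lborel (\<lambda>x. LL xi. a xi * cis (T xi \<bullet> x))"
 shows "riesz_conv t b (\<lambda>x. LL xi. a xi * cis (T xi \<bullet> x)) x =
  conv (gauss_kernel t) (\<lambda>x. LL xi. (multiplier_const TYPE('a) * (T xi \<bullet> b) / norm (T xi)) *\<^sub>R (- \<i> * a xi) * cis (T xi \<bullet> x)) x"
proof -
 have am[measurable]: "a \<in> borel_fun" using a by auto
 have ia: "integrable lborel (\<lambda>xi. (multiplier_const TYPE('a) * (T xi \<bullet> b) / norm (T xi)) *\<^sub>R (- \<i> * a xi))"
  by (rule L_integrable_bound[OF integrable_mult_right[OF integrable_norm[OF a], of "multiplier_const TYPE('a)"]])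
    (use multiplier_le[OF b] in \<open>auto intro!: AE_I2 intro: order_trans[OF _ abs_ge_self]\<close>)
 have "riesz_conv t b (\<lambda>x. LL xi. a xi * cis (T xi \<bullet> x)) x =
  (LL xi. exp (- (t * (norm (T xi))\<^sup>2)) *\<^sub>R ((multiplier_const TYPE('a) * (T xi \<bullet> b) / norm (T xi)) *\<^sub>R (- \<i> * a xi)) * cis (T xi \<bullet> x))"
 proof (rule riesz_heat_spectral[OF _ am T t b \<phi>])
  show "integrable lborel (\<lambda>xi. exp (- (t * (norm (T xi))\<^sup>2)) *\<^sub>R a xi)"
   by (rule L_integrable_bound[OF a]) (use t in \<open>auto intro!: mult_left_le_one_le\<close>)
  fix \<tau> assume "\<tau> > t"
  then have \<tau>: "\<tau> > 0" using t by simp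
  show "conv (\<lambda>z. grad_kernel \<tau> z \<bullet> b) (\<lambda>x. LL xi. a xi * cis (T xi \<bullet> x)) x =
   (LL xi. (2 * sqrt (4 * pi) ^ DIM('a) * (T xi \<bullet> b) * exp (- (\<tau> * (norm (T xi))\<^sup>2))) *\<^sub>R (- \<i> * a xi * cis (T xi \<bullet> x)))"
   unfolding conv_fourier[OF a T integrable_inner_left[OF grad_kernel_integrable[OF \<tau>]]]
   using gauss_kernel_fourier(2)[OF \<tau> b, of "- T _"] by (simp add: scaleR_conv_of_real mult_ac)
 qed
 also have "... = conv (gauss_kernel t) (\<lambda>x. LL xi. (multiplier_const TYPE('a) * (T xi \<bullet> b) / norm (T xi)) *\<^sub>R (- \<i> * a xi) * cis (T xi \<bullet> x)) x"
  unfolding conv_fourier[OF ia T gauss_kernel_integral(1)[OF t]]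
  using gauss_kernel_fourier(1)[OF t, of "- T _"] by (simp add: scaleR_conv_of_real mult_ac)
 finally show ?thesis .
qed

text \<open>Up to a constant the weighted Gaussian in z is itself a \<open>grad_kernel\<close>, at
  the dual time 1 / (4 t), so inversion for these kernels reduces to the forward formula.\<close>

lemma grad_kernel_inversion:
 fixes w :: "'a::euclidean_space"
 assumes t: "t > 0" and b: "b \<in> Basis"
 shows "(LL z. (2 * sqrt (4 * pi) ^ DIM('a) * (z \<bullet> b) * exp (- (t * (norm z)\<^sup>2))) *\<^sub>R cis (w \<bullet> z)) = ((2 * pi) ^ DIM('a) * (grad_kernel t w \<bullet> b)) *\<^sub>R \<i>" (is ?g1)
  and "integrable lborel (\<lambda>z::'a. 2 * sqrt (4 * pi) ^ DIM('a) * (z \<bullet> b) * exp (- (t * (norm z)\<^sup>2)))" (is ?g2)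
proof -
 define r where "r = 1 / (4 * t)"
 have r: "r > 0" using t by (simp add: r_def)
 define c where "c = 2 * sqrt (4 * pi) ^ DIM('a) * sqrt r ^ (DIM('a) + 2)"
 have K: "2 * sqrt (4 * pi) ^ DIM('a) * (z \<bullet> b) * exp (- (t * (norm z)\<^sup>2)) = c * (grad_kernel r z \<bullet> b)" for z :: 'a
 proof -
  have "(norm z)\<^sup>2 / (4 * r) = t * (norm z)\<^sup>2" using t by (simp add: r_def)
  then show ?thesis using r unfolding grad_kernel_def heat_profile_def c_def by (simp only: powr_neg_half) simp
 qed
 have "c * (2 * sqrt (4 * pi) ^ DIM('a)) = (2 * pi) ^ DIM('a) * (1 / sqrt t) ^ (DIM('a) + 2)"
  using t by (simp add: c_def r_def real_sqrt_divide real_sqrt_mult power_divide power_mult_distrib field_simps)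
    (simp flip: power_mult_distrib)
 moreover have "r * (norm w)\<^sup>2 = (norm w)\<^sup>2 / (4 * t)" by (simp add: r_def)
 ultimately have "(c * (2 * sqrt (4 * pi) ^ DIM('a) * (w \<bullet> b))) *\<^sub>R (\<i> * of_real (exp (- (r * (norm w)\<^sup>2)))) = ((2 * pi) ^ DIM('a) * (grad_kernel t w \<bullet> b)) *\<^sub>R \<i>"
  using t unfolding grad_kernel_def heat_profile_def by (simp only: powr_neg_half mult.assoc[symmetric]) (simp add: scaleR_conv_of_real power_one_over)
 then show ?g1
  unfolding K using gauss_kernel_fourier(2)[OF r b, of w] by (simp add: scaleR_scaleR[symmetric] del: scaleR_scaleR)
 show ?g2
  unfolding K by (intro integrable_mult_right integrable_inner_left grad_kernel_integrable r)
qed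

subsection \<open>The Riesz transform on \<open>L\<^sup>2\<close>\<close>

lemma gauss_conv_tendsto:
 fixes f :: "'a::euclidean_space \<Rightarrow> 'b::{banach, second_countable_topology}"
 assumes f: "f \<in> borel_fun" "lebesgue_point f x" "bounded_averages f x"
 shows "((\<lambda>t. conv (gauss_kernel t) f x) \<longlongrightarrow> f x) (at_right 0)"
proof -
 obtain C where C: "\<And>t (x::'a). t > 0 \<Longrightarrow> gauss_kernel t x \<le> C * (sqrt t / (sqrt t + norm x) ^ (DIM('a) + 1))"
  using gauss_kernel_bound by blast
 have "((\<lambda>t. conv (gauss_kernel (t\<^sup>2)) f x) \<longlongrightarrow> 1 *\<^sub>R f x) (at_right 0)"
 proof (rule conv_tendsto[OF f, where C = C])
  fix t :: real and y :: 'a assume t: "t > 0"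
  then show "\<bar>gauss_kernel (t\<^sup>2) y\<bar> \<le> C * (t / (t + norm y) ^ (DIM('a) + 1))" using C[of "t\<^sup>2" y] by simp
  show "(LL (y::'a). gauss_kernel (t\<^sup>2) y) = 1" using t by (intro gauss_kernel_integral(2)) simp
 qed measurable
 moreover have "filterlim sqrt (at_right 0) (at_right 0)"
  unfolding filterlim_at
  by (auto simp: eventually_at_right_less intro!: tendsto_eq_intros eventually_mono[OF eventually_at_right_less[of 0]])
 ultimately have "((\<lambda>t. conv (gauss_kernel ((sqrt t)\<^sup>2)) f x) \<longlongrightarrow> 1 *\<^sub>R f x) (at_right 0)"
  by (rule filterlim_compose)
 then have "((\<lambda>t. conv (gauss_kernel ((sqrt t)\<^sup>2)) f x) \<longlongrightarrow> f x) (at_right 0)" by (simp only: scaleR_one)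
 then show ?thesis
 proof (rule Lim_transform_eventually)
  show "\<forall>\<^sub>F t in at_right 0. conv (gauss_kernel ((sqrt t)\<^sup>2)) f x = conv (gauss_kernel t) f x"
   by (rule eventually_mono[OF eventually_at_right_less[of 0]]) simp
 qed
qed

lemma filterlim_at_right_sequence:
 fixes X :: "nat \<Rightarrow> real"
 assumes "\<And>n. X n > 0" "X \<longlonglongrightarrow> 0"
 shows "filterlim X (at_right 0) sequentially"
 unfolding filterlim_at using assms less_imp_neq[OF assms(1)] by (auto intro!: always_eventually)

lemma AE_gauss_conv_tendsto:
 fixes f :: "'a::euclidean_space \<Rightarrow> 'b::{banach, second_countable_topology}"
 assumes [measurable]: "f \<in> borel_fun" and p: "p = 1 \<or> p = 2" and fin: "(NN y. ennreal (norm (f y) ^ p)) < \<infinity>"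
 shows "AE x in lborel. ((\<lambda>t. conv (gauss_kernel t) f x) \<longlongrightarrow> f x) (at_right 0)"
proof -
 have "locally_integrable f"
  unfolding locally_integrable_def set_integrable_def
 proof (intro conjI allI)
  fix r
  show "integrable lborel (\<lambda>x. indicat_real (cball 0 r) x *\<^sub>R f x)"
  proof (rule integrableI_bounded)
   have "(N1 x. indicat_real (cball 0 r) x *\<^sub>R f x) \<le> (NN x. ennreal (norm (f x) ^ p) + indicator (cball 0 r) x)" (is "?l \<le> _")
   proof (intro nn_integral_mono)
    fix x :: 'a
    have "norm (f x) \<le> norm (f x) ^ p + 1"
     using p zero_le_power2[of "norm (f x) - 1/2"] by (auto simp: power2_eq_square algebra_simps)
    then have "ennreal (norm (f x)) \<le> ennreal (norm (f x) ^ p) + 1"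
     by (subst ennreal_1[symmetric], subst ennreal_plus[symmetric]) (auto intro!: ennreal_leI simp del: ennreal_plus ennreal_1)
    then show "ennreal (norm (indicat_real (cball 0 r) x *\<^sub>R f x)) \<le> ennreal (norm (f x) ^ p) + indicator (cball 0 r) x"
     by (auto simp: indicator_def)
   qed
   also have "... = (NN x. ennreal (norm (f x) ^ p)) + emeasure lborel (cball (0::'a) r)"
    by (subst nn_integral_add) auto
   also have "... < \<infinity>" using fin emeasure_lborel_cball_finite[of "0::'a" r] by auto
   finally show "?l < \<infinity>" .
  qed measurable
 qed measurable
 from AE_lebesgue_point[OF this] show ?thesis
  by eventually_elim (rule gauss_conv_tendsto[OF assms(1) _ bounded_averagesI[OF assms]])
qed

lemma tendsto_at_right_sequentiallyI:
 fixes f :: "real \<Rightarrow> 'b::topological_space"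
 assumes "\<And>X. (\<And>n. X n > a) \<Longrightarrow> X \<longlonglongrightarrow> a \<Longrightarrow> (\<lambda>n. f (X n)) \<longlonglongrightarrow> L"
 shows "(f \<longlongrightarrow> L) (at_right a)"
 unfolding tendsto_at_iff_sequentially comp_def using assms by auto

definition energy :: "('a::euclidean_space \<Rightarrow> 'b::real_normed_vector) \<Rightarrow> ennreal" where
 "energy f = (NN x. ennreal ((norm (f x))\<^sup>2))"

lemma energy_mono:
 assumes "\<And>x. norm (f x) \<le> c * norm (g x)" "c \<ge> 0" and [measurable]: "g \<in> borel_fun"
 shows "energy f \<le> ennreal (c\<^sup>2) * energy g"
proof -
 have "energy f \<le> (NN x. ennreal (c\<^sup>2) * ennreal ((norm (g x))\<^sup>2))"
  unfolding energy_def using power_mono[OF assms(1) norm_ge_zero, of _ 2]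
  by (intro nn_integral_mono) (auto simp: power_mult_distrib simp flip: ennreal_mult intro!: ennreal_leI)
 then show ?thesis unfolding energy_def by (simp add: nn_integral_cmult)
qed

text \<open>Fatou's lemma; it lets norm bounds pass to almost everywhere limits.\<close>

lemma energy_lower_semicontinuous:
 assumes [measurable]: "\<And>n. v n \<in> borel_fun" and lim: "AE x in lborel. (\<lambda>n::nat. v n x) \<longlonglongrightarrow> w x"
  and le: "\<And>n. n \<ge> N \<Longrightarrow> energy (v n) \<le> C"
 shows "energy w \<le> C"
proof -
 have "energy w = (NN x. liminf (\<lambda>n. ennreal ((norm (v n x))\<^sup>2)))"
  unfolding energy_def
 proof (rule nn_integral_cong_AE, use lim in eventually_elim)
  case (elim x)
  have "(\<lambda>n. ennreal ((norm (v n x))\<^sup>2)) \<longlonglongrightarrow> ennreal ((norm (w x))\<^sup>2)"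
   by (intro tendsto_ennrealI tendsto_intros elim)
  from lim_imp_Liminf[OF sequentially_bot this] show ?case ..
 qed
 also have "... \<le> liminf (\<lambda>n. energy (v n))" unfolding energy_def by (rule nn_integral_liminf) measurable
 also have "... \<le> liminf (\<lambda>n::nat. C)"
  by (intro Liminf_mono eventually_mono[OF eventually_ge_at_top[of N]] le)
 finally show ?thesis by (simp add: Liminf_const)
qed

lemma nn_integral_mult_le_energy:
 assumes [measurable]: "u \<in> borel_fun" "v \<in> borel_fun"
  and "energy u \<le> ennreal a" "energy v \<le> ennreal c" "a \<ge> 0" "c \<ge> 0"
 shows "(NN x. ennreal (norm (u x) * norm (v x))) \<le> ennreal (sqrt (a * c))"
proof -
 let ?I = "NN x. ennreal (norm (u x) * norm (v x))"
 have "?I\<^sup>2 \<le> energy u * energy v"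
  using Cauchy_Schwarz_nn_integral[of "\<lambda>x. ennreal (norm (u x))" lborel "\<lambda>x. ennreal (norm (v x))"]
  by (simp add: energy_def ennreal_mult ennreal_power)
 also have "... \<le> ennreal a * ennreal c" using assms by (intro mult_mono) auto
 also have "... = ennreal (a * c)" using assms by (simp add: ennreal_mult)
 finally have I: "?I\<^sup>2 \<le> ennreal (a * c)" .
 show ?thesis
 proof (cases ?I rule: ennreal_cases)
  case (real r)
  then have "r\<^sup>2 \<le> a * c" using I assms by (simp add: ennreal_power ennreal_le_iff)
  then show ?thesis using real by (simp add: real_le_rsqrt ennreal_leI)
 next
  case top
  then show ?thesis using I by (simp add: power2_eq_square ennreal_top_mult top_unique)
 qed
qed

lemma gauss_kernel_le: "t > 0 \<Longrightarrow> gauss_kernel t (x::'a::euclidean_space) \<le> gauss_kernel t (0::'a)"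
 unfolding gauss_kernel_def heat_profile_def by (intro mult_left_mono) auto

text \<open>The square of the kernel is at most its maximum \<open>gauss_kernel t 0\<close> times
  the kernel, whose mass is 1; Cauchy-Schwarz then pairs it with v. Thus square integrable functions
  can be smoothed without being integrable.\<close>

lemma gauss_kernel_energy:
 fixes v :: "'a::euclidean_space \<Rightarrow> 'b::{banach, second_countable_topology}"
 assumes t: "t > 0" and [measurable]: "v \<in> borel_fun" and v: "energy v \<le> ennreal a" "a \<ge> 0"
 shows "integrable lborel (\<lambda>y. gauss_kernel t (x - y) *\<^sub>R v y)" (is ?g1)
  and "(LL y. norm (gauss_kernel t (x - y) *\<^sub>R v y)) \<le> sqrt (gauss_kernel t (0::'a) * a)" (is ?g2)
proof -
 define k where "k y = gauss_kernel t (x - y)" for y :: 'a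
 have [measurable]: "k \<in> borel_fun" unfolding k_def by measurable
 have k: "(LL y. k y) = 1" "integrable lborel k"
  unfolding k_def using integral_lborel_reflect[of "gauss_kernel t" x] gauss_kernel_integral[OF t, where 'a='a] by auto
 have "energy k \<le> (NN y. ennreal (gauss_kernel t (0::'a) * k y))"
  unfolding energy_def using gauss_kernel_le[OF t] by (intro nn_integral_mono ennreal_leI) (auto simp: k_def power2_eq_square intro!: mult_right_mono)
 also have "... = ennreal (gauss_kernel t (0::'a) * (LL y. k y))"
  using k(2) gauss_kernel_nonneg[of t "x - _"] by (subst nn_integral_eq_integral) (auto simp flip: k_def)
 finally have "energy k \<le> ennreal (gauss_kernel t (0::'a))" by (simp add: k(1))
 from nn_integral_mult_le_energy[OF _ _ this v(1) _ v(2)]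
 have le: "(N1 y. k y *\<^sub>R v y) \<le> ennreal (sqrt (gauss_kernel t (0::'a) * a))" by simp
 then have i: "integrable lborel (\<lambda>y. k y *\<^sub>R v y)" by (intro integrableI_bounded) (auto intro: le_less_trans)
 then show ?g1 unfolding k_def .
 have "ennreal (LL y. norm (k y *\<^sub>R v y)) \<le> ennreal (sqrt (gauss_kernel t (0::'a) * a))"
  using le integrable_norm[OF i] by (subst nn_integral_eq_integral[symmetric]) auto
 then show ?g2
  using v by (simp add: k_def ennreal_le_iff)
qed

lemma norm_integral_le_nn_integral:
 fixes f :: "'a \<Rightarrow> 'b::{banach, second_countable_topology}"
 shows "ennreal (norm (\<integral>x. f x \<partial>M)) \<le> (\<integral>\<^sup>+x. ennreal (norm (f x)) \<partial>M)"
 by (cases "integrable M f") (auto simp: integral_norm_bound_ennreal not_integrable_integral_eq)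

lemma integral_exp_norm_sq:
 assumes t: "t > 0"
 shows "integrable lborel (\<lambda>z::'a::euclidean_space. exp (- (t * (norm z)\<^sup>2)))"
  and "(LL (z::'a). exp (- (t * (norm z)\<^sup>2))) = sqrt (pi / t) ^ DIM('a)"
proof -
 define r where "r = 1 / (4 * t)"
 have r: "r > 0" using t by (simp add: r_def)
 have e: "exp (- (t * (norm z)\<^sup>2)) = sqrt (pi / t) ^ DIM('a) * gauss_kernel r z" for z :: 'a
 proof -
  have "(norm z)\<^sup>2 / (4 * r) = t * (norm z)\<^sup>2" using t by (simp add: r_def)
  moreover have "sqrt (pi / t) = sqrt (4 * pi) * sqrt r" using t by (simp add: r_def real_sqrt_mult real_sqrt_divide)
  ultimately show ?thesis using r unfolding gauss_kernel_def heat_profile_def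
   by (simp only: powr_neg_half power_mult_distrib) (simp add: power_one_over)
 qed
 show "integrable lborel (\<lambda>z::'a. exp (- (t * (norm z)\<^sup>2)))" "(LL (z::'a). exp (- (t * (norm z)\<^sup>2))) = sqrt (pi / t) ^ DIM('a)"
  unfolding e using gauss_kernel_integral[OF r, where 'a='a] by auto
qed

text \<open>Weighting by a wide Gaussian turns the left-hand side into a quadratic form in \<open>a\<close> with a narrow Gaussian kernel,
 which is bounded by Schur's test.\<close>

lemma Plancherel_le:
 fixes a :: "'a::euclidean_space \<Rightarrow> complex"
 assumes a: "integrable lborel a"
 shows "energy (\<lambda>x. LL xi. a xi * cis (xi \<bullet> x)) \<le> ennreal ((2 * pi) ^ DIM('a)) * energy a"
proof -
 have am[measurable]: "a \<in> borel_fun" using a by auto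
 define A where "A x = (LL xi. a xi * cis (xi \<bullet> x))" for x
 have Am[measurable]: "A \<in> borel_fun" unfolding A_def by measurable
 define F where "F = (LL xi. norm (a xi))"
 have F0: "F \<ge> 0" by (simp add: F_def)
 have A: "norm (A x) \<le> F" for x
  using integral_norm_bound[of lborel "\<lambda>xi. a xi * cis (xi \<bullet> x)"] by (simp add: A_def F_def norm_mult)
 have "energy (\<lambda>x. exp (- (norm x)\<^sup>2 / (8 * \<tau>)) *\<^sub>R A x) \<le> ennreal ((2 * pi) ^ DIM('a)) * energy a" if \<tau>: "\<tau> > 0" for \<tau>
 proof -
  define e where "e z = exp (- (\<tau> * (norm z)\<^sup>2))" for z :: 'a
  have [measurable]: "e \<in> borel_fun" unfolding e_def by measurable
  define q where "q xi = ennreal ((norm (a xi))\<^sup>2 / 2)" for xi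
  have [measurable]: "q \<in> borel_fun" unfolding q_def by measurable
  \<comment> \<open>The constant with exp (-|x|^2 / (4 \<tau>)) = s * gauss_kernel \<tau> x.
    Multiplied by the mass of e it is (2 pi)^d for every \<tau>, which keeps the bound uniform as
    \<tau> grows.\<close>
  define s where "s = sqrt (4 * pi) ^ DIM('a) * sqrt \<tau> ^ DIM('a)"
  have "sqrt (4 * pi) * sqrt \<tau> * sqrt (pi / \<tau>) = 2 * pi" using \<tau> by (simp add: real_sqrt_mult real_sqrt_divide)
  then have s: "s \<ge> 0" "s * sqrt (pi / \<tau>) ^ DIM('a) = (2 * pi) ^ DIM('a)"
   using \<tau> by (simp_all only: s_def power_mult_distrib[symmetric]) simp
  have ie: "(NN z. ennreal (e z)) = ennreal (sqrt (pi / \<tau>) ^ DIM('a))"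
   unfolding e_def using integral_exp_norm_sq[OF \<tau>, where 'a='a] by (subst nn_integral_eq_integral) auto
  have w: "(norm (exp (- (norm x)\<^sup>2 / (8 * \<tau>)) *\<^sub>R A x))\<^sup>2 = s * (gauss_kernel \<tau> x * (norm (A x))\<^sup>2)" for x
  proof -
   have "(exp (- (norm x)\<^sup>2 / (8 * \<tau>)))\<^sup>2 = exp (- (norm x)\<^sup>2 / (4 * \<tau>))"
    using \<tau> by (simp add: power2_eq_square flip: exp_add)
   also have "... = s * gauss_kernel \<tau> x"
    using \<tau> unfolding s_def gauss_kernel_def heat_profile_def by (simp only: powr_neg_half) (simp add: power_one_over)
   finally show ?thesis by (simp add: power_mult_distrib)
  qed
  have ig: "integrable lborel (\<lambda>x. gauss_kernel \<tau> x * (norm (A x))\<^sup>2)"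
   by (rule L_integrable_bound[OF integrable_mult_left[OF gauss_kernel_integral(1)[OF \<tau>], of "F\<^sup>2"]])
     (auto intro!: mult_left_mono power_mono A)
  have inner: "(LL x. gauss_kernel \<tau> x *\<^sub>R (A x * cis (- (xi \<bullet> x)))) = (LL eta. a eta * e (eta - xi))" for xi
  proof -
   have "A x * cis (- (xi \<bullet> x)) = (LL eta. a eta * cis ((eta - xi) \<bullet> x))" for x
    unfolding A_def by (simp add: inner_diff_left mult.assoc cis_mult flip: integral_mult_left_zero)
   then have "(LL x. gauss_kernel \<tau> x *\<^sub>R (A x * cis (- (xi \<bullet> x)))) = conv (gauss_kernel \<tau>) (\<lambda>x. LL eta. a eta * cis ((eta - xi) \<bullet> x)) 0"
    by (simp add: conv_def)
   then show ?thesis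
    unfolding conv_fourier[OF a _ gauss_kernel_integral(1)[OF \<tau>], of "\<lambda>eta. eta - xi", simplified]
    using gauss_kernel_fourier(1)[OF \<tau>, of "xi - _"] by (simp add: e_def norm_minus_commute inner_diff_left)
  qed
  have "complex_of_real (LL x. gauss_kernel \<tau> x * (norm (A x))\<^sup>2) = (LL x. (LL xi. gauss_kernel \<tau> x *\<^sub>R (a xi * cis (xi \<bullet> x) * cnj (A x))))" (is "?l = _")
   unfolding integral_complex_of_real[symmetric]
   by (simp only: of_real_mult complex_norm_square integral_scaleR_right integral_mult_left_zero integral_mult_right_zero A_def[symmetric] scaleR_conv_of_real)
  also have "... = (LL xi. (LL x. gauss_kernel \<tau> x *\<^sub>R (a xi * cis (xi \<bullet> x) * cnj (A x))))"
  proof (rule lborel_Fubini(2))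
   have "(NN x. (N1 xi. gauss_kernel \<tau> x *\<^sub>R (a xi * cis (xi \<bullet> x) * cnj (A x))))
    \<le> (NN (x::'a). (NN xi. ennreal (gauss_kernel \<tau> x * F) * ennreal (norm (a xi))))"
   proof (intro nn_integral_mono)
    fix x xi
    show "ennreal (norm (gauss_kernel \<tau> x *\<^sub>R (a xi * cis (xi \<bullet> x) * cnj (A x)))) \<le> ennreal (gauss_kernel \<tau> x * F) * ennreal (norm (a xi))"
     using mult_right_mono[OF A[of x], of "gauss_kernel \<tau> x * norm (a xi)"] F0 by (simp add: norm_mult mult_ac ennreal_leI flip: ennreal_mult)
   qed
   also have "... = ennreal F * (N1 xi. a xi)"
    using gauss_kernel_integral[OF \<tau>, where 'a='a] F0 by (simp add: nn_integral_cmult nn_integral_multc nn_integral_eq_integral)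
   also have "... < \<infinity>" using a by (simp add: integrable_iff_bounded ennreal_mult_less_top)
   finally show "(NN x. (N1 xi. gauss_kernel \<tau> x *\<^sub>R (a xi * cis (xi \<bullet> x) * cnj (A x)))) < \<infinity>" .
  qed measurable
  also have "... = (LL xi. a xi * cnj (LL eta. a eta * e (eta - xi)))"
  proof (intro L_integral_cong refl)
   fix xi
   have "(LL x. gauss_kernel \<tau> x *\<^sub>R (a xi * cis (xi \<bullet> x) * cnj (A x))) = (LL x. a xi * cnj (gauss_kernel \<tau> x *\<^sub>R (A x * cis (- (xi \<bullet> x)))))"
    by (simp add: scaleR_conv_of_real cis_cnj mult_ac)
   then show "(LL x. gauss_kernel \<tau> x *\<^sub>R (a xi * cis (xi \<bullet> x) * cnj (A x))) = a xi * cnj (LL eta. a eta * e (eta - xi))"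
    by (simp only: integral_mult_right_zero L_integral_cnj inner)
  qed
  finally have "norm (?l) = norm (LL xi. a xi * cnj (LL eta. a eta * e (eta - xi)))"
   by (rule arg_cong)
  then have "ennreal (LL x. gauss_kernel \<tau> x * (norm (A x))\<^sup>2) = ennreal (norm (LL xi. a xi * cnj (LL eta. a eta * e (eta - xi))))" (is "?l = _")
   by (subst (asm) norm_of_real, subst (asm) abs_of_nonneg) (auto intro!: integral_nonneg_AE)
  also have "... \<le> (NN xi. (NN eta. ennreal (norm (a xi) * norm (a eta) * e (eta - xi))))"
  proof (rule order_trans[OF norm_integral_le_nn_integral nn_integral_mono])
   fix xi
   have "ennreal (norm (a xi)) * ennreal (norm (LL eta. a eta * e (eta - xi))) \<le> ennreal (norm (a xi)) * (N1 eta. a eta * e (eta - xi))"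
    by (intro mult_left_mono norm_integral_le_nn_integral) auto
   then show "ennreal (norm (a xi * cnj (LL eta. a eta * e (eta - xi)))) \<le> (NN eta. ennreal (norm (a xi) * norm (a eta) * e (eta - xi)))"
    by (simp add: norm_mult ennreal_mult e_def mult.assoc nn_integral_cmult)
  qed
  also have "... \<le> (NN xi. (NN eta. q xi * ennreal (e (eta - xi)) + q eta * ennreal (e (eta - xi))))"
  proof (intro nn_integral_mono)
   fix xi eta
   have "norm (a xi) * norm (a eta) * e (eta - xi) \<le> ((norm (a xi))\<^sup>2 / 2 + (norm (a eta))\<^sup>2 / 2) * e (eta - xi)"
    using sum_squares_bound[of "norm (a xi)" "norm (a eta)"] by (intro mult_right_mono) (auto simp: e_def)
   from ennreal_leI[OF this] show "ennreal (norm (a xi) * norm (a eta) * e (eta - xi)) \<le> q xi * ennreal (e (eta - xi)) + q eta * ennreal (e (eta - xi))"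
    by (simp add: q_def distrib_right ennreal_mult e_def del: times_divide_eq_left)
  qed
  also have "... = (NN xi. (NN eta. q xi * ennreal (e (eta - xi)))) + (NN xi. (NN eta. q eta * ennreal (e (eta - xi))))"
   by (simp add: nn_integral_add)
  also have "(NN xi. (NN eta. q eta * ennreal (e (eta - xi)))) = (NN eta. (NN xi. q eta * ennreal (e (eta - xi))))"
   by (rule lborel_pair.Fubini') measurable
  also have "(NN xi. (NN eta. q xi * ennreal (e (eta - xi)))) + ... = energy a * ennreal (sqrt (pi / \<tau>) ^ DIM('a))"
  proof -
   have "energy a = (NN xi. q xi + q xi)" unfolding energy_def q_def by (simp flip: ennreal_plus)
   then have "energy a = (NN xi. q xi) + (NN xi. q xi)" by (simp add: nn_integral_add)
   then show ?thesis
    using nn_integral_lborel_reflect[of "\<lambda>z. ennreal (e z)"] by (simp add: nn_integral_cmult nn_integral_multc ie distrib_right)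
  qed
  finally have "ennreal s * ?l \<le> ennreal s * (energy a * ennreal (sqrt (pi / \<tau>) ^ DIM('a)))"
   by (rule mult_left_mono) simp
  also have "... = ennreal ((2 * pi) ^ DIM('a)) * energy a"
   unfolding s(2)[symmetric] using s(1) \<tau> by (simp add: ennreal_mult mult_ac)
  also have "ennreal s * ennreal (LL x. gauss_kernel \<tau> x * (norm (A x))\<^sup>2) = energy (\<lambda>x. exp (- (norm x)\<^sup>2 / (8 * \<tau>)) *\<^sub>R A x)"
   unfolding energy_def w using ig s by (subst nn_integral_eq_integral) (auto simp: ennreal_mult)
  finally show ?thesis .
 qed
 note le = this
 show ?thesis
  unfolding A_def[symmetric]
 \<comment> \<open>Along \<tau> = n + 1 the weights tend to 1.\<close>
 proof (rule energy_lower_semicontinuous[where v = "\<lambda>n x. exp (- (norm x)\<^sup>2 / (8 * real (Suc n))) *\<^sub>R A x" and N = 0])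
  have "(\<lambda>n. exp (- (norm x)\<^sup>2 * (1 / 8) * inverse (real (Suc n))) *\<^sub>R A x) \<longlonglongrightarrow> exp (- (norm x)\<^sup>2 * (1 / 8) * 0) *\<^sub>R A x" for x
   by (intro tendsto_intros LIMSEQ_inverse_real_of_nat)
  then show "AE x in lborel. (\<lambda>n. exp (- (norm x)\<^sup>2 / (8 * real (Suc n))) *\<^sub>R A x) \<longlonglongrightarrow> A x"
   by (intro AE_I2) (simp add: inverse_eq_divide)
  show "energy (\<lambda>x. exp (- (norm x)\<^sup>2 / (8 * real (Suc n))) *\<^sub>R A x) \<le> ennreal ((2 * pi) ^ DIM('a)) * energy a" for n
   by (rule le) simp
 qed measurable
qed

text \<open>G is the L^2 limit of the smoothed transforms as t tends to 0. Their spectra are exp (-t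
  |xi|^2) times a fixed square integrable function, and an upper Plancherel bound suffices to make
  them Cauchy. Integrability of g bounds its transform, so that for t > 0 the damped spectra are
  integrable.\<close>

lemma riesz_L2:
 fixes g :: "'a::euclidean_space \<Rightarrow> complex"
 assumes g: "integrable lborel g" and g2: "energy g \<le> ennreal e" "e \<ge> 0" and b: "b \<in> Basis"
 shows "\<exists>G. G \<in> borel_fun \<and> energy G \<le> ennreal ((multiplier_const TYPE('a))\<^sup>2 * e) \<and>
   (\<forall>t>0. \<forall>x. riesz_conv t b g x = conv (gauss_kernel t) G x)"
proof -
 have gm[measurable]: "g \<in> borel_fun" using g by auto
 define P where "P = (2 * pi) ^ DIM('a)"
 have P: "P > 0" by (simp add: P_def)
 let ?mc = "multiplier_const TYPE('a)"
 have mc: "?mc \<ge> 0" by (simp add: multiplier_const_def)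
 \<comment> \<open>With the factor 1 / (2 pi)^d this is the coefficient for which g is formally the
   integral of \<open>a xi * cis (xi \<bullet> x)\<close>.\<close>
 define a where "a xi = (1 / P) *\<^sub>R (LL y. g y * cis (y \<bullet> (- xi)))" for xi
 have am[measurable]: "a \<in> borel_fun" unfolding a_def by measurable
 define F where "F = (LL y. norm (g y)) / P"
 have aF: "norm (a xi) \<le> F" for xi
  using integral_norm_bound[of lborel "\<lambda>y. g y * cis (- (y \<bullet> xi))"] P by (simp add: a_def F_def norm_mult divide_right_mono)
 have a2: "energy a \<le> ennreal (1 / P * e)"
 proof -
  have "energy a \<le> ennreal ((1 / P)\<^sup>2) * energy (\<lambda>xi. LL y. g y * cis (y \<bullet> (- xi)))"
   using P by (intro energy_mono) (auto simp: a_def)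
  also have "energy (\<lambda>xi. LL y. g y * cis (y \<bullet> (- xi))) = energy (\<lambda>xi. LL y. g y * cis (y \<bullet> xi))"
   unfolding energy_def using nn_integral_lborel_reflect(1)[of "\<lambda>xi. ennreal ((norm (LL y. g y * cis (y \<bullet> xi)))\<^sup>2)" 0] by simp
  also have "... \<le> ennreal P * ennreal e" using order_trans[OF Plancherel_le[OF g] mult_left_mono[OF g2(1)]] by (simp add: P_def)
  also have "ennreal ((1 / P)\<^sup>2) * (ennreal P * ennreal e) = ennreal (1 / P * e)"
   using P g2 by (simp add: power2_eq_square flip: ennreal_mult)
  finally show ?thesis by (simp add: mult_left_mono)
 qed
 define \<alpha> where "\<alpha> xi = (?mc * (xi \<bullet> b) / norm xi) *\<^sub>R (- \<i> * a xi)" for xi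
 have \<alpha>m[measurable]: "\<alpha> \<in> borel_fun" unfolding \<alpha>_def by measurable
 have \<alpha>: "norm (\<alpha> xi) \<le> ?mc * norm (a xi)" for xi unfolding \<alpha>_def by (rule multiplier_le[OF b])
 have \<alpha>2: "energy \<alpha> \<le> ennreal (?mc\<^sup>2 * (1 / P * e))"
 proof -
  have "energy \<alpha> \<le> ennreal (?mc\<^sup>2) * ennreal (1 / P * e)"
   by (rule order_trans[OF energy_mono[OF \<alpha> mc am] mult_left_mono[OF a2]]) simp
  also have "... = ennreal (?mc\<^sup>2 * (1 / P * e))" using P g2 by (intro ennreal_mult[symmetric]) auto
  finally show ?thesis .
 qed
 define ex where "ex t xi = exp (- (t * (norm xi)\<^sup>2))" for t and xi :: 'a
 have exm[measurable]: "ex t \<in> borel_fun" for t unfolding ex_def by measurable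
 have iex: "integrable lborel (\<lambda>xi. ex t xi *\<^sub>R h xi)" if "t > 0" "\<And>xi. norm (h xi) \<le> B" "h \<in> borel_fun" for t B and h :: "'a \<Rightarrow> complex"
  using that by (intro L_integrable_bound[OF integrable_mult_left[OF integral_exp_norm_sq(1)[OF that(1)], of B]])
   (auto simp: ex_def intro!: AE_I2 mult_left_mono intro: order_trans[OF _ abs_ge_self])
 have i\<alpha>: "integrable lborel (\<lambda>xi. ex t xi *\<^sub>R \<alpha> xi)" if "t > 0" for t
  by (rule iex[OF that]) (use mult_left_mono[OF aF mc] in \<open>auto intro: order_trans[OF \<alpha>]\<close>)
 define u where "u t = riesz_conv t b g" for t
 have um[measurable]: "u t \<in> borel_fun" for t unfolding u_def by measurable
 have u: "u t x = (LL xi. ex t xi *\<^sub>R \<alpha> xi * cis (xi \<bullet> x))" if t: "t > 0" for t x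
  unfolding u_def ex_def \<alpha>_def
 proof (rule riesz_heat_spectral[of t "\<lambda>xi. xi", OF _ am _ t b g])
  show "integrable lborel (\<lambda>xi. exp (- (t * (norm xi)\<^sup>2)) *\<^sub>R a xi)"
   using iex[OF t aF am] by (simp add: ex_def)
  fix \<tau> assume "\<tau> > t"
  then have \<tau>: "\<tau> > 0" using t by simp
  define K where "K z = 2 * sqrt (4 * pi) ^ DIM('a) * (z \<bullet> b) * exp (- (\<tau> * (norm z)\<^sup>2))" for z :: 'a
  have K: "integrable lborel K" "(LL z. K z *\<^sub>R cis (w \<bullet> z)) = (P * (grad_kernel \<tau> w \<bullet> b)) *\<^sub>R \<i>" for w
   using grad_kernel_inversion[OF \<tau> b] by (simp_all add: K_def[abs_def] P_def)
  have "(LL xi. K xi *\<^sub>R (- \<i> * a xi * cis (xi \<bullet> x))) = (\<i> / P) * conv K (\<lambda>xi. LL y. g y * cis ((x - y) \<bullet> xi)) 0"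
  proof -
   have "K xi *\<^sub>R (- \<i> * a xi * cis (xi \<bullet> x)) = (\<i> / P) * (K (0 - xi) *\<^sub>R (LL y. g y * cis ((x - y) \<bullet> xi)))" for xi
   proof -
    have "(LL y. g y * cis ((x - y) \<bullet> xi)) = (LL y. g y * cis (y \<bullet> (- xi))) * cis (xi \<bullet> x)"
     by (simp add: inner_diff_left inner_commute[of xi x] mult.assoc cis_mult flip: integral_mult_left_zero)
    then show ?thesis by (simp add: K_def a_def scaleR_conv_of_real)
   qed
   then show ?thesis unfolding conv_def by (simp only: integral_mult_right_zero)
  qed
  also have "... = (\<i> / P) * (LL y. (- \<i> * P) * ((grad_kernel \<tau> (x - y) \<bullet> b) *\<^sub>R g y))"
  proof -
   have "(LL z. K z *\<^sub>R cis (- ((x - y) \<bullet> z))) = (- \<i> * P) * (grad_kernel \<tau> (x - y) \<bullet> b)" for y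
    using K(2)[of "- (x - y)"] unfolding inner_minus_left grad_kernel_minus by (simp add: scaleR_conv_of_real)
   then show ?thesis by (subst conv_fourier[OF g _ K(1)]) (simp_all add: scaleR_conv_of_real mult_ac)
  qed
  also have "... = conv (\<lambda>z. grad_kernel \<tau> z \<bullet> b) g x" unfolding conv_def integral_mult_right_zero using P by simp
  finally show "conv (\<lambda>z. grad_kernel \<tau> z \<bullet> b) g x = (LL xi. (2 * sqrt (4 * pi) ^ DIM('a) * (xi \<bullet> b) * exp (- (\<tau> * (norm xi)\<^sup>2))) *\<^sub>R (- \<i> * a xi * cis (xi \<bullet> x)))"
   by (simp add: K_def)
 qed simp
 have conv_u: "conv (gauss_kernel s) (u t) x = u (s + t) x" if s: "s > 0" and t: "t > 0" for s t x
 proof -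
  have "conv (gauss_kernel s) (u t) x = conv (gauss_kernel s) (\<lambda>x. LL xi. ex t xi *\<^sub>R \<alpha> xi * cis (xi \<bullet> x)) x"
   unfolding conv_def u[OF t] ..
  moreover have ex_add: "ex (s + t) xi = ex s xi * ex t xi" for xi by (simp add: ex_def distrib_right flip: exp_add)
  have ft: "(LL z. gauss_kernel s z *\<^sub>R cis (- (xi \<bullet> z))) = of_real (ex s xi)" for xi
   using gauss_kernel_fourier(1)[OF s, of "- xi"] by (simp add: ex_def)
  have "conv (gauss_kernel s) (\<lambda>x. LL xi. ex t xi *\<^sub>R \<alpha> xi * cis (xi \<bullet> x)) x = u (s + t) x"
   unfolding conv_fourier[OF i\<alpha>[OF t] borel_measurable_continuous_onI[OF continuous_on_id] gauss_kernel_integral(1)[OF s]] u[OF add_pos_pos[OF s t]] ft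
   by (simp add: ex_add scaleR_conv_of_real mult_ac)
  ultimately show ?thesis by simp
 qed
 \<comment> \<open>Since exp (-t |xi|^2) lies between exp (-s |xi|^2) and 1 for t <= s, this one
   quantity bounds the distance from u s to every u t with t <= s.\<close>
 define h where "h s = energy (\<lambda>xi. (1 - ex s xi) *\<^sub>R \<alpha> xi)" for s
 have diff: "energy (\<lambda>x. u s x - u t x) \<le> ennreal P * h s" if "0 < t" "t \<le> s" for s t
 proof -
  have s: "s > 0" using that by simp
  have i: "integrable lborel (\<lambda>xi. (ex s xi - ex t xi) *\<^sub>R \<alpha> xi)"
   using i\<alpha>[OF s] i\<alpha>[OF that(1)] by (simp add: scaleR_diff_left)
  have "integrable lborel (\<lambda>xi. ex r xi *\<^sub>R \<alpha> xi * cis (xi \<bullet> x))" if "r > 0" for r x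
   by (rule L_integrable_bound[OF i\<alpha>[OF that]]) (auto simp: norm_mult)
  then have "u s x - u t x = (LL xi. (ex s xi - ex t xi) *\<^sub>R \<alpha> xi * cis (xi \<bullet> x))" for x
   unfolding u[OF s] u[OF that(1)] using s that by (simp add: scaleR_diff_left left_diff_distrib)
  then have "energy (\<lambda>x. u s x - u t x) \<le> ennreal P * energy (\<lambda>xi. (ex s xi - ex t xi) *\<^sub>R \<alpha> xi)"
   using Plancherel_le[OF i] by (simp add: P_def)
  also have "... \<le> ennreal P * (ennreal (1\<^sup>2) * h s)"
   unfolding h_def
  proof (intro mult_left_mono energy_mono)
   fix xi :: 'a
   have "t * (norm xi)\<^sup>2 \<le> s * (norm xi)\<^sup>2" "0 \<le> t * (norm xi)\<^sup>2" using that by (auto intro: mult_right_mono)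
   then have "\<bar>ex s xi - ex t xi\<bar> \<le> \<bar>1 - ex s xi\<bar>" by (auto simp: ex_def)
   then show "norm ((ex s xi - ex t xi) *\<^sub>R \<alpha> xi) \<le> 1 * norm ((1 - ex s xi) *\<^sub>R \<alpha> xi)" by (simp add: mult_right_mono)
  qed auto
  finally show ?thesis by simp
 qed
 define T where "T n = inverse (real (Suc n))" for n
 have T: "T n > 0" "n \<le> m \<Longrightarrow> T m \<le> T n" "T \<longlonglongrightarrow> 0" for n m
  by (auto simp: T_def[abs_def] simp del: of_nat_Suc intro!: LIMSEQ_inverse_real_of_nat)
 have "(\<lambda>n. h (T n)) \<longlonglongrightarrow> (NN (xi::'a). 0)"
  unfolding h_def energy_def
 proof (rule nn_integral_dominated_convergence[where w = "\<lambda>xi. ennreal ((norm (\<alpha> xi))\<^sup>2)"])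
  show "AE xi in lborel. ennreal ((norm ((1 - ex (T n) xi) *\<^sub>R \<alpha> xi))\<^sup>2) \<le> ennreal ((norm (\<alpha> xi))\<^sup>2)" for n
   using T(1)[of n] by (intro AE_I2 ennreal_leI power_mono) (auto simp: ex_def intro!: mult_left_le_one_le)
  show "AE xi in lborel. (\<lambda>n. ennreal ((norm ((1 - ex (T n) xi) *\<^sub>R \<alpha> xi))\<^sup>2)) \<longlonglongrightarrow> 0"
  proof (intro AE_I2)
   fix xi
   have "(\<lambda>n. ennreal ((norm ((1 - ex (T n) xi) *\<^sub>R \<alpha> xi))\<^sup>2)) \<longlonglongrightarrow> ennreal ((norm ((1 - exp (- (0 * (norm xi)\<^sup>2))) *\<^sub>R \<alpha> xi))\<^sup>2)"
    unfolding ex_def by (intro tendsto_ennrealI tendsto_intros T)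
   then show "(\<lambda>n. ennreal ((norm ((1 - ex (T n) xi) *\<^sub>R \<alpha> xi))\<^sup>2)) \<longlonglongrightarrow> 0" by simp
  qed
 qed (use \<alpha>2 in \<open>auto simp: energy_def intro: le_less_trans\<close>)
 then have h0: "(\<lambda>n. ennreal P * h (T n)) \<longlonglongrightarrow> ennreal P * 0"
  by (intro ennreal_tendsto_cmult) auto
 define H where "H n = enn2real (ennreal P * h (T n))" for n
 have H0: "H \<longlonglongrightarrow> 0" "H n \<ge> 0" for n
  unfolding H_def[abs_def] using tendsto_enn2real[OF h0[simplified, unfolded ennreal_0[symmetric]]] by auto
 have H: "ennreal P * h (T n) = ennreal (H n)" for n
 proof -
  have "h (T n) \<le> ennreal (1\<^sup>2) * energy \<alpha>"
   unfolding h_def using T(1)[of n] by (intro energy_mono) (auto simp: ex_def intro!: mult_left_le_one_le)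
  then show ?thesis using \<alpha>2 P by (auto simp: H_def ennreal_enn2real_if ennreal_mult_eq_top_iff top_unique)
 qed
 have diffT: "energy (\<lambda>x. u (T n) x - u (T m) x) \<le> ennreal (H n)" if "n \<le> m" for n m
  using diff[OF T(1) T(2)[OF that]] by (simp add: H)
 define e' where "e' = ?mc\<^sup>2 * e"
 have e': "e' \<ge> 0" using g2 by (simp add: e'_def)
 have unorm: "energy (u t) \<le> ennreal e'" if t: "t > 0" for t
 proof -
  have "energy (u t) \<le> ennreal P * energy (\<lambda>xi. ex t xi *\<^sub>R \<alpha> xi)"
   unfolding P_def using Plancherel_le[OF i\<alpha>[OF t]] by (simp add: u[OF t, abs_def])
  also have "... \<le> ennreal P * (ennreal (1\<^sup>2) * ennreal (?mc\<^sup>2 * (1 / P * e)))"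
   using t by (intro mult_left_mono order_trans[OF energy_mono mult_left_mono[OF \<alpha>2]]) (auto simp: ex_def intro!: mult_left_le_one_le)
  also have "... = ennreal e'" using P g2 by (simp add: e'_def flip: ennreal_mult)
  finally show ?thesis .
 qed
 \<comment> \<open>The weight \<open>gauss_kernel 1\<close> turns the L^2 estimates into L^1 ones,
   from which an almost everywhere Cauchy subsequence can be extracted; as the weight is positive,
   it is divided out afterwards.\<close>
 have ugk: "integrable lborel (\<lambda>y. gauss_kernel 1 y *\<^sub>R u (T n) y)" for n
  using gauss_kernel_energy(1)[OF _ um unorm[OF T(1)] e', of 1 0] by simp
 have "\<exists>N. \<forall>i\<ge>N. \<forall>j\<ge>N. (LL y. norm (gauss_kernel 1 y *\<^sub>R u (T i) y - gauss_kernel 1 y *\<^sub>R u (T j) y)) < e" if e: "e > 0" for e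
 proof -
  have le: "(LL y. norm (gauss_kernel 1 y *\<^sub>R u (T i) y - gauss_kernel 1 y *\<^sub>R u (T j) y)) \<le> sqrt (gauss_kernel 1 (0::'a) * H i)" if "i \<le> j" for i j
   using gauss_kernel_energy(2)[OF _ _ diffT[OF that] H0(2), of 1 0] by (simp add: scaleR_diff_right)
  have "(\<lambda>i. sqrt (gauss_kernel 1 (0::'a) * H i)) \<longlonglongrightarrow> sqrt (gauss_kernel 1 (0::'a) * 0)" by (intro tendsto_intros H0)
  then have "eventually (\<lambda>i. sqrt (gauss_kernel 1 (0::'a) * H i) < e) sequentially" using e by (auto intro: order_tendstoD)
  then obtain N where N: "\<And>i. i \<ge> N \<Longrightarrow> sqrt (gauss_kernel 1 (0::'a) * H i) < e" unfolding eventually_sequentially by blast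
  have "(LL y. norm (gauss_kernel 1 y *\<^sub>R u (T i) y - gauss_kernel 1 y *\<^sub>R u (T j) y)) < e" if "i \<ge> N" "j \<ge> N" for i j
   using le[of i j] le[of j i] N[OF that(1)] N[OF that(2)] by (cases "i \<le> j") (auto simp: norm_minus_commute)
  then show ?thesis by blast
 qed
 then obtain r where r: "strict_mono r" and C: "AE x in lborel. Cauchy (\<lambda>n. gauss_kernel 1 x *\<^sub>R u (T (r n)) x)"
  by (rule cauchy_L1_AE_cauchy_subseq[OF ugk])
 define G where "G x = lim (\<lambda>n. u (T (r n)) x)" for x
 have Gm[measurable]: "G \<in> borel_fun" unfolding G_def by measurable
 have G: "AE x in lborel. (\<lambda>n. u (T (r n)) x) \<longlonglongrightarrow> G x"
  using C
 proof eventually_elim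
  case (elim x)
  have "gauss_kernel 1 x > 0" by (simp add: gauss_kernel_def heat_profile_def)
  moreover obtain L where "(\<lambda>n. gauss_kernel 1 x *\<^sub>R u (T (r n)) x) \<longlonglongrightarrow> L"
   using elim unfolding Cauchy_convergent_iff convergent_def by blast
  from tendsto_scaleR[OF tendsto_const this, of "1 / gauss_kernel 1 x"]
  have "(\<lambda>n. (1 / gauss_kernel 1 x) *\<^sub>R gauss_kernel 1 x *\<^sub>R u (T (r n)) x) \<longlonglongrightarrow> (1 / gauss_kernel 1 x) *\<^sub>R L" .
  ultimately have "convergent (\<lambda>n. u (T (r n)) x)" unfolding convergent_def by auto
  then show ?case by (simp add: G_def convergent_LIMSEQ_iff)
 qed
 have G1: "energy G \<le> ennreal e'"
  by (rule energy_lower_semicontinuous[OF _ G unorm[OF T(1)]]) auto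
 have G2: "energy (\<lambda>x. u (T (r n)) x - G x) \<le> ennreal (H (r n))" for n
 proof (rule energy_lower_semicontinuous[where v = "\<lambda>m x. u (T (r n)) x - u (T (r m)) x" and N = n])
  show "AE x in lborel. (\<lambda>m. u (T (r n)) x - u (T (r m)) x) \<longlonglongrightarrow> u (T (r n)) x - G x"
   using G by eventually_elim (intro tendsto_intros)
  show "energy (\<lambda>x. u (T (r n)) x - u (T (r m)) x) \<le> ennreal (H (r n))" if "m \<ge> n" for m
   using that r by (intro diffT) (simp add: strict_mono_less_eq)
 qed measurable
 \<comment> \<open>By the semigroup law the smoothing of u (T (r n)) is u (t + T (r n)). It tends to
   the smoothing of G by L^2 closeness, and to u t by dominated convergence of the spectra.\<close>
 have "riesz_conv t b g x = conv (gauss_kernel t) G x" if t: "t > 0" for t x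
 proof -
  have id: "integrable lborel (\<lambda>y. gauss_kernel t (x - y) *\<^sub>R (u (T (r n)) y - G y))" for n
   by (rule gauss_kernel_energy(1)[OF t _ G2 H0(2)]) measurable
  have iG: "integrable lborel (\<lambda>y. gauss_kernel t (x - y) *\<^sub>R G y)"
   by (rule gauss_kernel_energy(1)[OF t Gm G1 e'])
  have "norm (u (t + T (r n)) x - conv (gauss_kernel t) G x) \<le> sqrt (gauss_kernel t (0::'a) * H (r n))" for n
  proof -
   have "u (t + T (r n)) x - conv (gauss_kernel t) G x = (LL y. gauss_kernel t (x - y) *\<^sub>R (u (T (r n)) y - G y))"
    using L_integral_add[OF id iG, of n] by (simp add: conv_u[OF t T(1), symmetric] conv_def scaleR_diff_right)
   also have "norm ... \<le> sqrt (gauss_kernel t (0::'a) * H (r n))"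
    by (rule order_trans[OF integral_norm_bound gauss_kernel_energy(2)[OF t _ G2 H0(2)]]) measurable
   finally show ?thesis .
  qed
  moreover have "(\<lambda>n. sqrt (gauss_kernel t (0::'a) * H (r n))) \<longlonglongrightarrow> sqrt (gauss_kernel t (0::'a) * 0)"
   by (intro tendsto_intros LIMSEQ_subseq_LIMSEQ[OF H0(1) r, unfolded comp_def])
  ultimately have "(\<lambda>n. u (t + T (r n)) x) \<longlonglongrightarrow> conv (gauss_kernel t) G x"
   by (simp only: mult_zero_right real_sqrt_zero) (rule LIM_zero_cancel, rule Lim_null_comparison[OF always_eventually[OF allI]])
  moreover have "(\<lambda>n. u (t + T (r n)) x) \<longlonglongrightarrow> u t x"
   unfolding u[OF t] u[OF add_pos_pos[OF t T(1)]]
  proof (rule integral_dominated_convergence[where w = "\<lambda>xi. norm (ex t xi *\<^sub>R \<alpha> xi)"])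
   show "AE xi in lborel. (\<lambda>n. ex (t + T (r n)) xi *\<^sub>R \<alpha> xi * cis (xi \<bullet> x)) \<longlonglongrightarrow> ex t xi *\<^sub>R \<alpha> xi * cis (xi \<bullet> x)"
   proof (intro AE_I2)
    fix xi
    have "(\<lambda>n. ex (t + T (r n)) xi *\<^sub>R \<alpha> xi * cis (xi \<bullet> x)) \<longlonglongrightarrow> ex (t + 0) xi *\<^sub>R \<alpha> xi * cis (xi \<bullet> x)"
     unfolding ex_def by (intro tendsto_intros LIMSEQ_subseq_LIMSEQ[OF T(3) r, unfolded comp_def])
    then show "(\<lambda>n. ex (t + T (r n)) xi *\<^sub>R \<alpha> xi * cis (xi \<bullet> x)) \<longlonglongrightarrow> ex t xi *\<^sub>R \<alpha> xi * cis (xi \<bullet> x)" by simp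
   qed
   show "AE xi in lborel. norm (ex (t + T (r n)) xi *\<^sub>R \<alpha> xi * cis (xi \<bullet> x)) \<le> norm (ex t xi *\<^sub>R \<alpha> xi)" for n
    using T(1)[of "r n"] by (intro AE_I2) (auto simp: ex_def norm_mult intro!: mult_right_mono)
  qed (use integrable_norm[OF i\<alpha>[OF t]] in auto)
  ultimately show ?thesis unfolding u_def[symmetric] by (rule LIMSEQ_unique[symmetric])
 qed
 then show ?thesis using Gm G1 unfolding e'_def by blast
qed

subsection \<open>The Calderon-Zygmund decomposition\<close>

lemma nn_integral_disjoint_UN:
 assumes [measurable]: "f \<in> borel_measurable M" "\<And>n. B n \<in> sets M" and d: "disjoint_family B"
 shows "(\<integral>\<^sup>+x\<in>(\<Union>n. B n). f x \<partial>M) = (\<Sum>n. \<integral>\<^sup>+x\<in>B n. f x \<partial>M)"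
proof -
 have "(\<Sum>n. \<integral>\<^sup>+x\<in>B n. f x \<partial>M) = (\<integral>\<^sup>+x. (\<Sum>n. f x * indicator (B n) x) \<partial>M)"
  by (rule nn_integral_suminf[symmetric]) measurable
 also have "... = (\<integral>\<^sup>+x\<in>(\<Union>n. B n). f x \<partial>M)"
  by (simp add: ennreal_suminf_cmult suminf_indicator[OF d])
 finally show ?thesis ..
qed

text \<open>Half-open cubes of side h / 2^m are encoded by the index of the cube through a point.
  The top scale h stays free so that the coarsest cubes can be made as large as f requires.\<close>

definition cube_index :: "real \<Rightarrow> nat \<Rightarrow> real ^ 'n \<Rightarrow> int ^ 'n" where
 "cube_index h m x = (\<chi> i. \<lfloor>2 ^ m * x $ i / h\<rfloor>)"

definition dyadic_cube :: "real \<Rightarrow> nat \<Rightarrow> int ^ 'n \<Rightarrow> (real ^ 'n) set" where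
 "dyadic_cube h m k = {x. cube_index h m x = k}"

lemma cube_index_mono:
 fixes x y :: "real ^ 'n"
 assumes "m \<le> m'" "cube_index h m' x = cube_index h m' y"
 shows "cube_index h m x = cube_index h m y"
 using assms
proof (induction m' rule: dec_induct)
 case (step j)
 have "\<lfloor>2 ^ j * z / h\<rfloor> = \<lfloor>2 ^ Suc j * z / h\<rfloor> div 2" for z
  using floor_divide_real_eq_div[of 2 "2 ^ Suc j * z / h"] by simp
 then have "cube_index h j x = cube_index h j y"
  using step.prems by (simp add: cube_index_def vec_eq_iff)
 then show ?case by (rule step.IH)
qed

text \<open>The open and the closed box have the same measure, which pins down that of the half-open
  cube; the closed box also bounds its diameter.\<close>

lemma dyadic_cube_sandwich:
 fixes k :: "int ^ 'n"
 assumes h: "h > 0"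
 shows "box (\<chi> i. of_int (k $ i) * (h / 2 ^ m)) (\<chi> i. (of_int (k $ i) + 1) * (h / 2 ^ m)) \<subseteq> dyadic_cube h m k" (is ?g1)
  and "dyadic_cube h m k \<subseteq> cbox (\<chi> i. of_int (k $ i) * (h / 2 ^ m)) (\<chi> i. (of_int (k $ i) + 1) * (h / 2 ^ m))"
proof -
 have eq: "\<lfloor>2 ^ m * z / h\<rfloor> = j \<longleftrightarrow> of_int j * (h / 2 ^ m) \<le> z \<and> z < (of_int j + 1) * (h / 2 ^ m)" for z and j :: int
  unfolding floor_eq_iff using h by (simp add: field_simps)
 show ?g1
  "dyadic_cube h m k \<subseteq> cbox (\<chi> i. of_int (k $ i) * (h / 2 ^ m)) (\<chi> i. (of_int (k $ i) + 1) * (h / 2 ^ m))"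
  unfolding dyadic_cube_def cube_index_def vec_eq_iff
  by (auto simp: eq mem_box_cart less_imp_le)
qed

lemma sets_dyadic_cube [measurable]: "dyadic_cube h m (k :: int ^ 'n) \<in> sets borel"
proof -
 have "dyadic_cube h m k = {x\<in>space borel. \<forall>i. \<lfloor>2 ^ m * x $ i / h\<rfloor> = k $ i}"
  by (auto simp: dyadic_cube_def cube_index_def vec_eq_iff)
 also have "... \<in> sets borel" by measurable
 finally show ?thesis .
qed

lemma emeasure_dyadic_cube:
 fixes k :: "int ^ 'n"
 assumes h: "h > 0"
 shows "emeasure lborel (dyadic_cube h m k) = ennreal ((h / 2 ^ m) ^ CARD('n))"
proof -
 let ?l = "\<chi> i. of_int (k $ i) * (h / 2 ^ m) :: real ^ 'n" and ?u = "\<chi> i. (of_int (k $ i) + 1) * (h / 2 ^ m) :: real ^ 'n"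
 have d: "?u - ?l = (\<chi> i. h / 2 ^ m)" by (simp add: vec_eq_iff ring_distribs add_divide_distrib)
 have ip: "(\<Prod>b\<in>Basis. (?u - ?l) \<bullet> b) = (h / 2 ^ m) ^ CARD('n)"
 proof -
  have "(?u - ?l) \<bullet> b = h / 2 ^ m" if "b \<in> Basis" for b
   using that unfolding d by (auto simp: Basis_vec_def inner_axis)
  then have "(\<Prod>b\<in>Basis. (?u - ?l) \<bullet> b) = (\<Prod>b\<in>(Basis :: (real ^ 'n) set). h / 2 ^ m)" by (intro prod.cong) auto
  then show ?thesis by simp
 qed
 have lu: "?l \<bullet> b \<le> ?u \<bullet> b" if "b \<in> Basis" for b
  using that h by (auto simp: Basis_vec_def inner_axis intro!: mult_right_mono divide_right_mono)
 have "emeasure lborel (box ?l ?u) \<le> emeasure lborel (dyadic_cube h m k)"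
  by (intro emeasure_mono dyadic_cube_sandwich h) auto
 moreover have "emeasure lborel (dyadic_cube h m k) \<le> emeasure lborel (cbox ?l ?u)"
  by (intro emeasure_mono dyadic_cube_sandwich h) auto
 moreover have "emeasure lborel (box ?l ?u) = ennreal ((h / 2 ^ m) ^ CARD('n))"
  unfolding ip[symmetric] by (rule emeasure_lborel_box[OF lu])
 moreover have "emeasure lborel (cbox ?l ?u) = ennreal ((h / 2 ^ m) ^ CARD('n))"
  unfolding ip[symmetric] by (rule emeasure_lborel_cbox[OF lu])
 ultimately show ?thesis by simp
qed

lemma dyadic_cube_diameter:
 fixes x y :: "real ^ 'n"
 assumes h: "h > 0" and x: "x \<in> cbox (\<chi> i. of_int (k $ i) * (h / 2 ^ m)) (\<chi> i. (of_int (k $ i) + 1) * (h / 2 ^ m))"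
  and y: "y \<in> cbox (\<chi> i. of_int (k $ i) * (h / 2 ^ m)) (\<chi> i. (of_int (k $ i) + 1) * (h / 2 ^ m))"
 shows "norm (x - y) \<le> real CARD('n) * (h / 2 ^ m)"
proof -
 have "norm (x - y) \<le> (\<Sum>i\<in>UNIV. \<bar>(x - y) $ i\<bar>)" by (rule norm_le_l1_cart)
 also have "... \<le> (\<Sum>i\<in>(UNIV::'n set). h / 2 ^ m)"
 proof (rule sum_mono)
  fix i
  have "of_int (k $ i) * (h / 2 ^ m) \<le> x $ i" "x $ i \<le> (of_int (k $ i) + 1) * (h / 2 ^ m)"
   "of_int (k $ i) * (h / 2 ^ m) \<le> y $ i" "y $ i \<le> (of_int (k $ i) + 1) * (h / 2 ^ m)"
   using x y by (auto simp: mem_box_cart)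
  then show "\<bar>(x - y) $ i\<bar> \<le> h / 2 ^ m" by (simp only: vector_minus_component distrib_right mult_1 abs_le_iff) linarith
 qed
 finally show ?thesis by simp
qed

text \<open>A stopping-time selection: keep the coarsest dyadic cubes on which the mean of |f|
  exceeds Lam. Their parents fail the test, which costs the factor 2^d in the upper bound; outside
  them all means are at most Lam, and so is |f| at Lebesgue points. The good part replaces f by its
  mean on each cube.\<close>

theorem Calderon_Zygmund_decomposition:
 fixes f :: "real ^ 'n \<Rightarrow> 'c::euclidean_space"
 assumes f: "integrable lborel f" and lam: "Lam > 0"
 obtains Q :: "nat \<Rightarrow> (real ^ 'n) set" and c :: "nat \<Rightarrow> real ^ 'n" and l :: "nat \<Rightarrow> real" and g :: "real ^ 'n \<Rightarrow> 'c"
 where "disjoint_family Q" "\<And>i. Q i \<in> sets borel" "\<And>i. Q i \<subseteq> cball (c i) (l i)" "\<And>i. l i \<ge> 0"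
  "\<And>i. Q i \<noteq> {} \<Longrightarrow> l i > 0"
  "\<And>i. ennreal (l i ^ CARD('n)) \<le> ennreal (real CARD('n) ^ CARD('n)) * emeasure lborel (Q i)"
  "\<And>i. ennreal Lam * emeasure lborel (Q i) \<le> (mass (Q i) f)"
  "integrable lborel g" "AE y in lborel. norm (g y) \<le> 2 ^ CARD('n) * Lam"
  "(N1 y. g y) \<le> (N1 y. f y)"
  "\<And>y. y \<notin> (\<Union>i. Q i) \<Longrightarrow> g y = f y"
  "\<And>i. (LINT y:Q i|lborel. f y - g y) = 0"
  "(N1 y. f y - g y) \<le> 2 * (mass (\<Union>i. Q i) f)"
proof -
 have fm[measurable]: "f \<in> borel_fun" using f by auto
 define F where "F = (LL y. norm (f y))"
 have F0: "F \<ge> 0" unfolding F_def by (intro integral_nonneg_AE) auto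
 have nF: "(N1 y. f y) = ennreal F"
  unfolding F_def using f by (intro nn_integral_eq_integral) auto
 \<comment> \<open>Cubes of the top level have volume h^d >= h >= F / Lam, so none of them can have
   mean above Lam.\<close>
 define h where "h = max 1 (F / Lam)"
 have h: "h \<ge> 1" "h > 0" by (auto simp: h_def)
 define side where "side m = h / 2 ^ m" for m :: nat
 have side: "side m > 0" for m using h by (simp add: side_def)
 define w where "w m k = (mass (dyadic_cube h m k) f)" for m and k :: "int ^ 'n"
 define P where "P m k \<longleftrightarrow> ennreal (Lam * side m ^ CARD('n)) < w m k" for m k
 have P0: "\<not> P 0 k" for k
 proof -
  have "w 0 k \<le> ennreal F" unfolding w_def nF[symmetric] by (intro nn_integral_mono) (auto simp: indicator_def)
  also have "F \<le> Lam * h" using lam by (auto simp: h_def field_simps max_def)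
  also have "h \<le> h ^ CARD('n)" using h by (intro self_le_power) auto
  then have "Lam * h \<le> Lam * side 0 ^ CARD('n)" using lam by (simp add: side_def)
  finally show ?thesis by (auto simp: P_def not_less intro: ennreal_leI)
 qed
 \<comment> \<open>Maximality is phrased through points: no coarser cube through any x of the cube
   passes the test.\<close>
 define S where "S = {(m, k). P m k \<and> (\<forall>x\<in>dyadic_cube h m k. \<forall>m'<m. \<not> P m' (cube_index h m' x))}"
 define p where "p i = (from_nat i :: nat \<times> (int ^ 'n))" for i
 \<comment> \<open>A natural number that is not the code of a selected cube gets the empty set and
   radius 0. The condition \<open>to_nat (p i) = i\<close> prevents a cube from occurring under two
   indices.\<close>
 define act where "act i \<longleftrightarrow> to_nat (p i) = i \<and> p i \<in> S" for i
 define Q where "Q i = (if act i then dyadic_cube h (fst (p i)) (snd (p i)) else {})" for i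
 \<comment> \<open>The centre is the lower corner of the cube, and d times the side bounds the
   diameter through the l^1 norm.\<close>
 define c :: "nat \<Rightarrow> real ^ 'n" where "c i = (\<chi> j. of_int (snd (p i) $ j) * side (fst (p i)))" for i
 define l where "l i = (if act i then real CARD('n) * side (fst (p i)) else 0)" for i
 have Qm[measurable]: "Q i \<in> sets borel" for i by (simp add: Q_def sets_dyadic_cube)
 have dis: "disjoint_family Q"
 proof (unfold disjoint_family_on_def, intro ballI impI)
  fix i j :: nat assume "i \<noteq> j"
  show "Q i \<inter> Q j = {}"
  proof (rule ccontr)
   assume "Q i \<inter> Q j \<noteq> {}"
   then obtain x where x: "x \<in> Q i" "x \<in> Q j" by blast
   then have a: "act i" "act j" by (auto simp: Q_def split: if_splits)
   have xi: "cube_index h (fst (p i)) x = snd (p i)" "cube_index h (fst (p j)) x = snd (p j)"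
    using x a by (auto simp: Q_def dyadic_cube_def)
   have Si: "P (fst (p i)) (snd (p i))" "\<And>m'. m' < fst (p i) \<Longrightarrow> \<not> P m' (cube_index h m' x)"
    using a(1) x(1) by (auto simp: act_def S_def Q_def split: prod.splits)
   have Sj: "P (fst (p j)) (snd (p j))" "\<And>m'. m' < fst (p j) \<Longrightarrow> \<not> P m' (cube_index h m' x)"
    using a(2) x(2) by (auto simp: act_def S_def Q_def split: prod.splits)
   have "fst (p i) = fst (p j)"
    using Si Sj xi by (metis linorder_neqE_nat)
   then have "p i = p j" using xi by (simp add: prod_eq_iff)
   then show False using a \<open>i \<noteq> j\<close> by (metis act_def)
  qed
 qed
 have cover: "x \<in> (\<Union>i. Q i)" if "P m (cube_index h m x)" for m x
 proof -
  define M where "M = (LEAST m. P m (cube_index h m x))"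
  have PM: "P M (cube_index h M x)" unfolding M_def by (rule LeastI[of "\<lambda>m. P m (cube_index h m x)"], rule that)
  have low: "\<not> P m' (cube_index h m' x)" if "m' < M" for m' using not_less_Least[OF that[unfolded M_def]] .
  have "(M, cube_index h M x) \<in> S"
   unfolding S_def
  proof (clarify, intro conjI ballI allI impI)
   fix y m' assume y: "y \<in> dyadic_cube h M (cube_index h M x)" and m': "m' < M"
   have "cube_index h m' y = cube_index h m' x"
    by (rule cube_index_mono[of m' M]) (use y m' in \<open>auto simp: dyadic_cube_def\<close>)
   with low[OF m'] show "\<not> P m' (cube_index h m' y)" by simp
  qed (rule PM)
  then have "act (to_nat (M, cube_index h M x))" by (simp add: act_def p_def)
  then have "x \<in> Q (to_nat (M, cube_index h M x))" by (simp add: Q_def p_def dyadic_cube_def)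
  then show ?thesis by blast
 qed
 have emQ: "emeasure lborel (Q i) = ennreal (side (fst (p i)) ^ CARD('n))" if "act i" for i
  using that emeasure_dyadic_cube[OF h(2)] by (simp add: Q_def side_def)
 have wQ: "(mass (Q i) f) = w (fst (p i)) (snd (p i))" if "act i" for i
  using that by (simp add: Q_def w_def)
 have low: "ennreal Lam * emeasure lborel (Q i) \<le> (mass (Q i) f)" for i
 proof (cases "act i")
  case True
  then have "P (fst (p i)) (snd (p i))" by (auto simp: act_def S_def split: prod.splits)
  then show ?thesis unfolding emQ[OF True] wQ[OF True] P_def
   using lam side[of "fst (p i)"] by (simp add: ennreal_mult[symmetric] less_imp_le)
 qed (simp add: Q_def)
 \<comment> \<open>The parent cube fails the test and has 2^d times the volume.\<close>
 have up: "(mass (Q i) f) \<le> ennreal (2 ^ CARD('n) * Lam) * emeasure lborel (Q i)" for i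
 proof (cases "act i")
  case True
  define m where "m = fst (p i)"
  define k where "k = snd (p i)"
  have S: "P m k" "\<And>x m'. x \<in> dyadic_cube h m k \<Longrightarrow> m' < m \<Longrightarrow> \<not> P m' (cube_index h m' x)"
   using True by (auto simp: act_def S_def m_def k_def split: prod.splits)
  have "m \<noteq> 0" using S(1) P0 by metis
  then obtain n where n: "m = Suc n" by (cases m) auto
  have "emeasure lborel (dyadic_cube h m k) \<noteq> 0"
   using emeasure_dyadic_cube[OF h(2), of m k] side[of m] by (simp add: side_def ennreal_eq_0_iff not_le)
  then obtain x where x: "x \<in> dyadic_cube h m k" by (metis all_not_in_conv emeasure_empty)
  have sub: "dyadic_cube h m k \<subseteq> dyadic_cube h n (cube_index h n x)"
  proof
   fix y assume "y \<in> dyadic_cube h m k"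
   then have "cube_index h n y = cube_index h n x"
    using x n by (intro cube_index_mono[of n m]) (auto simp: dyadic_cube_def)
   then show "y \<in> dyadic_cube h n (cube_index h n x)" by (simp add: dyadic_cube_def)
  qed
  have "w m k \<le> w n (cube_index h n x)"
   unfolding w_def using sub by (intro nn_integral_mono) (auto simp: indicator_def)
  also have "... \<le> ennreal (Lam * side n ^ CARD('n))"
   using S(2)[OF x, of n] n by (simp add: P_def not_less)
  also have "Lam * side n ^ CARD('n) = 2 ^ CARD('n) * Lam * side m ^ CARD('n)"
   by (simp add: side_def n power_divide power_mult_distrib)
  finally show ?thesis unfolding emQ[OF True] wQ[OF True] m_def[symmetric] k_def[symmetric]
   using lam side[of m] by (subst ennreal_mult[symmetric]) (auto simp: less_imp_le)
 qed (simp add: Q_def)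
 have lQ: "ennreal (l i ^ CARD('n)) \<le> ennreal (real CARD('n) ^ CARD('n)) * emeasure lborel (Q i)" for i
 proof (cases "act i")
  case True
  then show ?thesis using side[of "fst (p i)"] unfolding emQ[OF True]
   by (simp add: l_def power_mult_distrib ennreal_mult)
 qed (simp add: l_def Q_def zero_less_card_finite)
 have l0: "l i \<ge> 0" for i using side[of "fst (p i)"] by (simp add: l_def)
 have lpos: "l i > 0" if "Q i \<noteq> {}" for i
  using that side[of "fst (p i)"] by (auto simp: l_def Q_def split: if_splits)
 have Qc: "Q i \<subseteq> cball (c i) (l i)" for i
 proof
  fix y assume y: "y \<in> Q i"
  then have a: "act i" by (auto simp: Q_def split: if_splits)
  let ?B = "cbox (\<chi> j. of_int (snd (p i) $ j) * (h / 2 ^ fst (p i))) (\<chi> j. (of_int (snd (p i) $ j) + 1) * (h / 2 ^ fst (p i))) :: (real ^ 'n) set"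
  have "y \<in> ?B" using y a dyadic_cube_sandwich(2)[OF h(2), of "fst (p i)" "snd (p i)"] by (auto simp: Q_def)
  moreover have "c i \<in> ?B" using h side[of "fst (p i)"] by (auto simp: mem_box_cart c_def side_def intro!: divide_right_mono mult_right_mono)
  ultimately have "norm (c i - y) \<le> real CARD('n) * (h / 2 ^ fst (p i))"
   by (intro dyadic_cube_diameter[OF h(2)])
  then show "y \<in> cball (c i) (l i)" using a by (simp add: l_def side_def dist_norm)
 qed
 define avg where "avg i = (1 / measure lborel (Q i)) *\<^sub>R (LINT y:Q i|lborel. f y)" for i
 define g where "g y = (if y \<in> (\<Union>i. Q i) then avg (LEAST i. y \<in> Q i) else f y)" for y
 have least: "(LEAST i. y \<in> Q i) = i" if "y \<in> Q i" for y i
 proof (rule Least_equality)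
  show "i \<le> j" if "y \<in> Q j" for j
   using dis \<open>y \<in> Q i\<close> that unfolding disjoint_family_on_def by (metis IntI UNIV_I empty_iff order_refl)
 qed (rule that)
 have gQ: "g y = avg i" if "y \<in> Q i" for y i
  using that least[OF that] by (auto simp: g_def)
 have [measurable]: "g \<in> borel_fun"
 proof -
  have "(\<lambda>y. LEAST i. y \<in> Q i) \<in> measurable borel (count_space UNIV)" by measurable
  then have [measurable]: "(\<lambda>y. avg (LEAST i. y \<in> Q i)) \<in> borel_fun"
   by (rule measurable_compose) simp
  show ?thesis unfolding g_def by measurable
 qed
 have siQ: "set_integrable lborel (Q i) f" for i
  unfolding set_integrable_def by (intro integrable_mult_indicator f) (simp add: Qm)
 have Qfin: "emeasure lborel (Q i) < \<infinity>" for i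
  by (cases "act i") (auto simp: emQ, simp add: Q_def)
 have Qpos: "measure lborel (Q i) > 0" if "act i" for i
  using emQ[OF that] side[of "fst (p i)"] by (simp add: measure_def)
 have avg_norm: "ennreal (norm (avg i)) * emeasure lborel (Q i) \<le> (mass (Q i) f)" for i
 proof (cases "act i")
  case True
  have "norm (LINT y:Q i|lborel. f y) \<le> (LINT y:Q i|lborel. norm (f y))" using siQ by (rule set_integral_norm_bound)
  then have "norm (avg i) * measure lborel (Q i) \<le> (LINT y:Q i|lborel. norm (f y))"
   using Qpos[OF True] by (simp add: avg_def)
  then have "ennreal (norm (avg i) * measure lborel (Q i)) \<le> ennreal (LINT y:Q i|lborel. norm (f y))" by (rule ennreal_leI)
  also have "ennreal (LINT y:Q i|lborel. norm (f y)) = (mass (Q i) f)"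
   unfolding set_lebesgue_integral_def
   using set_integrable_norm[OF siQ[of i]] unfolding set_integrable_def
   by (subst nn_integral_eq_integral[symmetric]) (auto intro!: nn_integral_cong simp: indicator_def)
  finally show ?thesis using Qfin[of i] by (simp add: ennreal_mult'' emeasure_eq_ennreal_measure less_top[symmetric])
 qed (simp add: Q_def)
 have ngQ: "(mass (Q i) g) \<le> (mass (Q i) f)" for i
 proof -
  have "(mass (Q i) g) = (NN y. ennreal (norm (avg i)) * indicator (Q i) y)"
   by (intro nn_integral_cong) (auto simp: indicator_def gQ)
  also have "... = ennreal (norm (avg i)) * emeasure lborel (Q i)" by (rule nn_integral_cmult_indicator) simp
  finally show ?thesis using avg_norm[of i] by simp
 qed
 let ?O = "\<Union>i. Q i"
 have Om[measurable]: "?O \<in> sets borel" by measurable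
 have ngO: "(mass ?O g) \<le> (mass ?O f)"
  by (subst (1 2) nn_integral_disjoint_UN) (auto intro!: suminf_le ngQ dis)
 have split: "(NN y. u y) = (\<integral>\<^sup>+y\<in>?O. u y \<partial>lborel) + (\<integral>\<^sup>+y\<in>-?O. u y \<partial>lborel)" if [measurable]: "u \<in> borel_fun" for u :: "real ^ 'n \<Rightarrow> ennreal"
  by (subst nn_integral_add[symmetric]) (auto intro!: nn_integral_cong simp: indicator_def)
 have ng: "(N1 y. g y) \<le> (N1 y. f y)"
 proof -
  have "(mass (-?O) g) = (mass (-?O) f)"
   by (intro nn_integral_cong) (auto simp: indicator_def g_def)
  then show ?thesis using ngO by (subst (1 2) split) (auto intro!: add_right_mono)
 qed
 have gi: "integrable lborel g"
  by (rule integrableI_bounded) (use ng nF in \<open>auto intro: le_less_trans\<close>)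
 have nfg: "(N1 y. f y - g y) \<le> 2 * (mass ?O f)"
 proof -
  have "(N1 y. f y - g y) \<le> (NN y. ennreal (norm (f y)) * indicator ?O y + ennreal (norm (g y)) * indicator ?O y)"
  proof (intro nn_integral_mono)
   fix y
   show "ennreal (norm (f y - g y)) \<le> ennreal (norm (f y)) * indicator ?O y + ennreal (norm (g y)) * indicator ?O y"
   proof (cases "y \<in> ?O")
    case True
    then show ?thesis using norm_triangle_ineq4[of "f y" "g y"]
     by (simp add: ennreal_plus[symmetric] ennreal_leI del: ennreal_plus)
   qed (simp add: g_def)
  qed
  also have "... = (mass ?O f) + (mass ?O g)"
   by (rule nn_integral_add) measurable
  also have "... \<le> (mass ?O f) + (mass ?O f)"
   by (intro add_left_mono ngO)
  finally show ?thesis by (simp add: mult_2)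
 qed
 have mean: "(LINT y:Q i|lborel. f y - g y) = 0" for i
 proof (cases "act i")
  case True
  have "(LINT y:Q i|lborel. f y - g y) = (LINT y:Q i|lborel. f y) - (LINT y:Q i|lborel. g y)"
   using siQ gi unfolding set_integrable_def
   by (intro set_integral_diff) (auto simp: set_integrable_def intro!: integrable_mult_indicator)
  also have "(LINT y:Q i|lborel. g y) = (LINT y:Q i|lborel. avg i)"
   unfolding set_lebesgue_integral_def by (intro L_integral_cong) (auto simp: indicator_def gQ)
  also have "... = measure lborel (Q i) *\<^sub>R avg i"
   using Qfin[of i] by (simp add: set_integral_const)
  also have "... = (LINT y:Q i|lborel. f y)" using Qpos[OF True] by (simp add: avg_def)
  finally show ?thesis by simp
 qed (simp add: Q_def set_lebesgue_integral_def)
 have gbound: "AE y in lborel. norm (g y) \<le> 2 ^ CARD('n) * Lam"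
  using AE_lebesgue_point[OF locally_integrable_integrable[OF f]]
 proof eventually_elim
  case (elim x)
  show ?case
  proof (cases "x \<in> ?O")
   case True
   then obtain i where i: "x \<in> Q i" by blast
   then have a: "act i" by (auto simp: Q_def split: if_splits)
   have "ennreal (norm (avg i)) * emeasure lborel (Q i) \<le> ennreal (2 ^ CARD('n) * Lam) * emeasure lborel (Q i)"
    using avg_norm[of i] up[of i] by (rule order_trans)
   then have "norm (avg i) * measure lborel (Q i) \<le> 2 ^ CARD('n) * Lam * measure lborel (Q i)"
    using Qfin[of i] lam by (simp add: emeasure_eq_ennreal_measure less_top[symmetric] ennreal_mult[symmetric] del: ennreal_numeral)
   then show ?thesis using Qpos[OF a] gQ[OF i] by simp
  next
   case False
   have "norm (f x) \<le> Lam"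
   proof (rule ccontr)
    assume "\<not> norm (f x) \<le> Lam"
    define D where "D = real CARD('n) ^ CARD('n)"
    have D: "D > 0" by (simp add: D_def)
    \<comment> \<open>A cube of side \<open>side m\<close> through x lies in the ball of radius d *
      side m, whence the factor D = d^d. With this e the oscillation accounts for only half of the
      excess |f x| - Lam.\<close>
    define e where "e = (norm (f x) - Lam) / (2 * D)"
    have e: "e > 0" using \<open>\<not> norm (f x) \<le> Lam\<close> D by (simp add: e_def)
    obtain dl where dl: "dl > 0" "\<And>rho. 0 < rho \<Longrightarrow> rho < dl \<Longrightarrow> (mass (cball x rho) (\<lambda>y. f y - f x)) \<le> ennreal (e * rho ^ CARD('n))"
     using elim e unfolding lebesgue_point_def by auto
    have "(\<lambda>m. real CARD('n) * (h * (1/2) ^ m)) \<longlonglongrightarrow> real CARD('n) * (h * 0)"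
     by (intro tendsto_intros LIMSEQ_power_zero) auto
    then have "eventually (\<lambda>m. real CARD('n) * (h * (1/2) ^ m) < dl) sequentially"
     using dl(1) by (intro order_tendstoD) auto
    then obtain m where "real CARD('n) * (h * (1/2) ^ m) < dl" by (auto simp: eventually_sequentially)
    then have m: "real CARD('n) * side m < dl" by (simp add: side_def power_one_over)
    define C where "C = dyadic_cube h m (cube_index h m x)"
    have [measurable]: "C \<in> sets borel" by (simp add: C_def sets_dyadic_cube)
    have emC: "emeasure lborel C = ennreal (side m ^ CARD('n))"
     using emeasure_dyadic_cube[OF h(2), of m "cube_index h m x"] by (simp add: C_def side_def)
    have xC: "x \<in> C" by (simp add: C_def dyadic_cube_def)
    have CB: "C \<subseteq> cball x (real CARD('n) * side m)"
    proof
     fix y assume y: "y \<in> C"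
     have "norm (x - y) \<le> real CARD('n) * (h / 2 ^ m)"
      using dyadic_cube_sandwich(2)[OF h(2), of m "cube_index h m x"] xC y
      by (intro dyadic_cube_diameter[OF h(2)]) (auto simp: C_def)
     then show "y \<in> cball x (real CARD('n) * side m)" by (simp add: side_def dist_norm)
    qed
    have osc: "(mass C (\<lambda>y. f y - f x)) \<le> ennreal (e * D * side m ^ CARD('n))"
    proof -
     have "(mass C (\<lambda>y. f y - f x)) \<le> (mass (cball x (real CARD('n) * side m)) (\<lambda>y. f y - f x))"
      using CB by (intro nn_integral_mono) (auto simp: indicator_def)
     also have "... \<le> ennreal (e * (real CARD('n) * side m) ^ CARD('n))"
      using m side[of m] by (intro dl(2)) auto
     finally show ?thesis by (simp add: power_mult_distrib D_def mult_ac)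
    qed
    have "\<not> P m (cube_index h m x)" using cover False by blast
    then have "(mass C f) \<le> ennreal (Lam * side m ^ CARD('n))"
     by (simp add: P_def w_def C_def not_less)
    moreover have "ennreal (norm (f x)) * emeasure lborel C \<le> (mass C f) + (mass C (\<lambda>y. f y - f x))"
    proof -
     have "ennreal (norm (f x)) * emeasure lborel C = (NN y. ennreal (norm (f x)) * indicator C y)"
      by (rule nn_integral_cmult_indicator[symmetric]) simp
     also have "... \<le> (NN y. ennreal (norm (f y)) * indicator C y + ennreal (norm (f y - f x)) * indicator C y)"
     proof (intro nn_integral_mono)
      fix y
      have "norm (f x) \<le> norm (f y) + norm (f y - f x)"
       using norm_triangle_ineq[of "f y" "f x - f y"] by (simp add: norm_minus_commute)
      then show "ennreal (norm (f x)) * indicator C y \<le> ennreal (norm (f y)) * indicator C y + ennreal (norm (f y - f x)) * indicator C y"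
       by (auto simp: indicator_def ennreal_plus[symmetric] ennreal_leI simp del: ennreal_plus)
     qed
     also have "... = (mass C f) + (mass C (\<lambda>y. f y - f x))"
      by (rule nn_integral_add) measurable
     finally show ?thesis .
    qed
    ultimately have "ennreal (norm (f x)) * emeasure lborel C \<le> ennreal (Lam * side m ^ CARD('n)) + ennreal (e * D * side m ^ CARD('n))"
     using osc by (meson add_mono order_trans)
    then have "norm (f x) * side m ^ CARD('n) \<le> (Lam + e * D) * side m ^ CARD('n)"
     unfolding emC using lam e D side[of m]
     by (simp add: ennreal_mult[symmetric] ennreal_plus[symmetric] distrib_right less_imp_le del: ennreal_plus)
    then have "norm (f x) \<le> Lam + e * D" using side[of m] by simp
    also have "e * D = (norm (f x) - Lam) / 2" using D by (simp add: e_def)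
    finally show False using \<open>\<not> norm (f x) \<le> Lam\<close> by (simp add: field_simps)
   qed
   also have "Lam \<le> 2 ^ CARD('n) * Lam" using lam by (simp add: mult_le_cancel_right1)
   finally show ?thesis using False by (simp add: g_def)
  qed
 qed
 show thesis
  by (rule that[OF dis Qm Qc l0 lpos lQ low gi gbound ng _ mean nfg]) (auto simp: g_def)
qed

subsection \<open>Boundary values of the Riesz transform\<close>

text \<open>Cut f at height n: the part above has small integral by dominated convergence, the part
  below contributes at most n times the measure of A.\<close>

lemma nn_integral_absolutely_continuous:
 fixes f :: "'a::euclidean_space \<Rightarrow> 'b::{banach, second_countable_topology}"
 assumes f: "integrable lborel f" and e: "e > 0"
 shows "\<exists>dl>0. \<forall>A\<in>sets borel. emeasure lborel A \<le> ennreal dl \<longrightarrow> (mass A f) \<le> ennreal e"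
proof -
 have [measurable]: "f \<in> borel_fun" using f by auto
 have "(\<lambda>n. LL x. indicator {x. norm (f x) > real n} x * norm (f x)) \<longlonglongrightarrow> (LL (x::'a). 0)"
 proof (rule integral_dominated_convergence[where w = "\<lambda>x. norm (f x)"])
  show "AE x in lborel. (\<lambda>n. indicator {x. norm (f x) > real n} x * norm (f x)) \<longlonglongrightarrow> 0"
  proof (intro AE_I2 tendsto_eventually)
   fix x
   obtain N where "norm (f x) \<le> real N" using real_arch_simple by blast
   then show "\<forall>\<^sub>F n in sequentially. indicator {x. norm (f x) > real n} x * norm (f x) = 0"
    by (intro eventually_sequentiallyI[of N]) (auto simp: indicator_def)
  qed
 qed (use f in \<open>auto simp: indicator_def\<close>)
 then have "eventually (\<lambda>n. (LL x. indicator {x. norm (f x) > real n} x * norm (f x)) < e / 2) sequentially"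
  using e by (intro order_tendstoD) auto
 then obtain n where n: "(LL x. indicator {x. norm (f x) > real n} x * norm (f x)) < e / 2"
  by (auto simp: eventually_sequentially)
 have tail: "(NN x. ennreal (indicator {x. norm (f x) > real n} x * norm (f x))) \<le> ennreal (e / 2)"
 proof -
  have "integrable lborel (\<lambda>x. indicator {x. norm (f x) > real n} x * norm (f x))"
   by (rule L_integrable_bound[OF integrable_norm[OF f]]) (auto simp: indicator_def)
  then show ?thesis using n by (subst nn_integral_eq_integral) (auto intro!: ennreal_leI)
 qed
 show ?thesis
 proof (intro exI[of _ "e / (2 * (real n + 1))"] conjI ballI impI)
  fix A :: "'a set" assume A[measurable]: "A \<in> sets borel" and le: "emeasure lborel A \<le> ennreal (e / (2 * (real n + 1)))"
  have "(mass A f) \<le> (NN x. ennreal (real n) * indicator A x + ennreal (indicator {x. norm (f x) > real n} x * norm (f x)))"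
   by (intro nn_integral_mono) (auto simp: indicator_def intro!: ennreal_leI add_increasing)
  also have "... = ennreal (real n) * emeasure lborel A + (NN x. ennreal (indicator {x. norm (f x) > real n} x * norm (f x)))"
   by (subst nn_integral_add) (auto simp: nn_integral_cmult_indicator)
  also have "... \<le> ennreal (real n) * ennreal (e / (2 * (real n + 1))) + ennreal (e / 2)"
   by (intro add_mono mult_left_mono le tail) auto
  also have "... = ennreal (real n * (e / (2 * (real n + 1))) + e / 2)"
   using e by (simp add: ennreal_mult[symmetric] ennreal_plus[symmetric] del: ennreal_plus)
  also have "... \<le> ennreal e"
   using e by (intro ennreal_leI) (simp add: field_simps)
  finally show "(mass A f) \<le> ennreal e" .
 qed (use e in auto)
qed

text \<open>The Calderon-Zygmund decomposition at height \<open>Lam\<close> seen through the Riesz transform: \<open>G\<close> is the transform of the good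
 part, \<open>\<beta>\<close> that of the bad part off the exceptional set \<open>E\<close>, and \<open>\<omega>\<close> is the mass of \<open>f\<close> on the union \<open>\<Omega>\<close> of the cubes.\<close>

definition riesz_decomposition :: "real \<Rightarrow> 'a \<Rightarrow> ('a::euclidean_space \<Rightarrow> complex) \<Rightarrow> real \<Rightarrow> 'a set \<Rightarrow> 'a set \<Rightarrow> ('a \<Rightarrow> complex) \<Rightarrow> ('a \<Rightarrow> complex) \<Rightarrow> real \<Rightarrow> bool" where
 "riesz_decomposition K b f Lam E \<Omega> G \<beta> \<omega> \<longleftrightarrow>
  E \<in> sets borel \<and> \<Omega> \<in> sets borel \<and> G \<in> borel_fun \<and> \<beta> \<in> borel_fun \<and>
  \<omega> \<ge> 0 \<and> (mass \<Omega> f) = ennreal \<omega> \<and>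
  emeasure lborel \<Omega> \<le> ennreal (1 / Lam * (LL y. norm (f y))) \<and>
  emeasure lborel E \<le> ennreal (K / Lam * \<omega>) \<and>
  energy G \<le> ennreal (K * Lam * (LL y. norm (f y))) \<and>
  (mass (-E) \<beta>) \<le> ennreal (K * \<omega>) \<and>
  (AE x in lborel. x \<notin> E \<longrightarrow> ((\<lambda>t. riesz_conv t b f x) \<longlongrightarrow> G x + \<beta> x) (at_right 0)) \<and>
  (\<forall>t>0. \<forall>x B. (\<forall>z::'a. \<bar>riesz_heat t z \<bullet> b\<bar> \<le> B) \<longrightarrow>
   norm (riesz_conv t b f x - conv (gauss_kernel t) G x) \<le> B * (2 * \<omega>))"

text \<open>The good part is handled in L^2. On each cube the bad part has mean zero, so the kernel
  may be replaced by its increment from the centre of the cube, and off E the smoothness estimate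
  bounds this by a majorant free of t; hence the limit t -> 0 exists there almost everywhere. K
  depends on neither f nor Lam, and the bad part is measured by the mass \<omega> on the cubes
  instead of the full norm of f.\<close>

lemma Calderon_Zygmund_riesz:
 assumes b: "(b :: real ^ 'n) \<in> Basis"
 obtains K where "K \<ge> 0" "\<And>f Lam. integrable lborel f \<Longrightarrow> Lam > 0 \<Longrightarrow> \<exists>E \<Omega> G \<beta> \<omega>. riesz_decomposition K b f Lam E \<Omega> G \<beta> \<omega>"
proof -
 obtain Cs where Cs: "Cs \<ge> 0" "\<And>t (x :: real ^ 'n) y. t \<ge> 0 \<Longrightarrow> x \<noteq> 0 \<Longrightarrow> norm (x - y) \<le> norm x / 2 \<Longrightarrow>
   norm (riesz_heat t x - riesz_heat t y) \<le> Cs * norm (x - y) / norm x ^ (CARD('n) + 1)"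
  using riesz_heat_smooth[where 'a = "real ^ 'n"] by auto
 obtain Ct where Ct: "Ct > 0" "\<And>r (z :: real ^ 'n). r > 0 \<Longrightarrow>
   (NN x. ennreal (1 / norm (x - z) ^ (CARD('n) + 1)) * indicator {x. r \<le> norm (x - z)} x) \<le> ennreal (Ct / r)"
  using nn_integral_norm_tail[where 'a = "real ^ 'n"] by auto
 define V where "V = measure lborel (cball (0 :: real ^ 'n) 1)"
 have V: "V \<ge> 0" by (simp add: V_def)
 define K1 where "K1 = V * 2 ^ CARD('n) * real CARD('n) ^ CARD('n)"
 define K2 where "K2 = (multiplier_const TYPE(real ^ 'n))\<^sup>2 * 2 ^ CARD('n)"
 define K3 where "K3 = Cs * Ct"
 define K where "K = max K1 (max K2 K3)"
 have K1: "K1 \<ge> 0" "K1 \<le> K" using V by (auto simp: K1_def K_def)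
 have K2: "K2 \<ge> 0" "K2 \<le> K" by (auto simp: K2_def K_def)
 have K3: "K3 \<ge> 0" "K3 \<le> K" using Cs Ct by (auto simp: K3_def K_def)
 show thesis
 proof (rule that)
  show "K \<ge> 0" using K1 by linarith
  fix f :: "real ^ 'n \<Rightarrow> complex" and Lam :: real
  assume f: "integrable lborel f" and Lam: "Lam > 0"
  have [measurable]: "f \<in> borel_fun" using f by auto
  define F where "F = (LL y. norm (f y))"
  have F0: "F \<ge> 0" unfolding F_def by (intro integral_nonneg_AE) auto
  have nF: "(N1 y. f y) = ennreal F"
   unfolding F_def using f by (intro nn_integral_eq_integral) auto
  obtain Q :: "nat \<Rightarrow> (real ^ 'n) set" and c l g where
   dis: "disjoint_family Q" and Qm[measurable]: "\<And>i. Q i \<in> sets borel" and Qc: "\<And>i. Q i \<subseteq> cball (c i) (l i)"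
   and l0: "\<And>i. l i \<ge> 0" and lpos: "\<And>i. Q i \<noteq> {} \<Longrightarrow> l i > 0"
   and lQ: "\<And>i. ennreal (l i ^ CARD('n)) \<le> ennreal (real CARD('n) ^ CARD('n)) * emeasure lborel (Q i)"
   and low: "\<And>i. ennreal Lam * emeasure lborel (Q i) \<le> (mass (Q i) f)"
   and gi: "integrable lborel g" and gb: "AE y in lborel. norm (g y) \<le> 2 ^ CARD('n) * Lam"
   and ng: "(N1 y. g y) \<le> (N1 y. f y)"
   and gf: "\<And>y. y \<notin> (\<Union>i. Q i) \<Longrightarrow> g y = f y"
   and mean: "\<And>i. (LINT y:Q i|lborel. f y - g y) = 0"
   and nfg: "(N1 y. f y - g y) \<le> 2 * (mass (\<Union>i. Q i) f)"
   by (rule Calderon_Zygmund_decomposition[OF f Lam]) (rule that; assumption)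
  have [measurable]: "g \<in> borel_fun" using gi by auto
  define \<Omega> where "\<Omega> = (\<Union>i. Q i)"
  have \<Omega>m[measurable]: "\<Omega> \<in> sets borel" unfolding \<Omega>_def by measurable
  \<comment> \<open>Doubling the balls puts points outside E at more than twice the radius from each
    centre, as the smoothness estimate requires.\<close>
  define E where "E = (\<Union>i. cball (c i) (2 * l i))"
  have Em[measurable]: "E \<in> sets borel" unfolding E_def by measurable
  have "(mass \<Omega> f) \<le> ennreal F"
   unfolding nF[symmetric] by (intro nn_integral_mono) (auto simp: indicator_def)
  then obtain \<omega> where \<omega>: "\<omega> \<ge> 0" "(mass \<Omega> f) = ennreal \<omega>" "\<omega> \<le> F"
   using F0 by (cases "mass \<Omega> f") (auto simp: top_unique)
  have sumQ: "(\<Sum>i. emeasure lborel (Q i)) \<le> ennreal (1 / Lam * \<omega>)"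
  proof -
   have "ennreal Lam * (\<Sum>i. emeasure lborel (Q i)) = (\<Sum>i. ennreal Lam * emeasure lborel (Q i))" (is "?l = _")
    by (rule ennreal_suminf_cmult[symmetric])
   also have "... \<le> (\<Sum>i. mass (Q i) f)" by (intro suminf_le low) auto
   also have "... = ennreal \<omega>"
    unfolding \<omega>(2)[symmetric] \<Omega>_def by (rule nn_integral_disjoint_UN[symmetric]) (auto simp: dis)
   finally have "ennreal (1 / Lam) * (?l) \<le> ennreal (1 / Lam) * ennreal \<omega>"
    by (rule mult_left_mono) simp
   also have "ennreal (1 / Lam) * (ennreal Lam * (\<Sum>i. emeasure lborel (Q i))) = (\<Sum>i. emeasure lborel (Q i))"
    using Lam by (simp add: mult.assoc[symmetric] ennreal_mult[symmetric])
   finally show ?thesis using Lam \<omega>(1) by (simp add: ennreal_mult[symmetric])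
  qed
  have em\<Omega>: "emeasure lborel \<Omega> \<le> ennreal (1 / Lam * F)"
  proof -
   have "emeasure lborel \<Omega> \<le> (\<Sum>i. emeasure lborel (Q i))" unfolding \<Omega>_def by (rule emeasure_subadditive_countably) auto
   also note sumQ
   also have "ennreal (1 / Lam * \<omega>) \<le> ennreal (1 / Lam * F)" using \<omega> Lam by (intro ennreal_leI mult_left_mono) auto
   finally show ?thesis .
  qed
  have emE: "emeasure lborel E \<le> ennreal (K / Lam * \<omega>)"
  proof -
   have "emeasure lborel E \<le> (\<Sum>i. emeasure lborel (cball (c i) (2 * l i)))" unfolding E_def by (rule emeasure_subadditive_countably) auto
   also have "... \<le> (\<Sum>i. ennreal K1 * emeasure lborel (Q i))"
   proof (intro suminf_le)
    fix i
    have "emeasure lborel (cball (c i) (2 * l i)) = ennreal (V * 2 ^ CARD('n)) * ennreal (l i ^ CARD('n))" (is "?l = _")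
     using l0[of i] V by (simp add: V_def emeasure_cball content_cball power_mult_distrib ennreal_mult[symmetric] mult_ac)
    also have "... \<le> ennreal (V * 2 ^ CARD('n)) * (ennreal (real CARD('n) ^ CARD('n)) * emeasure lborel (Q i))"
     by (intro mult_left_mono lQ) auto
    also have "... = ennreal K1 * emeasure lborel (Q i)"
     using V by (simp add: K1_def mult.assoc[symmetric] ennreal_mult[symmetric])
    finally show "?l \<le> ennreal K1 * emeasure lborel (Q i)" .
   qed auto
   also have "... = ennreal K1 * (\<Sum>i. emeasure lborel (Q i))" by (rule ennreal_suminf_cmult)
   also have "... \<le> ennreal K1 * ennreal (1 / Lam * \<omega>)" by (intro mult_left_mono sumQ) auto
   also have "... = ennreal (K1 / Lam * \<omega>)" using K1 Lam \<omega> by (simp add: ennreal_mult[symmetric])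
   also have "... \<le> ennreal (K / Lam * \<omega>)" using K1 Lam \<omega> by (intro ennreal_leI mult_right_mono divide_right_mono) auto
   finally show ?thesis .
  qed
  have "energy g \<le> (NN y. ennreal (2 ^ CARD('n) * Lam) * ennreal (norm (g y)))"
   unfolding energy_def
  proof (rule nn_integral_mono_AE, use gb in eventually_elim)
   case (elim y)
   from mult_right_mono[OF this norm_ge_zero, of "g y"] Lam show ?case
    by (simp add: power2_eq_square ennreal_leI flip: ennreal_mult)
  qed
  also have "... \<le> ennreal (2 ^ CARD('n) * Lam) * ennreal F"
   using ng by (subst nn_integral_cmult) (auto simp: nF intro: mult_left_mono)
  also have "... = ennreal (2 ^ CARD('n) * Lam * F)" using Lam F0 by (simp add: ennreal_mult)
  finally have "energy g \<le> ennreal (2 ^ CARD('n) * Lam * F)" .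
  from riesz_L2[OF gi this _ b] Lam F0 obtain G where Gm[measurable]: "G \<in> borel_fun"
   and G2: "energy G \<le> ennreal (K2 * (Lam * F))"
   and Gc: "\<And>t x. t > 0 \<Longrightarrow> riesz_conv t b g x = conv (gauss_kernel t) G x"
   by (auto simp: K2_def mult.assoc)
  have "K2 * (Lam * F) \<le> K * Lam * F" using K2 Lam F0 by (simp add: mult_right_mono mult.assoc)
  with G2 have G2': "energy G \<le> ennreal (K * Lam * F)" by (meson ennreal_leI order_trans)
  define hb where "hb y = f y - g y" for y
  have hbi: "integrable lborel hb" unfolding hb_def[abs_def] using f gi by auto
  have [measurable]: "hb \<in> borel_fun" using hbi by auto
  have hb0: "hb y = 0" if "y \<notin> \<Omega>" for y using gf[of y] that by (simp add: hb_def \<Omega>_def)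
  have nhb: "(N1 y. hb y) \<le> ennreal (2 * \<omega>)"
   using nfg \<omega> unfolding \<Omega>_def[symmetric] hb_def by (simp add: ennreal_mult)
  have Ihb: "(LL y. norm (hb y)) \<le> 2 * \<omega>"
   using nhb hbi \<omega>(1) by (subst (asm) nn_integral_eq_integral) (auto simp: ennreal_le_iff)
  \<comment> \<open>The index of the cube containing y. With centre \<open>cc y\<close> and radius
    \<open>ll y\<close> as functions of y, sums over cubes become integrals in y.\<close>
  define \<iota> where "\<iota> y = (LEAST i. y \<in> Q i)" for y
  have \<iota>m: "\<iota> \<in> measurable borel (count_space UNIV)" unfolding \<iota>_def by measurable
  define cc where "cc y = c (\<iota> y)" for y
  define ll where "ll y = l (\<iota> y)" for y
  have [measurable]: "cc \<in> borel_fun" "ll \<in> borel_fun"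
   unfolding cc_def ll_def using measurable_compose[OF \<iota>m, of c borel] measurable_compose[OF \<iota>m, of l borel] by auto
  have \<iota>Q: "\<iota> y = i" if "y \<in> Q i" for y i
   unfolding \<iota>_def
  proof (rule Least_equality)
   show "i \<le> j" if "y \<in> Q j" for j
    using dis \<open>y \<in> Q i\<close> that unfolding disjoint_family_on_def by (metis IntI UNIV_I empty_iff order_refl)
  qed (rule that)
  have \<Omega>D: "norm (y - cc y) \<le> ll y" "ll y > 0" if y: "y \<in> \<Omega>" for y
  proof -
   obtain i where i: "y \<in> Q i" using y by (auto simp: \<Omega>_def)
   show "norm (y - cc y) \<le> ll y" using Qc[of i] i \<iota>Q[OF i] by (auto simp: cc_def ll_def dist_norm norm_minus_commute)
   show "ll y > 0" using lpos[of i] i \<iota>Q[OF i] by (auto simp: ll_def)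
  qed
  have ED: "2 * ll y < norm (x - cc y)" if "x \<notin> E" for x y
   using that by (auto simp: E_def cc_def ll_def dist_norm norm_minus_commute not_le)
  \<comment> \<open>Majorant for the increments of \<open>riesz_heat t\<close> at all t >= 0
    simultaneously.\<close>
  define H where "H x y = norm (hb y) * (Cs * ll y / norm (x - cc y) ^ (CARD('n) + 1))" for x y
  define \<beta> where "\<beta> x = (LL y. ((riesz_heat 0 (x - y) - riesz_heat 0 (x - cc y)) \<bullet> b) *\<^sub>R hb y)" for x
  have \<beta>m[measurable]: "\<beta> \<in> borel_fun" unfolding \<beta>_def by measurable
  have diff: "norm (((riesz_heat t (x - y) - riesz_heat t (x - cc y)) \<bullet> b) *\<^sub>R hb y) \<le> H x y"
   if x: "x \<notin> E" and t: "t \<ge> 0" for x y t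
  proof (cases "y \<in> \<Omega>")
   case True
   have d: "norm ((x - cc y) - (x - y)) \<le> ll y" using \<Omega>D(1)[OF True] by simp
   have p: "norm (x - cc y) > 0" using ED[OF x, of y] \<Omega>D(2)[OF True] by linarith
   have "\<bar>(riesz_heat t (x - y) - riesz_heat t (x - cc y)) \<bullet> b\<bar> \<le> norm (riesz_heat t (x - y) - riesz_heat t (x - cc y))"
    using b by (rule Basis_le_norm)
   also have "... = norm (riesz_heat t (x - cc y) - riesz_heat t (x - y))" by (rule norm_minus_commute)
   also have "... \<le> Cs * norm ((x - cc y) - (x - y)) / norm (x - cc y) ^ (CARD('n) + 1)"
    using d ED[OF x, of y] p by (intro Cs(2) t) auto
   also have "... \<le> Cs * ll y / norm (x - cc y) ^ (CARD('n) + 1)"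
    using d Cs(1) by (intro divide_right_mono mult_left_mono) auto
   finally show ?thesis unfolding H_def norm_scaleR real_norm_def by (subst mult.commute, intro mult_left_mono) auto
  qed (simp add: hb0 H_def)
  \<comment> \<open>Tonelli, then the tail integral at radius 2 * ll y: the factor
    \<open>ll y\<close> of H cancels against it, which leaves the L^1 norm of the bad part.\<close>
  have Hfin: "(NN x. (NN y. ennreal (H x y)) * indicator (-E) x) \<le> ennreal (K * \<omega>)"
  proof -
   have "(NN x. (NN y. ennreal (H x y)) * indicator (-E) x) = (NN x. (NN y. ennreal (H x y) * indicator (-E) x))"
    unfolding H_def by (intro nn_integral_cong nn_integral_multc[symmetric]) measurable
   also have "... = (NN y. (NN x. ennreal (H x y) * indicator (-E) x))"
    unfolding H_def by (rule lborel_pair.Fubini'[symmetric]) measurable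
   also have "... \<le> (NN y. ennreal (K3 / 2) * ennreal (norm (hb y)))"
   proof (intro nn_integral_mono)
    fix y
    show "(NN x. ennreal (H x y) * indicator (-E) x) \<le> ennreal (K3 / 2) * ennreal (norm (hb y))"
    proof (cases "y \<in> \<Omega>")
     case True
     note l = \<Omega>D(2)[OF True]
     have "(NN x. ennreal (H x y) * indicator (-E) x) \<le>
      (NN x. ennreal (norm (hb y) * (Cs * ll y)) * (ennreal (1 / norm (x - cc y) ^ (CARD('n) + 1)) * indicator {x. 2 * ll y \<le> norm (x - cc y)} x))"
     proof (intro nn_integral_mono)
      fix x
      show "ennreal (H x y) * indicator (-E) x \<le> ennreal (norm (hb y) * (Cs * ll y)) * (ennreal (1 / norm (x - cc y) ^ (CARD('n) + 1)) * indicator {x. 2 * ll y \<le> norm (x - cc y)} x)"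
      proof (cases "x \<in> E")
       case False
       then show ?thesis using ED[OF False, of y] l Cs(1)
        by (simp add: H_def ennreal_mult[symmetric] less_imp_le mult.assoc)
      qed simp
     qed
     also have "... = ennreal (norm (hb y) * (Cs * ll y)) * (NN x. ennreal (1 / norm (x - cc y) ^ (CARD('n) + 1)) * indicator {x. 2 * ll y \<le> norm (x - cc y)} x)"
      by (rule nn_integral_cmult) measurable
     also have "... \<le> ennreal (norm (hb y) * (Cs * ll y)) * ennreal (Ct / (2 * ll y))"
      using l by (intro mult_left_mono Ct(2)) auto
     also have "... = ennreal (K3 / 2) * ennreal (norm (hb y))"
      using l Cs(1) Ct(1) by (simp add: ennreal_mult[symmetric] K3_def mult_ac)
     finally show ?thesis .
    qed (simp add: H_def hb0)
   qed
   also have "... = ennreal (K3 / 2) * (N1 y. hb y)" by (rule nn_integral_cmult) measurable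
   also have "... \<le> ennreal (K3 / 2) * ennreal (2 * \<omega>)" by (intro mult_left_mono nhb) auto
   also have "... = ennreal (K3 * \<omega>)" using K3 \<omega> by (simp add: ennreal_mult[symmetric])
   also have "... \<le> ennreal (K * \<omega>)" using K3 \<omega> by (intro ennreal_leI mult_right_mono) auto
   finally show ?thesis .
  qed
  have Hm: "(\<lambda>x. NN y. ennreal (H x y)) \<in> borel_fun"
   unfolding H_def by measurable
  have \<beta>le: "ennreal (norm (\<beta> x)) \<le> (NN y. ennreal (H x y))" if x: "x \<notin> E" for x
   unfolding \<beta>_def by (rule order_trans[OF norm_integral_le_nn_integral]) (intro nn_integral_mono ennreal_leI diff x order_refl)
  have \<beta>int: "(mass (-E) \<beta>) \<le> ennreal (K * \<omega>)"
  proof -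
   have "(mass (-E) \<beta>) \<le> (NN x. (NN y. ennreal (H x y)) * indicator (-E) x)"
    by (intro nn_integral_mono) (use \<beta>le in \<open>auto simp: indicator_def\<close>)
   also note Hfin
   finally show ?thesis .
  qed
  \<comment> \<open>On one cube the centre is constant, so the kernel value leaves the integral and
    multiplies the vanishing mean.\<close>
  have zero: "(LL y. (riesz_heat t (x - cc y) \<bullet> b) *\<^sub>R hb y) = 0"
   and zi: "integrable lborel (\<lambda>y. (riesz_heat t (x - cc y) \<bullet> b) *\<^sub>R hb y)" if t: "t > 0" for t x
  proof -
   obtain B where B: "B \<ge> 0" "\<And>z::real ^ 'n. \<bar>riesz_heat t z \<bullet> b\<bar> \<le> B" using riesz_component_bounded[OF t] by blast
   show zi: "integrable lborel (\<lambda>y. (riesz_heat t (x - cc y) \<bullet> b) *\<^sub>R hb y)"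
    by (rule L_integrable_bound[where f = "\<lambda>y. B * norm (hb y)"])
      (use hbi B in \<open>auto intro!: AE_I2 mult_right_mono\<close>)
   have "(LL y. (riesz_heat t (x - cc y) \<bullet> b) *\<^sub>R hb y) = (LINT y:(\<Union>i. Q i)|lborel. (riesz_heat t (x - cc y) \<bullet> b) *\<^sub>R hb y)" (is "?l = _")
    unfolding set_lebesgue_integral_def
    using hb0 by (intro L_integral_cong) (force simp: indicator_def \<Omega>_def)+
   also have "... = (\<Sum>i. LINT y:Q i|lborel. (riesz_heat t (x - cc y) \<bullet> b) *\<^sub>R hb y)"
   proof (rule lebesgue_integral_countable_add)
    show "Q i \<inter> Q j = {}" if "i \<noteq> j" for i j using dis that by (auto simp: disjoint_family_on_def)
    show "set_integrable lborel (\<Union>i. Q i) (\<lambda>y. (riesz_heat t (x - cc y) \<bullet> b) *\<^sub>R hb y)"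
     unfolding set_integrable_def by (intro integrable_mult_indicator zi) auto
   qed auto
   also have "... = (\<Sum>i::nat. 0)"
   proof (rule suminf_cong)
    fix i
    have "(LINT y:Q i|lborel. (riesz_heat t (x - cc y) \<bullet> b) *\<^sub>R hb y) = (LINT y:Q i|lborel. (riesz_heat t (x - c i) \<bullet> b) *\<^sub>R hb y)" (is "?l = _")
     unfolding set_lebesgue_integral_def
     by (intro L_integral_cong refl) (auto simp: indicator_def cc_def \<iota>Q)
    also have "... = (riesz_heat t (x - c i) \<bullet> b) *\<^sub>R (LINT y:Q i|lborel. hb y)"
    proof -
     have "(\<lambda>y. indicator (Q i) y *\<^sub>R ((riesz_heat t (x - c i) \<bullet> b) *\<^sub>R hb y)) = (\<lambda>y. (riesz_heat t (x - c i) \<bullet> b) *\<^sub>R (indicator (Q i) y *\<^sub>R hb y))"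
      by (auto simp: fun_eq_iff)
     then show ?thesis unfolding set_lebesgue_integral_def by (simp only: integral_scaleR_right)
    qed
    also have "(LINT y:Q i|lborel. hb y) = 0" using mean[of i] by (simp add: hb_def)
    finally show "?l = 0" by simp
   qed
   finally show "?l = 0" by simp
  qed
  have split: "riesz_conv t b f x = conv (gauss_kernel t) G x + riesz_conv t b hb x" if t: "t > 0" for t x
  proof -
   obtain B where B: "B \<ge> 0" "\<And>z::real ^ 'n. \<bar>riesz_heat t z \<bullet> b\<bar> \<le> B" using riesz_component_bounded[OF t] by blast
   have "integrable lborel (\<lambda>y. (riesz_heat t (x - y) \<bullet> b) *\<^sub>R g y)" "integrable lborel (\<lambda>y. (riesz_heat t (x - y) \<bullet> b) *\<^sub>R hb y)"
    by (rule kernel_integrable(1)[OF _ B(2) gi], measurable) (rule kernel_integrable(1)[OF _ B(2) hbi], measurable)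
   then have "riesz_conv t b g x + riesz_conv t b hb x = (LL y. (riesz_heat t (x - y) \<bullet> b) *\<^sub>R g y + (riesz_heat t (x - y) \<bullet> b) *\<^sub>R hb y)"
    unfolding conv_def by (rule L_integral_add[symmetric])
   also have "... = riesz_conv t b f x"
    unfolding conv_def scaleR_add_right[symmetric] hb_def by simp
   finally show ?thesis using Gc[OF t, of x] by simp
  qed
  have AE1: "AE x in lborel. x \<notin> E \<longrightarrow> (NN y. ennreal (H x y)) < \<infinity>"
  proof -
   have "(NN x. (NN y. ennreal (H x y)) * indicator (-E) x) \<noteq> \<infinity>" using Hfin by (auto simp: top_unique)
   then have "AE x in lborel. (NN y. ennreal (H x y)) * indicator (-E) x \<noteq> \<infinity>"
    using Hm by (intro nn_integral_PInf_AE) auto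
   then show ?thesis by eventually_elim (auto simp: less_top[symmetric])
  qed
  have AE2: "AE x in lborel. ((\<lambda>t. conv (gauss_kernel t) G x) \<longlongrightarrow> G x) (at_right 0)"
   by (rule AE_gauss_conv_tendsto[where p = 2]) (use G2' in \<open>auto simp: energy_def intro: le_less_trans\<close>)
  have lim: "AE x in lborel. x \<notin> E \<longrightarrow> ((\<lambda>t. riesz_conv t b f x) \<longlongrightarrow> G x + \<beta> x) (at_right 0)"
   using AE1 AE2
  proof eventually_elim
   case (elim x)
   show ?case
   proof
    assume x: "x \<notin> E"
    have Hi: "integrable lborel (H x)"
    proof (rule integrableI_bounded)
     show "H x \<in> borel_measurable lborel" unfolding H_def[abs_def] by measurable
     have "norm (H x y) = H x y" for y using diff[OF x order_refl, of y] norm_ge_zero by (metis abs_of_nonneg order_trans real_norm_def)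
     then show "(N1 y. H x y) < \<infinity>" using elim(1) x by simp
    qed
    have "((\<lambda>t. riesz_conv t b hb x) \<longlongrightarrow> \<beta> x) (at_right 0)"
    proof (rule tendsto_at_right_sequentiallyI)
     fix X :: "nat \<Rightarrow> real" assume X: "\<And>n. X n > 0" "X \<longlonglongrightarrow> 0"
     have e: "riesz_conv (X n) b hb x = (LL y. ((riesz_heat (X n) (x - y) - riesz_heat (X n) (x - cc y)) \<bullet> b) *\<^sub>R hb y)" for n
     proof -
      obtain B where B: "B \<ge> 0" "\<And>z::real ^ 'n. \<bar>riesz_heat (X n) z \<bullet> b\<bar> \<le> B" using riesz_component_bounded[OF X(1)[of n]] by blast
      have "integrable lborel (\<lambda>y. (riesz_heat (X n) (x - y) \<bullet> b) *\<^sub>R hb y)"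
       by (rule kernel_integrable(1)[OF _ B(2) hbi]) measurable
      then have "(LL y. (riesz_heat (X n) (x - y) \<bullet> b) *\<^sub>R hb y - (riesz_heat (X n) (x - cc y) \<bullet> b) *\<^sub>R hb y) = riesz_conv (X n) b hb x - 0"
       unfolding zero[OF X(1)[of n], of x, symmetric] conv_def by (intro L_integral_diff zi X)
      then show ?thesis by (simp add: inner_diff_left scaleR_diff_left)
     qed
     show "(\<lambda>n. riesz_conv (X n) b hb x) \<longlonglongrightarrow> \<beta> x"
      unfolding e \<beta>_def
     proof (rule integral_dominated_convergence[where w = "H x"])
      show "AE y in lborel. (\<lambda>n. ((riesz_heat (X n) (x - y) - riesz_heat (X n) (x - cc y)) \<bullet> b) *\<^sub>R hb y) \<longlonglongrightarrow> ((riesz_heat 0 (x - y) - riesz_heat 0 (x - cc y)) \<bullet> b) *\<^sub>R hb y"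
      proof (intro AE_I2)
       fix y
       have fX: "filterlim X (at_right 0) sequentially" using X by (rule filterlim_at_right_sequence)
       show "(\<lambda>n. ((riesz_heat (X n) (x - y) - riesz_heat (X n) (x - cc y)) \<bullet> b) *\<^sub>R hb y) \<longlonglongrightarrow> ((riesz_heat 0 (x - y) - riesz_heat 0 (x - cc y)) \<bullet> b) *\<^sub>R hb y"
       proof (cases "y \<in> \<Omega>")
        case True
        have "x - cc y \<noteq> 0" "x - y \<noteq> 0" using ED[OF x, of y] \<Omega>D[OF True] by auto
        then have "((\<lambda>h. riesz_heat (0 + h) (x - y)) \<longlongrightarrow> riesz_heat 0 (x - y)) (at_right 0)" "((\<lambda>h. riesz_heat (0 + h) (x - cc y)) \<longlongrightarrow> riesz_heat 0 (x - cc y)) (at_right 0)"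
         by (intro riesz_heat_tendsto; simp)+
        from this[THEN filterlim_compose, OF fX] show ?thesis by (auto intro!: tendsto_intros)
       qed (simp add: hb0)
      qed
      show "AE y in lborel. norm (((riesz_heat (X n) (x - y) - riesz_heat (X n) (x - cc y)) \<bullet> b) *\<^sub>R hb y) \<le> H x y" for n
       by (intro AE_I2 diff x less_imp_le X)
     qed (use Hi in auto)
    qed
    from tendsto_add[OF elim(2) this]
    show "((\<lambda>t. riesz_conv t b f x) \<longlongrightarrow> G x + \<beta> x) (at_right 0)"
    proof (rule Lim_transform_eventually)
     show "\<forall>\<^sub>F t in at_right 0. conv (gauss_kernel t) G x + riesz_conv t b hb x = riesz_conv t b f x"
      by (rule eventually_mono[OF eventually_at_right_less[of 0]]) (simp add: split)
    qed
   qed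
  qed
  \<comment> \<open>A crude bound by the maximum of the kernel at time t. It degenerates as t tends
    to 0, but will be used at fixed t with \<omega> tending to 0.\<close>
  have close: "norm (riesz_conv t b f x - conv (gauss_kernel t) G x) \<le> B * (2 * \<omega>)"
   if t: "t > 0" and B: "\<forall>z::real ^ 'n. \<bar>riesz_heat t z \<bullet> b\<bar> \<le> B" for t x B
  proof -
   have "norm (riesz_conv t b hb x) \<le> B * (LL y. norm (hb y))"
    by (rule kernel_integrable(2)[OF _ _ hbi]) (use B in auto)
   also have "... \<le> B * (2 * \<omega>)" using B abs_ge_zero order_trans by (intro mult_left_mono Ihb) blast
   finally show ?thesis using split[OF t, of x] by simp
  qed
  show "\<exists>E \<Omega> G \<beta> \<omega>. riesz_decomposition K b f Lam E \<Omega> G \<beta> \<omega>"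
   unfolding riesz_decomposition_def F_def[symmetric]
   by (intro exI[of _ E] exI[of _ \<Omega>] exI[of _ G] exI[of _ \<beta>] exI[of _ \<omega>] conjI allI impI Em \<Omega>m Gm \<beta>m \<omega>(1,2)
      em\<Omega> emE G2' \<beta>int lim close) auto
 qed
qed

text \<open>The limit exists almost everywhere off an exceptional set of measure O(1 / Lam), and the
  intersection of these sets over Lam = 1, 2, 3, ... is null.\<close>

lemma AE_riesz_limit:
 fixes f :: "real ^ 'n \<Rightarrow> complex"
 assumes f: "integrable lborel f" and b: "b \<in> Basis"
 shows "AE x in lborel. \<exists>r. ((\<lambda>t. riesz_conv t b f x) \<longlongrightarrow> r) (at_right 0)"
proof -
 define F where "F = (LL y. norm (f y))"
 have nF: "(N1 y. f y) = ennreal F"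
  unfolding F_def using f by (intro nn_integral_eq_integral) auto
 have F0: "F \<ge> 0" unfolding F_def by (intro integral_nonneg_AE) auto
 obtain K where K: "K \<ge> 0" "\<And>f Lam. integrable lborel f \<Longrightarrow> Lam > 0 \<Longrightarrow> \<exists>E \<Omega> G \<beta> \<omega>. riesz_decomposition K b f Lam E \<Omega> G \<beta> \<omega>"
  using Calderon_Zygmund_riesz[OF b] that by metis
 have "\<forall>n. \<exists>E. E \<in> sets borel \<and> emeasure lborel E \<le> ennreal (K * F / real (Suc n)) \<and>
   (AE x in lborel. x \<notin> E \<longrightarrow> (\<exists>r. ((\<lambda>t. riesz_conv t b f x) \<longlongrightarrow> r) (at_right 0)))"
 proof
  fix n
  obtain E \<Omega> G \<beta> \<omega> where *: "E \<in> sets borel" "(mass \<Omega> f) = ennreal \<omega>"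
   "emeasure lborel E \<le> ennreal (K / real (Suc n) * \<omega>)"
   "AE x in lborel. x \<notin> E \<longrightarrow> ((\<lambda>t. riesz_conv t b f x) \<longlongrightarrow> G x + \<beta> x) (at_right 0)"
   using K(2)[OF f, of "real (Suc n)"] unfolding riesz_decomposition_def by auto
  have "ennreal \<omega> \<le> ennreal F" unfolding nF[symmetric] *(2)[symmetric] by (intro nn_integral_mono) (auto simp: indicator_def)
  then have "K / real (Suc n) * \<omega> \<le> K / real (Suc n) * F" using K F0 by (intro mult_left_mono) (auto simp: ennreal_le_iff)
  then have "emeasure lborel E \<le> ennreal (K * F / real (Suc n))"
   using *(3) by (metis ennreal_leI order_trans times_divide_eq_left)
  with *(1,4) show "\<exists>E. E \<in> sets borel \<and> emeasure lborel E \<le> ennreal (K * F / real (Suc n)) \<and>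
   (AE x in lborel. x \<notin> E \<longrightarrow> (\<exists>r. ((\<lambda>t. riesz_conv t b f x) \<longlongrightarrow> r) (at_right 0)))"
   by (intro exI[of _ E]) (auto elim!: eventually_mono)
 qed
 from choice[OF this] obtain E where E: "\<And>n. E n \<in> sets borel" "\<And>n. emeasure lborel (E n) \<le> ennreal (K * F / real (Suc n))"
  "\<And>n. AE x in lborel. x \<notin> E n \<longrightarrow> (\<exists>r. ((\<lambda>t. riesz_conv t b f x) \<longlongrightarrow> r) (at_right 0))"
  by auto
 have "emeasure lborel (\<Inter>n. E n) = 0"
 proof -
  have "emeasure lborel (\<Inter>n. E n) \<le> ennreal (K * F / real (Suc n))" for n
   by (rule order_trans[OF emeasure_mono E(2)]) (auto simp: E(1))
  moreover have "(\<lambda>n. ennreal (K * F / real (Suc n))) \<longlonglongrightarrow> ennreal 0"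
   by (intro tendsto_ennrealI lim_const_over_n[THEN LIMSEQ_Suc])
  ultimately have "emeasure lborel (\<Inter>n. E n) \<le> ennreal 0"
   by (intro LIMSEQ_le_const) auto
  then show ?thesis by simp
 qed
 then have "(\<Inter>n. E n) \<in> null_sets lborel" using E(1) by (auto simp: null_sets_def)
 then have "AE x in lborel. x \<notin> (\<Inter>n. E n)" by (rule AE_not_in)
 moreover have "AE x in lborel. \<forall>n. x \<notin> E n \<longrightarrow> (\<exists>r. ((\<lambda>t. riesz_conv t b f x) \<longlongrightarrow> r) (at_right 0))"
  by (subst AE_all_countable) (intro allI E(3))
 ultimately show ?thesis by eventually_elim blast
qed

text \<open>No singular part is lost in the limit because the exceptional sets at level \<open>Lam\<close> have measure \<open>o(1 / Lam)\<close>,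
 while the squared norm of the good part is only \<open>O(Lam)\<close>.\<close>

lemma integrable_riesz_limit_imp_conv:
 fixes f :: "real ^ 'n \<Rightarrow> complex"
 assumes f: "integrable lborel f" and b: "b \<in> Basis" and r: "integrable lborel r"
  and lim: "AE x in lborel. ((\<lambda>t. riesz_conv t b f x) \<longlongrightarrow> r x) (at_right 0)"
  and t: "t > 0"
 shows "riesz_conv t b f x = conv (gauss_kernel t) r x"
proof -
 have [measurable]: "f \<in> borel_fun" "r \<in> borel_fun" using f r by auto
 define F where "F = (LL y. norm (f y))"
 have F0: "F \<ge> 0" unfolding F_def by (intro integral_nonneg_AE) auto
 obtain K where K: "K \<ge> 0" and CZ: "\<And>f Lam. integrable lborel f \<Longrightarrow> Lam > 0 \<Longrightarrow> \<exists>E \<Omega> G \<beta> \<omega>. riesz_decomposition K b f Lam E \<Omega> G \<beta> \<omega>"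
  using Calderon_Zygmund_riesz[OF b] that by metis
 obtain B where B: "B \<ge> 0" "\<And>z::real ^ 'n. \<bar>riesz_heat t z \<bullet> b\<bar> \<le> B" using riesz_component_bounded[OF t] by blast
 obtain M where M: "M \<ge> 0" "\<And>z::real ^ 'n. gauss_kernel t z \<le> M" using gauss_kernel_bounded[OF t] by blast
 define k where "k y = gauss_kernel t (x - y)" for y
 have k: "0 \<le> k y" "k y \<le> M" for y using M by (auto simp: k_def)
 have [measurable]: "k \<in> borel_fun" unfolding k_def by measurable
 have ir: "integrable lborel (\<lambda>y. k y *\<^sub>R r y)"
  unfolding k_def by (rule kernel_integrable(1)[OF _ _ r, where B = M]) (use M in auto)
 define C where "C = 2 * B + M * (K * (F + 1) + 1 + K)"
 have small: "norm (riesz_conv t b f x - conv (gauss_kernel t) r x) \<le> C * s" if s: "0 < s" "s < 1" for s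
 proof -
  \<comment> \<open>The mass of G on E will come out as a multiple of sqrt eta; with eta = s^2 every
    error is at most linear in s.\<close>
  define eta where "eta = s\<^sup>2"
  have eta: "eta > 0" "eta \<le> s" using s by (auto simp: eta_def power2_eq_square mult_left_le)
  obtain dl1 where dl1: "dl1 > 0" "\<And>A. A \<in> sets borel \<Longrightarrow> emeasure lborel A \<le> ennreal dl1 \<Longrightarrow> (mass A f) \<le> ennreal eta"
   using nn_integral_absolutely_continuous[OF f eta(1)] by blast
  obtain dl2 where dl2: "dl2 > 0" "\<And>A. A \<in> sets borel \<Longrightarrow> emeasure lborel A \<le> ennreal dl2 \<Longrightarrow> (mass A r) \<le> ennreal eta"
   using nn_integral_absolutely_continuous[OF r eta(1)] by blast
  \<comment> \<open>A chain of requirements: the measure of \<Omega> falls below \<open>dl1\<close>,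
    so \<omega> <= eta <= 1, and then the measure of E falls below \<open>dl2\<close>.\<close>
  define Lam where "Lam = max (1 / eta) (max (F / dl1) (K / dl2))"
  have Lam: "Lam > 0" "1 / Lam \<le> eta" "1 / Lam * F \<le> dl1" "K / Lam \<le> dl2"
  proof -
   have "1 / eta > 0" using eta by simp
   then show L: "Lam > 0" unfolding Lam_def by linarith
   have "1 / eta \<le> Lam" "F / dl1 \<le> Lam" "K / dl2 \<le> Lam" by (auto simp: Lam_def)
   then show "1 / Lam \<le> eta" "1 / Lam * F \<le> dl1" "K / Lam \<le> dl2"
    using L eta(1) dl1(1) dl2(1) by (simp_all add: divide_le_eq mult.commute)
  qed
  from CZ[OF f Lam(1)] obtain E \<Omega> G \<beta> \<omega> where
   Em[measurable]: "E \<in> sets borel" and \<Omega>m: "\<Omega> \<in> sets borel" and Gm[measurable]: "G \<in> borel_fun"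
   and \<beta>m[measurable]: "\<beta> \<in> borel_fun" and \<omega>0: "\<omega> \<ge> 0"
   and \<omega>: "(mass \<Omega> f) = ennreal \<omega>"
   and em\<Omega>: "emeasure lborel \<Omega> \<le> ennreal (1 / Lam * F)"
   and emE: "emeasure lborel E \<le> ennreal (K / Lam * \<omega>)"
   and G2: "energy G \<le> ennreal (K * Lam * F)"
   and \<beta>1: "(mass (-E) \<beta>) \<le> ennreal (K * \<omega>)"
   and limE: "AE x in lborel. x \<notin> E \<longrightarrow> ((\<lambda>t. riesz_conv t b f x) \<longlongrightarrow> G x + \<beta> x) (at_right 0)"
   and close: "\<forall>t>0. \<forall>x B. (\<forall>z::real ^ 'n. \<bar>riesz_heat t z \<bullet> b\<bar> \<le> B) \<longrightarrow>
     norm (riesz_conv t b f x - conv (gauss_kernel t) G x) \<le> B * (2 * \<omega>)"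
   unfolding riesz_decomposition_def F_def[symmetric] by (elim exE conjE) (rule that; assumption)
  have "ennreal \<omega> \<le> ennreal eta"
   unfolding \<omega>[symmetric] by (intro dl1(2) \<Omega>m order_trans[OF em\<Omega>] ennreal_leI Lam)
  then have \<omega>eta: "\<omega> \<le> eta" using eta by (simp add: ennreal_le_iff)
  have rE: "(mass E r) \<le> ennreal eta"
  proof (rule dl2(2)[OF Em])
   have "\<omega> \<le> 1" using \<omega>eta eta s by linarith
   then have "K / Lam * \<omega> \<le> K / Lam * 1" using K Lam(1) by (intro mult_left_mono) auto
   then have "K / Lam * \<omega> \<le> dl2" using Lam(4) by linarith
   then show "emeasure lborel E \<le> ennreal dl2" using emE by (meson ennreal_leI order_trans)
  qed
  \<comment> \<open>Cauchy-Schwarz: the factor Lam in the energy of G cancels the 1 / Lam in the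
    measure of E, and \<omega> <= eta supplies the small factor.\<close>
  have GE: "(mass E G) \<le> ennreal (s * (K * (F + 1)))"
  proof -
   have i2: "(indicat_real E x)\<^sup>2 = indicator E x" "ennreal (indicator E x) = indicator E x" for x by (auto simp: indicator_def)
   have "energy (indicat_real E) \<le> ennreal (K / Lam * eta)"
    using K Lam \<omega>eta unfolding energy_def by (auto simp: i2 intro!: order_trans[OF emE] ennreal_leI mult_left_mono divide_right_mono)
   from nn_integral_mult_le_energy[OF _ _ G2 this] have "(mass E G) \<le> ennreal (sqrt (K * Lam * F * (K / Lam * eta)))"
    using K F0 Lam eta by (simp add: ennreal_mult i2)
   also have "K * Lam * F * (K / Lam * eta) = (K * s)\<^sup>2 * F" using Lam(1) by (simp add: eta_def power2_eq_square)
   also have "sqrt ((K * s)\<^sup>2 * F) \<le> sqrt ((K * s)\<^sup>2 * (F + 1)\<^sup>2)"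
    using F0 by (intro real_sqrt_le_mono mult_left_mono zero_le_power2) (simp add: power2_eq_square algebra_simps)
   also have "... = s * (K * (F + 1))" using K s F0 by (simp add: real_sqrt_mult)
   finally show ?thesis by (simp add: ennreal_leI)
  qed
  have iG: "integrable lborel (\<lambda>y. k y *\<^sub>R G y)"
   unfolding k_def by (rule gauss_kernel_energy(1)[OF t Gm G2]) (use K F0 Lam in simp)
  have "norm (conv (gauss_kernel t) G x - conv (gauss_kernel t) r x) \<le> M * (s * (K * (F + 1)) + eta + K * eta)" (is "?l \<le> _")
  proof -
   have eq: "conv (gauss_kernel t) G x - conv (gauss_kernel t) r x = (LL y. k y *\<^sub>R G y - k y *\<^sub>R r y)"
    unfolding conv_def k_def[symmetric] using iG ir by (rule L_integral_diff[symmetric])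
   \<comment> \<open>Off E both r and G + \<beta> are the limit, so there G - r = -\<beta>, and
     \<beta> has small mass; on E the masses of G and r are small separately.\<close>
   have "AE y in lborel. y \<notin> E \<longrightarrow> r y = G y + \<beta> y"
    using lim limE by eventually_elim (auto intro: tendsto_unique[OF trivial_limit_at_right_real])
   then have ptw: "AE y in lborel. ennreal (norm (k y *\<^sub>R G y - k y *\<^sub>R r y)) \<le>
     ennreal M * (ennreal (norm (G y)) * indicator E y + ennreal (norm (r y)) * indicator E y + ennreal (norm (\<beta> y)) * indicator (-E) y)"
   proof eventually_elim
    case (elim y)
    have kk: "norm (k y *\<^sub>R G y - k y *\<^sub>R r y) \<le> M * norm (G y - r y)"
     using k[of y] by (simp add: scaleR_diff_right[symmetric] mult_right_mono)
    show ?case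
    proof (cases "y \<in> E")
     case True
     have "norm (k y *\<^sub>R G y - k y *\<^sub>R r y) \<le> M * (norm (G y) + norm (r y))"
      using kk mult_left_mono[OF norm_triangle_ineq4[of "G y" "r y"] M(1)] by linarith
     then have "ennreal (norm (k y *\<^sub>R G y - k y *\<^sub>R r y)) \<le> ennreal (M * (norm (G y) + norm (r y)))" by (rule ennreal_leI)
     then show ?thesis using True M(1) by (simp add: ennreal_mult ennreal_plus)
    next
     case False
     then have "norm (k y *\<^sub>R G y - k y *\<^sub>R r y) \<le> M * norm (\<beta> y)" using kk elim by simp
     then have "ennreal (norm (k y *\<^sub>R G y - k y *\<^sub>R r y)) \<le> ennreal (M * norm (\<beta> y))" by (rule ennreal_leI)
     then show ?thesis using False M(1) by (simp add: ennreal_mult)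
    qed
   qed
   have "ennreal (norm (conv (gauss_kernel t) G x - conv (gauss_kernel t) r x)) \<le> (N1 y. k y *\<^sub>R G y - k y *\<^sub>R r y)"
    unfolding eq by (intro integral_norm_bound_ennreal L_integrable_diff iG ir)
   also have "... \<le> (NN y. ennreal M * (ennreal (norm (G y)) * indicator E y + ennreal (norm (r y)) * indicator E y + ennreal (norm (\<beta> y)) * indicator (-E) y))"
    by (rule nn_integral_mono_AE[OF ptw])
   also have "... = ennreal M * (NN y. ennreal (norm (G y)) * indicator E y + ennreal (norm (r y)) * indicator E y + ennreal (norm (\<beta> y)) * indicator (-E) y)"
    by (rule nn_integral_cmult) measurable
   also have "(NN y. ennreal (norm (G y)) * indicator E y + ennreal (norm (r y)) * indicator E y + ennreal (norm (\<beta> y)) * indicator (-E) y)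
    = (NN y. ennreal (norm (G y)) * indicator E y + ennreal (norm (r y)) * indicator E y) + (mass (-E) \<beta>)"
    by (rule nn_integral_add) measurable
   also have "(NN y. ennreal (norm (G y)) * indicator E y + ennreal (norm (r y)) * indicator E y)
    = (mass E G) + (mass E r)"
    by (rule nn_integral_add) measurable
   also have "ennreal M * ((mass E G) + (mass E r) + (mass (-E) \<beta>))
     \<le> ennreal M * (ennreal (s * (K * (F + 1))) + ennreal eta + ennreal (K * eta))"
    using K \<omega>eta by (intro mult_left_mono add_mono GE rE order_trans[OF \<beta>1] ennreal_leI) (auto intro: mult_left_mono)
   also have "... = ennreal (M * (s * (K * (F + 1)) + eta + K * eta))"
    using M K F0 s eta by (simp add: ennreal_mult[symmetric] ennreal_plus[symmetric] del: ennreal_plus)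
   finally show ?thesis
    using M K F0 s eta by (subst (asm) ennreal_le_iff) (auto intro!: mult_nonneg_nonneg add_nonneg_nonneg)
  qed
  also have "... \<le> M * (s * (K * (F + 1)) + s + K * s)"
   using M K eta by (intro mult_left_mono add_mono) auto
  finally have 1: "?l \<le> M * (s * (K * (F + 1)) + s + K * s)" .
  have "norm (riesz_conv t b f x - conv (gauss_kernel t) G x) \<le> B * (2 * \<omega>)" (is "?l \<le> _")
   using close t B(2) by blast
  also have "... \<le> B * (2 * s)" using B(1) \<omega>eta eta by (intro mult_left_mono) auto
  finally have 2: "?l \<le> B * (2 * s)" .
  have "norm (riesz_conv t b f x - conv (gauss_kernel t) r x) \<le> B * (2 * s) + M * (s * (K * (F + 1)) + s + K * s)"
   using norm_triangle_ineq[of "riesz_conv t b f x - conv (gauss_kernel t) G x" "conv (gauss_kernel t) G x - conv (gauss_kernel t) r x"] 1 2 by simp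
  also have "... = C * s" by (simp add: C_def algebra_simps)
  finally show ?thesis .
 qed
 have "norm (riesz_conv t b f x - conv (gauss_kernel t) r x) \<le> 0"
 proof (rule tendsto_lowerbound)
  show "((\<lambda>s. C * s) \<longlongrightarrow> 0) (at_right 0)" by (auto intro!: tendsto_eq_intros)
  show "\<forall>\<^sub>F s in at_right 0. norm (riesz_conv t b f x - conv (gauss_kernel t) r x) \<le> C * s"
   unfolding eventually_at_right_field using small by (intro exI[of _ 1]) auto
 qed simp
 then show ?thesis by simp
qed

subsection \<open>The Hardy space\<close>

lemma vec_lambda_eq_sum_axis: "(\<chi> i. v i) = (\<Sum>i\<in>UNIV. axis i (v i :: 'c::comm_monoid_add))"
 by (simp add: vec_eq_iff axis_def if_distrib cong: if_cong)

lemma norm_axis_complex: "norm (axis i z :: complex ^ 'n) = norm z"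
proof -
 have "(\<Sum>j\<in>UNIV. (norm (axis i z $ j :: complex))\<^sup>2) = (\<Sum>j\<in>UNIV. if j = i then (norm z)\<^sup>2 else 0)"
  by (intro sum.cong) (auto simp: axis_def)
 then show ?thesis by (simp add: norm_vec_def L2_set_def)
qed

lemma bounded_linear_axis: "bounded_linear (axis i :: complex \<Rightarrow> complex ^ 'n)"
 by (rule bounded_linear_intro[where K = 1]) (simp_all add: norm_axis_complex, auto simp: vec_eq_iff axis_def)

lemma integrable_vec_lambda:
 fixes v :: "'a \<Rightarrow> 'n::finite \<Rightarrow> complex"
 assumes "\<And>i. integrable M (\<lambda>x. v x i)"
 shows "integrable M (\<lambda>x. \<chi> i. v x i)" (is ?g1) and "(\<integral>x. (\<chi> i. v x i) \<partial>M) = (\<chi> i. \<integral>x. v x i \<partial>M)" (is ?g2)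
proof -
 show i: ?g1
  unfolding vec_lambda_eq_sum_axis by (intro L_integrable_sum integrable_bounded_linear[OF bounded_linear_axis] assms)
 show ?g2
  using integral_bounded_linear[OF bounded_linear_vec_nth i] by (simp add: vec_eq_iff)
qed

lemma borel_measurable_vec_lambda:
 fixes v :: "'a \<Rightarrow> 'n::finite \<Rightarrow> complex"
 assumes "\<And>i. (\<lambda>x. v x i) \<in> borel_measurable M"
 shows "(\<lambda>x. \<chi> i. v x i) \<in> borel_measurable M"
 unfolding vec_lambda_eq_sum_axis
 by (intro borel_measurable_sum borel_measurable_continuous_on[OF linear_continuous_on[OF bounded_linear_axis]] assms)

text \<open>The Hardy space is defined over \<open>lebesgue\<close>, while the analysis runs over
  \<open>lborel\<close>; Borel representatives connect the two.\<close>

lemma lebesgue_measurable_AE_borel: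
 fixes f :: "'a::euclidean_space \<Rightarrow> complex"
 assumes f: "f \<in> borel_measurable lebesgue"
 obtains g where "g \<in> borel_fun" "AE x in lborel. f x = g x"
proof -
 have "(\<lambda>x. Re (f x)) \<in> borel_measurable lebesgue" "(\<lambda>x. Im (f x)) \<in> borel_measurable lebesgue"
  using f by (auto intro!: borel_measurable_continuous_on[OF _ f] continuous_intros)
 from this[THEN completion_ex_borel_measurable_real] obtain u v
  where uv[measurable]: "u \<in> borel_fun" "v \<in> borel_fun"
   and eq: "AE x in lborel. Re (f x) = u x" "AE x in lborel. Im (f x) = v x" by auto
 show thesis
 proof (rule that)
  show "(\<lambda>x. complex_of_real (u x) + \<i> * complex_of_real (v x)) \<in> borel_fun" by measurable
  show "AE x in lborel. f x = complex_of_real (u x) + \<i> * complex_of_real (v x)" using eq by eventually_elim (simp add: complex_eq_iff)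
 qed
qed

lemma lebesgue_integral_AE_eq:
 fixes f g :: "'a::euclidean_space \<Rightarrow> 'b::euclidean_space"
 assumes eq: "AE x in lborel. f x = g x" and g: "integrable lborel g"
 shows "integrable lebesgue f" and "(\<integral>x. norm (f x) \<partial>lebesgue) = (LL x. norm (g x))" (is ?g1)
proof -
 have [measurable]: "g \<in> borel_fun" using g by auto
 have gl: "integrable lebesgue g" using g by (subst integrable_completion) auto
 have eq': "AE x in lebesgue. g x = f x" using AE_completion[OF eq] by eventually_elim simp
 have fm: "f \<in> borel_measurable lebesgue"
  by (rule borel_measurable_AE[OF borel_measurable_integrable[OF gl] eq'])
 show f: "integrable lebesgue f"
  using gl eq' fm by (subst integrable_cong_AE[where g = g]) (auto elim: AE_mp)
 have "(\<integral>x. norm (f x) \<partial>lebesgue) = (\<integral>x. norm (g x) \<partial>lebesgue)"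
  using eq' f gl by (intro integral_cong_AE) (auto elim: AE_mp)
 also have "... = (LL x. norm (g x))" by (rule integral_completion) auto
 finally show ?g1 .
qed

lemma AE_lborel_affine:
 fixes t :: "'a::euclidean_space"
 assumes "AE y in lborel. P y" and c: "c \<noteq> 0"
 shows "AE y in lborel. P (t + c *\<^sub>R y)"
proof -
 from assms(1) obtain N where N: "{y. \<not> P y} \<subseteq> N" "emeasure lborel N = 0" "N \<in> sets borel"
  unfolding eventually_ae_filter by (auto simp: null_sets_def)
 have [measurable]: "N \<in> sets borel" by (rule N)
 have "(NN y. indicator N (t + c *\<^sub>R y)) = ennreal (1 / \<bar>c\<bar> ^ DIM('a)) * (NN y. indicator N y)"
  by (rule nn_integral_lborel_affine[OF _ c]) measurable
 also have "... = 0" using N by simp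
 finally have "AE y in lborel. indicator N (t + c *\<^sub>R y) = (0::ennreal)"
  by (subst (asm) nn_integral_0_iff_AE) auto
 then show ?thesis by eventually_elim (use N(1) in \<open>auto simp: indicator_def split: if_splits\<close>)
qed

section \<open>Principal values compared with heat-kernel smoothing\<close>

lemma riesz_truncated_cong:
 fixes f g :: "real ^ 'n \<Rightarrow> complex"
 assumes f: "f \<in> borel_measurable lebesgue" and eq: "AE x in lborel. f x = g x"
 shows "riesz_truncated eps f x = riesz_truncated eps g x"
proof -
 have g: "g \<in> borel_measurable lebesgue"
  by (rule borel_measurable_AE[OF f AE_completion[OF eq]])
 have T: "(\<lambda>y. x - y) \<in> lebesgue \<rightarrow>\<^sub>M lebesgue"
  using lebesgue_affine_measurable[of "\<lambda>_. -1" x] by (simp add: sum_negf euclidean_representation)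
 have [measurable]: "(\<lambda>y. riesz_kernel (y :: real ^ 'n) $ i) \<in> borel_measurable lebesgue" for i
 proof -
  have "(\<lambda>y. riesz_kernel (y :: real ^ 'n) $ i) \<in> borel_fun"
   unfolding riesz_kernel_eq vector_scaleR_component
   using borel_measurable_continuous_on[OF linear_continuous_on[OF bounded_linear_vec_nth] measurable_kernels(3)] by measurable
  then show ?thesis by (intro measurable_completion) simp
 qed
 have [measurable]: "{y::real^'n. eps < norm y} \<in> sets lebesgue" by simp
 have m: "(\<lambda>y. indicator {y. eps < norm y} y *\<^sub>R (\<chi> i. h (x - y) * of_real (riesz_kernel y $ i))) \<in> borel_measurable lebesgue"
  if h: "h \<in> borel_measurable lebesgue" for h :: "real ^ 'n \<Rightarrow> complex"
 proof -
  have [measurable]: "(\<lambda>y. h (x - y)) \<in> borel_measurable lebesgue" by (rule measurable_compose[OF T h])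
  show ?thesis by (intro borel_measurable_scaleR borel_measurable_vec_lambda) measurable
 qed
 show ?thesis unfolding riesz_truncated_def set_lebesgue_integral_def
 proof (rule integral_cong_AE[OF m[OF f] m[OF g]])
  have "AE y in lebesgue. f (x - y) = g (x - y)"
   using AE_completion[OF AE_lborel_affine[OF eq, of "-1" x]] by simp
  then show "AE y in lebesgue. indicator {y. eps < norm y} y *\<^sub>R (\<chi> i. f (x - y) * complex_of_real (riesz_kernel y $ i)) =
   indicator {y. eps < norm y} y *\<^sub>R (\<chi> i. g (x - y) * complex_of_real (riesz_kernel y $ i))"
   by eventually_elim simp
 qed
qed

lemma riesz_transform_cong:
 assumes "f \<in> borel_measurable lebesgue" and "AE x in lborel. f x = g x"
 shows "riesz_transform f = riesz_transform g"
 unfolding riesz_transform_def[abs_def] riesz_truncated_cong[OF assms] ..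

abbreviation riesz_trunc :: "real \<Rightarrow> 'a::euclidean_space \<Rightarrow> 'a" where
 "riesz_trunc eps z \<equiv> indicator {z. eps < norm z} z *\<^sub>R riesz_heat 0 z"

lemma riesz_trunc_bounded:
 assumes eps: "eps > 0"
 shows "\<exists>B. \<forall>z::'a::euclidean_space. \<forall>b\<in>Basis. \<bar>riesz_trunc eps z \<bullet> b\<bar> \<le> B"
proof -
 obtain C where C: "C \<ge> 0" "\<And>x::'a. norm (riesz_heat (eps\<^sup>2) x - riesz_trunc eps x) \<le> C * (eps / (eps + norm x) ^ (DIM('a) + 1))"
  using riesz_heat_truncated[where 'a='a] eps by blast
 obtain B where B: "\<And>x::'a. norm (riesz_heat (eps\<^sup>2) x) \<le> B" using riesz_heat_bounded[of "eps\<^sup>2"] eps by auto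
 show ?thesis
 proof (intro exI[of _ "B + C * (eps / eps ^ (DIM('a) + 1))"] allI ballI)
  fix z b :: 'a assume b: "b \<in> Basis"
  have "norm (riesz_trunc eps z) \<le> norm (riesz_heat (eps\<^sup>2) z) + norm (riesz_heat (eps\<^sup>2) z - riesz_trunc eps z)" (is "?l \<le> _")
   using norm_triangle_sub[of "riesz_trunc eps z" "riesz_heat (eps\<^sup>2) z"] by (simp only: norm_minus_commute)
  also have "... \<le> B + C * (eps / (eps + norm z) ^ (DIM('a) + 1))" by (intro add_mono B C)
  also have "... \<le> B + C * (eps / eps ^ (DIM('a) + 1))"
   using eps C(1) by (intro add_left_mono mult_left_mono divide_left_mono power_mono mult_pos_pos zero_less_power) (auto intro: add_pos_nonneg)
  finally have n: "?l \<le> B + C * (eps / eps ^ (DIM('a) + 1))" .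
  show "\<bar>riesz_trunc eps z \<bullet> b\<bar> \<le> B + C * (eps / eps ^ (DIM('a) + 1))"
   by (rule order_trans[OF Basis_le_norm[OF b] n])
 qed
qed

lemma riesz_truncated_eq:
 fixes f :: "real ^ 'n \<Rightarrow> complex"
 assumes f: "integrable lborel f" and eps: "eps > 0"
 shows "riesz_truncated eps f x = (\<chi> i. riesz_ratio TYPE('n) *\<^sub>R conv (\<lambda>z. riesz_trunc eps z \<bullet> axis i 1) f x)"
proof -
 have [measurable]: "f \<in> borel_fun" using f by auto
 obtain B where B: "\<And>z b :: real ^ 'n. b \<in> Basis \<Longrightarrow> \<bar>riesz_trunc eps z \<bullet> b\<bar> \<le> B" using riesz_trunc_bounded[OF eps] by blast
 define g where "g i y = riesz_ratio TYPE('n) *\<^sub>R ((riesz_trunc eps (x - y) \<bullet> axis i 1) *\<^sub>R f y)" for i :: 'n and y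
 have g: "integrable lborel (g i)" for i
  unfolding g_def by (intro integrable_scaleR_right kernel_integrable(1)[OF _ _ f, where B = B]) (measurable, rule B, auto simp: Basis_vec_def)
 have g': "integrable lborel (\<lambda>y. g i (x - y))" for i
  using g[of i] integral_lborel_reflect(2)[of "g i" x] by simp
 have "riesz_truncated eps f x = (\<integral>y. (\<chi> i. g i (x - y)) \<partial>lebesgue)"
  unfolding riesz_truncated_def set_lebesgue_integral_def
  by (intro L_integral_cong refl)
    (auto simp: g_def riesz_kernel_eq vec_eq_iff inner_axis scaleR_conv_of_real[where 'a=complex] indicator_def)
 also have "... = (LL y. (\<chi> i. g i (x - y)))"
  using integrable_vec_lambda(1)[of lborel "\<lambda>y i. g i (x - y)"] g' by (intro integral_completion) auto
 also have "... = (\<chi> i. LL y. g i (x - y))"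
  by (rule integrable_vec_lambda(2)[OF g'])
 also have "... = (\<chi> i. riesz_ratio TYPE('n) *\<^sub>R conv (\<lambda>z. riesz_trunc eps z \<bullet> axis i 1) f x)"
  by (simp only: integral_lborel_reflect(1)[of "g _" x]) (simp only: g_def conv_def integral_scaleR_right)
 finally show ?thesis .
qed

text \<open>Truncation at eps and smoothing at time eps^2 differ by an odd kernel with the decay
  required by \<open>conv_tendsto\<close>. Its integral vanishes, so at Lebesgue points both
  regularisations have the same limit.\<close>

lemma riesz_transform_eq:
 fixes f :: "real ^ 'n \<Rightarrow> complex"
 assumes f: "integrable lborel f" and lp: "lebesgue_point f x"
  and lim: "\<And>i. ((\<lambda>t. riesz_conv t (axis i 1) f x) \<longlongrightarrow> L i) (at_right 0)"
 shows "riesz_transform f x = (\<chi> i. riesz_ratio TYPE('n) *\<^sub>R L i)"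
proof -
 have fm: "f \<in> borel_fun" using f by auto
 note [measurable] = fm
 have ba: "bounded_averages f x"
  by (rule bounded_averagesI[where p = 1]) (use f in \<open>auto simp: integrable_iff_bounded\<close>)
 obtain C where C: "C \<ge> 0" "\<And>eps x. eps > 0 \<Longrightarrow> norm (riesz_heat (eps\<^sup>2) x - riesz_trunc eps x) \<le> C * (eps / (eps + norm (x::real^'n)) ^ (DIM(real^'n) + 1))"
  using riesz_heat_truncated[where 'a="real^'n"] by blast
 have sq: "filterlim (\<lambda>eps::real. eps\<^sup>2) (at_right 0) (at_right 0)"
  by (auto simp: filterlim_at eventually_at_right_field intro!: tendsto_eq_intros exI[of _ 1])
 have "((\<lambda>eps. conv (\<lambda>z. riesz_trunc eps z \<bullet> axis i 1) f x) \<longlongrightarrow> L i) (at_right 0)" for i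
 proof -
  have ib: "axis i 1 \<in> (Basis :: (real ^ 'n) set)" by (auto simp: Basis_vec_def)
  define K where "K eps z = (riesz_heat (eps\<^sup>2) z - riesz_trunc eps z) \<bullet> axis i 1" for eps :: real and z :: "real ^ 'n"
  have Km: "K eps \<in> borel_fun" for eps unfolding K_def[abs_def] by measurable
  have Kb: "\<bar>K eps z\<bar> \<le> C * (eps / (eps + norm z) ^ (DIM(real^'n) + 1))" if "eps > 0" for eps z
   unfolding K_def by (rule order_trans[OF Basis_le_norm[OF ib] C(2)[OF that]])
  have "(LL z. K eps z) = 0" for eps
  proof -
   have "K eps (0 - z) = - K eps z" for z
    by (cases "eps < norm z") (simp_all add: K_def inner_diff_left)
   then show ?thesis using integral_lborel_reflect(1)[of "K eps" 0] by simp
  qed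
  from conv_tendsto[OF fm lp ba Km Kb this]
  have "((\<lambda>eps. conv (K eps) f x) \<longlongrightarrow> 0) (at_right 0)" by simp
  moreover have "((\<lambda>eps. riesz_conv (eps\<^sup>2) (axis i 1) f x) \<longlongrightarrow> L i) (at_right 0)"
   by (rule filterlim_compose[OF lim sq])
  ultimately have "((\<lambda>eps. riesz_conv (eps\<^sup>2) (axis i 1) f x - conv (K eps) f x) \<longlongrightarrow> L i - 0) (at_right 0)"
   by (intro tendsto_diff)
  moreover have "riesz_conv (eps\<^sup>2) (axis i 1) f x - conv (K eps) f x = conv (\<lambda>z. riesz_trunc eps z \<bullet> axis i 1) f x" if eps: "eps > 0" for eps
  proof -
   obtain B1 where B1: "\<And>z :: real ^ 'n. \<bar>riesz_trunc eps z \<bullet> axis i 1\<bar> \<le> B1" using riesz_trunc_bounded[OF eps, where 'a = "real ^ 'n"] ib by blast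
   obtain B2 where B2: "\<And>z :: real ^ 'n. \<bar>riesz_heat (eps\<^sup>2) z \<bullet> axis i 1\<bar> \<le> B2" using riesz_component_bounded[of "eps\<^sup>2"] eps by auto
   have 1: "integrable lborel (\<lambda>y. (riesz_trunc eps (x - y) \<bullet> axis i 1) *\<^sub>R f y)"
    by (rule kernel_integrable(1)[OF _ B1 f]) measurable
   have 2: "integrable lborel (\<lambda>y. (riesz_heat (eps\<^sup>2) (x - y) \<bullet> axis i 1) *\<^sub>R f y)"
    by (rule kernel_integrable(1)[OF _ B2 f]) measurable
   have "conv (K eps) f x = (LL y. (riesz_heat (eps\<^sup>2) (x - y) \<bullet> axis i 1) *\<^sub>R f y - (riesz_trunc eps (x - y) \<bullet> axis i 1) *\<^sub>R f y)"
    unfolding conv_def K_def by (simp only: inner_diff_left scaleR_diff_left)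
   also have "... = riesz_conv (eps\<^sup>2) (axis i 1) f x - conv (\<lambda>z. riesz_trunc eps z \<bullet> axis i 1) f x"
    unfolding conv_def by (rule L_integral_diff[OF 2 1])
   finally show ?thesis by simp
  qed
  then have "\<forall>\<^sub>F eps in at_right 0. riesz_conv (eps\<^sup>2) (axis i 1) f x - conv (K eps) f x = conv (\<lambda>z. riesz_trunc eps z \<bullet> axis i 1) f x"
   by (auto simp: eventually_at_right_field intro!: exI[of _ 1])
  ultimately show ?thesis by (simp add: tendsto_cong)
 qed
 then have "((\<lambda>eps. \<chi> i. riesz_ratio TYPE('n) *\<^sub>R conv (\<lambda>z. riesz_trunc eps z \<bullet> axis i 1) f x) \<longlongrightarrow> (\<chi> i. riesz_ratio TYPE('n) *\<^sub>R L i)) (at_right 0)"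
  by (intro vec_tendstoI) (simp, intro tendsto_intros)
 moreover have "\<forall>\<^sub>F eps in at_right 0. (\<chi> i. riesz_ratio TYPE('n) *\<^sub>R conv (\<lambda>z. riesz_trunc eps z \<bullet> axis i 1) f x) = riesz_truncated eps f x"
  by (auto simp: eventually_at_right_field riesz_truncated_eq[OF f] intro!: exI[of _ 1])
 ultimately have "((\<lambda>eps. riesz_truncated eps f x) \<longlongrightarrow> (\<chi> i. riesz_ratio TYPE('n) *\<^sub>R L i)) (at_right 0)"
  by (simp add: tendsto_cong)
 then show ?thesis unfolding riesz_transform_def by (intro tendsto_Lim) auto
qed

text \<open>Up to the constant \<open>riesz_ratio\<close>, \<open>r\<close> is the component of the Riesz transform of \<open>f\<close> in the
 direction \<open>b\<close>; smoothing by the heat kernel avoids principal values.\<close>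

definition weak_riesz :: "'a::euclidean_space \<Rightarrow> ('a \<Rightarrow> complex) \<Rightarrow> ('a \<Rightarrow> complex) \<Rightarrow> bool" where
 "weak_riesz b f r \<longleftrightarrow> integrable lborel f \<and> integrable lborel r \<and>
   (\<forall>t>0. \<forall>x. riesz_conv t b f x = conv (gauss_kernel t) r x)"

lemma AE_lebesgue_point_integrable: "integrable lborel f \<Longrightarrow> AE x in lborel. lebesgue_point f x"
 for f :: "'a::euclidean_space \<Rightarrow> complex"
 by (rule AE_lebesgue_point) (auto simp: locally_integrable_def set_integrable_def intro: integrable_mult_indicator)

lemma weak_riesz_tendsto:
 assumes "weak_riesz b f r"
 shows "AE x in lborel. ((\<lambda>t. riesz_conv t b f x) \<longlongrightarrow> r x) (at_right 0)"
proof -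
 have r: "integrable lborel r" using assms by (simp add: weak_riesz_def)
 have "AE x in lborel. ((\<lambda>t. conv (gauss_kernel t) r x) \<longlongrightarrow> r x) (at_right 0)"
  by (rule AE_gauss_conv_tendsto[where p = 1]) (use r in \<open>auto simp: integrable_iff_bounded\<close>)
 then show ?thesis
 proof eventually_elim
  case (elim x)
  have "\<forall>\<^sub>F t in at_right 0. conv (gauss_kernel t) r x = riesz_conv t b f x"
   using assms by (auto simp: weak_riesz_def eventually_at_right_field intro!: exI[of _ 1])
  then show ?case using elim by (simp add: tendsto_cong)
 qed
qed

text \<open>At almost every point the boundary limit exists in all directions, and there
  \<open>riesz_transform_eq\<close> evaluates the principal value. The function f need not be Borel,
  hence the representative g.\<close>

lemma weak_riesz_imp_H1:
 fixes f g :: "real ^ 'n \<Rightarrow> complex"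
 assumes w: "\<And>i. weak_riesz (axis i 1) g (r i)" and eq: "AE x in lborel. f x = g x"
 shows "f \<in> H1" and "H1_norm f \<le> ennreal ((LL x. norm (g x)) + riesz_ratio TYPE('n) * (\<Sum>i\<in>UNIV. LL x. norm (r i x)))"
proof -
 let ?\<kappa> = "riesz_ratio TYPE('n)"
 have g: "integrable lborel g" and r: "\<And>i. integrable lborel (r i)" using w by (auto simp: weak_riesz_def)
 note f = lebesgue_integral_AE_eq[OF eq g]
 define R where "R x = (\<chi> i. ?\<kappa> *\<^sub>R r i x)" for x
 have Ri: "integrable lborel R" unfolding R_def by (intro integrable_vec_lambda integrable_scaleR_right r)
 have "AE x in lborel. \<forall>i. ((\<lambda>t. riesz_conv t (axis i 1) g x) \<longlongrightarrow> r i x) (at_right 0)"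
  unfolding AE_all_countable using weak_riesz_tendsto[OF w] by auto
 then have "AE x in lborel. riesz_transform f x = R x" using AE_lebesgue_point_integrable[OF g]
  unfolding riesz_transform_cong[OF borel_measurable_integrable[OF f(1)] eq]
  by eventually_elim (auto simp: R_def intro!: riesz_transform_eq[OF g])
 note T = lebesgue_integral_AE_eq[OF this Ri]
 show H: "f \<in> H1" using f T by (simp add: H1_def)
 have "(\<integral>x. norm (riesz_transform f x) \<partial>lebesgue) = (LL x. norm (R x))" by (rule T(2))
 also have "... \<le> (LL x. (\<Sum>i\<in>UNIV. ?\<kappa> * norm (r i x)))"
 proof (rule integral_mono)
  fix x
  have "norm (R x) \<le> (\<Sum>i\<in>UNIV. norm (R x $ i))" unfolding norm_vec_def by (rule L2_set_le_sum) simp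
  then show "norm (R x) \<le> (\<Sum>i\<in>UNIV. ?\<kappa> * norm (r i x))"
   using riesz_ratio_pos[where 'n='n] by (simp add: R_def)
 qed (use Ri r in auto)
 also have "... = ?\<kappa> * (\<Sum>i\<in>UNIV. LL x. norm (r i x))"
  using r by (simp add: sum_distrib_left)
 finally show "H1_norm f \<le> ennreal ((LL x. norm (g x)) + ?\<kappa> * (\<Sum>i\<in>UNIV. LL x. norm (r i x)))"
  using H f(2) by (simp add: H1_norm_def ennreal_leI del: ennreal_plus)
qed

text \<open>The limit along t = 1 / (n + 1) is a measurable candidate r. Up to the constant it is a
  component of the Riesz transform, hence integrable, and this integrability upgrades the almost
  everywhere limit to the identity of smoothings.\<close>

lemma H1_imp_weak_riesz:
 fixes f g :: "real ^ 'n \<Rightarrow> complex"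
 assumes H: "f \<in> H1" and g[measurable]: "g \<in> borel_fun" and eq: "AE x in lborel. f x = g x"
 obtains r where "weak_riesz (axis i 1) g r"
  "ennreal (riesz_ratio TYPE('n) * (LL x. norm (r x))) \<le> H1_norm f"
  "r = (\<lambda>x. lim (\<lambda>n. riesz_conv (1 / real (Suc n)) (axis i 1) g x))"
proof -
 let ?\<kappa> = "riesz_ratio TYPE('n)"
 have \<kappa>: "?\<kappa> > 0" by (rule riesz_ratio_pos)
 have f: "integrable lebesgue f" and T: "integrable lebesgue (riesz_transform f)" using H by (auto simp: H1_def)
 have "integrable lebesgue g"
  using f AE_completion[OF eq] borel_measurable_AE[OF borel_measurable_integrable[OF f] AE_completion[OF eq]]
  by (subst integrable_cong_AE[where g = f]) (auto elim: AE_mp)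
 then have gi: "integrable lborel g" by (subst (asm) integrable_completion) auto
 have b: "axis j 1 \<in> (Basis :: (real ^ 'n) set)" for j by (auto simp: Basis_vec_def)
 define r where "r x = lim (\<lambda>n. riesz_conv (1 / real (Suc n)) (axis i 1) g x)" for x
 have rm[measurable]: "r \<in> borel_fun" unfolding r_def[abs_def]
  by (intro borel_measurable_lim_metric measurable_conv) measurable
 have sq: "filterlim (\<lambda>n. 1 / real (Suc n)) (at_right 0) sequentially"
  by (intro filterlim_at_right_sequence LIMSEQ_inverse_real_of_nat[unfolded inverse_eq_divide]) auto
 have "AE x in lborel. \<forall>j. \<exists>L. ((\<lambda>t. riesz_conv t (axis j 1) g x) \<longlongrightarrow> L) (at_right 0)"
  unfolding AE_all_countable by (intro allI AE_riesz_limit gi b)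
 then have lim: "AE x in lborel. ((\<lambda>t. riesz_conv t (axis i 1) g x) \<longlongrightarrow> r x) (at_right 0) \<and>
   ?\<kappa> *\<^sub>R r x = riesz_transform f x $ i"
  using AE_lebesgue_point_integrable[OF gi]
 proof eventually_elim
  case (elim x)
  from choice[OF elim(1)] obtain L where L: "\<And>j. ((\<lambda>t. riesz_conv t (axis j 1) g x) \<longlongrightarrow> L j) (at_right 0)"
   by blast
  have rL: "r x = L i" unfolding r_def by (intro limI filterlim_compose[OF L sq])
  have "riesz_transform f x = (\<chi> i. ?\<kappa> *\<^sub>R L i)"
   unfolding riesz_transform_cong[OF borel_measurable_integrable[OF f] eq] by (rule riesz_transform_eq[OF gi elim(2) L])
  then show ?case using L[of i] rL by simp
 qed
 have bnd: "AE x in lebesgue. norm (?\<kappa> *\<^sub>R r x) \<le> norm (riesz_transform f x)"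
  using AE_completion[OF lim] 
 proof eventually_elim
  case (elim x)
  show ?case unfolding conjunct2[OF elim] by (rule Finite_Cartesian_Product.norm_nth_le)
 qed
 have rml: "(\<lambda>x. ?\<kappa> *\<^sub>R r x) \<in> borel_measurable lebesgue"
  by (intro measurable_completion) measurable
 have "integrable lebesgue (\<lambda>x. ?\<kappa> *\<^sub>R r x)"
  by (rule L_integrable_bound[OF T rml bnd])
 then have "integrable lborel (\<lambda>x. ?\<kappa> *\<^sub>R r x)" by (subst (asm) integrable_completion) auto
 then have "integrable lborel (\<lambda>x. (1 / ?\<kappa>) *\<^sub>R (?\<kappa> *\<^sub>R r x))" by (rule integrable_scaleR_right)
 then have ri: "integrable lborel r" using \<kappa> by simp
 have W: "weak_riesz (axis i 1) g r"
  unfolding weak_riesz_def using gi ri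
  by (intro conjI allI impI integrable_riesz_limit_imp_conv b) (use lim in \<open>auto elim: AE_mp\<close>)
 have "?\<kappa> * (LL x. norm (r x)) = (LL x. norm (?\<kappa> *\<^sub>R r x))" (is "?l = _") using \<kappa> by simp
 also have "... = (\<integral>x. norm (?\<kappa> *\<^sub>R r x) \<partial>lebesgue)" by (rule integral_completion[symmetric]) measurable
 also have "... \<le> (\<integral>x. norm (riesz_transform f x) \<partial>lebesgue)"
  by (rule integral_mono_AE[OF _ _ bnd]) (intro integrable_norm T \<open>integrable lebesgue (\<lambda>x. ?\<kappa> *\<^sub>R r x)\<close>)+
 also have "... \<le> (\<integral>x. norm (f x) \<partial>lebesgue) + (\<integral>x. norm (riesz_transform f x) \<partial>lebesgue)" by simp
 finally have "ennreal (?l) \<le> H1_norm f" using H by (simp add: H1_norm_def ennreal_leI del: ennreal_plus)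
 with W show thesis by (rule that) (simp add: r_def[abs_def])
qed

text \<open>Fubini for a family of functions. M is later Lebesgue measure, for convolutions, and
  counting measure, for series; a bounded kernel such as those at fixed t > 0 can be exchanged with
  the integral.\<close>

lemma superposition:
 fixes F :: "'y \<Rightarrow> 'a::euclidean_space \<Rightarrow> complex"
 assumes sf: "sigma_finite_measure M" and meas: "(\<lambda>(x, y). F y x) \<in> borel_measurable (borel \<Otimes>\<^sub>M M)"
  and fin: "(\<integral>\<^sup>+y. (N1 x. F y x) \<partial>M) \<le> ennreal B" and B: "B \<ge> 0"
 shows "integrable lborel (\<lambda>x. \<integral>y. F y x \<partial>M)" (is ?g1)
  and "(LL x. norm (\<integral>y. F y x \<partial>M)) \<le> B" (is ?g2)
  and "AE x in lborel. integrable M (\<lambda>y. F y x)" (is ?g3)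
  and "\<And>K A x. K \<in> borel_fun \<Longrightarrow> (\<And>z. \<bar>K z\<bar> \<le> A) \<Longrightarrow>
   conv K (\<lambda>x. \<integral>y. F y x \<partial>M) x = (\<integral>y. conv K (F y) x \<partial>M)"
proof -
 interpret M: sigma_finite_measure M by (rule sf)
 interpret pair_sigma_finite lborel M ..
 have [measurable]: "(\<lambda>(x, y). F y x) \<in> borel_measurable (lborel \<Otimes>\<^sub>M M)"
  using meas by (simp cong: measurable_cong_sets)
 have bnd: "(NN x. \<integral>\<^sup>+y. ennreal (norm (F y x)) \<partial>M) \<le> ennreal B"
 proof -
  have "(NN x. \<integral>\<^sup>+y. ennreal (norm (F y x)) \<partial>M) = (\<integral>\<^sup>+y. (N1 x. F y x) \<partial>M)"
   using Fubini'[of "\<lambda>x y. ennreal (norm (F y x))"] by (simp add: split_beta')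
  then show ?thesis using fin by simp
 qed
 have int: "integrable (lborel \<Otimes>\<^sub>M M) (\<lambda>(x, y). H x y)"
  if [measurable]: "(\<lambda>(x, y). H x y) \<in> borel_measurable (lborel \<Otimes>\<^sub>M M)" and A: "A \<ge> 0"
   and H: "\<And>x y. norm (H x y) \<le> A * norm (F y x)" for H :: "'a \<Rightarrow> 'y \<Rightarrow> complex" and A
 proof (rule integrableI_bounded)
  have "(\<integral>\<^sup>+p. ennreal (norm (case p of (x, y) \<Rightarrow> H x y)) \<partial>(lborel \<Otimes>\<^sub>M M)) = (NN x. \<integral>\<^sup>+y. ennreal (norm (H x y)) \<partial>M)" (is "?l = _")
   by (subst M.nn_integral_fst[symmetric]) (auto simp: split_beta')
  also have "... \<le> (NN x. \<integral>\<^sup>+y. ennreal A * ennreal (norm (F y x)) \<partial>M)"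
   using A H by (intro nn_integral_mono) (auto simp: ennreal_mult[symmetric] intro: ennreal_leI)
  also have "... = ennreal A * (NN x. \<integral>\<^sup>+y. ennreal (norm (F y x)) \<partial>M)"
   by (subst nn_integral_cmult[symmetric]) (auto intro!: nn_integral_cong nn_integral_cmult)
  also have "... \<le> ennreal A * ennreal B" by (intro mult_left_mono bnd) simp
  also have "... < \<infinity>" using A B by (simp add: ennreal_mult[symmetric])
  finally show "?l < \<infinity>" .
 qed measurable
 have iF: "integrable (lborel \<Otimes>\<^sub>M M) (\<lambda>(x, y). F y x)" by (rule int[where A = 1]) auto
 show i: ?g1 using integrable_fst[OF iF] .
 show ?g3 using AE_integrable_fst[OF iF] .
 have "ennreal (LL x. norm (\<integral>y. F y x \<partial>M)) = (N1 x. \<integral>y. F y x \<partial>M)"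
  using i by (intro nn_integral_eq_integral[symmetric]) auto
 also have "... \<le> (NN x. \<integral>\<^sup>+y. ennreal (norm (F y x)) \<partial>M)"
  by (intro nn_integral_mono norm_integral_le_nn_integral)
 also have "... \<le> ennreal B" by (rule bnd)
 finally show ?g2 using B by (simp add: ennreal_le_iff)
 fix K :: "'a \<Rightarrow> real" and A x assume [measurable]: "K \<in> borel_fun" and A: "\<And>z. \<bar>K z\<bar> \<le> A"
 have "conv K (\<lambda>x. \<integral>y. F y x \<partial>M) x = (LL z. \<integral>y. K (x - z) *\<^sub>R F y z \<partial>M)" (is "?l = _")
  unfolding conv_def by (simp only: integral_scaleR_right)
 also have "... = (\<integral>y. (LL z. K (x - z) *\<^sub>R F y z) \<partial>M)"
 proof (rule Fubini_integral[symmetric], rule int[where A = A])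
  show "A \<ge> 0" using A[of 0] by linarith
  show "norm (K (x - z) *\<^sub>R F y z) \<le> A * norm (F y z)" for z y using A[of "x - z"] by (simp add: mult_right_mono)
 qed measurable
 finally show "?l = (\<integral>y. conv K (F y) x \<partial>M)" by (simp add: conv_def)
qed

lemma weak_riesz_superposition:
 fixes F G :: "'y \<Rightarrow> 'a::euclidean_space \<Rightarrow> complex"
 assumes sf: "sigma_finite_measure M"
  and F: "(\<lambda>(x, y). F y x) \<in> borel_measurable (borel \<Otimes>\<^sub>M M)" "(\<integral>\<^sup>+y. (N1 x. F y x) \<partial>M) \<le> ennreal A" "A \<ge> 0"
  and G: "(\<lambda>(x, y). G y x) \<in> borel_measurable (borel \<Otimes>\<^sub>M M)" "(\<integral>\<^sup>+y. (N1 x. G y x) \<partial>M) \<le> ennreal B" "B \<ge> 0"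
  and w: "\<And>y. weak_riesz b (F y) (G y)"
 shows "weak_riesz b (\<lambda>x. \<integral>y. F y x \<partial>M) (\<lambda>x. \<integral>y. G y x \<partial>M)"
 unfolding weak_riesz_def
proof (intro conjI allI impI)
 fix t :: real and x assume t: "t > 0"
 obtain A' where A': "\<And>x::'a. \<bar>riesz_heat t x \<bullet> b\<bar> \<le> A'" using riesz_component_bounded[OF t] by blast
 obtain B' where B': "\<And>x::'a. gauss_kernel t x \<le> B'" using gauss_kernel_bounded[OF t] by blast
 have "riesz_conv t b (\<lambda>x. \<integral>y. F y x \<partial>M) x = (\<integral>y. riesz_conv t b (F y) x \<partial>M)" (is "?l = _")
  by (rule superposition(4)[OF sf F _ A']) measurable
 also have "... = (\<integral>y. conv (gauss_kernel t) (G y) x \<partial>M)"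
  using w t by (simp add: weak_riesz_def)
 also have "... = conv (gauss_kernel t) (\<lambda>x. \<integral>y. G y x \<partial>M) x"
  by (rule superposition(4)[OF sf G, symmetric]) (use B' in auto)
 finally show "?l = conv (gauss_kernel t) (\<lambda>x. \<integral>y. G y x \<partial>M) x" .
qed (rule superposition(1)[OF sf F] superposition(1)[OF sf G])+

section \<open>Translations, linear combinations and dilations\<close>

lemma conv_translate: "conv K (\<lambda>x. f (x - y)) x = conv K f (x - y)"
 unfolding conv_def using integral_lborel_shift(1)[of "\<lambda>z. K (x - y - z) *\<^sub>R f z" y] by simp

lemma conv_lincomb:
 fixes f g :: "'a::euclidean_space \<Rightarrow> complex"
 assumes K: "K \<in> borel_fun" "\<And>z. \<bar>K z\<bar> \<le> B" and f: "integrable lborel f" and g: "integrable lborel g"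
 shows "conv K (\<lambda>x. c * f x + d * g x) x = c * conv K f x + d * conv K g x"
proof -
 have i: "integrable lborel (\<lambda>y. c * (K (x - y) *\<^sub>R f y))" "integrable lborel (\<lambda>y. d * (K (x - y) *\<^sub>R g y))"
  by (intro integrable_mult_right kernel_integrable(1)[OF K] f g)+
 have "conv K (\<lambda>x. c * f x + d * g x) x = (LL y. c * (K (x - y) *\<^sub>R f y) + d * (K (x - y) *\<^sub>R g y))"
  unfolding conv_def by (simp only: scaleR_add_right mult_scaleR_right)
 also have "... = c * conv K f x + d * conv K g x"
  unfolding conv_def L_integral_add[OF i] by (simp del: mult_scaleR_right)
 finally show ?thesis .
qed

lemma weak_riesz_translate:
 assumes "weak_riesz b f r" shows "weak_riesz b (\<lambda>x. f (x - y)) (\<lambda>x. r (x - y))"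
 using assms unfolding weak_riesz_def by (simp add: conv_translate integral_lborel_shift(2))

lemma weak_riesz_lincomb:
 assumes f: "weak_riesz b f r" and g: "weak_riesz b g q"
 shows "weak_riesz b (\<lambda>x. c * f x + d * g x) (\<lambda>x. c * r x + d * q x)"
 unfolding weak_riesz_def
proof (intro conjI allI impI)
 fix t :: real and x assume t: "t > 0"
 obtain A' where A': "\<And>x::'a. \<bar>riesz_heat t x \<bullet> b\<bar> \<le> A'" using riesz_component_bounded[OF t] by blast
 obtain B' where B': "\<And>x::'a. \<bar>gauss_kernel t x\<bar> \<le> B'" using gauss_kernel_bounded[OF t] by auto
 have i: "integrable lborel f" "integrable lborel g" "integrable lborel r" "integrable lborel q"
  using f g by (auto simp: weak_riesz_def)
 have 1: "riesz_conv t b (\<lambda>x. c * f x + d * g x) x = c * riesz_conv t b f x + d * riesz_conv t b g x"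
  by (rule conv_lincomb[OF _ A' i(1,2)]) measurable
 have 2: "conv (gauss_kernel t) (\<lambda>x. c * r x + d * q x) x = c * conv (gauss_kernel t) r x + d * conv (gauss_kernel t) q x"
  by (rule conv_lincomb[OF _ B' i(3,4)]) measurable
 show "riesz_conv t b (\<lambda>x. c * f x + d * g x) x = conv (gauss_kernel t) (\<lambda>x. c * r x + d * q x) x"
  unfolding 1 2 using f g t by (simp add: weak_riesz_def)
qed (use f g in \<open>auto simp: weak_riesz_def\<close>)

lemma weak_riesz_scale: "weak_riesz b f r \<Longrightarrow> weak_riesz b (\<lambda>x. c * f x) (\<lambda>x. c * r x)"
 using weak_riesz_lincomb[of b f r f r c 0] by simp

text \<open>The dilation changes t into \<alpha>^2 t, which is harmless because the relation holds
  for all t > 0; the odd kernel contributes the sign.\<close>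

lemma weak_riesz_dilate:
 fixes f :: "'a::euclidean_space \<Rightarrow> complex"
 assumes w: "weak_riesz b f r" and \<alpha>: "\<alpha> \<noteq> 0"
 shows "weak_riesz b (\<lambda>x. f (\<alpha> *\<^sub>R x)) (\<lambda>x. of_real (sgn \<alpha>) * r (\<alpha> *\<^sub>R x))"
 unfolding weak_riesz_def
proof (intro conjI allI impI)
 show i: "integrable lborel (\<lambda>x. f (\<alpha> *\<^sub>R x))" "integrable lborel (\<lambda>x. of_real (sgn \<alpha>) * r (\<alpha> *\<^sub>R x))"
  using w integral_lborel_affine(2)[OF _ \<alpha>, of _ 0] by (auto simp: weak_riesz_def)
 fix t :: real and x :: 'a assume t: "t > 0"
 have sub: "(LL y. g (\<alpha> *\<^sub>R y)) = (1 / \<bar>\<alpha>\<bar> ^ DIM('a)) *\<^sub>R (LL y. g y)" if "integrable lborel g" for g :: "'a \<Rightarrow> complex"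
  using integral_lborel_affine(1)[OF that \<alpha>, of 0] by simp
 have at: "\<alpha>\<^sup>2 * t > 0" using \<alpha> t by simp
 obtain A' where A': "\<And>x::'a. \<bar>riesz_heat (\<alpha>\<^sup>2 * t) x \<bullet> b\<bar> \<le> A'" using riesz_component_bounded[OF at] by blast
 obtain B' where B': "\<And>x::'a. \<bar>gauss_kernel (\<alpha>\<^sup>2 * t) x\<bar> \<le> B'" using gauss_kernel_bounded[OF at] by auto
 have a0: "\<bar>\<alpha>\<bar> ^ DIM('a) \<noteq> 0" using \<alpha> by simp
 have rh: "riesz_heat t z = (sgn \<alpha> * \<bar>\<alpha>\<bar> ^ DIM('a)) *\<^sub>R riesz_heat (\<alpha>\<^sup>2 * t) (\<alpha> *\<^sub>R z)" for z :: 'a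
  using riesz_heat_scale[OF \<alpha>, of t z] t \<alpha> a0 by (simp add: sgn_if)
 have gk: "gauss_kernel t z = \<bar>\<alpha>\<bar> ^ DIM('a) * gauss_kernel (\<alpha>\<^sup>2 * t) (\<alpha> *\<^sub>R z)" for z :: 'a
  using gauss_kernel_dilate[OF \<alpha>, of t z] t a0 by simp
 have "riesz_conv t b (\<lambda>x. f (\<alpha> *\<^sub>R x)) x =
   (LL y. (sgn \<alpha> * \<bar>\<alpha>\<bar> ^ DIM('a)) *\<^sub>R ((riesz_heat (\<alpha>\<^sup>2 * t) (\<alpha> *\<^sub>R x - \<alpha> *\<^sub>R y) \<bullet> b) *\<^sub>R f (\<alpha> *\<^sub>R y)))"
  unfolding conv_def rh scaleR_diff_right by simp
 also have "... = (sgn \<alpha> * \<bar>\<alpha>\<bar> ^ DIM('a)) *\<^sub>R (1 / \<bar>\<alpha>\<bar> ^ DIM('a)) *\<^sub>R riesz_conv (\<alpha>\<^sup>2 * t) b f (\<alpha> *\<^sub>R x)"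
  unfolding integral_scaleR_right conv_def
  by (subst sub[of "\<lambda>y. (riesz_heat (\<alpha>\<^sup>2 * t) (\<alpha> *\<^sub>R x - y) \<bullet> b) *\<^sub>R f y"], rule kernel_integrable(1)[OF _ A'])
    (use w in \<open>auto simp: weak_riesz_def\<close>)
 also have "riesz_conv (\<alpha>\<^sup>2 * t) b f (\<alpha> *\<^sub>R x) = conv (gauss_kernel (\<alpha>\<^sup>2 * t)) r (\<alpha> *\<^sub>R x)"
  using w at by (simp add: weak_riesz_def)
 also have "(sgn \<alpha> * \<bar>\<alpha>\<bar> ^ DIM('a)) *\<^sub>R (1 / \<bar>\<alpha>\<bar> ^ DIM('a)) *\<^sub>R conv (gauss_kernel (\<alpha>\<^sup>2 * t)) r (\<alpha> *\<^sub>R x) =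
   (LL y. (sgn \<alpha> * \<bar>\<alpha>\<bar> ^ DIM('a)) *\<^sub>R (gauss_kernel (\<alpha>\<^sup>2 * t) (\<alpha> *\<^sub>R x - \<alpha> *\<^sub>R y) *\<^sub>R r (\<alpha> *\<^sub>R y)))"
  unfolding integral_scaleR_right conv_def
  by (subst sub[of "\<lambda>y. gauss_kernel (\<alpha>\<^sup>2 * t) (\<alpha> *\<^sub>R x - y) *\<^sub>R r y"], rule kernel_integrable(1)[OF _ B'])
    (use w in \<open>auto simp: weak_riesz_def\<close>)
 also have "... = conv (gauss_kernel t) (\<lambda>x. of_real (sgn \<alpha>) * r (\<alpha> *\<^sub>R x)) x"
  unfolding conv_def gk scaleR_diff_right by (simp add: scaleR_conv_of_real mult_ac)
 finally show "riesz_conv t b (\<lambda>x. f (\<alpha> *\<^sub>R x)) x = conv (gauss_kernel t) (\<lambda>x. of_real (sgn \<alpha>) * r (\<alpha> *\<^sub>R x)) x" .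
qed

text \<open>A representative determined by f. The r of \<open>weak_riesz\<close> is unique only
  almost everywhere, and choosing it separately for each y would give no joint measurability in (x,
  y).\<close>

definition riesz_lim :: "'a::euclidean_space \<Rightarrow> ('a \<Rightarrow> complex) \<Rightarrow> 'a \<Rightarrow> complex" where
 "riesz_lim b f x = lim (\<lambda>n. riesz_conv (1 / real (Suc n)) b f x)"

lemma weak_riesz_lim:
 assumes w: "weak_riesz b f r"
 shows "AE x in lborel. r x = riesz_lim b f x"
proof -
 have sq: "filterlim (\<lambda>n. 1 / real (Suc n)) (at_right 0) sequentially"
  by (intro filterlim_at_right_sequence LIMSEQ_inverse_real_of_nat[unfolded inverse_eq_divide]) auto
 show ?thesis using weak_riesz_tendsto[OF w]
  by eventually_elim (unfold riesz_lim_def, rule limI[symmetric], erule filterlim_compose[OF _ sq])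
qed

lemma weak_riesz_AE_cong:
 assumes w: "weak_riesz b f r" and eq: "AE x in lborel. r x = q x" and [measurable]: "q \<in> borel_fun"
 shows "weak_riesz b f q" and "(LL x. norm (q x)) = (LL x. norm (r x))" (is ?g1)
proof -
 have r: "integrable lborel r" using w by (simp add: weak_riesz_def)
 note [measurable] = borel_measurable_integrable[OF r, simplified]
 have "integrable lborel q" using r eq by (subst integrable_cong_AE[where g = r]) (auto elim: AE_mp)
 moreover have "conv (gauss_kernel t) q x = conv (gauss_kernel t) r x" for t x
  unfolding conv_def by (rule integral_cong_AE) (measurable, use eq in \<open>auto elim: AE_mp\<close>)
 ultimately show "weak_riesz b f q" using w by (simp add: weak_riesz_def)
 show ?g1
  by (rule integral_cong_AE) (measurable, use eq in \<open>auto elim: AE_mp\<close>)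
qed

text \<open>Telescoping along the segment from \<open>0\<close> to \<open>y\<close> in steps of length at most \<open>1\<close> gives linear growth in \<open>y\<close>.\<close>

lemma weak_riesz_difference:
 fixes f :: "'a::euclidean_space \<Rightarrow> complex"
 assumes f: "integrable lborel f"
  and w: "\<And>y. norm y \<le> 1 \<Longrightarrow> \<exists>r. weak_riesz b (\<lambda>x. f x - f (x - y)) r \<and> (LL x. norm (r x)) \<le> A"
 defines "R y x \<equiv> riesz_lim b (\<lambda>x. f x - f (x - y)) x"
 shows "weak_riesz b (\<lambda>x. f x - f (x - y)) (R y)" (is ?g1) and "(LL x. norm (R y x)) \<le> A * (1 + norm y)" (is ?g2)
  and "(\<lambda>(x, y). R y x) \<in> borel_measurable (borel \<Otimes>\<^sub>M borel)" (is ?g3)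
proof -
 have [measurable]: "f \<in> borel_fun" using f by auto
 have A: "A \<ge> 0" using w[of 0] by (auto intro: order_trans[rotated])
 \<comment> \<open>By linearity the limit for f(x) - f(x - y) is one of differences of translates of
   these fixed functions, hence jointly measurable.\<close>
 define \<Psi> where "\<Psi> n = riesz_conv (1 / real (Suc n)) b f" for n
 have "R y x = lim (\<lambda>n. \<Psi> n x - \<Psi> n (x - y))" for y x
  unfolding R_def riesz_lim_def
 proof (intro arg_cong[where f = lim] ext)
  fix n
  have "0 < 1 / real (Suc n)" by simp
  then obtain B where B: "\<And>x::'a. \<bar>riesz_heat (1 / real (Suc n)) x \<bullet> b\<bar> \<le> B" using riesz_component_bounded by blast
  have "riesz_conv (1 / real (Suc n)) b (\<lambda>x. 1 * f x + (-1) * f (x - y)) x = 1 * \<Psi> n x + (-1) * riesz_conv (1 / real (Suc n)) b (\<lambda>x. f (x - y)) x"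
   unfolding \<Psi>_def by (rule conv_lincomb[OF _ B f]) (use f in \<open>auto simp: integral_lborel_shift(2)\<close>)
  then show "riesz_conv (1 / real (Suc n)) b (\<lambda>x. f x - f (x - y)) x = \<Psi> n x - \<Psi> n (x - y)"
   by (simp add: conv_translate \<Psi>_def)
 qed
 moreover have [measurable]: "\<Psi> n \<in> borel_fun" for n unfolding \<Psi>_def by measurable
 ultimately show Rm: ?g3 by (simp add: split_beta')
 have Rmy: "R y \<in> borel_fun" for y
  using measurable_compose[OF measurable_Pair2' Rm, of y] by simp
 have *: "\<exists>r. weak_riesz b (\<lambda>x. f x - f (x - real k *\<^sub>R u)) r \<and> (LL x. norm (r x)) \<le> real k * A" if u: "norm u \<le> 1" for u k
 proof (induction k)
  case 0
  show ?case by (intro exI[of _ "\<lambda>_. 0"]) (simp add: weak_riesz_def conv_def)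
 next
  case (Suc k)
  then obtain r where r: "weak_riesz b (\<lambda>x. f x - f (x - real k *\<^sub>R u)) r" "(LL x. norm (r x)) \<le> real k * A" by blast
  obtain q where q: "weak_riesz b (\<lambda>x. f x - f (x - u)) q" "(LL x. norm (q x)) \<le> A" using w[OF u] by blast
  define q' where "q' x = q (x - real k *\<^sub>R u)" for x
  have q': "weak_riesz b (\<lambda>x. f (x - real k *\<^sub>R u) - f (x - real k *\<^sub>R u - u)) q'"
   unfolding q'_def by (rule weak_riesz_translate[OF q(1)])
  have i: "integrable lborel r" "integrable lborel q'" using r q' by (auto simp: weak_riesz_def)
  have "weak_riesz b (\<lambda>x. f x - f (x - real (Suc k) *\<^sub>R u)) (\<lambda>x. r x + q' x)"
   using weak_riesz_lincomb[OF r(1) q', of 1 1] by (simp add: algebra_simps)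
  moreover have "(LL x. norm (r x + q' x)) \<le> real (Suc k) * A"
  proof -
   have "(LL x. norm (r x + q' x)) \<le> (LL x. norm (r x) + norm (q' x))"
    using i by (intro integral_mono norm_triangle_ineq) auto
   also have "... = (LL x. norm (r x)) + (LL x. norm (q' x))"
    using i by (intro L_integral_add) auto
   also have "(LL x. norm (q' x)) = (LL x. norm (q x))"
    unfolding q'_def by (rule integral_lborel_shift(1))
   finally show ?thesis using r q by (simp add: algebra_simps)
  qed
  ultimately show ?case by blast
 qed
 \<comment> \<open>An integer between |y| and 1 + |y|: the steps y / k then have length at most
   1.\<close>
 define k where "k = Suc (nat \<lfloor>norm y\<rfloor>)"
 have k: "norm y \<le> real k" "real k \<le> 1 + norm y" "real k > 0"
  using of_nat_nat[of "\<lfloor>norm y\<rfloor>", where 'a = real] zero_le_floor[of "norm y"] norm_ge_zero[of y] unfolding k_def by linarith+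
 then have "norm ((1 / real k) *\<^sub>R y) \<le> 1" by (simp add: divide_le_eq)
 from *[OF this, of k] k(3) obtain r where r: "weak_riesz b (\<lambda>x. f x - f (x - y)) r" "(LL x. norm (r x)) \<le> real k * A" by auto
 note c = weak_riesz_AE_cong[OF r(1) weak_riesz_lim[OF r(1), folded R_def] Rmy]
 show ?g1 by (rule c)
 have "real k * A \<le> A * (1 + norm y)" using k A by (simp add: mult.commute mult_left_mono)
 then show ?g2 using c(2) r(2) by simp
qed

text \<open>The first moment of \<phi> absorbs the linear growth of the norms of the differences,
  and its integral 1 makes f itself appear. Boundedness of \<phi> makes the convolution converge at
  every point rather than almost everywhere.\<close>

lemma weak_riesz_minus_smoothing:
 fixes f \<phi> :: "'a::euclidean_space \<Rightarrow> complex"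
 assumes f: "integrable lborel f"
  and w: "\<And>y. norm y \<le> 1 \<Longrightarrow> \<exists>r. weak_riesz b (\<lambda>x. f x - f (x - y)) r \<and> (LL x. norm (r x)) \<le> A"
  and \<phi>: "\<phi> \<in> borel_fun" "\<And>x. norm (\<phi> x) \<le> B" "integrable lborel (\<lambda>y. (1 + norm y) * norm (\<phi> y))"
   "(LL y. \<phi> y) = 1"
 shows "\<exists>r. weak_riesz b (\<lambda>x. f x - (LL y. f y * \<phi> (x - y))) r"
proof -
 have [measurable]: "f \<in> borel_fun" using f by auto
 note [measurable] = \<phi>(1)
 have A: "A \<ge> 0" using w[of 0] by (auto intro: order_trans[rotated])
 define R where "R y x = riesz_lim b (\<lambda>x. f x - f (x - y)) x" for y x
 note R = weak_riesz_difference[OF f w, folded R_def]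
 note [measurable] = R(3)
 have \<phi>i: "integrable lborel \<phi>" by (rule L_integrable_bound[OF \<phi>(3)]) (auto simp: mult_le_cancel_right1)
 define F where "F = (LL x. norm (f x))"
 have F: "F \<ge> 0" "(N1 x. f x) = ennreal F"
  using f unfolding F_def by (auto intro!: nn_integral_eq_integral)
 define \<Phi> where "\<Phi> = (LL y. (1 + norm y) * norm (\<phi> y))"
 have \<Phi>: "\<Phi> \<ge> 0" "(NN y. ennreal ((1 + norm y) * norm (\<phi> y))) = ennreal \<Phi>"
  using \<phi>(3) unfolding \<Phi>_def by (auto intro!: nn_integral_eq_integral)
 have bnd: "(NN y. (N1 x. \<phi> y * G y x)) \<le> ennreal (C * \<Phi>)"
  if G: "\<And>y. integrable lborel (G y)" "\<And>y. (LL x. norm (G y x)) \<le> C * (1 + norm y)" and C: "C \<ge> 0" for G :: "'a \<Rightarrow> 'a \<Rightarrow> complex" and C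
 proof -
  have "(N1 x. \<phi> y * G y x) \<le> ennreal C * ennreal ((1 + norm y) * norm (\<phi> y))" for y
  proof -
   have "(N1 x. \<phi> y * G y x) = ennreal (LL x. norm (\<phi> y * G y x))"
    using G by (intro nn_integral_eq_integral) auto
   also have "(LL x. norm (\<phi> y * G y x)) = norm (\<phi> y) * (LL x. norm (G y x))" by (simp add: norm_mult)
   also have "ennreal ... \<le> ennreal (norm (\<phi> y) * (C * (1 + norm y)))" by (intro ennreal_leI mult_left_mono G) auto
   finally show ?thesis using C by (simp add: ennreal_mult[symmetric] mult_ac)
  qed
  then have "(NN y. (N1 x. \<phi> y * G y x)) \<le> (NN y. ennreal C * ennreal ((1 + norm y) * norm (\<phi> y)))"
   by (intro nn_integral_mono)
  also have "... = ennreal C * ennreal \<Phi>" using \<phi>(1) by (subst nn_integral_cmult) (auto simp: \<Phi>)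
  finally show ?thesis using C \<Phi> by (simp add: ennreal_mult)
 qed
 have h: "integrable lborel (\<lambda>x. f x - f (x - y))" "(LL x. norm (f x - f (x - y))) \<le> (2 * F) * (1 + norm y)" for y
 proof -
  show i: "integrable lborel (\<lambda>x. f x - f (x - y))" using f by (auto simp: integral_lborel_shift(2))
  have "(LL x. norm (f x - f (x - y))) \<le> (LL x. norm (f x) + norm (f (x - y)))" (is "?l \<le> _")
   using i f by (intro integral_mono norm_triangle_ineq4) (auto simp: integral_lborel_shift(2)[of "\<lambda>x. norm (f x)"])
  also have "... = 2 * F" using f integral_lborel_shift[of "\<lambda>x. norm (f x)" y] by (simp add: F_def)
  also have "... \<le> (2 * F) * (1 + norm y)" using F mult_left_mono[of 1 "1 + norm y" "2 * F"] by simp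
  finally show "?l \<le> (2 * F) * (1 + norm y)" .
 qed
 have "weak_riesz b (\<lambda>x. LL y. \<phi> y * (f x - f (x - y))) (\<lambda>x. LL y. \<phi> y * R y x)"
 proof (rule weak_riesz_superposition[where A = "2 * F * \<Phi>" and B = "A * \<Phi>"])
  show "sigma_finite_measure (lborel :: 'a measure)" by (rule sigma_finite_lborel)
  show "(NN y. (N1 x. \<phi> y * (f x - f (x - y)))) \<le> ennreal (2 * F * \<Phi>)"
   by (rule bnd[OF h]) (use F in auto)
  show "(NN y. (N1 x. \<phi> y * R y x)) \<le> ennreal (A * \<Phi>)"
   by (rule bnd[OF _ R(2) A]) (use R(1) in \<open>auto simp: weak_riesz_def\<close>)
  show "weak_riesz b (\<lambda>x. \<phi> y * (f x - f (x - y))) (\<lambda>x. \<phi> y * R y x)" for y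
   by (rule weak_riesz_scale[OF R(1)])
  show "(\<lambda>(x, y). \<phi> y * (f x - f (x - y))) \<in> borel_measurable (borel \<Otimes>\<^sub>M lborel)" by measurable
  have "(\<lambda>p. \<phi> (snd p) * (case p of (x, y) \<Rightarrow> R y x)) \<in> borel_measurable (borel \<Otimes>\<^sub>M borel)" by measurable
  then show "(\<lambda>(x, y). \<phi> y * R y x) \<in> borel_measurable (borel \<Otimes>\<^sub>M lborel)"
   by (simp add: split_beta' cong: measurable_cong_sets)
 qed (use F \<Phi> A in auto)
 moreover have "(LL y. \<phi> y * (f x - f (x - y))) = f x - (LL y. f y * \<phi> (x - y))" for x
 proof -
  have fx: "integrable lborel (\<lambda>y. f (x - y))" using f by (simp add: integral_lborel_reflect(2))
  have i: "integrable lborel (\<lambda>y. \<phi> y * f (x - y))"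
   by (rule L_integrable_bound[OF integrable_mult_right[OF integrable_norm[OF fx], of "B"]])
     (auto simp: norm_mult intro!: AE_I2 order_trans[OF mult_right_mono[OF \<phi>(2)] abs_ge_self])
  have "(LL y. \<phi> y * (f x - f (x - y))) = (LL y. \<phi> y * f x - \<phi> y * f (x - y))" by (simp add: algebra_simps)
  also have "... = f x - (LL y. \<phi> y * f (x - y))"
   using \<phi>i i \<phi>(4) by simp
  also have "(LL y. \<phi> y * f (x - y)) = (LL y. f y * \<phi> (x - y))"
   using integral_lborel_reflect(1)[of "\<lambda>y. f y * \<phi> (x - y)" x] by (simp add: mult.commute)
  finally show ?thesis .
 qed
 ultimately show ?thesis by auto
qed

subsection \<open>A bump function and its Fourier transform\<close>

text \<open>The cube makes the function twice continuously differentiable, so three integrations by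
  parts give decay |u|^(-3) of \<open>bump_hat\<close>, enough for a first moment.\<close>

definition bump :: "real \<Rightarrow> real \<Rightarrow> real" where "bump dl eta = max 0 (1 - (eta / dl)\<^sup>2) ^ 3"

definition bump_hat :: "real \<Rightarrow> real \<Rightarrow> complex" where
 "bump_hat dl u = (LL eta. of_real (bump dl eta) * cis (2 * pi * eta * u))"

lemma measurable_bump [measurable]: "bump dl \<in> borel_fun"
 unfolding bump_def[abs_def] by measurable

lemma bump_bounds: "0 \<le> bump dl eta" "bump dl eta \<le> 1" "bump dl 0 = 1"
 by (auto simp: bump_def intro!: power_le_one)

lemma bump_support:
 assumes "dl > 0" "\<bar>eta\<bar> \<ge> dl" shows "bump dl eta = 0"
proof -
 have "1 \<le> \<bar>eta / dl\<bar>" using assms by (simp add: abs_divide)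
 then have "1 \<le> (eta / dl)\<^sup>2" by (metis one_le_power power2_abs)
 then show ?thesis by (simp add: bump_def)
qed

lemma bump_eq:
 assumes "dl > 0"
 shows "bump dl eta = indicator {-dl..dl} eta * (1 - 1 / dl\<^sup>2 * eta\<^sup>2) ^ 3"
proof (cases "\<bar>eta\<bar> \<le> dl")
 case True
 then have "(eta / dl)\<^sup>2 \<le> 1" using assms by (intro abs_square_le_1[THEN iffD2]) (simp add: abs_divide)
 then show ?thesis using True by (simp add: bump_def power_divide abs_le_iff indicator_def minus_le_iff)
qed (use assms bump_support[of dl eta] in \<open>auto simp: indicator_def\<close>)

lemma integrable_bump:
 assumes dl: "dl > 0" and f: "f \<in> borel_fun" "\<And>x. norm (f x) \<le> B"
 shows "integrable lborel (\<lambda>eta. of_real (bump dl eta) * f eta :: complex)"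
proof (rule L_integrable_bound)
 show "integrable lborel (\<lambda>eta. indicator {-dl..dl} eta *\<^sub>R B)" by (intro integrable_scaleR_left integrable_real_indicator) (auto simp: emeasure_lborel_Icc_eq)
 show "AE eta in lborel. norm (of_real (bump dl eta) * f eta) \<le> norm (indicator {-dl..dl} eta *\<^sub>R B)"
 proof (intro AE_I2)
  fix eta
  have B: "B \<ge> 0" using f(2) norm_ge_zero order_trans by blast
  show "norm (of_real (bump dl eta) * f eta) \<le> norm (indicator {-dl..dl} eta *\<^sub>R B)"
   using bump_support[OF dl, of eta] mult_mono[OF bump_bounds(2)[of dl eta] f(2)[of eta]] bump_bounds(1)[of dl eta] B
   by (cases "\<bar>eta\<bar> \<le> dl") (auto simp: norm_mult indicator_def)
 qed
qed (use f in measurable)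

lemma fourier_by_parts:
 fixes f f' :: "real \<Rightarrow> real"
 assumes f: "\<And>x. (f has_real_derivative f' x) (at x)" and f': "continuous_on UNIV f'"
  and 0: "f (-dl) = 0" "f dl = 0" and dl: "dl > 0" and \<theta>: "\<theta> \<noteq> 0"
 shows "(LL eta. indicator {-dl..dl} eta *\<^sub>R (of_real (f eta) * cis (\<theta> * eta))) =
  \<i> / \<theta> * (LL eta. indicator {-dl..dl} eta *\<^sub>R (of_real (f' eta) * cis (\<theta> * eta)))"
proof -
 let ?I = "\<lambda>f. LL eta. indicator {-dl..dl} eta *\<^sub>R (of_real (f eta) * cis (\<theta> * eta))"
 have cf: "continuous_on UNIV f" using f by (auto simp: continuous_on_eq_continuous_at intro: DERIV_isCont)
 have i: "integrable lborel (\<lambda>eta. indicator {-dl..dl} eta *\<^sub>R (of_real (g eta) * cis (\<theta> * eta)))" if "continuous_on UNIV g" for g :: "real \<Rightarrow> real"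
  by (rule borel_integrable_compact) (auto intro!: continuous_intros continuous_on_subset[OF that])
 have d: "((\<lambda>eta. of_real (f eta) * cis (\<theta> * eta)) has_vector_derivative (of_real (f' x) * cis (\<theta> * x) + \<theta> * \<i> * (of_real (f x) * cis (\<theta> * x)))) (at x within A)" for x A
  unfolding cis_conv_exp
  by (auto intro!: derivative_eq_intros has_vector_derivative_real_field f[THEN DERIV_subset] simp: has_real_derivative_iff_has_vector_derivative[symmetric])
 have "(LL eta. indicator {-dl..dl} eta *\<^sub>R (of_real (f' eta) * cis (\<theta> * eta) + \<theta> * \<i> * (of_real (f eta) * cis (\<theta> * eta)))) =
  of_real (f dl) * cis (\<theta> * dl) - of_real (f (-dl)) * cis (\<theta> * -dl)"
  using dl by (intro integral_FTC_atLeastAtMost d continuous_intros continuous_on_subset[OF f'] continuous_on_subset[OF cf]) auto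
 then have "(LL eta. indicator {-dl..dl} eta *\<^sub>R (of_real (f' eta) * cis (\<theta> * eta)) + \<theta> * \<i> * (indicator {-dl..dl} eta *\<^sub>R (of_real (f eta) * cis (\<theta> * eta)))) = 0"
  using 0 by (simp add: scaleR_add_right)
 then have "?I f' + \<theta> * \<i> * ?I f = 0"
  by (subst (asm) L_integral_add) (auto intro!: integrable_mult_right i f' cf simp del: mult_scaleR_right)
 then have "?I f' = - (\<theta> * \<i> * ?I f)" by (simp only: eq_neg_iff_add_eq_0)
 then show ?thesis using \<theta> by simp
qed

lemma bump_hat_decay:
 assumes dl: "dl > 0"
 shows "\<exists>C\<ge>0. \<forall>u. norm (bump_hat dl u) \<le> C / (1 + \<bar>u\<bar>) ^ 3"
proof -
 define c where "c = 1 / dl\<^sup>2"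
 have c: "c * dl\<^sup>2 = 1" using dl by (simp add: c_def)
 let ?I = "\<lambda>f u. LL eta. indicator {-dl..dl} eta *\<^sub>R (complex_of_real (f eta) * cis (u * eta))"
 define p where "p eta = 1 - c * eta\<^sup>2" for eta
 \<comment> \<open>Successive derivatives. As p vanishes at both endpoints, f0 does so to third
   order; hence f0, f1 and f2 are zero there and three integrations by parts leave no boundary
   terms.\<close>
 define f0 f1 f2 f3 where "f0 eta = p eta ^ 3" and "f1 eta = - 6 * c * eta * (p eta)\<^sup>2"
  and "f2 eta = - 6 * c * (p eta)\<^sup>2 + 24 * c\<^sup>2 * eta\<^sup>2 * p eta" and "f3 eta = 72 * c\<^sup>2 * eta * p eta - 48 * c ^ 3 * eta ^ 3" for eta
 note fs = f0_def f1_def f2_def f3_def p_def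
 have d: "(f0 has_real_derivative f1 x) (at x)" "(f1 has_real_derivative f2 x) (at x)" "(f2 has_real_derivative f3 x) (at x)" for x
  unfolding fs[abs_def] by (auto intro!: derivative_eq_intros simp: algebra_simps power2_eq_square power3_eq_cube)
 have co: "continuous_on UNIV f1" "continuous_on UNIV f2" "continuous_on UNIV f3"
  unfolding fs[abs_def] by (intro continuous_intros)+
 have z: "f0 (-dl) = 0" "f0 dl = 0" "f1 (-dl) = 0" "f1 dl = 0" "f2 (-dl) = 0" "f2 dl = 0"
  using c by (auto simp: fs)
 have b: "norm (?I f u) \<le> (LL eta. indicator {-dl..dl} eta * \<bar>f eta\<bar>)" for f :: "real \<Rightarrow> real" and u
  by (rule order_trans[OF integral_norm_bound]) (simp add: norm_mult abs_mult)
 define M where "M f = (LL eta. indicator {-dl..dl} eta * \<bar>f eta\<bar>)" for f :: "real \<Rightarrow> real"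
 have M: "M f \<ge> 0" for f by (auto simp: M_def)
 have hat: "bump_hat dl u = ?I f0 (2 * pi * u)" for u
  unfolding bump_hat_def bump_eq[OF dl] fs c_def
  by (intro L_integral_cong refl) (simp add: scaleR_conv_of_real mult_ac)
 show ?thesis
 \<comment> \<open>8 = 2^3 because 1 + |u| is at most twice the larger of 1 and |u|.\<close>
 proof (intro exI[of _ "8 * (M f0 + M f3)"] conjI allI)
  fix u :: real
  have n0: "norm (bump_hat dl u) \<le> M f0" unfolding hat M_def by (rule b)
  show "norm (bump_hat dl u) \<le> 8 * (M f0 + M f3) / (1 + \<bar>u\<bar>) ^ 3"
  proof (cases "\<bar>u\<bar> \<le> 1")
   case True
   have "(1 + \<bar>u\<bar>) ^ 3 \<le> 2 ^ 3" using True by (intro power_mono) auto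
   then have "norm (bump_hat dl u) * (1 + \<bar>u\<bar>) ^ 3 \<le> M f0 * 8" using n0 M by (intro mult_mono) auto
   also have "... \<le> 8 * (M f0 + M f3)" using M[of f3] by simp
   finally show ?thesis by (simp add: pos_le_divide_eq)
  next
   case False
   have u: "2 * pi * u \<noteq> 0" using False by auto
   have "bump_hat dl u = (\<i> / (2 * pi * u)) ^ 3 * ?I f3 (2 * pi * u)"
    unfolding hat fourier_by_parts[OF d(1) co(1) z(1,2) dl u] fourier_by_parts[OF d(2) co(2) z(3,4) dl u]
     fourier_by_parts[OF d(3) co(3) z(5,6) dl u] by (simp add: power3_eq_cube)
   then have "norm (bump_hat dl u) = norm (?I f3 (2 * pi * u)) / (2 * pi * \<bar>u\<bar>) ^ 3"
    by (simp add: norm_mult norm_power norm_divide power_divide)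
   also have "... \<le> M f3 / \<bar>u\<bar> ^ 3"
   proof (rule frac_le)
    have "1 * \<bar>u\<bar> \<le> 2 * pi * \<bar>u\<bar>" using pi_gt3 by (intro mult_right_mono) auto
    then show "\<bar>u\<bar> ^ 3 \<le> (2 * pi * \<bar>u\<bar>) ^ 3" by (intro power_mono) auto
   qed (use M b False in \<open>auto simp: M_def\<close>)
   also have "... = 8 * M f3 / (2 * \<bar>u\<bar>) ^ 3" by (simp add: power_mult_distrib)
   also have "... \<le> 8 * (M f0 + M f3) / (1 + \<bar>u\<bar>) ^ 3"
    using M False by (intro frac_le power_mono) auto
   finally show ?thesis .
  qed
 qed (use M in simp)
qed

section \<open>Fourier series on the unit interval\<close>

abbreviation unit_interval :: "real \<Rightarrow> real" where "unit_interval \<equiv> indicator {-1/2..1/2}"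

lemma integral_cis_period:
 fixes m :: int
 shows "(LL eta. unit_interval eta *\<^sub>R cis (2 * pi * m * eta)) = (if m = 0 then 1 else 0)"
proof (cases "m = 0")
 case False
 have "(LL eta. unit_interval eta *\<^sub>R cis (2 * pi * m * eta)) =
  cis (2 * pi * m * (1/2)) / (2 * pi * m * \<i>) - cis (2 * pi * m * (-1/2)) / (2 * pi * m * \<i>)"
  unfolding cis_conv_exp using False
  by (intro integral_FTC_atLeastAtMost) (auto intro!: derivative_eq_intros has_vector_derivative_real_field continuous_intros)
 moreover have "cis (2 * pi * m * (1/2)) = cis (2 * pi * m * (-1/2))"
 proof -
  have "cis (2 * pi * m * (1/2)) = cis (2 * pi * m * (-1/2) + 2 * pi * m)" by (simp add: algebra_simps)
  also have "... = cis (2 * pi * m * (-1/2))" unfolding cis_mult[symmetric] by (simp add: cis_multiple_2pi)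
  finally show ?thesis .
 qed
 ultimately show ?thesis using False by simp
qed simp

text \<open>Bessel's inequality bounds every finite sum of squared coefficients by the same
  constant, so the squares are summable along any injective enumeration and the coefficients tend to
  0.\<close>

lemma Riemann_Lebesgue_bounded:
 fixes g :: "real \<Rightarrow> complex"
 assumes [measurable]: "g \<in> borel_fun" and B: "\<And>x. norm (g x) \<le> B"
 defines "c m \<equiv> (LL eta. unit_interval eta *\<^sub>R (g eta * cis (- 2 * pi * of_int m * eta)))"
 shows "(\<lambda>n. c (int n)) \<longlonglongrightarrow> 0" (is ?g1) "(\<lambda>n. c (- int n)) \<longlonglongrightarrow> 0"
proof -
 let ?L = "\<lambda>h. LL eta. unit_interval eta *\<^sub>R h eta"
 have i: "integrable lborel (\<lambda>eta. unit_interval eta *\<^sub>R h eta)"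
  if [measurable]: "h \<in> borel_fun" and b: "\<And>x. norm (h x) \<le> A" for h :: "real \<Rightarrow> complex" and A
 proof (rule L_integrable_bound)
  show "integrable lborel (\<lambda>eta. unit_interval eta *\<^sub>R A)" by (intro integrable_scaleR_left integrable_real_indicator) (auto simp: emeasure_lborel_Icc_eq)
  show "AE eta in lborel. norm (unit_interval eta *\<^sub>R h eta) \<le> norm (unit_interval eta *\<^sub>R A)"
   using b order_trans[OF b abs_ge_self] by (auto simp: indicator_def)
 qed measurable
 have Bessel: "(\<Sum>m\<in>A. (norm (c m))\<^sup>2) \<le> Re (?L (\<lambda>eta. g eta * cnj (g eta)))" if A: "finite A" for A :: "int set"
 proof -
  define S where "S eta = (\<Sum>m\<in>A. c m * cis (2 * pi * m * eta))" for eta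
  have [measurable]: "S \<in> borel_fun" unfolding S_def by measurable
  have Sb: "norm (S eta) \<le> (\<Sum>m\<in>A. norm (c m))" for eta
   unfolding S_def by (rule sum_norm_le) (simp add: norm_mult)
  have iS: "integrable lborel (\<lambda>eta. unit_interval eta *\<^sub>R (h eta * cnj (S eta)))" if "h \<in> borel_fun" "\<And>x. norm (h x) \<le> D" for h D
   by (rule i[of _ "D * (\<Sum>m\<in>A. norm (c m))"]) (use that Sb in \<open>auto simp: norm_mult intro!: mult_mono order_trans[OF norm_ge_zero that(2)]\<close>)
  have gS: "?L (\<lambda>eta. h eta * cnj (S eta)) = (\<Sum>m\<in>A. cnj (c m) * ?L (\<lambda>eta. h eta * cis (- 2 * pi * of_int m * eta)))"
   if h: "h \<in> borel_fun" "\<And>x. norm (h x) \<le> D" for h D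
  proof -
   have "?L (\<lambda>eta. h eta * cnj (S eta)) = (LL eta. (\<Sum>m\<in>A. cnj (c m) * (unit_interval eta *\<^sub>R (h eta * cis (- 2 * pi * of_int m * eta)))))"
    by (intro L_integral_cong refl)
      (simp add: S_def cnj_sum sum_distrib_left scaleR_sum_right cis_cnj scaleR_conv_of_real mult_ac)
   also have "... = (\<Sum>m\<in>A. cnj (c m) * ?L (\<lambda>eta. h eta * cis (- 2 * pi * of_int m * eta)))"
   proof (subst L_integral_sum)
    show "integrable lborel (\<lambda>eta. cnj (c m) * (unit_interval eta *\<^sub>R (h eta * cis (- 2 * pi * of_int m * eta))))" for m
     by (intro integrable_mult_right i[of _ D]) (use h in \<open>auto simp: norm_mult\<close>)
   qed (simp del: mult_scaleR_right)
   finally show ?thesis .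
  qed
  have SS: "?L (\<lambda>eta. S eta * cnj (S eta)) = (\<Sum>m\<in>A. cnj (c m) * c m)"
  proof -
   have "?L (\<lambda>eta. S eta * cis (- 2 * pi * of_int m * eta)) = c m" if m: "m \<in> A" for m
   proof -
    have "?L (\<lambda>eta. S eta * cis (- 2 * pi * of_int m * eta)) = (LL eta. (\<Sum>l\<in>A. c l * (unit_interval eta *\<^sub>R cis (2 * pi * of_int (l - m) * eta))))"
     by (intro L_integral_cong refl)
       (simp only: S_def sum_distrib_right scaleR_sum_right, intro sum.cong refl, simp add: cis_mult mult.assoc right_diff_distrib left_diff_distrib)
    also have "... = (\<Sum>l\<in>A. c l * ?L (\<lambda>eta. cis (2 * pi * of_int (l - m) * eta)))"
    proof (subst L_integral_sum)
     show "integrable lborel (\<lambda>eta. c l * (unit_interval eta *\<^sub>R cis (2 * pi * of_int (l - m) * eta)))" for l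
      by (intro integrable_mult_right i[of _ 1]) auto
    qed (simp del: mult_scaleR_right)
    also have "... = (\<Sum>l\<in>A. if l = m then c l else 0)"
     unfolding integral_cis_period by (intro sum.cong) auto
    finally show ?thesis using A m by simp
   qed
   then show ?thesis by (subst gS[OF _ Sb]) (auto intro!: sum.cong)
  qed
  have gS': "?L (\<lambda>eta. g eta * cnj (S eta)) = (\<Sum>m\<in>A. cnj (c m) * c m)"
   unfolding gS[OF assms(1) B] c_def ..
  have "(\<Sum>m\<in>A. cnj (c m) * c m) = of_real (\<Sum>m\<in>A. (norm (c m))\<^sup>2)"
   by (simp add: complex_norm_square mult.commute del: of_real_power)
  note SS = SS[unfolded this] and gS' = gS'[unfolded this]
  define X Y Z where "X eta = unit_interval eta *\<^sub>R (g eta * cnj (g eta))" and "Y eta = unit_interval eta *\<^sub>R (S eta * cnj (S eta))"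
   and "Z eta = unit_interval eta *\<^sub>R (g eta * cnj (S eta))" for eta
  have r: "integrable lborel X" "integrable lborel Y" "integrable lborel Z"
   unfolding X_def Y_def Z_def using i[of "\<lambda>eta. g eta * cnj (g eta)" "B * B"] iS[OF _ Sb] iS[OF assms(1) B]
   by (auto simp: norm_mult B mult_mono' intro!: mult_mono')
  have "0 \<le> (LL eta. Re (X eta) + Re (Y eta) - 2 * Re (Z eta))"
  proof (rule integral_nonneg_AE, intro AE_I2)
   fix eta
   have "0 \<le> (Re (g eta) - Re (S eta))\<^sup>2 + (Im (g eta) - Im (S eta))\<^sup>2" by simp
   then show "0 \<le> Re (X eta) + Re (Y eta) - 2 * Re (Z eta)"
    by (simp add: X_def Y_def Z_def indicator_def power2_eq_square algebra_simps)
  qed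
  also have "... = Re (?L (\<lambda>eta. g eta * cnj (g eta))) + Re (?L (\<lambda>eta. S eta * cnj (S eta))) - 2 * Re (?L (\<lambda>eta. g eta * cnj (S eta)))"
   unfolding X_def[symmetric] Y_def[symmetric] Z_def[symmetric] using r by simp
  finally show ?thesis unfolding SS gS' by simp
 qed
 define E where "E = Re (?L (\<lambda>eta. g eta * cnj (g eta)))"
 have "(\<lambda>n. c (h n)) \<longlonglongrightarrow> 0" if h: "inj h" for h :: "nat \<Rightarrow> int"
 proof -
  have "(\<Sum>k<n. (norm (c (h k)))\<^sup>2) \<le> E" for n
   using Bessel[of "h ` {..<n}"] sum.reindex[of h "{..<n}" "\<lambda>m. (norm (c m))\<^sup>2"] h by (simp add: inj_on_subset E_def o_def)
  then have "summable (\<lambda>k. (norm (c (h k)))\<^sup>2)" by (intro summableI_nonneg_bounded) auto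
  from summable_LIMSEQ_zero[OF this] have "(\<lambda>k. norm (c (h k))) \<longlonglongrightarrow> 0" by (simp add: power_tendsto_0_iff)
  then show ?thesis by (rule tendsto_norm_zero_cancel)
 qed
 from this[of int] this[of "\<lambda>n. - int n"] show ?g1 "(\<lambda>n. c (- int n)) \<longlonglongrightarrow> 0"
  by (auto simp: inj_def)
qed

lemma norm_cis_diff: "norm (cis a - cis b) = 2 * \<bar>sin ((a - b) / 2)\<bar>"
proof -
 have "(norm (cis a - cis b))\<^sup>2 = 2 - 2 * cos (a - b)"
  using sin_cos_squared_add[of a] sin_cos_squared_add[of b] unfolding cmod_power2 by (simp add: power2_diff cos_diff del: sin_cos_squared_add sin_cos_squared_add2)
 also have "... = 2 - 2 * cos (2 * ((a - b) / 2))" by (simp only: nonzero_mult_div_cancel_left times_divide_eq_right zero_neq_numeral[symmetric] simp_thms not_False_eq_True)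
 also have "... = (2 * \<bar>sin ((a - b) / 2)\<bar>)\<^sup>2" unfolding cos_double_sin by (simp add: power_mult_distrib)
 finally show ?thesis by (rule power2_eq_imp_eq) auto
qed

lemma norm_cis_diff_le: "norm (cis a - cis b) \<le> \<bar>a - b\<bar>"
 unfolding norm_cis_diff using abs_sin_x_le_abs_x[of "(a - b) / 2"] by simp

lemma bump_lipschitz:
 assumes dl: "dl > 0" and "\<bar>eta\<bar> \<le> 1/2" "\<bar>eta'\<bar> \<le> 1/2"
 shows "\<bar>bump dl eta - bump dl eta'\<bar> \<le> 3 / dl\<^sup>2 * \<bar>eta - eta'\<bar>"
proof -
 define a b where "a = max 0 (1 - (eta / dl)\<^sup>2)" and "b = max 0 (1 - (eta' / dl)\<^sup>2)"
 have ab: "0 \<le> a" "a \<le> 1" "0 \<le> b" "b \<le> 1" by (auto simp: a_def b_def)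
 have "a * a \<le> 1" "a * b \<le> 1" "b * b \<le> 1" using ab by (auto intro: mult_le_one)
 moreover have "0 \<le> a * a" "0 \<le> a * b" "0 \<le> b * b" using ab by auto
 ultimately have q: "\<bar>a * a + a * b + b * b\<bar> \<le> 3" by linarith
 have "\<bar>a ^ 3 - b ^ 3\<bar> = \<bar>a - b\<bar> * \<bar>a * a + a * b + b * b\<bar>"
  unfolding abs_mult[symmetric] by (simp add: algebra_simps power3_eq_cube)
 also have "... \<le> \<bar>a - b\<bar> * 3" by (intro mult_left_mono q) simp
 also have "\<bar>a - b\<bar> \<le> \<bar>(eta / dl)\<^sup>2 - (eta' / dl)\<^sup>2\<bar>" unfolding a_def b_def by linarith
 also have "... = \<bar>eta - eta'\<bar> * \<bar>eta + eta'\<bar> / dl\<^sup>2"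
  by (simp add: power_divide diff_divide_distrib[symmetric] abs_mult[symmetric] power2_eq_square square_diff_square_factored mult.commute)
 also have "... \<le> \<bar>eta - eta'\<bar> * 1 / dl\<^sup>2"
  using assms by (intro divide_right_mono mult_left_mono) auto
 finally show ?thesis by (simp add: bump_def a_def b_def mult.commute)
qed

text \<open>The Fourier series of \<open>bump dl eta cis (2 \<pi> eta x)\<close> on the unit interval converges pointwise: after
 division by \<open>cis (2 \<pi> (eta - eta0)) - 1\<close> the partial sums at \<open>eta0\<close> telescope to Fourier coefficients, which vanish at infinity.\<close>

lemma bump_hat_partial_sums:
 fixes x eta0 :: real
 assumes dl: "0 < dl" "dl < 1/2" and eta0: "\<bar>eta0\<bar> < 1/2"
 shows "(\<lambda>N. \<Sum>m\<in>{- int N..int N}. bump_hat dl (x - of_int m) * cis (2 * pi * eta0 * of_int m))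
  \<longlonglongrightarrow> of_real (bump dl eta0) * cis (2 * pi * eta0 * x)"
proof -
 define V where "V = of_real (bump dl eta0) * cis (2 * pi * eta0 * x)"
 define f where "f eta = of_real (bump dl eta) * cis (2 * pi * eta * x) - V" for eta
 define D where "D eta = cis (2 * pi * (eta - eta0)) - 1" for eta
 define g where "g eta = unit_interval eta *\<^sub>R (f eta / D eta)" for eta
 have [measurable]: "g \<in> borel_fun" unfolding g_def[abs_def] f_def D_def by measurable
 define L where "L = 3 / dl\<^sup>2 + 2 * pi * \<bar>x\<bar>"
 have fL: "norm (f eta) \<le> L * \<bar>eta - eta0\<bar>" if eta: "\<bar>eta\<bar> \<le> 1/2" for eta
 proof -
  have "f eta = of_real (bump dl eta - bump dl eta0) * cis (2 * pi * eta * x) + of_real (bump dl eta0) * (cis (2 * pi * eta * x) - cis (2 * pi * eta0 * x))"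
   by (simp add: f_def V_def algebra_simps)
  also have "norm ... \<le> \<bar>bump dl eta - bump dl eta0\<bar> + \<bar>bump dl eta0\<bar> * norm (cis (2 * pi * eta * x) - cis (2 * pi * eta0 * x))"
   by (intro order_trans[OF norm_triangle_ineq] add_mono) (auto simp: norm_mult simp del: of_real_diff)
  also have "... \<le> \<bar>bump dl eta - bump dl eta0\<bar> + 1 * \<bar>2 * pi * eta * x - 2 * pi * eta0 * x\<bar>"
   using bump_bounds(1,2)[of dl eta0] by (intro add_left_mono mult_mono norm_cis_diff_le) auto
  also have "2 * pi * eta * x - 2 * pi * eta0 * x = (2 * pi * x) * (eta - eta0)" by (simp add: algebra_simps)
  also have "\<bar>bump dl eta - bump dl eta0\<bar> + 1 * \<bar>(2 * pi * x) * (eta - eta0)\<bar> \<le> 3 / dl\<^sup>2 * \<bar>eta - eta0\<bar> + 2 * pi * \<bar>x\<bar> * \<bar>eta - eta0\<bar>"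
   using bump_lipschitz[OF dl(1) eta, of eta0] eta0 by (intro add_mono) (auto simp: abs_mult)
  finally show ?thesis by (simp add: L_def algebra_simps)
 qed
 \<comment> \<open>|D eta| is 2 |sin (pi (eta - eta0))|, a multiple of |eta - eta0| times a sinc
   factor. As |eta0| < 1/2, the argument stays strictly between -pi and pi, so the continuous factor
   has a positive minimum.\<close>
 obtain c where c: "c > 0" "\<And>eta. \<bar>eta\<bar> \<le> 1/2 \<Longrightarrow> c * \<bar>eta - eta0\<bar> \<le> norm (D eta)"
 proof -
  define h where "h eta = \<bar>sinc (pi * (eta - eta0))\<bar>" for eta
  have "continuous_on {-1/2..1/2} h" unfolding h_def by (intro continuous_intros)
  from continuous_attains_inf[OF compact_Icc _ this]
  obtain y where y: "y \<in> {-1/2..1/2}" "\<And>eta. eta \<in> {-1/2..1/2} \<Longrightarrow> h y \<le> h eta" by auto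
  have "\<bar>y - eta0\<bar> < 1" using y(1) eta0 by auto
  then have "\<bar>pi * (y - eta0)\<bar> < pi" by (simp add: abs_mult)
  then have "h y \<noteq> 0"
   using sin_gt_zero[of "pi * (y - eta0)"] sin_gt_zero[of "- (pi * (y - eta0))"] unfolding h_def abs_less_iff
   by (cases "y < eta0") (auto simp: mult_less_0_iff)
  then have h: "h y > 0" by (simp add: h_def)
  show thesis
  proof (rule that[of "2 * pi * h y"])
   fix eta :: real assume eta: "\<bar>eta\<bar> \<le> 1/2"
   have "2 * pi * h y * \<bar>eta - eta0\<bar> \<le> 2 * pi * h eta * \<bar>eta - eta0\<bar>" (is "?l \<le> _") using eta by (intro mult_right_mono mult_left_mono y(2)) auto
   also have "... = norm (D eta)"
    using norm_cis_diff[of "2 * pi * (eta - eta0)" 0] by (simp add: D_def h_def abs_mult)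
   finally show "?l \<le> norm (D eta)" .
  qed (use h in simp)
 qed
 have D0: "D eta \<noteq> 0" if eta: "\<bar>eta\<bar> \<le> 1/2" "eta \<noteq> eta0" for eta
  using c(2)[OF eta(1)] eta(2) c(1) by (auto simp: mult_le_0_iff)
 have L: "L \<ge> 0" by (simp add: L_def)
 have gB: "norm (g eta) \<le> L / c" for eta
 proof (cases "\<bar>eta\<bar> \<le> 1/2 \<and> eta \<noteq> eta0")
  case True
  then have p: "c * \<bar>eta - eta0\<bar> > 0" using c(1) by simp
  have "norm (f eta / D eta) \<le> (L * \<bar>eta - eta0\<bar>) / (c * \<bar>eta - eta0\<bar>)"
   unfolding norm_divide using True c(2)[of eta] fL[of eta] p L by (intro frac_le) auto
  also have "... = L / c" using True by simp
  finally show ?thesis using True by (auto simp: g_def indicator_def)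
 next
  case False
  then have "g eta = 0" by (auto simp: g_def D_def indicator_def abs_le_iff)
  then show ?thesis using L c(1) by simp
 qed
 define C where "C m = (LL eta. unit_interval eta *\<^sub>R (g eta * cis (- 2 * pi * of_int m * eta)))" for m
 have ib: "integrable lborel (\<lambda>eta. unit_interval eta *\<^sub>R h eta)" if "h \<in> borel_fun" "\<And>eta. norm (h eta) \<le> A" for h :: "real \<Rightarrow> complex" and A
 proof (rule L_integrable_bound)
  show "integrable lborel (\<lambda>eta. unit_interval eta *\<^sub>R A)" by (intro integrable_scaleR_left integrable_real_indicator) (auto simp: emeasure_lborel_Icc_eq)
 qed (use that order_trans[OF that(2) abs_ge_self] in \<open>auto simp: indicator_def\<close>)
 define T where "T m = cis (2 * pi * of_int m * eta0) * C m" for m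
 define a where "a m = bump_hat dl (x - of_int m) * cis (2 * pi * eta0 * of_int m)" for m :: int
 \<comment> \<open>On the unit interval the constant V has only the coefficient m = 0, whence the
   case distinction; f = g D turns each coefficient of f into a difference of consecutive T.\<close>
 have coeff: "a m - (if m = 0 then V else 0) = T (m - 1) - T m" for m
 proof -
  have i: "integrable lborel (\<lambda>eta. cis a * (unit_interval eta *\<^sub>R (g eta * cis (- 2 * pi * of_int k * eta))))" for a and k :: int
   by (intro integrable_mult_right ib[where A = "L / c"]) (use gB in \<open>auto simp: norm_mult\<close>)
  have iq: "integrable lborel (\<lambda>eta. e * (unit_interval eta *\<^sub>R cis (2 * pi * of_int (- m) * eta)))" for e
   by (intro integrable_mult_right ib[where A = 1]) auto
  have "T (m - 1) - T m = (LL eta. cis (2 * pi * of_int (m - 1) * eta0) * (unit_interval eta *\<^sub>R (g eta * cis (- 2 * pi * of_int (m - 1) * eta)))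
    - cis (2 * pi * of_int m * eta0) * (unit_interval eta *\<^sub>R (g eta * cis (- 2 * pi * of_int m * eta))))"
   unfolding C_def T_def by (subst L_integral_diff[OF i i]) (simp del: mult_scaleR_right)
  also have "... = (LL eta. unit_interval eta *\<^sub>R (f eta * cis (2 * pi * of_int m * (eta0 - eta))))"
  proof (intro L_integral_cong refl)
   fix eta
   have "g eta * D eta = unit_interval eta *\<^sub>R f eta"
   proof (cases "eta \<in> {-1/2..1/2} \<and> eta \<noteq> eta0")
    case True
    then have "\<bar>eta\<bar> \<le> 1/2" by auto
    from D0[OF this] show ?thesis using True by (simp add: g_def)
   next
    case False
    then show ?thesis using fL[of eta0] eta0 by (auto simp: g_def)
   qed
   moreover have "cis (2 * pi * of_int (m - 1) * eta0) * cis (- 2 * pi * of_int (m - 1) * eta) - cis (2 * pi * of_int m * eta0) * cis (- 2 * pi * of_int m * eta)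
    = D eta * cis (2 * pi * of_int m * (eta0 - eta))"
    by (simp add: D_def cis_mult left_diff_distrib) (simp add: algebra_simps)
   ultimately show "cis (2 * pi * of_int (m - 1) * eta0) * (unit_interval eta *\<^sub>R (g eta * cis (- 2 * pi * of_int (m - 1) * eta)))
    - cis (2 * pi * of_int m * eta0) * (unit_interval eta *\<^sub>R (g eta * cis (- 2 * pi * of_int m * eta)))
    = unit_interval eta *\<^sub>R (f eta * cis (2 * pi * of_int m * (eta0 - eta)))"
    by (cases "eta \<in> {-1/2..1/2}") (auto simp: algebra_simps)
  qed
  also have "... = (LL eta. cis (2 * pi * eta0 * of_int m) * (of_real (bump dl eta) * cis (2 * pi * eta * (x - of_int m)))
    - V * cis (2 * pi * eta0 * of_int m) * (unit_interval eta *\<^sub>R cis (2 * pi * of_int (- m) * eta)))"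
  proof (intro L_integral_cong refl)
   fix eta
   have *: "(B * c1 - V) * c2 = c3 * (B * c4) - V * c3 * c5" if "c1 * c2 = c3 * c4" "c2 = c3 * c5" for B c1 c2 c3 c4 c5
    using that by algebra
   have e: "cis (2 * pi * eta * x) * cis (2 * pi * of_int m * (eta0 - eta)) = cis (2 * pi * eta0 * of_int m) * cis (2 * pi * eta * (x - of_int m))"
    "cis (2 * pi * of_int m * (eta0 - eta)) = cis (2 * pi * eta0 * of_int m) * cis (2 * pi * of_int (- m) * eta)"
    by (simp_all add: cis_mult algebra_simps)
   show "unit_interval eta *\<^sub>R (f eta * cis (2 * pi * of_int m * (eta0 - eta))) = cis (2 * pi * eta0 * of_int m) * (of_real (bump dl eta) * cis (2 * pi * eta * (x - of_int m)))
    - V * cis (2 * pi * eta0 * of_int m) * (unit_interval eta *\<^sub>R cis (2 * pi * of_int (- m) * eta))"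
   proof (cases "eta \<in> {-1/2..1/2}")
    case True
    then show ?thesis unfolding f_def using *[OF e, of "of_real (bump dl eta)"] by simp
   next
    case False
    then have "\<bar>eta\<bar> \<ge> dl" using dl(2) by auto
    then show ?thesis using False bump_support[OF dl(1)] by simp
   qed
  qed
  also have "... = cis (2 * pi * eta0 * of_int m) * bump_hat dl (x - of_int m) - V * cis (2 * pi * eta0 * of_int m) * (if - m = 0 then 1 else 0)"
   unfolding bump_hat_def integral_cis_period[symmetric]
   by (subst L_integral_diff[OF _ iq]) (auto intro!: integrable_mult_right integrable_bump[OF dl(1), where B = 1] simp del: mult_scaleR_right of_int_minus)
  finally show ?thesis by (simp add: a_def mult.commute)
 qed
 have sum: "(\<Sum>m\<in>{- int N..int N}. a m) = V + (T (- int (Suc N)) - T (int N))" for N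
 proof (induction N)
  case 0
  show ?case using coeff[of 0] by (simp add: algebra_simps)
 next
  case (Suc N)
  have "{- int (Suc N)..int (Suc N)} = insert (int (Suc N)) (insert (- int (Suc N)) {- int N..int N})" by auto
  moreover have m: "- int (Suc N) - 1 = - int (Suc (Suc N))" "int (Suc N) - 1 = int N" by auto
  ultimately have "(\<Sum>m\<in>{- int (Suc N)..int (Suc N)}. a m) = (V + T (- int (Suc N)) - T (int N)) + (T (int N) - T (int (Suc N))) + (T (- int (Suc (Suc N))) - T (- int (Suc N)))"
   using Suc coeff[of "int (Suc N)", unfolded m] coeff[of "- int (Suc N)", unfolded m] by (simp add: ac_simps del: of_nat_Suc)
  then show ?case by simp
 qed
 have "(\<lambda>N. T (h N)) \<longlonglongrightarrow> 0" if "(\<lambda>N. C (h N)) \<longlonglongrightarrow> 0" for h :: "nat \<Rightarrow> int"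
  using tendsto_norm_zero[OF that] by (intro tendsto_norm_zero_cancel[of "\<lambda>N. T (h N)"]) (simp add: T_def norm_mult)
 note this[of "\<lambda>n. - int (Suc n)"] this[of int]
 then have "(\<lambda>N. T (- int (Suc N))) \<longlonglongrightarrow> 0" "(\<lambda>N. T (int N)) \<longlonglongrightarrow> 0"
  using Riemann_Lebesgue_bounded[of g, OF _ gB, folded C_def] LIMSEQ_Suc[of "\<lambda>n. C (- int n)"] by auto
 then have "(\<lambda>N. V + (T (- int (Suc N)) - T (int N))) \<longlonglongrightarrow> V + (0 - 0)" by (intro tendsto_intros)
 then show ?thesis unfolding sum[symmetric] by (simp add: a_def V_def)
qed

text \<open>The inequality 1 + |m| <= (1 + |x|) (1 + |x - m|) transfers the decay in x - m to decay
  in m.\<close>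

lemma abs_summable_bump_hat:
 assumes dl: "dl > 0"
 shows "Infinite_Set_Sum.abs_summable_on (\<lambda>m::int. bump_hat dl (x - of_int m)) UNIV"
proof -
 obtain C where C: "C \<ge> 0" "\<And>u. norm (bump_hat dl u) \<le> C / (1 + \<bar>u\<bar>) ^ 3" using bump_hat_decay[OF dl] by blast
 have "Infinite_Set_Sum.abs_summable_on (\<lambda>m::int. C * (1 + \<bar>x\<bar>) ^ 3 * inverse ((1 + \<bar>real_of_int m\<bar>) ^ 3)) (range int \<union> range (\<lambda>n. - int n))"
 proof (intro abs_summable_on_union abs_summable_on_reindex)
  have "summable (\<lambda>n. inverse (real (Suc n) ^ 3))"
   using inverse_power_summable[of 3, where 'a = real] by (subst summable_Suc_iff) simp
  then show "Infinite_Set_Sum.abs_summable_on (\<lambda>n. C * (1 + \<bar>x\<bar>) ^ 3 * inverse ((1 + \<bar>real_of_int (int n)\<bar>) ^ 3)) UNIV"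
   "Infinite_Set_Sum.abs_summable_on (\<lambda>n. C * (1 + \<bar>x\<bar>) ^ 3 * inverse ((1 + \<bar>real_of_int (- int n)\<bar>) ^ 3)) UNIV"
   using C(1) by (auto simp: abs_summable_on_nat_iff' abs_mult intro!: summable_mult)
 qed
 also have "range int \<union> range (\<lambda>n. - int n) = UNIV"
  by (auto intro: int_cases2 simp: image_iff)
 finally show ?thesis
 proof (rule abs_summable_on_comparison_test')
  fix m :: int
  have "1 + \<bar>real_of_int m\<bar> \<le> (1 + \<bar>x\<bar>) * (1 + \<bar>x - of_int m\<bar>)"
  proof -
   have "(1 + \<bar>x\<bar>) * (1 + \<bar>x - of_int m\<bar>) = 1 + \<bar>x\<bar> + \<bar>x - of_int m\<bar> + \<bar>x\<bar> * \<bar>x - of_int m\<bar>" by (simp add: algebra_simps)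
   moreover have "0 \<le> \<bar>x\<bar> * \<bar>x - of_int m\<bar>" by simp
   ultimately show ?thesis by linarith
  qed
  then have "(1 + \<bar>real_of_int m\<bar>) ^ 3 \<le> ((1 + \<bar>x\<bar>) * (1 + \<bar>x - of_int m\<bar>)) ^ 3" by (intro power_mono) auto
  then have "C / (1 + \<bar>x - of_int m\<bar>) ^ 3 \<le> C * (1 + \<bar>x\<bar>) ^ 3 / (1 + \<bar>real_of_int m\<bar>) ^ 3"
   using mult_left_mono[OF _ C(1), of "(1 + \<bar>real_of_int m\<bar>) ^ 3" "((1 + \<bar>x\<bar>) * (1 + \<bar>x - of_int m\<bar>)) ^ 3"]
   by (simp add: divide_le_eq pos_le_divide_eq power_mult_distrib mult_ac)
  then show "norm (bump_hat dl (x - of_int m)) \<le> C * (1 + \<bar>x\<bar>) ^ 3 * inverse ((1 + \<bar>real_of_int m\<bar>) ^ 3)"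
   using C(2)[of "x - of_int m"] by (simp add: divide_inverse)
 qed
qed

text \<open>Poisson summation for the bump. Absolute summability identifies the unordered sum with
  the limit of the symmetric partial sums.\<close>

lemma bump_hat_infsetsum:
 assumes dl: "0 < dl" "dl < 1/2" and eta0: "\<bar>eta0\<bar> < 1/2"
 shows "Infinite_Set_Sum.abs_summable_on (\<lambda>m::int. bump_hat dl (x - of_int m) * cis (2 * pi * eta0 * of_int m)) UNIV"
  and "infsetsum (\<lambda>m::int. bump_hat dl (x - of_int m) * cis (2 * pi * eta0 * of_int m)) UNIV = of_real (bump dl eta0) * cis (2 * pi * eta0 * x)"
proof -
 let ?f = "\<lambda>m::int. bump_hat dl (x - of_int m) * cis (2 * pi * eta0 * of_int m)"
 show s: "Infinite_Set_Sum.abs_summable_on ?f UNIV"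
  by (rule abs_summable_on_comparison_test[OF abs_summable_bump_hat[OF dl(1), of x]]) (simp add: norm_mult)
 have "(?f has_sum infsetsum ?f UNIV) UNIV"
  unfolding infsetsum_infsum[OF s] by (rule has_sum_infsum[OF abs_summable_summable]) (use s in \<open>simp add: abs_summable_equivalent\<close>)
 then have "(sum ?f \<longlongrightarrow> infsetsum ?f UNIV) (finite_subsets_at_top UNIV)" by (simp add: has_sum_def)
 moreover have "filterlim (\<lambda>N. {- int N..int N}) (finite_subsets_at_top UNIV) sequentially"
  unfolding filterlim_finite_subsets_at_top
 proof (intro allI impI)
  fix X :: "int set" assume "finite X \<and> X \<subseteq> UNIV"
  then obtain k where k: "abs ` X \<subseteq> {..k}" using finite_int_iff_bounded_le by blast
  have "X \<subseteq> {- int N..int N}" if "N \<ge> nat k" for N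
   using k that by (fastforce simp: image_subset_iff abs_le_iff nat_le_iff)
  then show "\<forall>\<^sub>F N in sequentially. finite {- int N..int N} \<and> X \<subseteq> {- int N..int N} \<and> {- int N..int N} \<subseteq> UNIV"
   by (auto simp: eventually_sequentially intro!: exI[of _ "nat k"])
 qed
 ultimately have "(\<lambda>N. \<Sum>m\<in>{- int N..int N}. ?f m) \<longlonglongrightarrow> infsetsum ?f UNIV"
  by (rule filterlim_compose)
 from LIMSEQ_unique[OF this bump_hat_partial_sums[OF dl eta0]]
 show "infsetsum ?f UNIV = of_real (bump dl eta0) * cis (2 * pi * eta0 * x)" .
qed

section \<open>Exchanging countable sums with integrals\<close>

abbreviation lattice_count :: "(int ^ 'n::finite) measure" where "lattice_count \<equiv> count_space UNIV"

lemma measurable_countable_family: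
 fixes F :: "'k::countable \<Rightarrow> 'a \<Rightarrow> 'b::topological_space"
 assumes "\<And>k. F k \<in> borel_measurable N"
 shows "(\<lambda>(x, k). F k x) \<in> borel_measurable (N \<Otimes>\<^sub>M count_space UNIV)"
 unfolding split_beta'
 by (rule measurable_compose_countable'[where f = "\<lambda>k p. F k (fst p)" and g = snd and I = UNIV])
   (auto intro!: measurable_compose[OF measurable_fst assms])

lemma sum_prod_swap:
 fixes F :: "'k::countable \<Rightarrow> 'a::euclidean_space \<Rightarrow> complex"
 assumes "\<And>k. F k \<in> borel_fun" and "(NC k. (N1 x. F k x)) \<le> ennreal B" "B \<ge> 0"
 shows "(LL x. (LC k. F k x)) = (LC k. (LL x. F k x))"
 using superposition(4)[OF sigma_finite_measure_count_space_countable measurable_countable_family assms(2,3), of "\<lambda>_. 1" 1 undefined] assms(1)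
 by (simp add: conv_def)

lemma measurable_bump_hat [measurable]: "bump_hat dl \<in> borel_fun"
 unfolding bump_hat_def[abs_def] by measurable

lemma integrable_bump_hat:
 assumes dl: "dl > 0"
 shows "integrable lborel (\<lambda>u. (1 + \<bar>u\<bar>) * norm (bump_hat dl u))" (is ?g1) and "integrable lborel (bump_hat dl)" (is ?g2)
proof -
 obtain C where C: "C \<ge> 0" "\<And>u. norm (bump_hat dl u) \<le> C / (1 + \<bar>u\<bar>) ^ 3" using bump_hat_decay[OF dl] by blast
 have "integrable lborel (\<lambda>u::real. (1 + \<bar>u\<bar>) powr (-2))"
  using nn_integral_one_plus_abs_powr[of 2] by (simp add: integrable_iff_bounded)
 then have i: "integrable lborel (\<lambda>u::real. C * (1 + \<bar>u\<bar>) powr (-2))" by simp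
 show ?g1
 proof (rule L_integrable_bound[OF i], measurable, intro AE_I2)
  fix u
  have "(1 + \<bar>u\<bar>) * norm (bump_hat dl u) \<le> (1 + \<bar>u\<bar>) * (C / (1 + \<bar>u\<bar>) ^ 3)" (is "?l \<le> _") by (intro mult_left_mono C) auto
  also have "... = C * (1 + \<bar>u\<bar>) powr (-2)" by (simp add: powr_minus divide_inverse power3_eq_cube power2_eq_square)
  finally show "norm (?l) \<le> norm (C * (1 + \<bar>u\<bar>) powr (-2))" using C by (simp add: abs_mult)
 qed
 then show ?g2
  by (rule L_integrable_bound) (auto simp: mult_le_cancel_right1)
qed

text \<open>Fourier inversion at 0 by unfolding: the sum over integer translates is
  \<open>bump dl 0 = 1\<close> at every x, by Poisson summation at eta0 = 0, and integrating it over
  [0, 1) reassembles the integral over the line.\<close>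

lemma integral_bump_hat:
 assumes dl: "0 < dl" "dl < 1/2"
 shows "(LL u. bump_hat dl u) = 1"
proof -
 let ?I = "indicator {0..<1} :: real \<Rightarrow> real" and ?N = "count_space (UNIV :: int set)"
 interpret N: sigma_finite_measure ?N by (rule sigma_finite_measure_count_space_countable) simp
 interpret pair_sigma_finite lborel ?N ..
 have I: "?I (y + of_int m) = indicator {- \<lfloor>y\<rfloor>} m" for y and m :: int
  by (auto simp: indicator_def floor_eq_iff) linarith+
 define G where "G m y = ?I (y + of_int m) *\<^sub>R bump_hat dl y" for m :: int and y
 define F where "F m x = ?I x *\<^sub>R bump_hat dl (x - of_int m)" for m :: int and x
 have Gm: "G m \<in> borel_fun" and Fm: "F m \<in> borel_fun" for m unfolding G_def F_def by measurable
 have FG: "F m x = G m (x - of_int m)" for m x by (simp add: F_def G_def)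
 define B where "B = (LL y. norm (bump_hat dl y))"
 have B0: "B \<ge> 0" by (simp add: B_def)
 have GB: "(\<integral>\<^sup>+m. (N1 y. G m y) \<partial>?N) \<le> ennreal B"
 proof -
  have "(\<lambda>(y, m). ennreal (norm (G m y))) \<in> borel_measurable (lborel \<Otimes>\<^sub>M ?N)"
   using Gm by (intro measurable_countable_family) auto
  from Fubini'[OF this] have "(\<integral>\<^sup>+m. (N1 y. G m y) \<partial>?N) = (NN y. \<integral>\<^sup>+m. ennreal (norm (bump_hat dl y)) * indicator {- \<lfloor>y\<rfloor>} m \<partial>?N)"
   by (simp add: G_def I ennreal_mult mult.commute ennreal_indicator)
  also have "... = (N1 y. bump_hat dl y)" by (subst nn_integral_cmult_indicator) auto
  also have "... = ennreal B" unfolding B_def using integrable_bump_hat[OF dl(1)] by (intro nn_integral_eq_integral) auto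
  finally show ?thesis by simp
 qed
 have FB: "(\<integral>\<^sup>+m. (N1 y. F m y) \<partial>?N) \<le> ennreal B"
 proof -
  have "(N1 y. F m y) = (N1 y. G m y)" for m
   unfolding FG using nn_integral_lborel_affine[of "\<lambda>y. ennreal (norm (G m y))" 1 "- of_int m"] Gm by simp
  then show ?thesis using GB by simp
 qed
 have 1: "(\<integral>m. F m x \<partial>?N) = of_real (?I x)" for x
  using bump_hat_infsetsum(2)[OF dl, of 0 x] by (simp add: F_def bump_bounds(3) infsetsum_def scaleR_conv_of_real)
 have 2: "(\<integral>m. G m y \<partial>?N) = bump_hat dl y" for y
  unfolding G_def I by (subst integral_scaleR_left) (auto simp: lebesgue_integral_count_space_finite_support)
 have "1 = (LL x. complex_of_real (?I x))" by simp
 also have "... = (LL x. \<integral>m. F m x \<partial>?N)" by (simp add: 1)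
 also have "... = (\<integral>m. (LL x. F m x) \<partial>?N)" by (rule sum_prod_swap[OF Fm FB B0])
 also have "... = (\<integral>m. (LL y. G m y) \<partial>?N)" unfolding FG using integral_lborel_shift(1)[of "G _"] by simp
 also have "... = (LL y. \<integral>m. G m y \<partial>?N)" by (rule sum_prod_swap[OF Gm GB B0, symmetric])
 finally show ?thesis by (simp add: 2)
qed

subsection \<open>Mollifiers adapted to the lattice\<close>

definition bumps :: "real \<Rightarrow> real ^ 'n \<Rightarrow> real" where "bumps dl xi = (\<Prod>i\<in>UNIV. bump dl (xi $ i))"
definition bumps_hat :: "real \<Rightarrow> real ^ 'n \<Rightarrow> complex" where "bumps_hat dl u = (\<Prod>i\<in>UNIV. bump_hat dl (u $ i))"

lemma prod_Basis_vec: "(\<Prod>b\<in>(Basis :: (real ^ 'n) set). h b) = (\<Prod>i\<in>UNIV. h (axis i 1))"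
proof -
 have "(Basis :: (real ^ 'n) set) = (\<lambda>i. axis i 1) ` UNIV" by (auto simp: Basis_vec_def)
 from arg_cong[OF this, of "prod h"] show ?thesis by (simp add: prod.reindex inj_on_def axis_eq_axis)
qed

lemma lborel_prod_vec:
 fixes f :: "'n::finite \<Rightarrow> real \<Rightarrow> 'b::{real_normed_field, banach, second_countable_topology}"
 assumes "\<And>i. integrable lborel (f i)"
 shows "integrable lborel (\<lambda>x::real ^ 'n. \<Prod>i\<in>UNIV. f i (x $ i))" (is ?g1)
  and "(LL (x::real ^ 'n). (\<Prod>i\<in>UNIV. f i (x $ i))) = (\<Prod>i\<in>UNIV. LL u. f i u)"
proof -
 define g where "g b = f (THE i. b = axis i 1)" for b :: "real ^ 'n"
 have g: "g (axis i 1) = f i" for i by (simp add: g_def axis_eq_axis)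
 have "integrable lborel (g b)" for b unfolding g_def by (rule assms)
 from lborel_prod_basis[of g, OF this] show ?g1
  "(LL (x::real ^ 'n). (\<Prod>i\<in>UNIV. f i (x $ i))) = (\<Prod>i\<in>UNIV. LL u. f i u)"
  unfolding prod_Basis_vec g by (simp_all add: inner_axis)
qed

lemma measurable_bumps [measurable]: "bumps dl \<in> borel_fun" "bumps_hat dl \<in> borel_fun"
proof -
 have [measurable]: "(\<lambda>x::real ^ 'n. x $ i) \<in> borel_fun" for i
  by (intro borel_measurable_continuous_onI continuous_intros)
 show "bumps dl \<in> borel_fun" "bumps_hat dl \<in> borel_fun"
  unfolding bumps_def[abs_def] bumps_hat_def[abs_def] by measurable
qed

lemma integrable_bumps:
 assumes dl: "dl > 0"
 shows "integrable lborel (\<lambda>xi::real ^ 'n. complex_of_real (bumps dl xi))" (is ?g1)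
  and "bumps_hat dl u = (LL (xi::real ^ 'n). of_real (bumps dl xi) * cis (2 * pi * (xi \<bullet> u)))" (is ?g2)
proof -
 have i: "integrable lborel (\<lambda>eta. of_real (bump dl eta) * cis (2 * pi * eta * v))" for v
  by (rule integrable_bump[OF dl, where B = 1]) auto
 show ?g1
  using lborel_prod_vec(1)[where 'n='n, OF i[of 0]] by (simp add: bumps_def)
 have c: "cis (2 * pi * (xi \<bullet> u)) = (\<Prod>i\<in>UNIV. cis (2 * pi * xi $ i * u $ i))" for xi :: "real ^ 'n"
  unfolding prod_cis by (simp add: inner_vec_def sum_distrib_left mult.assoc)
 show ?g2
  unfolding bumps_hat_def bump_hat_def bumps_def c of_real_prod prod.distrib[symmetric]
  by (rule lborel_prod_vec(2)[OF i, symmetric])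
qed

lemma norm_bumps_hat_le:
 fixes u :: "real ^ 'n"
 assumes dl: "dl > 0"
 shows "norm (bumps_hat dl u) \<le> (LL (xi::real ^ 'n). \<bar>bumps dl xi\<bar>)"
 unfolding integrable_bumps(2)[OF dl] by (rule order_trans[OF integral_norm_bound]) (simp add: norm_mult)

lemma one_plus_sum_le_prod:
 fixes a :: "'i \<Rightarrow> real"
 assumes "finite A" "\<And>i. i \<in> A \<Longrightarrow> a i \<ge> 0"
 shows "1 + (\<Sum>i\<in>A. a i) \<le> (\<Prod>i\<in>A. 1 + a i)"
 using assms
proof (induction A rule: finite_induct)
 case (insert i A)
 have "0 \<le> a i * (\<Sum>i\<in>A. a i)" using insert.prems by (intro mult_nonneg_nonneg sum_nonneg) auto
 then have "1 + (\<Sum>i\<in>insert i A. a i) \<le> (1 + a i) * (1 + (\<Sum>i\<in>A. a i))" using insert by (simp add: algebra_simps)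
 also have "... \<le> (1 + a i) * (\<Prod>i\<in>A. 1 + a i)" using insert by (intro mult_left_mono) auto
 finally show ?case using insert by simp
qed simp

text \<open>Since 1 + |x| is at most the product of the factors 1 + |x_i|, the first moment is
  dominated by a product of one-dimensional ones.\<close>

lemma integrable_bumps_hat:
 assumes dl: "0 < dl" "dl < 1/2"
 shows "integrable lborel (\<lambda>x::real ^ 'n. (1 + norm x) * norm (bumps_hat dl x))" (is ?g1)
  and "(LL (x::real ^ 'n). bumps_hat dl x) = 1" (is ?g2)
proof -
 show ?g1
 proof (rule L_integrable_bound[OF lborel_prod_vec(1)[OF integrable_bump_hat(1)[OF dl(1)]]], measurable, intro AE_I2)
  fix x :: "real ^ 'n"
  have "1 + norm x \<le> (\<Prod>i\<in>UNIV. 1 + \<bar>x $ i\<bar>)"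
   using norm_le_l1_cart[of x] one_plus_sum_le_prod[of UNIV "\<lambda>i. \<bar>x $ i\<bar>"] by simp
  then have "(1 + norm x) * norm (bumps_hat dl x) \<le> (\<Prod>i\<in>UNIV. 1 + \<bar>x $ i\<bar>) * norm (bumps_hat dl x)" by (intro mult_right_mono) auto
  then show "norm ((1 + norm x) * norm (bumps_hat dl x)) \<le> norm (\<Prod>i\<in>UNIV. (1 + \<bar>x $ i\<bar>) * norm (bump_hat dl (x $ i)))"
   by (simp add: bumps_hat_def prod_norm prod.distrib abs_mult abs_prod)
 qed
 show ?g2
  unfolding bumps_hat_def lborel_prod_vec(2)[OF integrable_bump_hat(2)[OF dl(1)]] integral_bump_hat[OF dl] by simp
qed

text \<open>Sum and summability factor over the coordinates, once lattice vectors are identified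
  with functions in \<open>PiE\<close>.\<close>

lemma bumps_hat_lattice_sum:
 fixes u xi :: "real ^ 'n"
 assumes dl: "0 < dl" "dl < 1/2" and xi: "xi \<in> unit_cell"
 shows "integrable lattice_count (\<lambda>k. bumps_hat dl (u - lattice_vec k) * cis (2 * pi * (xi \<bullet> lattice_vec k)))" (is ?g1)
  and "(LC k. bumps_hat dl (u - lattice_vec k) * cis (2 * pi * (xi \<bullet> lattice_vec k))) = of_real (bumps dl xi) * cis (2 * pi * (xi \<bullet> u))" (is ?g2)
proof -
 define f where "f i m = bump_hat dl (u $ i - of_int m) * cis (2 * pi * xi $ i * of_int m)" for i and m :: int
 have "\<bar>xi $ i\<bar> < 1/2" for i
 proof -
  have "- 1/2 < xi $ i \<and> xi $ i < 1/2" using xi by (simp add: unit_cell_def)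
  then show ?thesis by linarith
 qed
 note f = bump_hat_infsetsum[OF dl this, of "u $ i" i for i, folded f_def]
 have c: "cis (2 * pi * (xi \<bullet> v)) = (\<Prod>i\<in>UNIV. cis (2 * pi * xi $ i * v $ i))" for v
  unfolding prod_cis by (simp add: inner_vec_def sum_distrib_left mult.assoc)
 have eq: "bumps_hat dl (u - lattice_vec k) * cis (2 * pi * (xi \<bullet> lattice_vec k)) = (\<Prod>i\<in>UNIV. f i (vec_nth k i))" for k
  by (simp add: bumps_hat_def c f_def lattice_vec_def prod.distrib)
 have bij: "bij_betw vec_nth (UNIV :: (int ^ 'n) set) (PiE UNIV (\<lambda>_. UNIV))"
  by (intro bij_betwI[where g = vec_lambda]) auto
 have P: "Infinite_Set_Sum.abs_summable_on (\<lambda>g. \<Prod>i\<in>UNIV. f i (g i)) (PiE UNIV (\<lambda>_. UNIV))"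
  by (rule abs_summable_on_prod_PiE) (auto intro: f(1))
 show ?g1
  using P unfolding eq abs_summable_on_reindex_bij_betw[OF bij, symmetric] by (simp add: abs_summable_on_def)
 have "infsetsum (\<lambda>k::int ^ 'n. \<Prod>i\<in>UNIV. f i (vec_nth k i)) UNIV = infsetsum (\<lambda>g. \<Prod>i\<in>UNIV. f i (g i)) (PiE UNIV (\<lambda>_. UNIV))"
  by (rule infsetsum_reindex_bij_betw[OF bij])
 also have "... = (\<Prod>i\<in>UNIV. infsetsum (f i) UNIV)"
  by (rule infsetsum_prod_PiE) (auto intro: f(1))
 also have "... = of_real (bumps dl xi) * cis (2 * pi * (xi \<bullet> u))"
  by (simp add: f(2) bumps_def c prod.distrib)
 finally show ?g2
  unfolding eq by (simp add: infsetsum_def)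
qed

text \<open>By uniqueness of translation-invariant measures, with \<open>\<gamma>\<close> fixed by comparison with a Gaussian: the library computes
 its value \<open>1 / \<bar>det A\<bar>\<close> only for well-ordered index types.\<close>

lemma lborel_matrix:
 fixes A B :: "real ^ 'n ^ 'n"
 assumes AB: "A ** B = mat 1" "B ** A = mat 1"
 obtains \<gamma> where "\<gamma> > 0" "\<And>f. f \<in> borel_fun \<Longrightarrow> (NN x. f (A *v x)) = ennreal \<gamma> * (NN x. f x)"
proof -
 have [measurable]: "(*v) C \<in> borel_fun" for C :: "real ^ 'n ^ 'n"
  by (intro borel_measurable_continuous_onI linear_continuous_on matrix_vector_mul_bounded_linear)
 have BA: "B *v (A *v x) = x" "A *v (B *v x) = x" for x by (simp_all add: matrix_vector_mul_assoc AB)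
 have sh: "(NN x. h (x + v)) = (NN x. h x)" if [measurable]: "h \<in> borel_fun" for h :: "real ^ 'n \<Rightarrow> ennreal" and v
  using nn_integral_lborel_affine[of h 1 v] by (simp add: add.commute)
 \<comment> \<open>In the double integral of f (A x) g (y + A x), shifting y removes A x from g,
   while shifting x by B y moves the variable y from g into f. Both evaluations rest on translation
   invariance.\<close>
 have prod: "(NN x. f (A *v x)) * (NN y. g y) = (NN x. g (A *v x)) * (NN y. f y)"
  if [measurable]: "f \<in> borel_fun" "g \<in> borel_fun" for f g :: "real ^ 'n \<Rightarrow> ennreal"
 proof -
  have "(NN x. f (A *v x)) * (NN y. g y) = (NN x. (NN y. f (A *v x) * g (y + A *v x)))"
   by (simp add: nn_integral_cmult nn_integral_multc sh)
  also have "... = (NN y. (NN x. f (A *v x) * g (y + A *v x)))"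
   by (intro lborel_pair.Fubini') measurable
  also have "... = (NN y. (NN x. f (A *v x - y) * g (A *v x)))"
  proof (rule nn_integral_cong)
   fix y
   have m: "(\<lambda>x. f (A *v x - y) * g (A *v x)) \<in> borel_fun" by measurable
   show "(NN x. f (A *v x) * g (y + A *v x)) = (NN x. f (A *v x - y) * g (A *v x))"
    using sh[OF m, of "B *v y"] by (simp add: matrix_vector_right_distrib BA add.commute)
  qed
  also have "... = (NN x. (NN y. f (A *v x - y) * g (A *v x)))"
   by (intro lborel_pair.Fubini') measurable
  also have "... = (NN x. g (A *v x)) * (NN y. f y)"
   by (simp add: nn_integral_cmult nn_integral_multc nn_integral_lborel_reflect(1) mult.commute)
  finally show ?thesis .
 qed
 define g where "g x = ennreal (gauss_kernel 1 x)" for x :: "real ^ 'n"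
 have [measurable]: "g \<in> borel_fun" unfolding g_def[abs_def] by measurable
 have g1: "(NN x. g x) = 1"
  unfolding g_def using gauss_kernel_integral[of 1, where 'a = "real ^ 'n"] by (subst nn_integral_eq_integral) auto
 define \<Gamma> where "\<Gamma> = (NN x. g (A *v x))"
 have main: "(NN x. f (A *v x)) = \<Gamma> * (NN x. f x)" if "f \<in> borel_fun" for f
  using prod[of f g] that by (simp add: g1 \<Gamma>_def)
 \<comment> \<open>Otherwise the constant 1 would have integral 0.\<close>
 have "\<Gamma> \<noteq> 0" using main[of "\<lambda>_. 1"] by auto
 moreover have "\<Gamma> < \<infinity>"
 proof -
  obtain C where C: "\<And>x::real ^ 'n. gauss_kernel 1 x \<le> C * (1 / (1 + norm x) ^ (DIM(real ^ 'n) + 1))"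
   using gauss_kernel_bound[where 'a = "real ^ 'n"] by (metis real_sqrt_one zero_less_one)
  have C0: "C \<ge> 0" using order_trans[OF gauss_kernel_nonneg C[of 0]] by simp
  obtain K where K: "K > 0" "\<And>x. norm (B *v x) \<le> norm x * K"
   using bounded_linear.pos_bounded[OF matrix_vector_mul_bounded_linear[of B]] by blast
  define K' where "K' = max 1 K"
  let ?d = "DIM(real ^ 'n) + 1"
  have le: "gauss_kernel 1 (A *v x) \<le> C * K' ^ ?d * inverse ((1 + norm x) ^ ?d)" for x
  proof -
   have "norm x \<le> K' * norm (A *v x)"
    using K(2)[of "A *v x"] mult_right_mono[of K K' "norm (A *v x)"] by (simp add: BA K'_def mult.commute)
   then have "1 + norm x \<le> K' * (1 + norm (A *v x))" by (simp add: K'_def distrib_left)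
   then have "(1 + norm x) ^ ?d \<le> K' ^ ?d * (1 + norm (A *v x)) ^ ?d"
    unfolding power_mult_distrib[symmetric] by (intro power_mono) auto
   moreover have "(1 + norm x) ^ ?d > 0" "(1 + norm (A *v x)) ^ ?d > 0" by (intro zero_less_power add_pos_nonneg; simp)+
   ultimately have "1 / (1 + norm (A *v x)) ^ ?d \<le> K' ^ ?d * inverse ((1 + norm x) ^ ?d)"
    by (simp only: pos_divide_le_eq) (simp only: inverse_eq_divide times_divide_eq_right mult_1_right times_divide_eq_left pos_le_divide_eq mult_1_left)
   from mult_left_mono[OF this C0] show ?thesis using C[of "A *v x"] by (simp only: mult.assoc)
  qed
  have "\<Gamma> \<le> (N1 (x::real ^ 'n). C * K' ^ ?d * inverse ((1 + norm x) ^ ?d))"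
   unfolding \<Gamma>_def g_def by (intro nn_integral_mono ennreal_leI order_trans[OF le]) simp
  also have "... < \<infinity>"
   using integrable_mult_right[OF integrable_inverse_norm_power[where 'a = "real ^ 'n"], of "C * K' ^ ?d"] unfolding integrable_iff_bounded by blast
  finally show ?thesis .
 qed
 ultimately have "enn2real \<Gamma> > 0" "\<Gamma> = ennreal (enn2real \<Gamma>)" by (auto simp: enn2real_positive_iff zero_less_iff_neq_zero)
 then show thesis using that[of "enn2real \<Gamma>"] main by auto
qed

lemma integral_matrix:
 fixes A B :: "real ^ 'n ^ 'n"
 assumes AB: "A ** B = mat 1" "B ** A = mat 1"
 obtains \<gamma> where "\<gamma> > 0"
  "\<And>f::real ^ 'n \<Rightarrow> 'b::{banach, second_countable_topology}. integrable lborel f \<Longrightarrow> integrable lborel (\<lambda>x. f (A *v x)) \<and> (LL x. f (A *v x)) = \<gamma> *\<^sub>R (LL x. f x)"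
proof -
 have [measurable]: "(*v) A \<in> borel_fun"
  by (intro borel_measurable_continuous_onI linear_continuous_on matrix_vector_mul_bounded_linear)
 obtain \<gamma> where \<gamma>: "\<gamma> > 0" "\<And>f. f \<in> borel_fun \<Longrightarrow> (NN x. f (A *v x)) = ennreal \<gamma> * (NN x. f x)"
  using lborel_matrix[OF AB] by blast
 have d: "distr lborel borel ((*v) A) = density lborel (\<lambda>_. ennreal \<gamma>)"
 proof (rule measure_eqI)
  fix S :: "(real ^ 'n) set" assume S: "S \<in> sets (distr lborel borel ((*v) A))"
  then have [measurable]: "S \<in> sets borel" by simp
  have "emeasure (distr lborel borel ((*v) A)) S = (\<integral>\<^sup>+x. indicator S x \<partial>distr lborel borel ((*v) A))" (is "?l = _") by simp
  also have "... = (NN x. indicator S (A *v x))" by (rule nn_integral_distr) measurable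
  also have "... = emeasure (density lborel (\<lambda>_. ennreal \<gamma>)) S"
   using \<gamma>(2)[of "indicator S"] by (simp add: emeasure_density nn_integral_cmult_indicator)
  finally show "?l = emeasure (density lborel (\<lambda>_. ennreal \<gamma>)) S" .
 qed simp
 show thesis
 proof (rule that[OF \<gamma>(1)])
  fix f :: "real ^ 'n \<Rightarrow> 'b" assume f: "integrable lborel f"
  have [measurable]: "f \<in> borel_fun" using f by auto
  have "integrable (distr lborel borel ((*v) A)) f" unfolding d using f \<gamma>(1) by (subst integrable_density) auto
  then have "integrable lborel (\<lambda>x. f (A *v x))" by (subst (asm) integrable_distr_eq) auto
  moreover have "(LL x. f (A *v x)) = (\<integral>x. f x \<partial>distr lborel borel ((*v) A))" by (rule integral_distr[symmetric]) measurable
  moreover have "... = \<gamma> *\<^sub>R (LL x. f x)" unfolding d using \<gamma>(1) by (subst integral_density) auto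
  ultimately show "integrable lborel (\<lambda>x. f (A *v x)) \<and> (LL x. f (A *v x)) = \<gamma> *\<^sub>R (LL x. f x)" by simp
 qed
qed

lemma matrix_inv_mult:
 assumes "invertible A"
 shows "A ** matrix_inv A = mat 1" "matrix_inv A ** A = mat 1"
 using someI_ex[OF assms[unfolded invertible_def]] by (simp_all add: matrix_inv_def)

lemma unit_cell_eq_box: "unit_cell = box (\<chi> i. -1/2) (\<chi> i. 1/2)"
 by (auto simp: unit_cell_def mem_box_cart)

lemma discrete_riesz_kernel_eq:
 fixes b :: "real ^ 'n ^ 'n"
 assumes \<nu>: "cutoff \<nu>"
 defines "g i xi \<equiv> indicator unit_cell xi *\<^sub>R (- \<i> * of_real ((xi v* matrix_inv b) $ i / norm (xi v* matrix_inv b)) * \<nu> xi)"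
 shows "integrable lborel (g i)"
  and "discrete_riesz_kernel b \<nu> k $ i = (LL xi. g i xi * cis (2 * pi * (xi \<bullet> lattice_vec k)))" (is ?g1)
proof -
 have "Ck 0 \<nu>" using \<nu> unfolding cutoff_def by blast
 then have c: "continuous_on UNIV \<nu>" by simp
 then have [measurable]: "\<nu> \<in> borel_fun" by (rule borel_measurable_continuous_onI)
 have [measurable]: "(unit_cell :: (real ^ 'n) set) \<in> sets borel" by (simp add: unit_cell_eq_box)
 have [measurable]: "(\<lambda>xi. xi v* matrix_inv b) \<in> borel_fun"
  unfolding transpose_matrix_vector[symmetric] by (intro borel_measurable_continuous_onI linear_continuous_on matrix_vector_mul_bounded_linear)
 have [measurable]: "(\<lambda>x::real ^ 'n. x $ i) \<in> borel_fun" for i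
  by (intro borel_measurable_continuous_onI continuous_intros)
 have "bounded (\<nu> ` cbox (\<chi> i. -1/2) (\<chi> i. 1/2))"
  by (intro compact_imp_bounded compact_continuous_image continuous_on_subset[OF c]) auto
 then obtain V where V: "\<And>xi. xi \<in> unit_cell \<Longrightarrow> norm (\<nu> xi) \<le> V"
  unfolding bounded_iff unit_cell_eq_box using box_subset_cbox by (metis (no_types, lifting) image_eqI subsetD)
 have gi: "integrable lborel (\<lambda>xi. g i xi * h xi)" if [measurable]: "h \<in> borel_fun" and h: "\<And>xi. norm (h xi) = 1" for i h
 proof (rule L_integrable_bound)
  show "integrable lborel (\<lambda>xi::real ^ 'n. indicator unit_cell xi *\<^sub>R V)"
   unfolding unit_cell_eq_box by (intro integrable_scaleR_left integrable_real_indicator) (auto simp: emeasure_lborel_box_eq)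
  have "norm (g i xi * h xi) \<le> norm (indicator unit_cell xi *\<^sub>R V)" for xi
  proof (cases "xi \<in> unit_cell")
   case True
   have "\<bar>(xi v* matrix_inv b) $ i / norm (xi v* matrix_inv b)\<bar> \<le> 1"
    by (simp add: abs_divide divide_le_eq component_le_norm_cart)
   from mult_mono[OF this V[OF True]] show ?thesis using True by (auto simp: g_def norm_mult norm_divide h intro: order_trans[OF _ abs_ge_self])
  qed (simp add: g_def)
  then show "AE xi in lborel. norm (g i xi * h xi) \<le> norm (indicator unit_cell xi *\<^sub>R V)" by simp
 qed (unfold g_def, measurable)
 from gi[of "\<lambda>_. 1"] show "integrable lborel (g i)" by simp
 have gc: "integrable lborel (\<lambda>xi. g i xi * cis (2 * pi * (xi \<bullet> lattice_vec k)))" for i by (rule gi) auto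
 have "discrete_riesz_kernel b \<nu> k = (\<integral>xi. (\<chi> i. g i xi * cis (2 * pi * (xi \<bullet> lattice_vec k))) \<partial>lebesgue)"
  unfolding discrete_riesz_kernel_def set_lebesgue_integral_def
  by (intro L_integral_cong refl)
    (simp add: vec_eq_iff discrete_riesz_symbol_def Let_def g_def cis_conv_exp scaleR_conv_of_real[where 'a = complex] mult_ac)
 also have "... = (LL xi. (\<chi> i. g i xi * cis (2 * pi * (xi \<bullet> lattice_vec k))))"
  using borel_measurable_integrable[OF integrable_vec_lambda(1)[of lborel "\<lambda>xi i. g i xi * cis (2 * pi * (xi \<bullet> lattice_vec k))", OF gc]]
  by (intro integral_completion) simp
 finally show ?g1
  unfolding integrable_vec_lambda(2)[OF gc] by simp
qed

text \<open>On lattice translates of \<open>\<phi>\<close> the Riesz transform acts as convolution with the discrete Riesz kernel: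
 the Fourier transform of \<open>\<phi>\<close> is supported where the cut-off \<open>\<nu>\<close> equals \<open>1\<close>.\<close>

lemma lattice_mollifier:
 fixes b :: "real ^ 'n ^ 'n" and \<nu> :: "real ^ 'n \<Rightarrow> complex"
 assumes b: "invertible b" and \<nu>: "cutoff \<nu>"
 obtains \<phi> :: "real ^ 'n \<Rightarrow> complex" and B c Z where
  "\<phi> \<in> borel_fun" "\<And>x. norm (\<phi> x) \<le> B" "integrable lborel (\<lambda>x. (1 + norm x) * norm (\<phi> x))" "(LL x. \<phi> x) = 1"
  "\<And>x. integrable lattice_count (\<lambda>k. \<phi> (x - b *v lattice_vec k))"
  "\<And>i k. norm (discrete_riesz_kernel b \<nu> k $ i) \<le> Z"
  "\<And>i x. norm (LC k. discrete_riesz_kernel b \<nu> k $ i * \<phi> (x - b *v lattice_vec k)) \<le> Z"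
  "\<And>i t x. t > 0 \<Longrightarrow> riesz_conv t (axis i 1) \<phi> x =
    conv (gauss_kernel t) (\<lambda>x. of_real c * (LC k. discrete_riesz_kernel b \<nu> k $ i * \<phi> (x - b *v lattice_vec k))) x"
proof -
 let ?B = "matrix_inv b"
 note bB = matrix_inv_mult[OF b]
 have Bb: "?B *v (b *v x) = x" "b *v (?B *v x) = x" for x by (simp_all add: matrix_vector_mul_assoc bB)
 obtain e where e: "e > 0" "\<And>xi. norm xi < e \<Longrightarrow> \<nu> xi = 1"
  using \<nu> unfolding cutoff_def eventually_nhds_metric by (auto simp: dist_norm)
 \<comment> \<open>dl <= 1/4 keeps the support of the bumps inside the unit cell; e / (2 d) keeps
   its points at l^1 norm below e, where \<nu> equals 1.\<close>
 define dl where "dl = min (1/4) (e / (2 * real CARD('n)))"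
 have dl: "0 < dl" "dl < 1/2" using e by (auto simp: dl_def)
 define W where "W = (bumps dl :: real ^ 'n \<Rightarrow> real)"
 have W: "xi \<in> unit_cell \<and> \<nu> xi = 1" if "W xi \<noteq> 0" for xi
 proof -
  have i: "\<bar>xi $ i\<bar> < dl" for i
   using that bump_support[OF dl(1), of "xi $ i"] by (auto simp: W_def bumps_def not_le[symmetric])
  have "norm xi \<le> (\<Sum>i\<in>UNIV. \<bar>xi $ i\<bar>)" by (rule norm_le_l1_cart)
  also have "... \<le> (\<Sum>i\<in>(UNIV :: 'n set). dl)" by (intro sum_mono less_imp_le i)
  also have "... \<le> e / 2" by (simp add: dl_def min_def field_simps)
  also have "... < e" using e(1) by simp
  finally have "\<nu> xi = 1" by (rule e(2))
  moreover have "- 1/2 < xi $ i \<and> xi $ i < 1/2" for i using i[of i] dl(2) by linarith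
  ultimately show ?thesis by (simp add: unit_cell_def)
 qed
 have [measurable]: "(*v) C \<in> borel_fun" for C :: "real ^ 'n ^ 'n"
  by (intro borel_measurable_continuous_onI linear_continuous_on matrix_vector_mul_bounded_linear)
 have hat_int: "integrable lborel (bumps_hat dl :: real ^ 'n \<Rightarrow> complex)"
  by (rule L_integrable_bound[OF integrable_bumps_hat(1)[OF dl]]) (auto simp: mult_le_cancel_right1)
 obtain \<gamma> where \<gamma>: "\<gamma> > 0" "integrable lborel (\<lambda>x. bumps_hat dl (?B *v x))" "(LL x. bumps_hat dl (?B *v x)) = \<gamma> *\<^sub>R 1"
  using integral_matrix[OF bB(2,1), where 'b = complex] hat_int integrable_bumps_hat(2)[OF dl, where 'n = 'n] by metis
 have wt: "integrable lborel (\<lambda>x. (1 + norm (?B *v x)) * norm (bumps_hat dl (?B *v x)))"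
  by (rule integral_matrix[OF bB(2,1), where 'b = real]) (use integrable_bumps_hat(1)[OF dl, where 'n = 'n] in blast)
 \<comment> \<open>Inverse transform of the bump in lattice coordinates, normalised by \<gamma> to
   integral 1.\<close>
 define \<phi> where "\<phi> x = (1 / \<gamma>) *\<^sub>R bumps_hat dl (?B *v x)" for x
 have \<phi>m: "\<phi> \<in> borel_fun" unfolding \<phi>_def[abs_def] by measurable
 have \<phi>i: "integrable lborel \<phi>" unfolding \<phi>_def[abs_def] by (intro integrable_scaleR_right \<gamma>(2))
 define B0 where "B0 = 1 / \<gamma> * (LL (xi::real ^ 'n). \<bar>bumps dl xi\<bar>)"
 have \<phi>b: "norm (\<phi> x) \<le> B0" for x
  unfolding \<phi>_def B0_def norm_scaleR using \<gamma>(1) norm_bumps_hat_le[OF dl(1)] by (auto intro!: divide_right_mono)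
 have \<phi>w: "integrable lborel (\<lambda>x. (1 + norm x) * norm (\<phi> x))"
 proof -
  obtain K where K: "K > 0" "\<And>x. norm (b *v x) \<le> norm x * K"
   using bounded_linear.pos_bounded[OF matrix_vector_mul_bounded_linear[of b]] by blast
  have le: "1 + norm x \<le> (1 + K) * (1 + norm (?B *v x))" for x
  proof -
   have "(1 + K) * (1 + norm (?B *v x)) = 1 + K + norm (?B *v x) + norm (?B *v x) * K" by (simp add: algebra_simps)
   then show ?thesis using K(2)[of "?B *v x"] K(1) norm_ge_zero[of "?B *v x"] by (simp only: Bb)
  qed
  show ?thesis
  proof (rule L_integrable_bound[OF integrable_mult_right[OF wt, of "(1 + K) / \<gamma>"]])
   have "(1 + norm x) * norm (\<phi> x) \<le> (1 + K) / \<gamma> * ((1 + norm (?B *v x)) * norm (bumps_hat dl (?B *v x)))" for x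
    using mult_right_mono[OF le[of x], of "norm (bumps_hat dl (?B *v x)) / \<gamma>"] \<gamma>(1) by (simp add: \<phi>_def)
   then show "AE x in lborel. norm ((1 + norm x) * norm (\<phi> x)) \<le> norm ((1 + K) / \<gamma> * ((1 + norm (?B *v x)) * norm (bumps_hat dl (?B *v x))))"
    using \<gamma>(1) K(1) by (intro AE_I2) (simp only: real_norm_def abs_mult, rule order_trans[OF _ mult_mono'[OF abs_ge_self]], auto simp: abs_mult)
  qed (use \<phi>m in measurable)
 qed
 have \<phi>1: "(LL x. \<phi> x) = 1" unfolding \<phi>_def[abs_def] integral_scaleR_right \<gamma>(3) using \<gamma>(1) by simp
 have \<phi>k: "\<phi> (x - b *v lattice_vec k) = (1 / \<gamma>) *\<^sub>R bumps_hat dl (?B *v x - lattice_vec k)" for x k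
  by (simp add: \<phi>_def matrix_vector_mult_diff_distrib Bb)
 have \<phi>s: "integrable lattice_count (\<lambda>k. \<phi> (x - b *v lattice_vec k))" for x
  unfolding \<phi>k using bumps_hat_lattice_sum(1)[OF dl, of 0 "?B *v x"] by (intro integrable_scaleR_right) (simp add: unit_cell_def)
 \<comment> \<open>The frequency carried by xi in \<open>bumps_hat dl (?B *v x)\<close>: pairing xi
   with \<open>?B *v x\<close> moves the matrix onto the row vector xi, which is the argument of the
   discrete symbol.\<close>
 define T where "T xi = (2 * pi) *\<^sub>R (xi v* ?B)" for xi :: "real ^ 'n"
 have Tm[measurable]: "T \<in> borel_fun"
  unfolding T_def[abs_def] transpose_matrix_vector[symmetric] by measurable
 have Tx: "T xi \<bullet> x = 2 * pi * (xi \<bullet> (?B *v x))" for xi x by (simp add: T_def dot_lmul_matrix)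
 define a where "a xi = complex_of_real (W xi / \<gamma>)" for xi
 have ai: "integrable lborel a"
  unfolding a_def W_def using integrable_bumps(1)[OF dl(1), where 'n = 'n] by simp
 have \<phi>a: "\<phi> = (\<lambda>x. LL xi. a xi * cis (T xi \<bullet> x))"
  by (simp add: \<phi>_def[abs_def] integrable_bumps(2)[OF dl(1)] a_def W_def Tx scaleR_conv_of_real)
 define g where "g i xi = indicator unit_cell xi *\<^sub>R (- \<i> * of_real ((xi v* matrix_inv b) $ i / norm (xi v* matrix_inv b)) * \<nu> xi)" for i xi
 note z = discrete_riesz_kernel_eq[OF \<nu>, where b = b, folded g_def]
 define c where "c = multiplier_const TYPE(real ^ 'n)"
 define N where "N i x = (LL xi. g i xi * a xi * cis (T xi \<bullet> x))" for i x
 \<comment> \<open>Write z_k as a Fourier integral and sum under it: at each xi of the cell the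
   lattice sum is evaluated by Poisson summation, and off the cell g vanishes.\<close>
 have N: "(LC k. discrete_riesz_kernel b \<nu> k $ i * \<phi> (x - b *v lattice_vec k)) = N i x" for i x
 proof -
  define F where "F k xi = g i xi * cis (2 * pi * (xi \<bullet> lattice_vec k)) * \<phi> (x - b *v lattice_vec k)" for k xi
  have [measurable]: "g i \<in> borel_fun" using z(1)[of i] by auto
  define G where "G = (LL xi. norm (g i xi))"
  define S where "S = (LC k. norm (\<phi> (x - b *v lattice_vec k)))"
  have "(NC k. (N1 xi. F k xi)) = (NC k. ennreal G * ennreal (norm (\<phi> (x - b *v lattice_vec k))))" (is "?l = _")
  proof (intro nn_integral_cong)
   fix k
   have "(N1 xi. F k xi) = (NN xi. ennreal (norm (g i xi)) * ennreal (norm (\<phi> (x - b *v lattice_vec k))))"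
    by (simp add: F_def norm_mult ennreal_mult)
   also have "... = ennreal G * ennreal (norm (\<phi> (x - b *v lattice_vec k)))"
    unfolding G_def using z(1) by (subst nn_integral_multc) (auto simp: nn_integral_eq_integral)
   finally show "(N1 xi. F k xi) = ennreal G * ennreal (norm (\<phi> (x - b *v lattice_vec k)))" .
  qed
  also have "... = ennreal (G * S)"
   using \<phi>s[of x] by (simp add: nn_integral_cmult nn_integral_eq_integral S_def G_def ennreal_mult)
  finally have "?l \<le> ennreal (G * S)" by simp
  from sum_prod_swap[OF _ this] have "(LL xi. (LC k. F k xi)) = (LC k. (LL xi. F k xi))"
   by (auto simp: F_def G_def S_def)
  moreover have "(LC k. F k xi) = g i xi * a xi * cis (T xi \<bullet> x)" for xi
  proof (cases "xi \<in> unit_cell")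
   case True
   have "(LC k. F k xi) = (LC k. (g i xi / \<gamma>) * (bumps_hat dl (?B *v x - lattice_vec k) * cis (2 * pi * (xi \<bullet> lattice_vec k))))"
    by (simp add: F_def \<phi>k scaleR_conv_of_real mult_ac)
   then show ?thesis unfolding integral_mult_right_zero bumps_hat_lattice_sum(2)[OF dl True] by (simp add: a_def W_def Tx)
  qed (simp add: F_def g_def)
  ultimately show ?thesis unfolding z(2) N_def by (simp add: F_def)
 qed
 define Z where "Z = Max (range (\<lambda>i. max (LL xi. norm (g i xi)) (LL xi. norm (g i xi * a xi))))"
 have Z: "max (LL xi. norm (g i xi)) (LL xi. norm (g i xi * a xi)) \<le> Z" for i
  unfolding Z_def by (rule Max_ge) auto
 show thesis
 proof (rule that[OF \<phi>m \<phi>b \<phi>w \<phi>1 \<phi>s])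
  fix i k x
  have "norm (discrete_riesz_kernel b \<nu> k $ i) \<le> (LL xi. norm (g i xi))"
   unfolding z(2) by (rule order_trans[OF integral_norm_bound]) (simp add: norm_mult)
  then show "norm (discrete_riesz_kernel b \<nu> k $ i) \<le> Z" using Z[of i] by linarith
  have "norm (N i x) \<le> (LL xi. norm (g i xi * a xi))"
   unfolding N_def by (rule order_trans[OF integral_norm_bound]) (simp add: norm_mult)
  then show "norm (LC k. discrete_riesz_kernel b \<nu> k $ i * \<phi> (x - b *v lattice_vec k)) \<le> Z"
   unfolding N using Z[of i] by linarith
  fix t :: real assume t: "t > 0"
  \<comment> \<open>Where a is not zero, xi lies in the cell and \<nu> xi = 1, so that g is exactly
    the Riesz symbol at \<open>T xi\<close>; the factor 2 pi cancels in the quotient.\<close>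
  have M: "(LL xi. (multiplier_const TYPE(real ^ 'n) * (T xi \<bullet> axis i 1) / norm (T xi)) *\<^sub>R (- \<i> * a xi) * cis (T xi \<bullet> x)) = of_real c * N i x" for x
  proof -
   have "(multiplier_const TYPE(real ^ 'n) * (T xi \<bullet> axis i 1) / norm (T xi)) *\<^sub>R (- \<i> * a xi) * cis (T xi \<bullet> x) = of_real c * (g i xi * a xi * cis (T xi \<bullet> x))" for xi
   proof (cases "W xi = 0")
    case False
    have "T xi \<bullet> axis i 1 / norm (T xi) = (xi v* ?B) $ i / norm (xi v* ?B)" by (simp add: T_def inner_axis)
    then show ?thesis using W[OF False] by (simp add: c_def g_def scaleR_conv_of_real flip: times_divide_eq_right)
   qed (simp add: a_def)
   then show ?thesis unfolding N_def by simp
  qed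
  then show "riesz_conv t (axis i 1) \<phi> x =
    conv (gauss_kernel t) (\<lambda>x. of_real c * (LC k. discrete_riesz_kernel b \<nu> k $ i * \<phi> (x - b *v lattice_vec k))) x"
   using riesz_heat_fourier[OF ai Tm t _ \<phi>i[unfolded \<phi>a], of "axis i 1" x] unfolding N M \<phi>a[symmetric] by (auto simp: Basis_vec_def)
 qed
qed

subsection \<open>Lattice series\<close>

lemma nn_integral_weighted_le:
 fixes s :: "'k \<Rightarrow> complex" and W :: "'k \<Rightarrow> 'x \<Rightarrow> complex"
 assumes s: "integrable M s" and W: "\<And>k. W k \<in> borel_measurable N" "\<And>k. (\<integral>\<^sup>+x. ennreal (norm (W k x)) \<partial>N) \<le> ennreal C" and C: "C \<ge> 0"
 shows "(\<integral>\<^sup>+k. \<integral>\<^sup>+x. ennreal (norm (s k * W k x)) \<partial>N \<partial>M) \<le> ennreal ((\<integral>k. norm (s k) \<partial>M) * C)"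
proof -
 have "(\<integral>\<^sup>+k. \<integral>\<^sup>+x. ennreal (norm (s k * W k x)) \<partial>N \<partial>M) \<le> (\<integral>\<^sup>+k. ennreal (norm (s k)) * ennreal C \<partial>M)"
  using W by (intro nn_integral_mono) (simp add: norm_mult ennreal_mult nn_integral_cmult mult_left_mono)
 also have "... = ennreal ((\<integral>k. norm (s k) \<partial>M) * C)"
  using s C by (simp add: nn_integral_multc nn_integral_eq_integral ennreal_mult)
 finally show ?thesis .
qed

lemma nn_integral_translates:
 fixes s :: "'k \<Rightarrow> complex" and g :: "'a::euclidean_space \<Rightarrow> complex"
 assumes s: "integrable M s" and g: "integrable lborel g"
 shows "(\<integral>\<^sup>+k. (N1 x. s k * g (x - v k)) \<partial>M)
  \<le> ennreal ((\<integral>k. norm (s k) \<partial>M) * (LL x. norm (g x)))"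
proof (rule nn_integral_weighted_le[OF s])
 have [measurable]: "g \<in> borel_fun" using g by auto
 show "(\<lambda>x. g (x - v k)) \<in> borel_measurable lborel" for k by measurable
 show "(N1 x. g (x - v k)) \<le> ennreal (LL x. norm (g x))" for k
  using g nn_integral_lborel_reflect(2)[of "\<lambda>x. ennreal (norm (g x))" "v k"] by (simp add: nn_integral_eq_integral)
qed simp

text \<open>Boundedness of z is enough for absolute convergence because s is summable; the
  vector-valued sum may then be taken componentwise.\<close>

lemma discrete_conv_component:
 fixes z :: "int ^ 'n \<Rightarrow> complex ^ 'n"
 assumes s: "integrable lattice_count s" and z: "\<And>i k. norm (z k $ i) \<le> Z"
 shows "discrete_conv s z k $ i = (LC l. s l * z (k - l) $ i)"
proof -
 have c: "integrable lattice_count (\<lambda>l. s l * z (k - l) $ i)" for i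
  by (rule L_integrable_bound[OF integrable_mult_right[OF integrable_norm[OF s], of Z]])
    (auto simp: AE_count_space norm_mult mult.commute[of _ "norm (s _)"] intro!: order_trans[OF mult_left_mono[OF z norm_ge_zero] abs_ge_self])
 have "discrete_conv s z k = infsum (\<lambda>l. \<chi> i. s l * z (k - l) $ i) UNIV"
  unfolding discrete_conv_def by (intro infsum_cong) (simp add: vec_eq_iff)
 also have "... = (LC l. (\<chi> i. s l * z (k - l) $ i))"
  using infsetsum_infsum[of "\<lambda>l. \<chi> i. s l * z (k - l) $ i" UNIV] integrable_vec_lambda(1)[of _ "\<lambda>l i. s l * z (k - l) $ i", OF c] by (simp add: abs_summable_on_def infsetsum_def)
 finally show ?thesis unfolding integrable_vec_lambda(2)[OF c] by simp
qed

text \<open>Holds without summability, since both sides then have the default value 0.\<close>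

lemma infsum_eq_count_integral:
 fixes g :: "'k \<Rightarrow> complex"
 shows "infsum g UNIV = (LC k. g k)"
proof (cases "g summable_on UNIV")
 case True
 then have "Infinite_Set_Sum.abs_summable_on g UNIV" unfolding summable_on_iff_abs_summable_on_complex abs_summable_equivalent .
 from infsetsum_infsum[OF this] show ?thesis by (simp add: infsetsum_def)
next
 case False
 then have "\<not> integrable (count_space UNIV) g" unfolding summable_on_iff_abs_summable_on_complex abs_summable_equivalent abs_summable_on_def .
 then show ?thesis using False by (simp add: infsum_not_exists not_integrable_integral_eq)
qed

lemma h1_sums:
 fixes s :: "int ^ 'n \<Rightarrow> complex"
 assumes s: "s \<in> h1 b \<nu>"
 defines "S \<equiv> (LC k. norm (s k))"
  and "d \<equiv> discrete_conv s (discrete_riesz_kernel b \<nu>)"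
 shows "integrable lattice_count s" "integrable lattice_count (\<lambda>k. d k $ i)" (is ?g1) "S \<le> h1_norm b \<nu> s"
  "(LC k. norm (d k $ i)) \<le> h1_norm b \<nu> s" (is ?g2)
proof -
 have s1: "Infinite_Set_Sum.abs_summable_on s UNIV" and d1: "Infinite_Set_Sum.abs_summable_on d UNIV"
  using s unfolding h1_def d_def abs_summable_equivalent[symmetric] by auto
 then have i: "integrable lattice_count s" "integrable lattice_count d" by (auto simp: abs_summable_on_def)
 show di: ?g1 "integrable lattice_count s"
  using i integrable_bounded_linear[OF bounded_linear_vec_nth i(2)] by auto
 have eq: "infsum (\<lambda>k. norm (g k)) UNIV = (LC k. norm (g k))" if "Infinite_Set_Sum.abs_summable_on g UNIV" for g :: "int ^ 'n \<Rightarrow> 'b::{banach,second_countable_topology}"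
  using infsetsum_infsum[of "\<lambda>k. norm (g k)" UNIV] that by (simp add: infsetsum_def)
 have h: "h1_norm b \<nu> s = S + (LC k. norm (d k))"
  unfolding h1_norm_def S_def eq[OF s1] d_def[symmetric] eq[OF d1] ..
 have "(LC k. norm (d k)) \<ge> 0" "S \<ge> 0" by (auto simp: S_def)
 then show "S \<le> h1_norm b \<nu> s" unfolding h by simp
 have "(LC k. norm (d k $ i)) \<le> (LC k. norm (d k))"
  by (intro integral_mono integrable_norm i di Finite_Cartesian_Product.norm_nth_le)
 then show ?g2 unfolding h using \<open>S \<ge> 0\<close> by simp
qed

text \<open>The two norms in \<open>h1_norm\<close> play separate roles: the sum of |s_k| controls
  the Riesz transform of the part with f - f * \<phi>, the sum of |(s * z)_k| that of the part with
  f * \<phi>.\<close>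

lemma lattice_series_weak_riesz:
 fixes b :: "real ^ 'n ^ 'n" and f :: "real ^ 'n \<Rightarrow> complex"
 assumes b: "invertible b" and \<nu>: "cutoff \<nu>" and f: "integrable lborel f"
  and w: "\<And>y i. norm y \<le> 1 \<Longrightarrow> \<exists>r. weak_riesz (axis i 1) (\<lambda>x. f x - f (x - y)) r \<and> (LL x. norm (r x)) \<le> A"
 shows "\<exists>C\<ge>0. \<forall>s\<in>h1 b \<nu>. \<exists>G r. (AE x in lborel. (LC k. s k * f (x - b *v lattice_vec k)) = G x) \<and>
  (\<forall>i. weak_riesz (axis i 1) G (r i) \<and> (LL x. norm (r i x)) \<le> C * h1_norm b \<nu> s)"
proof -
 have [measurable]: "f \<in> borel_fun" using f by auto
 let ?v = "\<lambda>k. b *v lattice_vec k" and ?z = "discrete_riesz_kernel b \<nu>"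
 obtain \<phi> :: "real ^ 'n \<Rightarrow> complex" and B c Z where
  \<phi>m[measurable]: "\<phi> \<in> borel_fun" and \<phi>b: "\<And>x. norm (\<phi> x) \<le> B" and \<phi>w: "integrable lborel (\<lambda>x. (1 + norm x) * norm (\<phi> x))"
  and \<phi>1: "(LL x. \<phi> x) = 1" and \<phi>s: "\<And>x. integrable lattice_count (\<lambda>k. \<phi> (x - ?v k))"
  and zb: "\<And>i k. norm (?z k $ i) \<le> Z" and Nb: "\<And>i x. norm (LC k. ?z k $ i * \<phi> (x - ?v k)) \<le> Z"
  and key: "\<And>i t x. t > 0 \<Longrightarrow> riesz_conv t (axis i 1) \<phi> x =
    conv (gauss_kernel t) (\<lambda>x. of_real c * (LC k. ?z k $ i * \<phi> (x - ?v k))) x"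
  by (rule lattice_mollifier[OF b \<nu>]) (rule that; assumption)
 have \<phi>i: "integrable lborel \<phi>" by (rule L_integrable_bound[OF \<phi>w]) (auto simp: mult_le_cancel_right1)
 have B0: "B \<ge> 0" and Z0: "Z \<ge> 0" using \<phi>b[of 0] zb[of 0] norm_ge_zero order_trans by blast+
 define D where "D x = f x - (LL y. f y * \<phi> (x - y))" for x
 have "\<exists>r. weak_riesz (axis i 1) D r" for i unfolding D_def by (rule weak_riesz_minus_smoothing[OF f w \<phi>m \<phi>b \<phi>w \<phi>1])
 then obtain rho where rho: "\<And>i. weak_riesz (axis i 1) D (rho i)" by metis
 have Di: "integrable lborel D" and rhoi: "\<And>i. integrable lborel (rho i)" using rho by (auto simp: weak_riesz_def)
 note [measurable] = borel_measurable_integrable[OF Di, simplified] borel_measurable_integrable[OF rhoi, simplified]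
 define Fn \<Phi> R where "Fn = (LL x. norm (f x))" and "\<Phi> = (LL x. norm (\<phi> x))" and "R = (\<Sum>i\<in>UNIV. LL x. norm (rho i x))"
 have nn: "Fn \<ge> 0" "\<Phi> \<ge> 0" "R \<ge> 0" by (auto simp: Fn_def \<Phi>_def R_def sum_nonneg)
 have sf: "sigma_finite_measure (count_space (UNIV :: (int ^ 'n) set))" by (rule sigma_finite_measure_count_space_countable) simp
 \<comment> \<open>R bounds the norms of the Riesz transforms of D, and the second summand is the
   norm of f times that of c \<phi>.\<close>
 define C where "C = R + Fn * (\<bar>c\<bar> * \<Phi>)"
 have C0: "C \<ge> 0" using nn by (simp add: C_def)
 show ?thesis
 proof (intro exI[of _ C] conjI C0 ballI)
  fix s assume s: "s \<in> h1 b \<nu>"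
  define S where "S = (LC k. norm (s k))"
  define d where "d i k = discrete_conv s ?z k $ i" for i k
  note h = h1_sums[OF s, folded S_def, folded d_def]
  have S0: "S \<ge> 0" by (simp add: S_def)
  have [measurable]: "(\<lambda>x. h (x - ?v k)) \<in> borel_fun" if [measurable]: "h \<in> borel_fun" for h :: "real ^ 'n \<Rightarrow> complex" and k by measurable
  have tr: "(\<lambda>(x, k). q k * h (x - ?v k)) \<in> borel_measurable (borel \<Otimes>\<^sub>M lattice_count)" if [measurable]: "h \<in> borel_fun" for h :: "real ^ 'n \<Rightarrow> complex" and q
   by (rule measurable_countable_family) measurable
  define F1 rho1 where "F1 x = (LC k. s k * D (x - ?v k))" and "rho1 i x = (LC k. s k * rho i (x - ?v k))" for i x
  have w1: "weak_riesz (axis i 1) F1 (rho1 i)" for i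
   unfolding F1_def[abs_def] rho1_def[abs_def]
   by (rule weak_riesz_superposition[OF sf tr nn_integral_translates[OF h(1) Di] _ tr nn_integral_translates[OF h(1) rhoi]])
     (auto intro!: weak_riesz_scale weak_riesz_translate rho)
  have n1: "(LL x. norm (rho1 i x)) \<le> S * (LL x. norm (rho i x))" for i
   unfolding rho1_def S_def by (rule superposition(2)[OF sf tr nn_integral_translates[OF h(1) rhoi]]) auto
  define g where "g x = (LC k. s k * \<phi> (x - ?v k))" for x
  define q where "q i x = of_real c * (LC k. d i k * \<phi> (x - ?v k))" for i x
  define N where "N i x = of_real c * (LC k. ?z k $ i * \<phi> (x - ?v k))" for i x
  have gi: "integrable lborel g" and gn: "(LL x. norm (g x)) \<le> S * \<Phi>"
   unfolding g_def S_def \<Phi>_def by (rule superposition(1,2)[OF sf tr nn_integral_translates[OF h(1) \<phi>i]]; simp)+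
  have qi0: "integrable lborel (\<lambda>x. LC k. d i k * \<phi> (x - ?v k))" and qn0: "(LL x. norm (LC k. d i k * \<phi> (x - ?v k))) \<le> (LC k. norm (d i k)) * \<Phi>" for i
   unfolding \<Phi>_def by (rule superposition(1,2)[OF sf tr nn_integral_translates[OF h(2) \<phi>i]]; simp)+
  have qi: "integrable lborel (q i)" for i unfolding q_def using qi0 by simp
  have qn: "(LL x. norm (q i x)) \<le> \<bar>c\<bar> * (h1_norm b \<nu> s * \<Phi>)" for i
   using mult_left_mono[OF order_trans[OF qn0 mult_right_mono[OF h(4) nn(2)]] abs_ge_zero[of c]] by (simp add: q_def norm_mult)
  note [measurable] = borel_measurable_integrable[OF gi, simplified] borel_measurable_integrable[OF qi, simplified]
  have Nm[measurable]: "N i \<in> borel_fun" for i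
  proof -
   have "(\<lambda>(x, k). ?z k $ i * \<phi> (x - ?v k)) \<in> borel_measurable (borel \<Otimes>\<^sub>M lattice_count)" by (rule tr) measurable
   from sigma_finite_measure.borel_measurable_lebesgue_integral[OF sf this] show ?thesis unfolding N_def[abs_def] by measurable
  qed
  have NB: "norm (N i x) \<le> \<bar>c\<bar> * Z" for i x unfolding N_def norm_mult using Nb by (simp add: mult_left_mono)
  \<comment> \<open>Fubini over pairs of lattice points: \<phi>(x - b k) s_l is summable over pairs
    and z is bounded. The substitution k = m + l then collects N at x - b l.\<close>
  have qN: "q i x = (LC l. s l * N i (x - ?v l))" for i x
  proof -
   define H where "H k l = s l * ?z (k - l) $ i * \<phi> (x - ?v k)" for k l
   have pr: "Infinite_Set_Sum.abs_summable_on (\<lambda>(k, l). \<phi> (x - ?v k) * s l) (UNIV \<times> UNIV)"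
    using h(1) \<phi>s by (intro abs_summable_on_product) (auto simp: abs_summable_on_def)
   have "Infinite_Set_Sum.abs_summable_on (\<lambda>(k, l). H k l) (UNIV \<times> UNIV)"
   proof (rule abs_summable_on_comparison_test[OF abs_summable_on_cmult_right[OF pr, of "of_real Z"]], clarify)
    fix k l
    have "norm (H k l) \<le> norm (s l) * Z * norm (\<phi> (x - ?v k))" unfolding H_def norm_mult by (intro mult_right_mono mult_left_mono zb) auto
    then show "norm (H k l) \<le> norm (of_real Z * (\<phi> (x - ?v k) * s l))" using Z0 by (simp add: norm_mult mult_ac)
   qed
   from infsetsum_swap[OF _ _ this] have sw: "(LC l. (LC k. H k l)) = (LC k. (LC l. H k l))"
    by (simp add: infsetsum_def)
   have "(LC l. H k l) = d i k * \<phi> (x - ?v k)" for k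
    unfolding d_def discrete_conv_component[OF h(1) zb] H_def by simp
   moreover have "(LC k. H k l) = s l * (LC m. ?z m $ i * \<phi> (x - ?v l - ?v m))" for l
   proof -
    have "bij_betw (\<lambda>m. m + l) UNIV (UNIV :: (int ^ 'n) set)" by (rule bij_betwI[where g = "\<lambda>m. m - l"]) auto
    from infsetsum_reindex_bij_betw[OF this, of "\<lambda>k. H k l"]
    have "(LC k. H k l) = (LC m. H (m + l) l)" by (simp add: infsetsum_def)
    also have "... = (LC m. s l * (?z m $ i * \<phi> (x - ?v l - ?v m)))"
    proof -
     have "?v (m + l) = ?v m + ?v l" for m by (simp add: matrix_vector_right_distrib[symmetric] lattice_vec_def vec_eq_iff flip: matrix_vector_right_distrib) (simp add: plus_vec_def)
     then show ?thesis by (simp add: H_def algebra_simps)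
    qed
    finally show ?thesis by simp
   qed
   ultimately show ?thesis using sw by (simp add: q_def N_def mult.left_commute[of _ "of_real c"])
  qed
  \<comment> \<open>N is bounded but not known to be integrable, so this is not a superposition of
    instances of \<open>weak_riesz\<close>. Under a Gaussian boundedness suffices to exchange the
    sum over k, and q is integrable because s * z is summable.\<close>
  have w2: "weak_riesz (axis i 1) g (q i)" for i
   unfolding weak_riesz_def
  proof (intro conjI gi qi allI impI)
   fix t :: real and x :: "real ^ 'n" assume t: "t > 0"
   obtain A' where A': "\<And>x::real ^ 'n. \<bar>riesz_heat t x \<bullet> axis i 1\<bar> \<le> A'" using riesz_component_bounded[OF t] by blast
   have G: "integrable lborel (\<lambda>y. gauss_kernel t (x - y))"
    using gauss_kernel_integral(1)[OF t, where 'a = "real ^ 'n"] integral_lborel_reflect(2)[of "gauss_kernel t" x] by simp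
   have "riesz_conv t (axis i 1) g x = (LC k. riesz_conv t (axis i 1) (\<lambda>x. s k * \<phi> (x - ?v k)) x)" (is "?l = _")
    unfolding g_def[abs_def] by (rule superposition(4)[OF sf tr nn_integral_translates[OF h(1) \<phi>i] _ _ A']) auto
   also have "... = (LC k. s k * conv (gauss_kernel t) (N i) (x - ?v k))"
   proof -
    have "riesz_conv t (axis i 1) (\<lambda>x. s k * \<phi> (x - ?v k)) x = s k * riesz_conv t (axis i 1) \<phi> (x - ?v k)" for k
     unfolding conv_translate[symmetric] by (simp only: conv_def integral_mult_right_zero[symmetric] mult_scaleR_right)
    then show ?thesis unfolding key[OF t] N_def[abs_def] by simp
   qed
   also have "... = (LC k. (LL y. s k * (gauss_kernel t (x - y) *\<^sub>R N i (y - ?v k))))"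
    unfolding conv_translate[symmetric] by (simp only: conv_def integral_mult_right_zero)
   also have "... = (LL y. (LC k. s k * (gauss_kernel t (x - y) *\<^sub>R N i (y - ?v k))))"
   proof (rule sum_prod_swap[symmetric])
    show "(NC k. (N1 y. s k * (gauss_kernel t (x - y) *\<^sub>R N i (y - ?v k)))) \<le> ennreal (S * (\<bar>c\<bar> * Z))"
     unfolding S_def
    proof (rule nn_integral_weighted_le[OF h(1)])
     fix k
     have "(N1 y. gauss_kernel t (x - y) *\<^sub>R N i (y - ?v k)) \<le> (NN y. ennreal (gauss_kernel t (x - y) * (\<bar>c\<bar> * Z)))" (is "?l \<le> _")
      by (intro nn_integral_mono ennreal_leI) (auto intro: mult_left_mono NB)
     also have "... = ennreal (\<bar>c\<bar> * Z)"
      using G Z0 gauss_kernel_integral(2)[OF t, where 'a = "real ^ 'n"] integral_lborel_reflect(1)[of "gauss_kernel t" x] by (subst nn_integral_eq_integral) auto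
     finally show "?l \<le> ennreal (\<bar>c\<bar> * Z)" .
    qed (use Z0 in auto)
   qed (use S0 Z0 in auto)
   also have "... = conv (gauss_kernel t) (q i) x"
    unfolding conv_def qN by (simp add: mult.left_commute[of "s _"] scaleR_conv_of_real)
   finally show "?l = conv (gauss_kernel t) (q i) x" .
  qed
  have cm: "(\<lambda>(x, y). f y * h (x - y)) \<in> borel_measurable (borel \<Otimes>\<^sub>M lborel)" if [measurable]: "h \<in> borel_fun" for h :: "real ^ 'n \<Rightarrow> complex"
   by measurable
  note cn = nn_integral_translates[OF f, where v = "\<lambda>y. y", folded Fn_def]
  have gm: "g \<in> borel_fun" and qm: "q i \<in> borel_fun" for i by measurable
  \<comment> \<open>The translates of f * \<phi> sum to f * g: a superposition of translates of g
    with weight f, so the Riesz transform q of g is carried along.\<close>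
  define F3 rho3 where "F3 x = (LL y. f y * g (x - y))" and "rho3 i x = (LL y. f y * q i (x - y))" for i x
  have w3: "weak_riesz (axis i 1) F3 (rho3 i)" for i
   unfolding F3_def[abs_def] rho3_def[abs_def]
   by (rule weak_riesz_superposition[OF sigma_finite_lborel cm[OF gm] cn[OF gi] _ cm[OF qm] cn[OF qi]])
     (auto intro!: weak_riesz_scale weak_riesz_translate w2 nn mult_nonneg_nonneg)
  have n3: "(LL x. norm (rho3 i x)) \<le> Fn * (LL x. norm (q i x))" for i
   unfolding rho3_def by (rule superposition(2)[OF sigma_finite_lborel cm[OF qm] cn[OF qi]]) (use nn in auto)
  show "\<exists>G r. (AE x in lborel. (LC k. s k * f (x - ?v k)) = G x) \<and>
   (\<forall>i. weak_riesz (axis i 1) G (r i) \<and> (LL x. norm (r i x)) \<le> C * h1_norm b \<nu> s)"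
  proof (intro exI conjI allI)
   show "weak_riesz (axis i 1) (\<lambda>x. 1 * F1 x + 1 * F3 x) (\<lambda>x. 1 * rho1 i x + 1 * rho3 i x)" for i
    by (rule weak_riesz_lincomb[OF w1 w3])
   show "(LL x. norm (1 * rho1 i x + 1 * rho3 i x)) \<le> C * h1_norm b \<nu> s" for i
   proof -
    have i: "integrable lborel (rho1 i)" "integrable lborel (rho3 i)" using w1 w3 by (auto simp: weak_riesz_def)
    have "(LL x. norm (1 * rho1 i x + 1 * rho3 i x)) \<le> (LL x. norm (rho1 i x) + norm (rho3 i x))"
     using i by (intro integral_mono) (auto intro: norm_triangle_ineq)
    also have "... \<le> S * (LL x. norm (rho i x)) + Fn * (\<bar>c\<bar> * (h1_norm b \<nu> s * \<Phi>))"
     using i n1[of i] order_trans[OF n3 mult_left_mono[OF qn nn(1)], of i] by simp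
    also have "... \<le> h1_norm b \<nu> s * R + Fn * (\<bar>c\<bar> * (h1_norm b \<nu> s * \<Phi>))"
     using h(3) S0 unfolding R_def by (intro add_right_mono mult_mono member_le_sum) auto
    also have "... = C * h1_norm b \<nu> s" by (simp add: C_def algebra_simps)
    finally show ?thesis .
   qed
   have "AE x in lborel. integrable lattice_count (\<lambda>k. s k * f (x - ?v k))"
    by (rule superposition(3)[OF sf tr nn_integral_translates[OF h(1) f]]) auto
   then show "AE x in lborel. (LC k. s k * f (x - ?v k)) = 1 * F1 x + 1 * F3 x"
   proof eventually_elim
    case (elim x)
    define P where "P k = s k * (LL y. f y * \<phi> (x - ?v k - y))" for k
    have tot: "(NC k. (N1 y. s k * (f y * \<phi> (x - ?v k - y)))) \<le> ennreal (S * (Fn * B))"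
     unfolding S_def
    proof (rule nn_integral_weighted_le[OF h(1)])
     fix k
     have "(N1 y. f y * \<phi> (x - ?v k - y)) \<le> (NN y. ennreal (norm (f y) * B))" (is "?l \<le> _")
      by (intro nn_integral_mono ennreal_leI) (auto simp: norm_mult intro: mult_left_mono \<phi>b)
     also have "... = ennreal (Fn * B)" using f B0 by (subst nn_integral_eq_integral) (auto simp: Fn_def)
     finally show "?l \<le> ennreal (Fn * B)" .
    qed (use B0 nn in auto)
    have P: "integrable lattice_count P"
    proof (rule integrableI_bounded)
     have Pk: "P k = (LL y. s k * (f y * \<phi> (x - ?v k - y)))" for k by (simp add: P_def)
     have "ennreal (norm (P k)) \<le> (N1 y. s k * (f y * \<phi> (x - ?v k - y)))" for k
      unfolding Pk by (rule norm_integral_le_nn_integral)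
     then have "(NC k. ennreal (norm (P k))) \<le> ennreal (S * (Fn * B))"
      by (intro order_trans[OF nn_integral_mono tot])
     then show "(NC k. ennreal (norm (P k))) < \<infinity>" by (rule le_less_trans) simp
    qed simp
    have "F3 x = (LL y. (LC k. s k * (f y * \<phi> (x - ?v k - y))))"
     unfolding F3_def g_def by (simp add: mult.left_commute[of "f _"] diff_diff_eq add.commute flip: integral_mult_right_zero)
    also have "... = (LC k. P k)"
     unfolding P_def integral_mult_right_zero[symmetric] by (rule sum_prod_swap[OF _ tot]) (use S0 B0 nn in auto)
    finally have "F3 x = (LC k. P k)" .
    moreover have "F1 x = (LC k. s k * f (x - ?v k) - P k)"
     unfolding F1_def D_def P_def by (simp add: algebra_simps)
    ultimately show ?case using elim P by simp
   qed
  qed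
 qed
qed

subsection \<open>Synthesis\<close>

lemma nn_integral_count_eq_infsum:
 fixes B :: "'k \<Rightarrow> real"
 assumes B: "\<And>k. k \<in> A \<Longrightarrow> B k \<ge> 0" "B summable_on A"
 shows "(NC k. ennreal (if k \<in> A then B k else 0)) = ennreal (infsum B A)"
proof -
 have s: "Infinite_Set_Sum.abs_summable_on B A"
  using B(2) unfolding abs_summable_equivalent[symmetric] summable_on_iff_abs_summable_on_real[symmetric] .
 have "(NC k. ennreal (if k \<in> A then B k else 0)) = (NC k. ennreal (B k) * indicator A k)"
  by (intro nn_integral_cong) (auto simp: indicator_def)
 also have "... = (\<integral>\<^sup>+k. ennreal (B k) \<partial>count_space A)" by (simp add: nn_integral_count_space_indicator)
 also have "... = ennreal (\<integral>k. B k \<partial>count_space A)"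
  using s B(1) by (intro nn_integral_eq_integral) (auto simp: abs_summable_on_def AE_count_space)
 also have "(\<integral>k. B k \<partial>count_space A) = infsum B A" using infsetsum_infsum[OF s] by (simp add: infsetsum_def)
 finally show ?thesis .
qed

lemma infsum_tail_tendsto:
 fixes B :: "'k \<Rightarrow> real"
 assumes "B summable_on A"
 shows "((\<lambda>J. infsum B (A - J)) \<longlongrightarrow> 0) (finite_subsets_at_top A)"
proof -
 have "(sum B \<longlongrightarrow> infsum B A) (finite_subsets_at_top A)" using has_sum_infsum[OF assms] by (simp add: has_sum_def)
 then have "((\<lambda>J. infsum B A - sum B J) \<longlongrightarrow> infsum B A - infsum B A) (finite_subsets_at_top A)" by (intro tendsto_intros)
 moreover have "\<forall>\<^sub>F J in finite_subsets_at_top A. infsum B A - sum B J = infsum B (A - J)"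
  by (rule eventually_finite_subsets_at_top_weakI) (use assms infsum_Diff[OF assms] in \<open>simp add: infsum_finite\<close>)
 ultimately show ?thesis by (simp add: tendsto_cong)
qed

text \<open>Common frame of both series: over lattice points at one scale, and over scales. The G
  are integrable Borel representatives of the given g, and B is a summable bound for their
  norms.\<close>

locale AE_summable_family =
 fixes g G :: "'k::countable \<Rightarrow> real ^ 'n \<Rightarrow> complex" and A :: "'k set" and B :: "'k \<Rightarrow> real"
 assumes eq: "\<And>k. k \<in> A \<Longrightarrow> AE x in lborel. g k x = G k x"
  and G: "\<And>k. k \<in> A \<Longrightarrow> integrable lborel (G k)" and GB: "\<And>k. k \<in> A \<Longrightarrow> (LL x. norm (G k x)) \<le> B k"
  and B: "B summable_on A"
begin

text \<open>Extension by 0 to the whole type, so that sums over A - J become integrals over one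
  counting measure.\<close>

definition tail :: "'k set \<Rightarrow> ('k \<Rightarrow> real ^ 'n \<Rightarrow> complex) \<Rightarrow> 'k \<Rightarrow> real ^ 'n \<Rightarrow> complex" where
 "tail J H k x = (if k \<in> A - J then H k x else 0)"

lemma B_nonneg: "k \<in> A \<Longrightarrow> B k \<ge> 0" using GB[of k] by (auto intro: order_trans[rotated])

lemma sigma_finite_count: "sigma_finite_measure (count_space (UNIV :: 'k set))"
 by (rule sigma_finite_measure_count_space_countable) simp

lemma B_tail: "B summable_on (A - J)" "infsum B (A - J) \<ge> 0"
 using summable_on_subset_banach[OF B, of "A - J"] B_nonneg by (auto intro!: infsum_nonneg)

lemma tail_bound:
 assumes H: "\<And>k. k \<in> A \<Longrightarrow> integrable lborel (H k)" "\<And>k. k \<in> A \<Longrightarrow> (LL x. norm (H k x)) \<le> B k"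
 shows "(NC k. (N1 x. tail J H k x)) \<le> ennreal (infsum B (A - J))" (is ?g1)
  and "(\<lambda>(x, k). tail J H k x) \<in> borel_measurable (borel \<Otimes>\<^sub>M count_space UNIV)" (is ?g2)
proof -
 have "(N1 x. tail J H k x) \<le> ennreal (if k \<in> A - J then B k else 0)" for k
  using H[of k] by (auto simp: tail_def nn_integral_eq_integral intro: ennreal_leI)
 then have "(NC k. (N1 x. tail J H k x)) \<le> (NC k. ennreal (if k \<in> A - J then B k else 0))"
  by (intro nn_integral_mono)
 also have "... = ennreal (infsum B (A - J))" by (rule nn_integral_count_eq_infsum) (use B_nonneg B_tail in auto)
 finally show ?g1 .
 show ?g2
 proof (rule measurable_countable_family)
  show "tail J H k \<in> borel_fun" for k
   using borel_measurable_integrable[OF H(1)[of k]] by (cases "k \<in> A - J") (auto simp: tail_def[abs_def])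
 qed
qed

lemmas tail_G = tail_bound[OF G GB]

text \<open>The case J = {} represents the series itself; the other J give the remainders, whose
  norms are bounded by the tails of the sum of B.\<close>

lemma remainder_eq:
 assumes J: "finite J" "J \<subseteq> A"
 shows "AE x in lborel. infsum (\<lambda>k. g k x) A - (\<Sum>k\<in>J. g k x) = (LC k. tail J G k x)"
proof -
 have "AE x in lborel. \<forall>k. k \<in> A \<longrightarrow> g k x = G k x" unfolding AE_all_countable using eq by auto
 moreover have "AE x in lborel. integrable (count_space UNIV) (\<lambda>k. tail {} G k x)"
  by (rule superposition(3)[OF sigma_finite_count tail_G(2,1)[of "{}"] B_tail(2)])
 ultimately show ?thesis
 proof eventually_elim
  case (elim x)
  have fin: "integrable (count_space UNIV) (\<lambda>k. indicator J k *\<^sub>R G k x)"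
   using abs_summable_on_finite[OF J(1), of "\<lambda>k. G k x"] unfolding abs_summable_on_altdef set_integrable_def .
  have "infsum (\<lambda>k. g k x) A = infsum (\<lambda>k. tail {} G k x) UNIV" (is "?l = _")
   using elim(1) by (intro infsum_cong_neutral) (auto simp: tail_def)
  also have "... = (LC k. tail {} G k x)" by (rule infsum_eq_count_integral)
  finally have 1: "?l = (LC k. tail {} G k x)" .
  have "(\<Sum>k\<in>J. g k x) = (\<Sum>k\<in>J. G k x)" using elim(1) J by (intro sum.cong) auto
  also have "... = (LC k. indicator J k *\<^sub>R G k x)"
   using infsetsum_finite[OF J(1), of "\<lambda>k. G k x"] unfolding infsetsum_altdef set_lebesgue_integral_def ..
  finally have "infsum (\<lambda>k. g k x) A - (\<Sum>k\<in>J. g k x) = (LC k. tail {} G k x - indicator J k *\<^sub>R G k x)"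
   unfolding 1 using elim(2) fin by simp
  also have "... = (LC k. tail J G k x)"
   using J by (intro L_integral_cong) (auto simp: tail_def indicator_def)
  finally show ?case .
 qed
qed

lemma L1_abs_has_sum: "L1_abs_has_sum g A (\<lambda>x. infsum (\<lambda>k. g k x) A)"
proof -
 note sup = superposition(1,2)[OF sigma_finite_count tail_G(2,1) B_tail(2)]
 note rem = lebesgue_integral_AE_eq[OF remainder_eq sup(1)]
 have t: "(\<integral>x. norm (infsum (\<lambda>k. g k x) A - (\<Sum>k\<in>J. g k x)) \<partial>lebesgue) \<le> infsum B (A - J)" if "finite J" "J \<subseteq> A" for J
  using rem(2)[OF that] sup(2)[of J] by simp
 show ?thesis
  unfolding L1_abs_has_sum_def
 proof (intro conjI ballI)
  show "integrable lebesgue (g k)" if "k \<in> A" for k by (rule lebesgue_integral_AE_eq(1)[OF eq G]) (use that in auto)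
  show "integrable lebesgue (\<lambda>x. infsum (\<lambda>k. g k x) A)" using rem(1)[of "{}"] by simp
  show "(\<lambda>k. \<integral>x. norm (g k x) \<partial>lebesgue) summable_on A"
  proof (rule summable_on_comparison_test[OF B])
   show "(\<integral>x. norm (g k x) \<partial>lebesgue) \<le> B k" if "k \<in> A" for k using lebesgue_integral_AE_eq(2)[OF eq G] GB that by simp
  qed auto
  show "((\<lambda>J. \<integral>x. norm (infsum (\<lambda>k. g k x) A - (\<Sum>k\<in>J. g k x)) \<partial>lebesgue) \<longlongrightarrow> 0) (finite_subsets_at_top A)"
   by (rule tendsto_sandwich[OF _ _ tendsto_const infsum_tail_tendsto[OF B]])
     (auto intro!: eventually_finite_subsets_at_top_weakI t)
 qed
qed

text \<open>In K the 1 accounts for the L^1 norm and the other summand for the d components of the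
  Riesz transform, each obeying the same bound B.\<close>

lemma H1_abs_has_sum:
 assumes r: "\<And>k i. k \<in> A \<Longrightarrow> weak_riesz (axis i 1) (G k) (r k i)" "\<And>k i. k \<in> A \<Longrightarrow> (LL x. norm (r k i x)) \<le> B k"
 defines "K \<equiv> 1 + riesz_ratio TYPE('n) * real CARD('n)"
 shows "H1_abs_has_sum g A (\<lambda>x. infsum (\<lambda>k. g k x) A)" (is ?g1)
  and "H1_norm (\<lambda>x. infsum (\<lambda>k. g k x) A) \<le> ennreal (K * infsum B A)" (is ?g2)
  and "k \<in> A \<Longrightarrow> g k \<in> H1"
proof -
 have \<kappa>: "riesz_ratio TYPE('n) > 0" by (rule riesz_ratio_pos)
 have K: "K > 0" using \<kappa> by (simp add: K_def add_pos_nonneg)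
 have ri: "k \<in> A \<Longrightarrow> integrable lborel (r k i)" for k i using r(1) by (auto simp: weak_riesz_def)
 note tail_r = tail_bound[where H = "\<lambda>k. r k i" for i, OF ri r(2)]
 have w: "weak_riesz (axis i 1) (\<lambda>x. LC k. tail J G k x) (\<lambda>x. LC k. tail J (\<lambda>k. r k i) k x)" for i J
 proof (rule weak_riesz_superposition[OF sigma_finite_count tail_G(2,1) B_tail(2) tail_r(2,1) B_tail(2)])
  show "weak_riesz (axis i 1) (tail J G k) (tail J (\<lambda>k. r k i) k)" for k
   using r(1)[of k i] by (cases "k \<in> A - J") (auto simp: tail_def[abs_def] weak_riesz_def conv_def)
 qed
 have bnd: "(\<lambda>x. infsum (\<lambda>k. g k x) A - (\<Sum>k\<in>J. g k x)) \<in> H1 \<and> H1_norm (\<lambda>x. infsum (\<lambda>k. g k x) A - (\<Sum>k\<in>J. g k x)) \<le> ennreal (K * infsum B (A - J))"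
  if J: "finite J" "J \<subseteq> A" for J
 proof (intro conjI weak_riesz_imp_H1(1)[OF w remainder_eq[OF J]] order_trans[OF weak_riesz_imp_H1(2)[OF w remainder_eq[OF J]]] ennreal_leI)
  have "(\<Sum>i\<in>(UNIV :: 'n set). LL x. norm (LC k. tail J (\<lambda>k. r k i) k x)) \<le> (\<Sum>i\<in>(UNIV :: 'n set). infsum B (A - J))"
   by (intro sum_mono superposition(2)[OF sigma_finite_count tail_r(2,1) B_tail(2)])
  then show "(LL x. norm (LC k. tail J G k x)) + riesz_ratio TYPE('n) * (\<Sum>i\<in>UNIV. LL x. norm (LC k. tail J (\<lambda>k. r k i) k x)) \<le> K * infsum B (A - J)"
   using superposition(2)[OF sigma_finite_count tail_G(2,1) B_tail(2), of J] mult_left_mono[OF _ less_imp_le[OF \<kappa>]] by (fastforce simp: K_def distrib_right mult.assoc intro: add_mono)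
 qed
 show n: ?g2 using bnd[of "{}"] by simp
 have gk: "g k \<in> H1 \<and> H1_norm (g k) \<le> ennreal (K * B k)" if k: "k \<in> A" for k
 proof (intro conjI weak_riesz_imp_H1(1)[OF r(1)[OF k] eq[OF k]] order_trans[OF weak_riesz_imp_H1(2)[OF r(1)[OF k] eq[OF k]]] ennreal_leI)
  have "(\<Sum>i\<in>(UNIV :: 'n set). LL x. norm (r k i x)) \<le> (\<Sum>i\<in>(UNIV :: 'n set). B k)"
   by (intro sum_mono r(2) k)
  then show "(LL x. norm (G k x)) + riesz_ratio TYPE('n) * (\<Sum>i\<in>UNIV. LL x. norm (r k i x)) \<le> K * B k"
   using GB[OF k] mult_left_mono[OF _ less_imp_le[OF \<kappa>]] by (fastforce simp: K_def distrib_right mult.assoc intro: add_mono)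
 qed
 then show "g k \<in> H1" if "k \<in> A" using that by blast
 show ?g1
  unfolding H1_abs_has_sum_def
 proof (intro conjI ballI)
  show "(\<lambda>x. infsum (\<lambda>k. g k x) A) \<in> H1" using bnd[of "{}"] by simp
  show "g k \<in> H1" if "k \<in> A" for k using gk that by blast
  have "(\<Sum>\<^sub>\<infinity>k\<in>A. H1_norm (g k)) \<le> ennreal (K * infsum B A)"
   unfolding nonneg_infsum_complete[OF zero_le]
  proof (rule SUP_least, clarify)
   fix F assume F: "finite F" "F \<subseteq> A"
   have "(\<Sum>k\<in>F. H1_norm (g k)) \<le> (\<Sum>k\<in>F. ennreal (K * B k))" (is "?l \<le> _") using gk F by (intro sum_mono) auto
   also have "... = ennreal (K * (\<Sum>k\<in>F. B k))"
    using K B_nonneg F by (subst sum_ennreal) (auto simp: sum_distrib_left subset_iff)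
   also have "... \<le> ennreal (K * infsum B A)"
    using K F B B_nonneg by (intro ennreal_leI mult_left_mono finite_sum_le_infsum) auto
   finally show "?l \<le> ennreal (K * infsum B A)" .
  qed
  then show "(\<Sum>\<^sub>\<infinity>k\<in>A. H1_norm (g k)) < \<infinity>" by (rule le_less_trans) simp
  have "((\<lambda>J. ennreal (K * infsum B (A - J))) \<longlongrightarrow> ennreal (K * 0)) (finite_subsets_at_top A)"
   by (intro tendsto_ennrealI tendsto_mult tendsto_const infsum_tail_tendsto[OF B])
  then have t: "((\<lambda>J. ennreal (K * infsum B (A - J))) \<longlongrightarrow> 0) (finite_subsets_at_top A)" by simp
  show "((\<lambda>J. H1_norm (\<lambda>x. infsum (\<lambda>k. g k x) A - (\<Sum>k\<in>J. g k x))) \<longlongrightarrow> 0) (finite_subsets_at_top A)"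
   by (rule tendsto_sandwich[OF _ _ tendsto_const t])
     (auto intro!: eventually_finite_subsets_at_top_weakI conjunct2[OF bnd])
 qed
qed

end

text \<open>C does not depend on \<alpha>: with the factor |det a| = |\<alpha>|^d the dilated
  functions keep their L^1 norms, and their Riesz transforms are dilated along up to sign. This
  reduces everything to the undilated lattice series.\<close>

lemma synthesis_at_weak_riesz:
 fixes b :: "real ^ 'n ^ 'n" and f \<psi> :: "real ^ 'n \<Rightarrow> complex"
 assumes b: "invertible b" and \<nu>: "cutoff \<nu>" and f: "integrable lborel f" and \<psi>: "AE x in lborel. \<psi> x = f x"
  and w: "\<And>y i. norm y \<le> 1 \<Longrightarrow> \<exists>r. weak_riesz (axis i 1) (\<lambda>x. f x - f (x - y)) r \<and> (LL x. norm (r x)) \<le> A"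
 shows "\<exists>C\<ge>0. \<forall>\<alpha> s. \<alpha> \<noteq> 0 \<longrightarrow> s \<in> h1 b \<nu> \<longrightarrow>
  L1_abs_has_sum (\<lambda>k x. s k * affine_copy (mat \<alpha>) b \<psi> k x) UNIV (synthesis_at (mat \<alpha>) b \<psi> s) \<and>
  (\<exists>G r. (AE x in lborel. synthesis_at (mat \<alpha>) b \<psi> s x = G x) \<and> integrable lborel G \<and> (LL x. norm (G x)) \<le> C * h1_norm b \<nu> s \<and>
    (\<forall>i. weak_riesz (axis i 1) G (r i) \<and> (LL x. norm (r i x)) \<le> C * h1_norm b \<nu> s))"
proof -
 let ?v = "\<lambda>k. b *v lattice_vec k"
 obtain C where C: "C \<ge> 0" "\<And>s. s \<in> h1 b \<nu> \<Longrightarrow> \<exists>G r. (AE x in lborel. (LC k. s k * f (x - ?v k)) = G x) \<and>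
  (\<forall>i. weak_riesz (axis i 1) G (r i) \<and> (LL x. norm (r i x)) \<le> C * h1_norm b \<nu> s)"
  using lattice_series_weak_riesz[OF b \<nu> f w] by blast
 define Fn where "Fn = (LL x. norm (f x))"
 have Fn: "Fn \<ge> 0" by (simp add: Fn_def)
 show ?thesis
 \<comment> \<open>\<open>Fn\<close> enters for the L^1 norm of the series itself, C for its Riesz
   transforms.\<close>
 proof (intro exI[of _ "C + Fn"] conjI allI impI)
  show "C + Fn \<ge> 0" using C(1) Fn by simp
  fix \<alpha> :: real and s assume \<alpha>: "\<alpha> \<noteq> 0" and s: "s \<in> h1 b \<nu>"
  note h = h1_sums[OF s]
  define D where "D = \<bar>\<alpha>\<bar> ^ CARD('n)"
  have D: "D > 0" using \<alpha> by (simp add: D_def)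
  have a: "affine_copy (mat \<alpha>) b \<psi> k x = of_real D * \<psi> (- ?v k + \<alpha> *\<^sub>R x)" for k x
  proof -
   have "mat \<alpha> *v x = \<alpha> *\<^sub>R x" by (simp add: vec_eq_iff mat_def matrix_vector_mult_def if_distrib[of "\<lambda>c. c * _"] cong: if_cong)
   moreover have "det (mat \<alpha> :: real ^ 'n ^ 'n) = \<alpha> ^ CARD('n)" by (subst det_diagonal) (auto simp: mat_def)
   ultimately show ?thesis by (simp add: affine_copy_def D_def power_abs)
  qed
  have sub: "integrable lborel (\<lambda>x. g (t + \<alpha> *\<^sub>R x))" "D * (LL x. norm (g (t + \<alpha> *\<^sub>R x))) = (LL x. norm (g x))"
   if "integrable lborel g" for g :: "real ^ 'n \<Rightarrow> complex" and t
   using integral_lborel_affine[OF integrable_norm[OF that] \<alpha>, of t] integral_lborel_affine(2)[OF that \<alpha>, of t] D by (auto simp: D_def)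
  define S where "S = (LC k. norm (s k))"
  define H where "H k x = s k * (of_real D * f (- ?v k + \<alpha> *\<^sub>R x))" for k x
  interpret AE_summable_family "\<lambda>k x. s k * affine_copy (mat \<alpha>) b \<psi> k x" H UNIV "\<lambda>k. norm (s k) * Fn"
  proof
   show "AE x in lborel. s k * affine_copy (mat \<alpha>) b \<psi> k x = H k x" for k
    using AE_lborel_affine[OF \<psi> \<alpha>, of "- ?v k"] by eventually_elim (simp add: a H_def)
   show "integrable lborel (H k)" for k unfolding H_def[abs_def] by (intro integrable_mult_right sub f)
   show "(LL x. norm (H k x)) \<le> norm (s k) * Fn" for k
    using sub(2)[OF f, of "- ?v k"] D by (simp add: H_def norm_mult Fn_def)
   show "(\<lambda>k. norm (s k) * Fn) summable_on UNIV"
    using s by (intro summable_on_cmult_left) (simp add: h1_def)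
  qed
  have syn: "synthesis_at (mat \<alpha>) b \<psi> s = (\<lambda>x. \<Sum>\<^sub>\<infinity>k. s k * affine_copy (mat \<alpha>) b \<psi> k x)"
   by (simp add: synthesis_at_def[abs_def])
  show "L1_abs_has_sum (\<lambda>k x. s k * affine_copy (mat \<alpha>) b \<psi> k x) UNIV (synthesis_at (mat \<alpha>) b \<psi> s)"
   unfolding syn by (rule L1_abs_has_sum)
  obtain G r where G: "AE x in lborel. (LC k. s k * f (x - ?v k)) = G x"
   and r: "\<And>i. weak_riesz (axis i 1) G (r i)" "\<And>i. (LL x. norm (r i x)) \<le> C * h1_norm b \<nu> s"
   using C(2)[OF s] by blast
  have i: "integrable lborel G" "\<And>i. integrable lborel (r i)" using r(1) by (auto simp: weak_riesz_def)
  note [measurable] = borel_measurable_integrable[OF i(1), simplified]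
  have h0: "h1_norm b \<nu> s \<ge> 0" using h(3) by (rule order_trans[rotated]) simp
  define G' where "G' x = of_real D * G (\<alpha> *\<^sub>R x)" for x
  define r' where "r' i x = of_real D * (of_real (sgn \<alpha>) * r i (\<alpha> *\<^sub>R x))" for i x
  have wG: "weak_riesz (axis i 1) G' (r' i)" for i
   unfolding G'_def[abs_def] r'_def[abs_def] by (intro weak_riesz_scale weak_riesz_dilate r \<alpha>)
  have eq1: "AE x in lborel. (LC k. H k x) = G' x"
   using AE_lborel_affine[OF G \<alpha>, of 0]
  proof eventually_elim
   case (elim x)
   have "(LC k. H k x) = (LC k. of_real D * (s k * f (\<alpha> *\<^sub>R x - ?v k)))"
    by (simp add: H_def mult.left_commute)
   then show ?case using elim by (simp add: G'_def)
  qed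
  have "AE x in lborel. synthesis_at (mat \<alpha>) b \<psi> s x = (LC k. H k x)"
   using remainder_eq[of "{}"] unfolding syn by (simp add: tail_def)
  then have eq2: "AE x in lborel. synthesis_at (mat \<alpha>) b \<psi> s x = G' x" using eq1 by eventually_elim simp
  have iG: "integrable lborel G'" using wG by (simp add: weak_riesz_def)
  have "(LL x. norm (G' x)) \<le> (C + Fn) * h1_norm b \<nu> s"
  proof -
   have "(LL x. norm (G' x)) = (LL x. norm (LC k. H k x))"
    using eq1 iG superposition(1)[OF sigma_finite_count tail_G(2,1) B_tail(2), of "{}"] by (intro integral_cong_AE) (auto simp: tail_def elim: AE_mp)
   also have "... \<le> infsum (\<lambda>k. norm (s k) * Fn) UNIV"
    using superposition(2)[OF sigma_finite_count tail_G(2,1) B_tail(2), of "{}"] by (simp add: tail_def)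
   also have "... = infsum (\<lambda>k. norm (s k)) UNIV * Fn" by (rule infsum_cmult_left')
   also have "... \<le> h1_norm b \<nu> s * Fn"
    unfolding h1_norm_def using Fn by (intro mult_right_mono) (auto intro: infsum_nonneg)
   also have "... \<le> (C + Fn) * h1_norm b \<nu> s" using C(1) h0 by (simp add: algebra_simps)
   finally show ?thesis .
  qed
  moreover have "(LL x. norm (r' i x)) \<le> (C + Fn) * h1_norm b \<nu> s" for i
  proof -
   have "(LL x. norm (r' i x)) = D * (LL x. norm (r i (\<alpha> *\<^sub>R x)))"
    using D \<alpha> by (simp add: r'_def norm_mult abs_sgn_eq)
   also have "... = (LL x. norm (r i x))" using sub(2)[OF i(2), of i 0] by simp
   also have "... \<le> C * h1_norm b \<nu> s" by (rule r)
   also have "... \<le> (C + Fn) * h1_norm b \<nu> s" using Fn h0 by (simp add: distrib_right)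
   finally show ?thesis .
  qed
  ultimately show "\<exists>G r. (AE x in lborel. synthesis_at (mat \<alpha>) b \<psi> s x = G x) \<and> integrable lborel G \<and> (LL x. norm (G x)) \<le> (C + Fn) * h1_norm b \<nu> s \<and>
    (\<forall>i. weak_riesz (axis i 1) G (r i) \<and> (LL x. norm (r i x)) \<le> (C + Fn) * h1_norm b \<nu> s)"
   using eq2 wG iG by blast
 qed
qed

theorem theorem7:
  fixes \<psi> :: "real ^ 'n \<Rightarrow> complex"
    and b :: "real ^ 'n ^ 'n"
    and \<nu> :: "real ^ 'n \<Rightarrow> complex"
  assumes "invertible b"
    and "cutoff \<nu>"
    and "integrable lebesgue \<psi>"
    and "(SUP y\<in>cball 0 1. H1_norm (\<lambda>x. \<psi> x - \<psi> (x - y))) < \<infinity>"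
  shows "\<exists>C\<ge>0. \<forall>(\<alpha> :: nat \<Rightarrow> real) (a :: nat \<Rightarrow> real ^ 'n ^ 'n).
    (\<forall>j>0. \<alpha> j \<noteq> 0) \<longrightarrow>
    filterlim (\<lambda>j. \<bar>\<alpha> j\<bar>) at_top sequentially \<longrightarrow>
    (\<forall>j>0. a j = mat (\<alpha> j)) \<longrightarrow>
    (\<forall>c\<in>l1_h1 b \<nu>.
       (\<forall>j>0. L1_abs_has_sum (\<lambda>k x. c j k * affine_copy (a j) b \<psi> k x) UNIV
                  (synthesis_at (a j) b \<psi> (c j)) \<and>
              synthesis_at (a j) b \<psi> (c j) \<in> H1) \<and>
       H1_abs_has_sum (\<lambda>j. synthesis_at (a j) b \<psi> (c j)) {0<..} (synthesis a b \<psi> c) \<and>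
       H1_norm (synthesis a b \<psi> c) \<le> ennreal (C * l1_h1_norm b \<nu> c))"
proof -
 let ?\<kappa> = "riesz_ratio TYPE('n)"
 have \<kappa>: "?\<kappa> > 0" by (rule riesz_ratio_pos)
 obtain f where f[measurable]: "f \<in> borel_fun" and \<psi>f: "AE x in lborel. \<psi> x = f x"
  using lebesgue_measurable_AE_borel[OF borel_measurable_integrable[OF assms(3)]] by blast
 have fi: "integrable lborel f"
 proof -
  have "integrable lebesgue f"
   using assms(3) AE_completion[OF \<psi>f] measurable_completion[of f lborel borel] by (subst integrable_cong_AE[where g = \<psi>]) (auto elim: AE_mp)
  then show ?thesis by (subst (asm) integrable_completion) auto
 qed
 define M where "M = enn2real (SUP y\<in>cball 0 1. H1_norm (\<lambda>x. \<psi> x - \<psi> (x - y)))"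
 \<comment> \<open>\<open>H1_norm\<close> counts the component r with the factor
   \<open>?\<kappa>\<close>, hence the quotient.\<close>
 have w: "\<exists>r. weak_riesz (axis i 1) (\<lambda>x. f x - f (x - y)) r \<and> (LL x. norm (r x)) \<le> M / ?\<kappa>" if y: "norm y \<le> 1" for y i
 proof -
  have "H1_norm (\<lambda>x. \<psi> x - \<psi> (x - y)) \<le> (SUP y\<in>cball 0 1. H1_norm (\<lambda>x. \<psi> x - \<psi> (x - y)))" (is "?l \<le> _")
   using y by (intro SUP_upper) simp
  also have "... = ennreal M" using assms(4) by (simp add: M_def)
  finally have le: "?l \<le> ennreal M" .
  then have "H1_norm (\<lambda>x. \<psi> x - \<psi> (x - y)) < \<infinity>" by (rule le_less_trans) simp
  then have H: "(\<lambda>x. \<psi> x - \<psi> (x - y)) \<in> H1" by (auto simp: H1_norm_def split: if_splits)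
  have "AE x in lborel. \<psi> x - \<psi> (x - y) = f x - f (x - y)"
   using \<psi>f AE_lborel_affine[OF \<psi>f one_neq_zero, of "- y"] by eventually_elim simp
  from H1_imp_weak_riesz[OF H _ this, of i] obtain r where r: "weak_riesz (axis i 1) (\<lambda>x. f x - f (x - y)) r"
   "ennreal (?\<kappa> * (LL x. norm (r x))) \<le> H1_norm (\<lambda>x. \<psi> x - \<psi> (x - y))" by auto
  have "ennreal (?\<kappa> * (LL x. norm (r x))) \<le> ennreal M" using r(2) le by (rule order_trans)
  then have "?\<kappa> * (LL x. norm (r x)) \<le> M" by (subst (asm) ennreal_le_iff) (auto simp: M_def)
  then show ?thesis using r(1) \<kappa> by (auto simp: pos_le_divide_eq mult.commute)
 qed
 obtain C where C: "C \<ge> 0" and syn: "\<And>\<alpha> s. \<alpha> \<noteq> 0 \<Longrightarrow> s \<in> h1 b \<nu> \<Longrightarrow>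
  L1_abs_has_sum (\<lambda>k x. s k * affine_copy (mat \<alpha>) b \<psi> k x) UNIV (synthesis_at (mat \<alpha>) b \<psi> s) \<and>
  (\<exists>G r. (AE x in lborel. synthesis_at (mat \<alpha>) b \<psi> s x = G x) \<and> integrable lborel G \<and> (LL x. norm (G x)) \<le> C * h1_norm b \<nu> s \<and>
    (\<forall>i. weak_riesz (axis i 1) G (r i) \<and> (LL x. norm (r i x)) \<le> C * h1_norm b \<nu> s))"
  using synthesis_at_weak_riesz[OF assms(1,2) fi \<psi>f w] by blast
 define K where "K = 1 + ?\<kappa> * real CARD('n)"
 show ?thesis
 proof (intro exI[of _ "K * C"] conjI allI impI ballI)
  show "K * C \<ge> 0" using C \<kappa> by (simp add: K_def)
  fix \<alpha> :: "nat \<Rightarrow> real" and a :: "nat \<Rightarrow> real ^ 'n ^ 'n" and c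
  assume \<alpha>: "\<forall>j>0. \<alpha> j \<noteq> 0" and a: "\<forall>j>0. a j = mat (\<alpha> j)" and c: "c \<in> l1_h1 b \<nu>"
  have cj: "c j \<in> h1 b \<nu>" if "j > 0" for j using c that by (auto simp: l1_h1_def)
  define Q where "Q j G r \<longleftrightarrow> (AE x in lborel. synthesis_at (a j) b \<psi> (c j) x = G x) \<and> integrable lborel G \<and> (LL x. norm (G x)) \<le> C * h1_norm b \<nu> (c j) \<and>
    (\<forall>i. weak_riesz (axis i 1) G (r i) \<and> (LL x. norm (r i x)) \<le> C * h1_norm b \<nu> (c j))" for j G r
  have "\<exists>G r. Q j G r" if "j > 0" for j
   using conjunct2[OF syn[of "\<alpha> j" "c j"]] \<alpha> a cj[OF that] that unfolding Q_def by simp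
  then obtain G r where GQ: "\<And>j. j > 0 \<Longrightarrow> Q j (G j) (r j)" by metis
  \<comment> \<open>Now the index runs over the scales, and the bound is summable because c lies in
    \<open>l1_h1\<close>.\<close>
  interpret AE_summable_family "\<lambda>j. synthesis_at (a j) b \<psi> (c j)" G "{0<..}" "\<lambda>j. C * h1_norm b \<nu> (c j)"
   by standard (use GQ c in \<open>auto simp: Q_def l1_h1_def intro: summable_on_cmult_right\<close>)
  have wr: "weak_riesz (axis i 1) (G j) (r j i)" "(LL x. norm (r j i x)) \<le> C * h1_norm b \<nu> (c j)" if "j \<in> {0<..}" for i j
   using GQ that by (auto simp: Q_def)
  note res = H1_abs_has_sum[OF wr]
  have "synthesis a b \<psi> c = (\<lambda>x. \<Sum>\<^sub>\<infinity>j\<in>{0<..}. synthesis_at (a j) b \<psi> (c j) x)" by (simp add: synthesis_def[abs_def])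
  note res = res[folded this]
  show "H1_abs_has_sum (\<lambda>j. synthesis_at (a j) b \<psi> (c j)) {0<..} (synthesis a b \<psi> c)" by (rule res(1))
  show "H1_norm (synthesis a b \<psi> c) \<le> ennreal (K * C * l1_h1_norm b \<nu> c)"
   using res(2) by (simp add: K_def l1_h1_norm_def infsum_cmult_right' mult.assoc)
  fix j :: nat assume j: "j > 0"
  show "synthesis_at (a j) b \<psi> (c j) \<in> H1" using res(3)[of j] j by simp
  show "L1_abs_has_sum (\<lambda>k x. c j k * affine_copy (a j) b \<psi> k x) UNIV (synthesis_at (a j) b \<psi> (c j))"
   using syn[of "\<alpha> j" "c j"] \<alpha> a cj j by auto
 qed
qed

end
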